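(* Let $R$ be regular and essentially of finite type over an $F$-finite field of characteristic $p>0$. Let $(M,\kappa)$ be a Cartier module over $R$, $f\in R$ an $M$-regular element and assume that $M_f$ is $F$-regular. Let $\lambda\in(0,1]\cap\mathbb Z_{(p)}$. If $\frac{\lceil\lambda p^e\rceil-1}{p^e}$ is a zero of the $e$th Bernstein-Sato polynomial $b^e_{M,f}(s)$ for some $e\gg0$ such that $\lambda(p^e-1)\in\mathbb Z$, then $Gr^\lambda_\sigma M\neq0$. (Here "for some $e\gg0$" means: there is $e_0$, depending on $M,\kappa,f,\lambda$, such that the implication holds for each such $e\ge e_0$.)
   Context: All rings are commutative Noetherian of prime characteristic $p$; $F$ is the Frobenius, and $F^e_*M$ is $M$ with $R$ acting through $p^e$-th powers. $R$ is $F$-finite if $F_*R$ is a finitely generated $R$-module. A Cartier module $(M,\kappa)$ is a finitely generated $R$-module $M$ with an $R$-linear map $\kappa\colon F_*M\to M$; $\kappa^e\colon F^e_*M\to M$ is its iterate, and for $g\in R$, $\kappa^e g$ denotes $m\mapsto\kappa^e(gm)$. $f\in R$ is $M$-regular if it is a non-zero-divisor on $M$. A Cartier algebra is an $\mathbb N$-graded ring $\mathcal C=\bigoplus_{e\ge0}\mathcal C_e$ with $\mathcal C_0=R$ and $r\varphi=\varphi r^{p^e}$ for $\varphi\in\mathcal C_e$, $r\in R$; $\mathcal C_+=\bigoplus_{e\ge1}\mathcal C_e$. A $\mathcal C$-module is a left $\mathcal C$-module finitely generated over $R$; it is nilpotent if $\mathcal C_+^aM=0$ for some $a$; a morphism is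 a nil-isomorphism if its kernel and cokernel are nilpotent. $F$-regularity: for a Cartier module $(M,\kappa)$ let $\mathcal C$ be the Cartier algebra with $\mathcal C_0=R$, $\mathcal C_e=\kappa^eR$. $\tau(M,f^0)$ is the smallest $\mathcal C$-submodule $N\subseteq M$ such that $H^0_\eta(N)_\eta\subseteq H^0_\eta(M)_\eta$ is a nil-isomorphism for every associated prime $\eta$ of the $R$-module $M$ ($H^0_\eta$ = elements killed by a power of $\eta$; the outer subscript is localization). $(M,\kappa)$ is $F$-regular if $\tau(M,f^0)=M$; $M_f$ is a Cartier module over $R_f$ via $\kappa(m/f^{n})=\kappa(f^{n(p-1)}m)/f^{n}$. Non-$F$-pure modules: for rational $\lambda\ge0$ let $\mathcal C=\bigoplus_{e\ge0}\kappa^ef^{\lceil\lambda(p^e-1)\rceil}R$. Then $\sigma(M,f^\lambda)$ is the stable value $\mathcal C_+^hM$, $h\gg0$, of the descending chain $\mathcal C_+M\supseteq\mathcal C_+^2M\supseteq\cdots$ (which stabilizes). $Gr^\lambda_\sigma M=\sigma(M,f^\lambda)/\sigma(M,f^{\lambda+\varepsilon})$ for $0<\varepsilon\ll1$. $\mathcal D$-modules: for an $\mathbb F_p$-algebra $A$, $\mathcal D^e_A=\operatorname{End}_A(F^e_*A)$, and modules over it are right modules. For an $A$-module $P$, ${F^e}^!P=\operatorname{Hom}_A(F^e_*A,P)$, a right $\mathcal D^e_A$-module by precomposition. In $\mathcal D^e_{R[t]}$ there are, for $a<p^e$, the Euler operators $\theta_a=t^a\partial_t^{[a]}$ acting by $\theta_a(rt^m)=\binom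 ma rt^m$ ($r\in R$), and $\mathcal D^e_R\subseteq\mathcal D^e_{R[t]}$ acts on coefficients. Every $\mathcal D^e_R[\theta_1,\theta_p,\dots,\theta_{p^{e-1}}]$-module $A$ decomposes uniquely as $A=\bigoplus_{i\in\mathbb F_p^e}E_i$ with $\theta_{p^{j-1}}$ acting on $E_i$ as multiplication by $i_j$ ($j=1,\dots,e$); $E_i$ is the generalized $i$-eigenspace. Let $\gamma\colon\operatorname{Spec}R\to\operatorname{Spec}R[t]$ be the graph embedding given by $\gamma^\#\colon R[t]\to R$, $t\mapsto f$. For a submodule $A\subseteq M$, $\gamma_*C^e(A)\subseteq{F^e}^!\gamma_*M=\operatorname{Hom}_{R[t]}(F^e_*R[t],\gamma_*M)$ denotes the set of maps $s\mapsto\kappa^e(\gamma^\#(s)m)$, $m\in A$. Put \[N_e=\big(\gamma_*C^e(M)\big)\mathcal D^e_R[\theta_1,\theta_p,\dots,\theta_{p^{e-1}}]\big/\big(\gamma_*C^e(fM)\big)\mathcal D^e_R[\theta_1,\theta_p,\dots,\theta_{p^{e-1}}].\] Let $\Gamma\subseteq\{0,\dots,p-1\}^e$ be the set of those $i=(i_1,\dots,i_e)$ (identified with elements of $\mathbb F_p^e$) for which the generalized $i$-eigenspace of $N_e$ is non-zero. The $e$th Bernstein-Sato polynomial is \[b^e_{M,f}(s)=\prod_{i\in\Gamma}\Big(s-\Big(\frac{i_e}{p}+\dots+\frac{i_1}{p^e}\Big)\Big)\in\mathbb Q[s].\] *)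

theory Defs
  imports
    "HOL-Computational_Algebra.Polynomial"
    "HOL-Library.Extended_Nat"
    "HOL-Algebra.UnivPoly"
    "HOL-Algebra.QuotRing"
    "HOL-Algebra.Ideal_Product"
    "HOL-Algebra.Ring_Divisibility"
    "HOL-Algebra.Generated_Groups"
    "HOL-Algebra.Generated_Rings"
begin

section \<open>Modules, linear maps and the Frobenius\<close>

definition self_mod :: "('a, 'x) ring_scheme \<Rightarrow> ('a, 'a) module" where
  "self_mod A = \<lparr>carrier = carrier A, mult = mult A, one = one A, zero = zero A, add = add A,
                 smult = mult A\<rparr>"

definition fg_module :: "('a, 'x) ring_scheme \<Rightarrow> ('a, 'm, 'y) module_scheme \<Rightarrow> bool" where
  "fg_module A M \<longleftrightarrow>
     (\<exists>S. finite S \<and> S \<subseteq> carrier M \<and> (\<forall>N. submodule N A M \<and> S \<subseteq> N \<longrightarrow> N = carrier M))"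

definition lin_map :: "('a, 'x) ring_scheme \<Rightarrow> ('a, 'm, 'y) module_scheme \<Rightarrow>
    ('a, 'n, 'z) module_scheme \<Rightarrow> ('m \<Rightarrow> 'n) \<Rightarrow> bool" where
  "lin_map A M N h \<longleftrightarrow> h \<in> carrier M \<rightarrow> carrier N \<and>
     (\<forall>x\<in>carrier M. \<forall>y\<in>carrier M. h (x \<oplus>\<^bsub>M\<^esub> y) = h x \<oplus>\<^bsub>N\<^esub> h y) \<and>
     (\<forall>a\<in>carrier A. \<forall>x\<in>carrier M. h (a \<odot>\<^bsub>M\<^esub> x) = a \<odot>\<^bsub>N\<^esub> h x)"

text \<open>Elements of \<open>Hom\<^sub>A(M, N)\<close> are normalised to be \<open>undefined\<close> outside of \<open>carrier M\<close>, so that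
  equality of functions is equality of maps.  The fields \<open>mult\<close> and \<open>one\<close>, which are
  meaningless for a module, are only filled in for endomorphisms (see \<open>end_ring\<close>).\<close>

definition hom_mod :: "('a, 'x) ring_scheme \<Rightarrow> ('a, 'm, 'y) module_scheme \<Rightarrow>
    ('a, 'n, 'z) module_scheme \<Rightarrow> ('m \<Rightarrow> 'n) ring" where
  "hom_mod A M N = \<lparr>carrier = {h \<in> extensional (carrier M). lin_map A M N h},
     mult = undefined, one = undefined,
     zero = (\<lambda>x\<in>carrier M. \<zero>\<^bsub>N\<^esub>),
     add = (\<lambda>g h. \<lambda>x\<in>carrier M. g x \<oplus>\<^bsub>N\<^esub> h x)\<rparr>"

definition end_ring :: "('a, 'x) ring_scheme \<Rightarrow> ('a, 'm, 'y) module_scheme \<Rightarrow> ('m \<Rightarrow> 'm) ring" where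
  "end_ring A M = (hom_mod A M M)\<lparr>mult := compose (carrier M), one := (\<lambda>x\<in>carrier M. x)\<rparr>"

definition frob :: "nat \<Rightarrow> nat \<Rightarrow> ('a, 'x) ring_scheme \<Rightarrow> ('a, 'm) module \<Rightarrow> ('a, 'm) module" where
  "frob p e A M = M\<lparr>smult := (\<lambda>a x. (a [^]\<^bsub>A\<^esub> (p ^ e)) \<odot>\<^bsub>M\<^esub> x)\<rparr>"

definition F_finite :: "nat \<Rightarrow> ('a, 'x) ring_scheme \<Rightarrow> bool" where
  "F_finite p A \<longleftrightarrow> fg_module A (frob p 1 A (self_mod A))"

definition has_prime_char :: "('a, 'x) ring_scheme \<Rightarrow> nat \<Rightarrow> bool" where
  "has_prime_char A p \<longleftrightarrow> Factorial_Ring.prime p \<and> [p] \<cdot>\<^bsub>A\<^esub> \<one>\<^bsub>A\<^esub> = \<zero>\<^bsub>A\<^esub>"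

definition regular_element :: "('a, 'm, 'y) module_scheme \<Rightarrow> 'a \<Rightarrow> bool" where
  "regular_element M f \<longleftrightarrow> (\<forall>m\<in>carrier M. f \<odot>\<^bsub>M\<^esub> m = \<zero>\<^bsub>M\<^esub> \<longrightarrow> m = \<zero>\<^bsub>M\<^esub>)"


section \<open>Localization\<close>

text \<open>The fraction \<open>m/s\<close> is the equivalence class of \<open>(m, s)\<close>.  Operations on fractions are
  unions, over all representatives, of one and the same class.\<close>

definition frac :: "'a set \<Rightarrow> ('a, 'm, 'y) module_scheme \<Rightarrow> 'm \<Rightarrow> 'a \<Rightarrow> ('m \<times> 'a) set" where
  "frac S M m s = {(n, t). n \<in> carrier M \<and> t \<in> S \<and>
     (\<exists>u\<in>S. u \<odot>\<^bsub>M\<^esub> (t \<odot>\<^bsub>M\<^esub> m) = u \<odot>\<^bsub>M\<^esub> (s \<odot>\<^bsub>M\<^esub> n))}"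

definition loc_ring :: "('a, 'x) ring_scheme \<Rightarrow> 'a set \<Rightarrow> ('a \<times> 'a) set ring" where
  "loc_ring R S = \<lparr>
     carrier = {frac S (self_mod R) a s | a s. a \<in> carrier R \<and> s \<in> S},
     mult = (\<lambda>X Y. \<Union>(a, s)\<in>X. \<Union>(b, t)\<in>Y. frac S (self_mod R) (a \<otimes>\<^bsub>R\<^esub> b) (s \<otimes>\<^bsub>R\<^esub> t)),
     one = frac S (self_mod R) \<one>\<^bsub>R\<^esub> \<one>\<^bsub>R\<^esub>,
     zero = frac S (self_mod R) \<zero>\<^bsub>R\<^esub> \<one>\<^bsub>R\<^esub>,
     add = (\<lambda>X Y. \<Union>(a, s)\<in>X. \<Union>(b, t)\<in>Y.
              frac S (self_mod R) ((t \<otimes>\<^bsub>R\<^esub> a) \<oplus>\<^bsub>R\<^esub> (s \<otimes>\<^bsub>R\<^esub> b)) (s \<otimes>\<^bsub>R\<^esub> t))\<rparr>"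

definition loc_mod :: "('a, 'x) ring_scheme \<Rightarrow> 'a set \<Rightarrow> ('a, 'm) module \<Rightarrow>
    (('a \<times> 'a) set, ('m \<times> 'a) set) module" where
  "loc_mod R S M = \<lparr>
     carrier = {frac S M m s | m s. m \<in> carrier M \<and> s \<in> S},
     mult = undefined, one = undefined,
     zero = frac S M \<zero>\<^bsub>M\<^esub> \<one>\<^bsub>R\<^esub>,
     add = (\<lambda>X Y. \<Union>(m, s)\<in>X. \<Union>(n, t)\<in>Y.
              frac S M ((t \<odot>\<^bsub>M\<^esub> m) \<oplus>\<^bsub>M\<^esub> (s \<odot>\<^bsub>M\<^esub> n)) (s \<otimes>\<^bsub>R\<^esub> t)),
     smult = (\<lambda>X Y. \<Union>(a, s)\<in>X. \<Union>(m, t)\<in>Y. frac S M (a \<odot>\<^bsub>M\<^esub> m) (s \<otimes>\<^bsub>R\<^esub> t))\<rparr>"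

text \<open>The localization of a submodule \<open>N \<subseteq> M\<close>, as a submodule of the localization of \<open>M\<close>
  (localization is exact).\<close>

definition loc_sub :: "'a set \<Rightarrow> ('a, 'm) module \<Rightarrow> 'm set \<Rightarrow> ('m \<times> 'a) set set" where
  "loc_sub S M N = {frac S M n s | n s. n \<in> N \<and> s \<in> S}"

definition loc_kappa :: "nat \<Rightarrow> ('a, 'x) ring_scheme \<Rightarrow> 'a set \<Rightarrow> ('a, 'm) module \<Rightarrow>
    ('m \<Rightarrow> 'm) \<Rightarrow> ('m \<times> 'a) set \<Rightarrow> ('m \<times> 'a) set" where
  "loc_kappa p R S M \<kappa> = (\<lambda>X. \<Union>(m, s)\<in>X. frac S M (\<kappa> ((s [^]\<^bsub>R\<^esub> (p - 1)) \<odot>\<^bsub>M\<^esub> m)) s)"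

definition powers :: "('a, 'x) ring_scheme \<Rightarrow> 'a \<Rightarrow> 'a set" where
  "powers R f = {f [^]\<^bsub>R\<^esub> n | n :: nat. True}"


section \<open>Regular rings, rings essentially of finite type\<close>

definition krull_dim :: "('a, 'x) ring_scheme \<Rightarrow> enat" where
  "krull_dim A = Sup {enat n | n. \<exists>P :: nat \<Rightarrow> 'a set.
     (\<forall>i\<le>n. primeideal (P i) A) \<and> (\<forall>i<n. P i \<subset> P (Suc i))}"

definition regular_local_ring :: "('a, 'x) ring_scheme \<Rightarrow> bool" where
  "regular_local_ring A \<longleftrightarrow> cring A \<and> noetherian_ring A \<and> (\<exists>!I. maximalideal I A) \<and>
     (\<exists>S. finite S \<and> S \<subseteq> carrier A \<and> maximalideal (genideal A S) A \<and> enat (card S) = krull_dim A)"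

definition regular_ring :: "('a, 'x) ring_scheme \<Rightarrow> bool" where
  "regular_ring A \<longleftrightarrow> cring A \<and> noetherian_ring A \<and>
     (\<forall>P. primeideal P A \<longrightarrow> regular_local_ring (loc_ring A (carrier A - P)))"

text \<open>\<open>R\<close> is isomorphic to a localization of a finitely generated \<open>k\<close>-algebra \<open>B\<close>.  Requiring the
  elements of \<open>B\<close> to have the same type as those of \<open>R\<close> is no restriction: \<open>B\<close> can be
  replaced by its image in \<open>R\<close>.\<close>

definition ess_finite_type :: "('k, 'x) ring_scheme \<Rightarrow> ('a, 'y) ring_scheme \<Rightarrow> bool" where
  "ess_finite_type k R \<longleftrightarrow> (\<exists>(B :: 'a ring) \<psi> S W. cring B \<and> \<psi> \<in> ring_hom k B \<and>
     finite S \<and> S \<subseteq> carrier B \<and> generate_ring B (\<psi> ` carrier k \<union> S) = carrier B \<and>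
     submonoid W B \<and> loc_ring B W \<simeq> R)"


section \<open>Cartier algebras and their modules\<close>

text \<open>A graded ring \<open>C\<close> acting on an abelian group is represented by the operators through which
  its homogeneous elements act: \<open>C e\<close> is the set of operators of degree \<open>e\<close>.\<close>

definition C_plus :: "('m, 'x) monoid_scheme \<Rightarrow> (nat \<Rightarrow> ('m \<Rightarrow> 'm) set) \<Rightarrow> 'm set \<Rightarrow> 'm set" where
  "C_plus G C X = generate G {\<phi> x | \<phi> x. (\<exists>e\<ge>1. \<phi> \<in> C e) \<and> x \<in> X}"

definition nilpotent :: "('m, 'x) monoid_scheme \<Rightarrow> (nat \<Rightarrow> ('m \<Rightarrow> 'm) set) \<Rightarrow> bool" where
  "nilpotent G C \<longleftrightarrow> (\<exists>a. (C_plus G C ^^ a) (carrier G) = {\<one>\<^bsub>G\<^esub>})"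

text \<open>The operator induced by \<open>\<phi>\<close> on the quotient by \<open>N\<close>: the coset of \<open>x\<close> is mapped to
  \<open>N + \<phi>(N + x)\<close>, the coset of \<open>\<phi> x\<close> if \<open>\<phi> N \<subseteq> N\<close>.\<close>

definition quot_op :: "('m, 'x) ring_scheme \<Rightarrow> 'm set \<Rightarrow> ('m \<Rightarrow> 'm) \<Rightarrow> 'm set \<Rightarrow> 'm set" where
  "quot_op M N \<phi> = (\<lambda>X. set_add M N (\<phi> ` X))"

definition nil_isomorphism :: "('m, 'x) ring_scheme \<Rightarrow> (nat \<Rightarrow> ('m \<Rightarrow> 'm) set) \<Rightarrow>
    ('n, 'y) ring_scheme \<Rightarrow> (nat \<Rightarrow> ('n \<Rightarrow> 'n) set) \<Rightarrow> ('m \<Rightarrow> 'n) \<Rightarrow> bool" where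
  "nil_isomorphism M C N D h \<longleftrightarrow>
     nilpotent (add_monoid (M\<lparr>carrier := a_kernel M N h\<rparr>)) C \<and>
     nilpotent (A_FactGroup N (h ` carrier M)) (\<lambda>e. quot_op N (h ` carrier M) ` D e)"

definition C_submodule :: "('a, 'x) ring_scheme \<Rightarrow> ('a, 'm) module \<Rightarrow>
    (nat \<Rightarrow> ('m \<Rightarrow> 'm) set) \<Rightarrow> 'm set \<Rightarrow> bool" where
  "C_submodule R M C N \<longleftrightarrow> submodule N R M \<and> (\<forall>e. \<forall>\<phi>\<in>C e. \<phi> ` N \<subseteq> N)"

definition cartier_module :: "nat \<Rightarrow> ('a, 'x) ring_scheme \<Rightarrow> ('a, 'm) module \<Rightarrow> ('m \<Rightarrow> 'm) \<Rightarrow> bool" where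
  "cartier_module p R M \<kappa> \<longleftrightarrow> module R M \<and> fg_module R M \<and> lin_map R (frob p 1 R M) M \<kappa>"

definition cartier_alg :: "('a, 'x) ring_scheme \<Rightarrow> ('a, 'm) module \<Rightarrow> ('m \<Rightarrow> 'm) \<Rightarrow> (nat \<Rightarrow> 'a) \<Rightarrow>
    nat \<Rightarrow> ('m \<Rightarrow> 'm) set" where
  "cartier_alg R M \<kappa> g e = {\<lambda>m. (\<kappa> ^^ e) ((g e \<otimes>\<^bsub>R\<^esub> r) \<odot>\<^bsub>M\<^esub> m) | r. r \<in> carrier R}"


section \<open>F-regularity\<close>

definition ass_primes :: "('a, 'x) ring_scheme \<Rightarrow> ('a, 'm) module \<Rightarrow> 'a set set" where
  "ass_primes R M = {\<eta>. primeideal \<eta> R \<and> (\<exists>m\<in>carrier M. \<eta> = {a \<in> carrier R. a \<odot>\<^bsub>M\<^esub> m = \<zero>\<^bsub>M\<^esub>})}"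

definition ideal_power :: "('a, 'x) ring_scheme \<Rightarrow> 'a set \<Rightarrow> nat \<Rightarrow> 'a set" where
  "ideal_power R I n = (ideal_prod R I ^^ n) (carrier R)"

text \<open>\<open>H\<^sup>0\<^sub>\<eta>(N)\<close> for a submodule \<open>N \<subseteq> M\<close>.\<close>

definition H0 :: "('a, 'x) ring_scheme \<Rightarrow> 'a set \<Rightarrow> ('a, 'm) module \<Rightarrow> 'm set \<Rightarrow> 'm set" where
  "H0 R \<eta> M N = {x \<in> N. \<exists>n. \<forall>a\<in>ideal_power R \<eta> n. a \<odot>\<^bsub>M\<^esub> x = \<zero>\<^bsub>M\<^esub>}"

text \<open>The submodules among which \<open>\<tau>(M, f\<^sup>0)\<close> is the smallest.\<close>

definition test_candidate :: "nat \<Rightarrow> ('a, 'x) ring_scheme \<Rightarrow> ('a, 'm) module \<Rightarrow> ('m \<Rightarrow> 'm) \<Rightarrow>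
    'm set \<Rightarrow> bool" where
  "test_candidate p R M \<kappa> N \<longleftrightarrow>
     C_submodule R M (cartier_alg R M \<kappa> (\<lambda>e. \<one>\<^bsub>R\<^esub>)) N \<and>
     (\<forall>\<eta>\<in>ass_primes R M.
        let S = carrier R - \<eta>;
            R\<eta> = loc_ring R S;
            M\<eta> = loc_mod R S M;
            C = cartier_alg R\<eta> M\<eta> (loc_kappa p R S M \<kappa>) (\<lambda>e. \<one>\<^bsub>R\<eta>\<^esub>)
        in nil_isomorphism
             (M\<eta>\<lparr>carrier := loc_sub S M (H0 R \<eta> M N)\<rparr>) C
             (M\<eta>\<lparr>carrier := loc_sub S M (H0 R \<eta> M (carrier M))\<rparr>) C
             (\<lambda>x. x))"

definition is_test_module :: "nat \<Rightarrow> ('a, 'x) ring_scheme \<Rightarrow> ('a, 'm) module \<Rightarrow> ('m \<Rightarrow> 'm) \<Rightarrow>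
    'm set \<Rightarrow> bool" where
  "is_test_module p R M \<kappa> T \<longleftrightarrow>
     test_candidate p R M \<kappa> T \<and> (\<forall>N. test_candidate p R M \<kappa> N \<longrightarrow> T \<subseteq> N)"

definition F_regular :: "nat \<Rightarrow> ('a, 'x) ring_scheme \<Rightarrow> ('a, 'm) module \<Rightarrow> ('m \<Rightarrow> 'm) \<Rightarrow> bool" where
  "F_regular p R M \<kappa> \<longleftrightarrow> is_test_module p R M \<kappa> (carrier M)"


section \<open>Non-F-pure modules\<close>

definition sigma_alg :: "nat \<Rightarrow> ('a, 'x) ring_scheme \<Rightarrow> ('a, 'm) module \<Rightarrow> ('m \<Rightarrow> 'm) \<Rightarrow> 'a \<Rightarrow> rat \<Rightarrow>
    nat \<Rightarrow> ('m \<Rightarrow> 'm) set" where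
  "sigma_alg p R M \<kappa> f l =
     cartier_alg R M \<kappa> (\<lambda>e. f [^]\<^bsub>R\<^esub> (nat \<lceil>l * (of_nat p ^ e - 1)\<rceil>))"

definition sigma :: "nat \<Rightarrow> ('a, 'x) ring_scheme \<Rightarrow> ('a, 'm) module \<Rightarrow> ('m \<Rightarrow> 'm) \<Rightarrow> 'a \<Rightarrow> rat \<Rightarrow>
    'm set" where
  "sigma p R M \<kappa> f l = (THE N. \<exists>h0. \<forall>h\<ge>h0.
     (C_plus (add_monoid M) (sigma_alg p R M \<kappa> f l) ^^ h) (carrier M) = N)"

text \<open>\<open>sigma p R M \<kappa> f l\<close> decreases as \<open>l\<close> grows, so for a Noetherian module \<open>sigma p R M \<kappa> f (l + \<epsilon>)\<close>
  does not depend on \<open>\<epsilon>\<close> once \<open>\<epsilon> > 0\<close> is small.\<close>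

definition sigma_plus :: "nat \<Rightarrow> ('a, 'x) ring_scheme \<Rightarrow> ('a, 'm) module \<Rightarrow> ('m \<Rightarrow> 'm) \<Rightarrow> 'a \<Rightarrow> rat \<Rightarrow>
    'm set" where
  "sigma_plus p R M \<kappa> f l = (THE N. \<exists>\<delta>>0. \<forall>\<epsilon>. 0 < \<epsilon> \<and> \<epsilon> < \<delta> \<longrightarrow> sigma p R M \<kappa> f (l + \<epsilon>) = N)"

definition Gr_sigma :: "nat \<Rightarrow> ('a, 'x) ring_scheme \<Rightarrow> ('a, 'm) module \<Rightarrow> ('m \<Rightarrow> 'm) \<Rightarrow> 'a \<Rightarrow> rat \<Rightarrow>
    'm set monoid" where
  "Gr_sigma p R M \<kappa> f l =
     A_FactGroup (M\<lparr>carrier := sigma p R M \<kappa> f l\<rparr>) (sigma_plus p R M \<kappa> f l)"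


section \<open>Differential operators and Bernstein-Sato polynomials\<close>

definition diff_ops :: "nat \<Rightarrow> nat \<Rightarrow> ('a, 'x) ring_scheme \<Rightarrow> ('a \<Rightarrow> 'a) ring" where
  "diff_ops p e A = end_ring A (frob p e A (self_mod A))"

text \<open>An element \<open>\<delta>\<close> of \<open>diff_ops p e A\<close> acts on \<open>F_shriek p e A P\<close> from the right by
  \<open>h \<mapsto> compose (carrier A) h \<delta>\<close>.\<close>

definition F_shriek :: "nat \<Rightarrow> nat \<Rightarrow> ('a, 'x) ring_scheme \<Rightarrow> ('a, 'm) module \<Rightarrow> ('a \<Rightarrow> 'm) ring" where
  "F_shriek p e A P = hom_mod A (frob p e A (self_mod A)) P"

definition coeff_op :: "('a, 'x) ring_scheme \<Rightarrow> ('a \<Rightarrow> 'a) \<Rightarrow> (nat \<Rightarrow> 'a) \<Rightarrow> (nat \<Rightarrow> 'a)" where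
  "coeff_op R \<delta> = (\<lambda>g\<in>carrier (UP R). \<lambda>m. \<delta> (g m))"

definition euler_op :: "('a, 'x) ring_scheme \<Rightarrow> nat \<Rightarrow> (nat \<Rightarrow> 'a) \<Rightarrow> (nat \<Rightarrow> 'a)" where
  "euler_op R a = (\<lambda>g\<in>carrier (UP R). \<lambda>m. [(m choose a)] \<cdot>\<^bsub>R\<^esub> g m)"

definition euler_alg :: "nat \<Rightarrow> nat \<Rightarrow> ('a, 'x) ring_scheme \<Rightarrow> ((nat \<Rightarrow> 'a) \<Rightarrow> (nat \<Rightarrow> 'a)) set" where
  "euler_alg p e R = generate_ring (diff_ops p e (UP R))
     (coeff_op R ` carrier (diff_ops p e R) \<union> {euler_op R (p ^ j) | j. j < e})"

definition graph_map :: "('a, 'x) ring_scheme \<Rightarrow> 'a \<Rightarrow> (nat \<Rightarrow> 'a) \<Rightarrow> 'a" where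
  "graph_map R f = eval R R (\<lambda>r. r) f"

definition graph_push :: "('a, 'x) ring_scheme \<Rightarrow> 'a \<Rightarrow> ('a, 'm) module \<Rightarrow> (nat \<Rightarrow> 'a, 'm) module" where
  "graph_push R f M = \<lparr>carrier = carrier M, mult = mult M, one = one M, zero = zero M, add = add M,
     smult = (\<lambda>g m. graph_map R f g \<odot>\<^bsub>M\<^esub> m)\<rparr>"

definition graph_C :: "nat \<Rightarrow> ('a, 'x) ring_scheme \<Rightarrow> ('a, 'm) module \<Rightarrow> ('m \<Rightarrow> 'm) \<Rightarrow> 'a \<Rightarrow> 'm set \<Rightarrow>
    ((nat \<Rightarrow> 'a) \<Rightarrow> 'm) set" where
  "graph_C e R M \<kappa> f A =
     {\<lambda>s\<in>carrier (UP R). (\<kappa> ^^ e) (graph_map R f s \<odot>\<^bsub>M\<^esub> m) | m. m \<in> A}"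

definition graph_CD :: "nat \<Rightarrow> nat \<Rightarrow> ('a, 'x) ring_scheme \<Rightarrow> ('a, 'm) module \<Rightarrow> ('m \<Rightarrow> 'm) \<Rightarrow> 'a \<Rightarrow>
    'm set \<Rightarrow> ((nat \<Rightarrow> 'a) \<Rightarrow> 'm) set" where
  "graph_CD p e R M \<kappa> f A = generate (add_monoid (F_shriek p e (UP R) (graph_push R f M)))
     {compose (carrier (UP R)) h \<delta> | h \<delta>. h \<in> graph_C e R M \<kappa> f A \<and> \<delta> \<in> euler_alg p e R}"

definition N_mod :: "nat \<Rightarrow> nat \<Rightarrow> ('a, 'x) ring_scheme \<Rightarrow> ('a, 'm) module \<Rightarrow> ('m \<Rightarrow> 'm) \<Rightarrow> 'a \<Rightarrow>
    ((nat \<Rightarrow> 'a) \<Rightarrow> 'm) set monoid" where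
  "N_mod p e R M \<kappa> f =
     A_FactGroup
       ((F_shriek p e (UP R) (graph_push R f M))\<lparr>carrier := graph_CD p e R M \<kappa> f (carrier M)\<rparr>)
       (graph_CD p e R M \<kappa> f ((\<lambda>m. f \<odot>\<^bsub>M\<^esub> m) ` carrier M))"

definition N_act :: "nat \<Rightarrow> nat \<Rightarrow> ('a, 'x) ring_scheme \<Rightarrow> ('a, 'm) module \<Rightarrow> ('m \<Rightarrow> 'm) \<Rightarrow> 'a \<Rightarrow>
    ((nat \<Rightarrow> 'a) \<Rightarrow> (nat \<Rightarrow> 'a)) \<Rightarrow> ((nat \<Rightarrow> 'a) \<Rightarrow> 'm) set \<Rightarrow> ((nat \<Rightarrow> 'a) \<Rightarrow> 'm) set" where
  "N_act p e R M \<kappa> f \<delta> = quot_op (F_shriek p e (UP R) (graph_push R f M))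
     (graph_CD p e R M \<kappa> f ((\<lambda>m. f \<odot>\<^bsub>M\<^esub> m) ` carrier M)) (\<lambda>h. compose (carrier (UP R)) h \<delta>)"

text \<open>The group operation of \<open>N_mod\<close> is written multiplicatively, so that multiplication by
  \<open>i\<^sub>j\<close> becomes a power.\<close>

definition eigenspace :: "nat \<Rightarrow> nat \<Rightarrow> ('a, 'x) ring_scheme \<Rightarrow> ('a, 'm) module \<Rightarrow> ('m \<Rightarrow> 'm) \<Rightarrow> 'a \<Rightarrow>
    (nat \<Rightarrow> nat) \<Rightarrow> ((nat \<Rightarrow> 'a) \<Rightarrow> 'm) set set" where
  "eigenspace p e R M \<kappa> f i = {X \<in> carrier (N_mod p e R M \<kappa> f).
     \<forall>j\<in>{1..e}. N_act p e R M \<kappa> f (euler_op R (p ^ (j - 1))) X = X [^]\<^bsub>N_mod p e R M \<kappa> f\<^esub> i j}"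

definition Gamma_set :: "nat \<Rightarrow> nat \<Rightarrow> ('a, 'x) ring_scheme \<Rightarrow> ('a, 'm) module \<Rightarrow> ('m \<Rightarrow> 'm) \<Rightarrow> 'a \<Rightarrow>
    (nat \<Rightarrow> nat) set" where
  "Gamma_set p e R M \<kappa> f = {i \<in> {1..e} \<rightarrow>\<^sub>E {0..<p}.
     eigenspace p e R M \<kappa> f i \<noteq> {\<one>\<^bsub>N_mod p e R M \<kappa> f\<^esub>}}"

definition bernstein_sato_poly :: "nat \<Rightarrow> nat \<Rightarrow> ('a, 'x) ring_scheme \<Rightarrow> ('a, 'm) module \<Rightarrow> ('m \<Rightarrow> 'm) \<Rightarrow>
    'a \<Rightarrow> rat poly" where
  "bernstein_sato_poly p e R M \<kappa> f = (\<Prod>i\<in>Gamma_set p e R M \<kappa> f.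
     [:- (\<Sum>j=1..e. of_nat (i j) / of_nat p ^ (e + 1 - j)), 1:])"

end

(* Put n = l (p^e - 1), whose base p digits are the joint Euler eigenvalue attached to the root n / p^e.
   If the graded piece of the non-F-pure filtration vanishes at l, then for large e comparing
   kappa^e f^n M with the stable values sigma(M, f^l) and sigma(M, f^(l + epsilon)) gives
   kappa^e(f^n M) = kappa^e(f^(n+1) M). By Kunz's theorem F^e_*R is projective, hence has a dual basis
   id = sum_j delta_j(-) g_j. The projector of F^e_*R[t] to the exponents congruent to n mod p^e,
   expanded in this basis, sends the map s |-> kappa^e(gamma(s) m) to a sum of terms built from
   kappa^e(g_j f^n m) = kappa^e(f^n f m_j), which lie in gamma_* C^e(fM) D^e_R[theta]. So the
   eigenspace in question is zero, and n / p^e is not a root of b^e. *)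

theory Submission
  imports Defs "HOL-Number_Theory.Residues"
begin

text \<open>The inclusion of kappa^e(f^n M) in kappa^e(f^(n+1) M) gives for each m some m' with
  kappa^e(f^n m) = kappa^e(f^(n+1) m'), but m' need not be R-linear in m, whereas the projected map
  multiplies m by coefficients that vary with its argument s. The dual basis separates the two: only
  the fixed vectors g_j m have to be replaced, and what varies with s is a p^e-th power, which
  leaves kappa^e as a scalar.

  \<open>sigma\<close> is a definite description, so the chain C_+^h M must first be shown to
  stabilize, the theorem of Hartshorne, Speiser and Gabber. Regularity is given only as a maximal
  ideal with as many generators as the Krull dimension, so Kunz's theorem rests on chains of primes
  and hence on Krull's principal ideal theorem. Both need a finite length argument at a prime P. It
  is carried out in R: a multiplier outside P stands for a denominator, and
  \<open>loc_stable\<close> stands for finite length.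

  Large e serves two ends: both chains must have reached sigma, and epsilon (p^e - 1) >= 1 must hold
  to gain the extra factor f.\<close>

lemma self_mod_simps [simp]:
  "carrier (self_mod A) = carrier A" "zero (self_mod A) = zero A" "one (self_mod A) = one A"
  "add (self_mod A) = add A" "mult (self_mod A) = mult A" "smult (self_mod A) = mult A"
  by (simp_all add: self_mod_def)

lemma a_inv_self_mod [simp]: "a_inv (self_mod A) x = a_inv A x"
  by (simp add: a_inv_def m_inv_def)

lemma (in cring) module_self_mod: "module R (self_mod R)"
proof (rule moduleI)
  show "cring R" by (rule is_cring)
  show "abelian_group (self_mod R)"
    by (rule abelian_groupI)
       (auto simp: add.m_assoc add.m_comm add.m_lcomm intro!: bexI[of _ "\<ominus> x" for x] l_neg)
qed (auto simp: l_distr r_distr m_assoc)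

lemma (in cring) submodule_self_mod_iff: "submodule I R (self_mod R) \<longleftrightarrow> ideal I R"
proof
  interpret S: module R "self_mod R" by (rule module_self_mod)
  assume s: "submodule I R (self_mod R)"
  show "ideal I R"
  proof (rule idealI)
    show "subgroup I (add_monoid R)"
      using S.submoduleE[OF s] by (intro add.subgroupI) auto
    show "x \<otimes> a \<in> I" "a \<otimes> x \<in> I" if "a \<in> I" "x \<in> carrier R" for a x
      using S.submoduleE(1,4)[OF s] that m_comm[of a x] by auto
  qed (rule ring_axioms)
next
  interpret S: module R "self_mod R" by (rule module_self_mod)
  assume "ideal I R"
  then interpret ideal I R .
  show "submodule I R (self_mod R)"
    by (rule S.submoduleI) (auto simp: a_subset I_l_closed)
qed

section \<open>Finitely generated and Noetherian modules\<close>

definition mspan :: "('a, 'x) ring_scheme \<Rightarrow> ('a, 'm, 'y) module_scheme \<Rightarrow> 'm set \<Rightarrow> 'm set" where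
  "mspan R M S = \<Inter>{N. submodule N R M \<and> S \<subseteq> N}"

definition noeth_module :: "('a, 'x) ring_scheme \<Rightarrow> ('a, 'm, 'y) module_scheme \<Rightarrow> bool" where
  "noeth_module R M \<longleftrightarrow>
     (\<forall>N. submodule N R M \<longrightarrow> (\<exists>S. finite S \<and> S \<subseteq> N \<and> N = mspan R M S))"

definition ideal_smult :: "('a, 'm, 'y) module_scheme \<Rightarrow> ('a, 'x) ring_scheme \<Rightarrow> 'a set \<Rightarrow> 'm set \<Rightarrow> 'm set" where
  "ideal_smult M R I X = mspan R M {a \<odot>\<^bsub>M\<^esub> x | a x. a \<in> I \<and> x \<in> X}"

lemma fg_module_iff: "fg_module R M \<longleftrightarrow> (\<exists>S. finite S \<and> S \<subseteq> carrier M \<and> carrier M \<subseteq> mspan R M S)"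
  if "module R M"
proof -
  interpret module R M by fact
  show ?thesis
    unfolding fg_module_def mspan_def
    by (intro ex_cong1 conj_cong refl) (use carrier_is_submodule submoduleE(1) in blast)
qed

context module
begin

lemma submoduleI':
  assumes "H \<subseteq> carrier M" "\<zero>\<^bsub>M\<^esub> \<in> H" "\<And>a b. \<lbrakk>a \<in> H; b \<in> H\<rbrakk> \<Longrightarrow> a \<oplus>\<^bsub>M\<^esub> b \<in> H"
    and sm: "\<And>a x. \<lbrakk>a \<in> carrier R; x \<in> H\<rbrakk> \<Longrightarrow> a \<odot>\<^bsub>M\<^esub> x \<in> H"
  shows "submodule H R M"
proof (rule submoduleI)
  fix a assume "a \<in> H"
  then have "(\<ominus> \<one>) \<odot>\<^bsub>M\<^esub> a \<in> H" by (intro sm) auto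
  then show "\<ominus>\<^bsub>M\<^esub> a \<in> H" using \<open>a \<in> H\<close> assms(1) by (simp add: smult_l_minus subset_iff)
qed (use assms in auto)

lemma submodule_zero: "submodule N R M \<Longrightarrow> \<zero>\<^bsub>M\<^esub> \<in> N"
  using subgroup.one_closed[OF submodule.axioms(1)] by fastforce

lemma submodule_minus: "submodule N R M \<Longrightarrow> x \<in> N \<Longrightarrow> y \<in> N \<Longrightarrow> x \<ominus>\<^bsub>M\<^esub> y \<in> N"
  unfolding a_minus_def by (intro submoduleE(5) submoduleE(3))

lemma submodule_Inter:
  assumes "\<And>N. N \<in> F \<Longrightarrow> submodule N R M" "F \<noteq> {}"
  shows "submodule (\<Inter>F) R M"
proof (rule submoduleI')
  show "\<Inter>F \<subseteq> carrier M" using assms submoduleE(1) by blast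
  show "\<zero>\<^bsub>M\<^esub> \<in> \<Inter>F" using assms submodule_zero by blast
  show "a \<oplus>\<^bsub>M\<^esub> b \<in> \<Inter>F" if "a \<in> \<Inter>F" "b \<in> \<Inter>F" for a b
    using that submoduleE(5)[OF assms(1)] by auto
  show "a \<odot>\<^bsub>M\<^esub> x \<in> \<Inter>F" if "a \<in> carrier R" "x \<in> \<Inter>F" for a x
    using that submoduleE(4)[OF assms(1)] by auto
qed

lemma submodule_Int: "submodule A R M \<Longrightarrow> submodule B R M \<Longrightarrow> submodule (A \<inter> B) R M"
  using submodule_Inter[of "{A, B}"] by auto

lemma mspan_submodule: "S \<subseteq> carrier M \<Longrightarrow> submodule (mspan R M S) R M"
  unfolding mspan_def by (rule submodule_Inter) (use carrier_is_submodule in auto)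

lemma mspan_incl: "S \<subseteq> mspan R M S"
  unfolding mspan_def by blast

lemma mspan_superset: "x \<in> S \<Longrightarrow> x \<in> mspan R M S"
  unfolding mspan_def by blast

lemma mspan_minimal: "submodule N R M \<Longrightarrow> S \<subseteq> N \<Longrightarrow> mspan R M S \<subseteq> N"
  unfolding mspan_def by blast

lemma mspan_mono: "S \<subseteq> T \<Longrightarrow> mspan R M S \<subseteq> mspan R M T"
  unfolding mspan_def by blast

lemma mspan_carrier: "S \<subseteq> carrier M \<Longrightarrow> mspan R M S \<subseteq> carrier M"
  using mspan_minimal[OF carrier_is_submodule] .

lemma mspan_of_submodule: "submodule N R M \<Longrightarrow> mspan R M N = N"
  using mspan_minimal mspan_incl by blast

lemma zero_submodule: "submodule {\<zero>\<^bsub>M\<^esub>} R M"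
  by (rule submoduleI') auto

lemma mspan_empty: "mspan R M {} = {\<zero>\<^bsub>M\<^esub>}"
  using mspan_minimal[OF zero_submodule, of "{}"] submodule_zero[OF mspan_submodule[of "{}"]] by auto

lemma submodule_sum:
  assumes A: "submodule A R M" and B: "submodule B R M"
  shows "submodule {a \<oplus>\<^bsub>M\<^esub> b | a b. a \<in> A \<and> b \<in> B} R M"
proof (rule submoduleI')
  note A' = submoduleE[OF A] and B' = submoduleE[OF B]
  show "{a \<oplus>\<^bsub>M\<^esub> b | a b. a \<in> A \<and> b \<in> B} \<subseteq> carrier M" using A' B' by auto
  show "\<zero>\<^bsub>M\<^esub> \<in> {a \<oplus>\<^bsub>M\<^esub> b | a b. a \<in> A \<and> b \<in> B}"
    using submodule_zero[OF A] submodule_zero[OF B] M.r_zero by force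
  show "x \<oplus>\<^bsub>M\<^esub> y \<in> {a \<oplus>\<^bsub>M\<^esub> b | a b. a \<in> A \<and> b \<in> B}"
    if xy: "x \<in> {a \<oplus>\<^bsub>M\<^esub> b | a b. a \<in> A \<and> b \<in> B}" "y \<in> {a \<oplus>\<^bsub>M\<^esub> b | a b. a \<in> A \<and> b \<in> B}" for x y
  proof -
    from xy obtain a b a' b' where "x = a \<oplus>\<^bsub>M\<^esub> b" "y = a' \<oplus>\<^bsub>M\<^esub> b'" "a \<in> A" "b \<in> B" "a' \<in> A" "b' \<in> B"
      by blast
    moreover from this have "x \<oplus>\<^bsub>M\<^esub> y = (a \<oplus>\<^bsub>M\<^esub> a') \<oplus>\<^bsub>M\<^esub> (b \<oplus>\<^bsub>M\<^esub> b')"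
      using A'(1) B'(1) by (simp add: subset_iff M.add.m_ac)
    ultimately show ?thesis using A'(5) B'(5) by blast
  qed
  show "r \<odot>\<^bsub>M\<^esub> x \<in> {a \<oplus>\<^bsub>M\<^esub> b | a b. a \<in> A \<and> b \<in> B}"
    if "r \<in> carrier R" "x \<in> {a \<oplus>\<^bsub>M\<^esub> b | a b. a \<in> A \<and> b \<in> B}" for r x
  proof -
    from that obtain a b where "x = a \<oplus>\<^bsub>M\<^esub> b" "a \<in> A" "b \<in> B" by blast
    moreover from this have "r \<odot>\<^bsub>M\<^esub> x = r \<odot>\<^bsub>M\<^esub> a \<oplus>\<^bsub>M\<^esub> r \<odot>\<^bsub>M\<^esub> b"
      using that(1) A'(1) B'(1) by (simp add: subset_iff smult_r_distr)
    ultimately show ?thesis using A'(4) B'(4) that(1) by blast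
  qed
qed

lemma submodule_smult_image:
  assumes x: "x \<in> carrier M"
  shows "submodule {a \<odot>\<^bsub>M\<^esub> x | a. a \<in> carrier R} R M"
proof (rule submoduleI')
  show "\<zero>\<^bsub>M\<^esub> \<in> {a \<odot>\<^bsub>M\<^esub> x | a. a \<in> carrier R}" using x smult_l_null[of x] by force
  show "u \<oplus>\<^bsub>M\<^esub> v \<in> {a \<odot>\<^bsub>M\<^esub> x | a. a \<in> carrier R}"
    if "u \<in> {a \<odot>\<^bsub>M\<^esub> x | a. a \<in> carrier R}" "v \<in> {a \<odot>\<^bsub>M\<^esub> x | a. a \<in> carrier R}" for u v
    using that x by (auto simp: smult_l_distr[symmetric])
  show "r \<odot>\<^bsub>M\<^esub> u \<in> {a \<odot>\<^bsub>M\<^esub> x | a. a \<in> carrier R}"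
    if "r \<in> carrier R" "u \<in> {a \<odot>\<^bsub>M\<^esub> x | a. a \<in> carrier R}" for r u
    using that x by (auto simp: smult_assoc1[symmetric])
qed (use x in auto)

lemma submodule_add_cyclic:
  assumes Y: "submodule Y R M" and x: "x \<in> carrier M"
  shows "mspan R M (insert x Y) = {y \<oplus>\<^bsub>M\<^esub> a \<odot>\<^bsub>M\<^esub> x | y a. y \<in> Y \<and> a \<in> carrier R}"
proof
  note Y' = submoduleE[OF Y]
  have "{y \<oplus>\<^bsub>M\<^esub> a \<odot>\<^bsub>M\<^esub> x | y a. y \<in> Y \<and> a \<in> carrier R} =
      {a \<oplus>\<^bsub>M\<^esub> b | a b. a \<in> Y \<and> b \<in> {a \<odot>\<^bsub>M\<^esub> x | a. a \<in> carrier R}}" by blast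
  then have sm: "submodule {y \<oplus>\<^bsub>M\<^esub> a \<odot>\<^bsub>M\<^esub> x | y a. y \<in> Y \<and> a \<in> carrier R} R M"
    using submodule_sum[OF Y submodule_smult_image[OF x]] by simp
  show "mspan R M (insert x Y) \<subseteq> {y \<oplus>\<^bsub>M\<^esub> a \<odot>\<^bsub>M\<^esub> x | y a. y \<in> Y \<and> a \<in> carrier R}"
  proof (rule mspan_minimal[OF sm], safe)
    show "\<exists>y a. x = y \<oplus>\<^bsub>M\<^esub> a \<odot>\<^bsub>M\<^esub> x \<and> y \<in> Y \<and> a \<in> carrier R"
      by (intro exI[of _ "\<zero>\<^bsub>M\<^esub>"] exI[of _ \<one>]) (use x submodule_zero[OF Y] in auto)
    show "\<exists>y' a. y = y' \<oplus>\<^bsub>M\<^esub> a \<odot>\<^bsub>M\<^esub> x \<and> y' \<in> Y \<and> a \<in> carrier R" if "y \<in> Y" for y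
      by (intro exI[of _ y] exI[of _ \<zero>]) (use x that Y' in auto)
  qed
  have sub: "submodule (mspan R M (insert x Y)) R M" using x Y' by (intro mspan_submodule) auto
  show "{y \<oplus>\<^bsub>M\<^esub> a \<odot>\<^bsub>M\<^esub> x | y a. y \<in> Y \<and> a \<in> carrier R} \<subseteq> mspan R M (insert x Y)"
    using submoduleE(4,5)[OF sub] mspan_incl[of "insert x Y"] by auto
qed

lemma mspan_insert_mspan:
  "S \<subseteq> carrier M \<Longrightarrow> x \<in> carrier M \<Longrightarrow> mspan R M (insert x (mspan R M S)) = mspan R M (insert x S)"
proof (rule equalityI)
  assume a: "S \<subseteq> carrier M" "x \<in> carrier M"
  show "mspan R M (insert x (mspan R M S)) \<subseteq> mspan R M (insert x S)"
    using a mspan_mono[of S "insert x S"] mspan_superset[of x "insert x S"]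
    by (intro mspan_minimal mspan_submodule) auto
  show "mspan R M (insert x S) \<subseteq> mspan R M (insert x (mspan R M S))"
    using mspan_incl[of S] by (intro mspan_mono) auto
qed

lemma mspan_insert:
  assumes "S \<subseteq> carrier M" "x \<in> carrier M"
  shows "mspan R M (insert x S) = {y \<oplus>\<^bsub>M\<^esub> a \<odot>\<^bsub>M\<^esub> x | y a. y \<in> mspan R M S \<and> a \<in> carrier R}"
  using submodule_add_cyclic[OF mspan_submodule[OF assms(1)] assms(2)] mspan_insert_mspan[OF assms]
  by simp

lemma submodule_vimage_smult:
  assumes N: "submodule N R M" and s: "s \<in> carrier R"
  shows "submodule {x \<in> carrier M. s \<odot>\<^bsub>M\<^esub> x \<in> N} R M"
proof (rule submoduleI')
  note N' = submoduleE[OF N]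
  show "a \<odot>\<^bsub>M\<^esub> x \<in> {x \<in> carrier M. s \<odot>\<^bsub>M\<^esub> x \<in> N}"
    if "a \<in> carrier R" "x \<in> {x \<in> carrier M. s \<odot>\<^bsub>M\<^esub> x \<in> N}" for a x
    using that N'(4)[of a "s \<odot>\<^bsub>M\<^esub> x"] s by (simp add: smult_assoc1[symmetric] R.m_comm)
qed (use s submodule_zero[OF N] submoduleE[OF N] in \<open>auto simp: smult_r_distr\<close>)

lemma ideal_smult_submodule:
  assumes "I \<subseteq> carrier R" "X \<subseteq> carrier M"
  shows "submodule (ideal_smult M R I X) R M"
  unfolding ideal_smult_def using assms by (intro mspan_submodule) auto

lemma ideal_smultI: "a \<in> I \<Longrightarrow> x \<in> X \<Longrightarrow> a \<odot>\<^bsub>M\<^esub> x \<in> ideal_smult M R I X"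
  unfolding ideal_smult_def by (intro mspan_superset) auto

lemma ideal_smult_minimal:
  "submodule N R M \<Longrightarrow> (\<And>a x. a \<in> I \<Longrightarrow> x \<in> X \<Longrightarrow> a \<odot>\<^bsub>M\<^esub> x \<in> N) \<Longrightarrow> ideal_smult M R I X \<subseteq> N"
  unfolding ideal_smult_def by (intro mspan_minimal) auto

lemma colon_ideal:
  assumes N: "submodule N R M" and X: "X \<subseteq> carrier M"
  shows "ideal {a \<in> carrier R. \<forall>x\<in>X. a \<odot>\<^bsub>M\<^esub> x \<in> N} R"
proof (rule idealI[OF ring_axioms])
  note N' = submoduleE[OF N]
  show "subgroup {a \<in> carrier R. \<forall>x\<in>X. a \<odot>\<^bsub>M\<^esub> x \<in> N} (add_monoid R)"
    using X N' submodule_zero[OF N]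
    by (intro R.add.subgroupI) (auto simp: smult_l_minus smult_l_distr subset_iff intro!: exI[of _ \<zero>])
  show "x \<otimes> a \<in> {a \<in> carrier R. \<forall>x\<in>X. a \<odot>\<^bsub>M\<^esub> x \<in> N}"
    if "a \<in> {a \<in> carrier R. \<forall>x\<in>X. a \<odot>\<^bsub>M\<^esub> x \<in> N}" "x \<in> carrier R" for a x
    using that X N' by (auto simp: smult_assoc1 subset_iff)
  then show "a \<otimes> x \<in> {a \<in> carrier R. \<forall>x\<in>X. a \<odot>\<^bsub>M\<^esub> x \<in> N}"
    if "a \<in> {a \<in> carrier R. \<forall>x\<in>X. a \<odot>\<^bsub>M\<^esub> x \<in> N}" "x \<in> carrier R" for a x
    using that R.m_comm[of a x] by auto
qed

lemma noeth_module_obtain: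
  assumes "noeth_module R M" "submodule N R M"
  obtains S where "finite S" "S \<subseteq> carrier M" "S \<subseteq> N" "N = mspan R M S"
  using assms submoduleE(1)[OF assms(2)] unfolding noeth_module_def by (metis subset_trans)

lemma finite_subset_chain:
  assumes "finite S" "\<And>n. N n \<subseteq> N (Suc n)" "S \<subseteq> (\<Union>n. N n :: 'c set)"
  shows "\<exists>n. S \<subseteq> N n"
  using assms(1,3)
proof (induct S)
  case (insert x S)
  then obtain n m where "S \<subseteq> N n" "x \<in> N m" by auto
  then have "insert x S \<subseteq> N (max n m)"
    using lift_Suc_mono_le[of N, OF assms(2)] by (meson insert_subset max.cobounded1 max.cobounded2 subset_trans subsetD)
  then show ?case ..
qed auto

lemma ascending_chain:
  assumes no: "noeth_module R M" and sub: "\<And>n. submodule (N n) R M" and inc: "\<And>n. N n \<subseteq> N (Suc n)"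
  shows "\<exists>n0. \<forall>n\<ge>n0. N n = N n0"
proof -
  have mono: "N i \<subseteq> N j" if "i \<le> j" for i j using lift_Suc_mono_le[of N, OF inc that] .
  have "submodule (\<Union>n. N n) R M"
  proof (rule submoduleI')
    show "\<zero>\<^bsub>M\<^esub> \<in> (\<Union>n. N n)" using submodule_zero[OF sub] by auto
    show "a \<oplus>\<^bsub>M\<^esub> b \<in> (\<Union>n. N n)" if "a \<in> (\<Union>n. N n)" "b \<in> (\<Union>n. N n)" for a b
    proof -
      from that obtain i j where "a \<in> N i" "b \<in> N j" by blast
      then have "a \<in> N (max i j)" "b \<in> N (max i j)" using mono[of i "max i j"] mono[of j "max i j"] by auto
      then show ?thesis using submoduleE(5)[OF sub] by blast
    qed
    show "(\<Union>n. N n) \<subseteq> carrier M" using submoduleE(1)[OF sub] by auto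
    show "a \<odot>\<^bsub>M\<^esub> x \<in> (\<Union>n. N n)" if "a \<in> carrier R" "x \<in> (\<Union>n. N n)" for a x
      using that submoduleE(4)[OF sub] by auto
  qed
  then obtain S where S: "finite S" "S \<subseteq> (\<Union>n. N n)" "(\<Union>n. N n) = mspan R M S"
    using noeth_module_obtain[OF no] by metis
  then obtain n0 where "S \<subseteq> N n0" using finite_subset_chain[of S N] inc by blast
  then have "(\<Union>n. N n) \<subseteq> N n0" using S(3) mspan_minimal[OF sub] by simp
  then show ?thesis using mono by blast
qed

text \<open>The form in which Noetherian induction is used: a largest counterexample is chosen. A
  family without maximal member would yield a strictly increasing sequence by choice.\<close>

lemma maximal_submodule:
  assumes no: "noeth_module R M" and sub: "\<And>N. N \<in> F \<Longrightarrow> submodule N R M" and ne: "F \<noteq> {}"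
  shows "\<exists>N\<in>F. \<forall>N'\<in>F. N \<subseteq> N' \<longrightarrow> N' = N"
proof (rule ccontr)
  assume "\<not> ?thesis"
  then have "\<forall>N\<in>F. \<exists>N'\<in>F. N \<subset> N'" by blast
  then obtain g where g: "\<And>N. N \<in> F \<Longrightarrow> g N \<in> F" "\<And>N. N \<in> F \<Longrightarrow> N \<subset> g N" by metis
  obtain N0 where N0: "N0 \<in> F" using ne by blast
  have mem: "(g ^^ n) N0 \<in> F" for n by (induct n) (auto simp: N0 g)
  obtain n0 where "\<forall>n\<ge>n0. (g ^^ n) N0 = (g ^^ n0) N0"
    using ascending_chain[OF no, of "\<lambda>n. (g ^^ n) N0"] sub[OF mem] g(2)[OF mem] by auto
  then have "(g ^^ Suc n0) N0 = (g ^^ n0) N0" using le_Suc_eq by blast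
  then show False using g(2)[OF mem[of n0]] by simp
qed

end

lemma (in cring) mspan_self_mod: "mspan R (self_mod R) S = Idl S"
  by (simp add: mspan_def genideal_def submodule_self_mod_iff)

lemma (in cring) noeth_module_self_mod:
  assumes "noetherian_ring R" shows "noeth_module R (self_mod R)"
  unfolding noeth_module_def submodule_self_mod_iff mspan_self_mod
  using noetherian_ring.finetely_gen[OF assms] genideal_self by metis

lemma (in cring) finite_ideal_generators:
  assumes "noetherian_ring R" "ideal I R"
  obtains S where "finite S" "S \<subseteq> carrier R" "S \<subseteq> I" "I = Idl S"
  using noetherian_ring.finetely_gen[OF assms] genideal_self by metis

lemma (in abelian_group) minus_add_cancel: "x \<in> carrier G \<Longrightarrow> y \<in> carrier G \<Longrightarrow> (x \<ominus> y) \<oplus> y = x"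
  by (simp add: minus_eq add.m_assoc l_neg)

section \<open>Submodules of finitely generated modules, and Nakayama's lemma at a prime\<close>

context module
begin

text \<open>Induction on the generators. The coefficients with which the new generator x occurs in N
  form an ideal. Lifting finitely many generators of this ideal to N reduces every element of N to
  one that also lies in the span of F, where the induction hypothesis applies.\<close>

lemma fg_submodules_fg:
  assumes no: "noetherian_ring R" and F: "finite F" "F \<subseteq> carrier M"
    and N: "submodule N R M" "N \<subseteq> mspan R M F"
  shows "\<exists>S. finite S \<and> S \<subseteq> N \<and> N = mspan R M S"
  using F N
proof (induct F arbitrary: N)
  case empty
  then show ?case using submodule_zero[OF empty(2)] mspan_empty by (intro exI[of _ "{}"]) auto
next
  case (insert x F)
  have x: "x \<in> carrier M" and F: "F \<subseteq> carrier M" using insert by auto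
  note N = insert.prems(2)
  have spF: "submodule (mspan R M F) R M" by (rule mspan_submodule[OF F])
  note sp = submoduleE[OF spF] submodule_zero[OF spF]
  note N' = submoduleE[OF N] submodule_zero[OF N]
  obtain S0 where S0: "finite S0" "S0 \<subseteq> N \<inter> mspan R M F" "N \<inter> mspan R M F = mspan R M S0"
    using insert(3)[OF F submodule_Int[OF N spF]] by auto
  \<comment> \<open>A function of the submodule because it is applied twice: to N, and to the span
    of the chosen lifts, whose coefficient ideal is shown to contain that of N.\<close>
  define A where "A = (\<lambda>N. {a \<in> carrier R. \<exists>y\<in>mspan R M F. y \<oplus>\<^bsub>M\<^esub> a \<odot>\<^bsub>M\<^esub> x \<in> N})"
  have idA: "ideal (A N) R" if N: "submodule N R M" for N
    unfolding submodule_self_mod_iff[symmetric]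
  proof -
    interpret S: module R "self_mod R" by (rule R.module_self_mod)
    note N' = submoduleE[OF N] submodule_zero[OF N]
    show "submodule (A N) R (self_mod R)"
    proof (rule S.submoduleI')
      show "\<zero>\<^bsub>self_mod R\<^esub> \<in> A N" using sp N' x by (auto simp: A_def intro!: bexI[of _ "\<zero>\<^bsub>M\<^esub>"])
      show "a \<oplus>\<^bsub>self_mod R\<^esub> b \<in> A N" if "a \<in> A N" "b \<in> A N" for a b
      proof -
        from that obtain y z where yz: "y \<in> mspan R M F" "z \<in> mspan R M F" "y \<oplus>\<^bsub>M\<^esub> a \<odot>\<^bsub>M\<^esub> x \<in> N"
          "z \<oplus>\<^bsub>M\<^esub> b \<odot>\<^bsub>M\<^esub> x \<in> N" "a \<in> carrier R" "b \<in> carrier R" by (auto simp: A_def)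
        have yzc: "y \<in> carrier M" "z \<in> carrier M" using yz sp by auto
        have "(y \<oplus>\<^bsub>M\<^esub> z) \<oplus>\<^bsub>M\<^esub> (a \<oplus> b) \<odot>\<^bsub>M\<^esub> x = (y \<oplus>\<^bsub>M\<^esub> a \<odot>\<^bsub>M\<^esub> x) \<oplus>\<^bsub>M\<^esub> (z \<oplus>\<^bsub>M\<^esub> b \<odot>\<^bsub>M\<^esub> x)"
          using yz(5,6) yzc x by (simp add: smult_l_distr M.add.m_ac)
        then have "(y \<oplus>\<^bsub>M\<^esub> z) \<oplus>\<^bsub>M\<^esub> (a \<oplus> b) \<odot>\<^bsub>M\<^esub> x \<in> N" using N'(5)[OF yz(3,4)] by simp
        then show ?thesis using sp(5)[OF yz(1,2)] yz(5,6) by (auto simp: A_def)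
      qed
      show "r \<odot>\<^bsub>self_mod R\<^esub> a \<in> A N" if "r \<in> carrier R" "a \<in> A N" for r a
      proof -
        from that obtain y where y: "y \<in> mspan R M F" "y \<oplus>\<^bsub>M\<^esub> a \<odot>\<^bsub>M\<^esub> x \<in> N" "a \<in> carrier R" by (auto simp: A_def)
        have "y \<in> carrier M" using y sp by auto
        then have "r \<odot>\<^bsub>M\<^esub> y \<oplus>\<^bsub>M\<^esub> (r \<otimes> a) \<odot>\<^bsub>M\<^esub> x = r \<odot>\<^bsub>M\<^esub> (y \<oplus>\<^bsub>M\<^esub> a \<odot>\<^bsub>M\<^esub> x)"
          using y that x by (simp add: smult_r_distr smult_assoc1)
        then have "r \<odot>\<^bsub>M\<^esub> y \<oplus>\<^bsub>M\<^esub> (r \<otimes> a) \<odot>\<^bsub>M\<^esub> x \<in> N" using N'(4)[OF that(1) y(2)] by simp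
        then show ?thesis using sp(4)[OF that(1) y(1)] y(3) that(1) by (auto simp: A_def)
      qed
    qed (auto simp: A_def)
  qed
  obtain T where T: "finite T" "T \<subseteq> carrier R" "T \<subseteq> A N" "A N = Idl T"
    using R.finite_ideal_generators[OF no idA[OF N]] by blast
  have "\<forall>t\<in>T. \<exists>n\<in>N. \<exists>y\<in>mspan R M F. n = y \<oplus>\<^bsub>M\<^esub> t \<odot>\<^bsub>M\<^esub> x" using T(3) unfolding A_def by blast
  then obtain g where g: "\<And>t. t \<in> T \<Longrightarrow> g t \<in> N"
    "\<And>t. t \<in> T \<Longrightarrow> \<exists>y\<in>mspan R M F. g t = y \<oplus>\<^bsub>M\<^esub> t \<odot>\<^bsub>M\<^esub> x" by metis
  have gT: "g ` T \<subseteq> N" "g ` T \<subseteq> carrier M" using g(1) N'(1) by auto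
  have spT: "submodule (mspan R M (g ` T)) R M" by (rule mspan_submodule[OF gT(2)])
  have "T \<subseteq> A (mspan R M (g ` T))"
  proof
    fix t assume t: "t \<in> T"
    then obtain y where "y \<in> mspan R M F" "g t = y \<oplus>\<^bsub>M\<^esub> t \<odot>\<^bsub>M\<^esub> x" using g(2) by blast
    moreover have "g t \<in> mspan R M (g ` T)" using t by (intro mspan_superset) auto
    ultimately show "t \<in> A (mspan R M (g ` T))" using t T(2) by (auto simp: A_def)
  qed
  then have sub: "A N \<subseteq> A (mspan R M (g ` T))"
    unfolding T(4) by (rule R.genideal_minimal[OF idA[OF spT]])
  let ?S = "S0 \<union> g ` T"
  have SN: "?S \<subseteq> N" using S0 gT by auto
  then have Sc: "?S \<subseteq> carrier M" using N' by auto
  note spS = submoduleE[OF mspan_submodule[OF Sc]]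
  have "N \<subseteq> mspan R M ?S"
  proof
    fix n assume n: "n \<in> N"
    then obtain y a where ya: "n = y \<oplus>\<^bsub>M\<^esub> a \<odot>\<^bsub>M\<^esub> x" "y \<in> mspan R M F" "a \<in> carrier R"
      using insert.prems(3) mspan_insert[OF F x] by auto
    then have "a \<in> A N" using n by (auto simp: A_def)
    then obtain y' where y': "y' \<in> mspan R M F" "y' \<oplus>\<^bsub>M\<^esub> a \<odot>\<^bsub>M\<^esub> x \<in> mspan R M (g ` T)"
      using sub by (auto simp: A_def)
    let ?w = "y' \<oplus>\<^bsub>M\<^esub> a \<odot>\<^bsub>M\<^esub> x"
    have wN: "?w \<in> N" using y'(2) mspan_minimal[OF N gT(1)] by auto
    have c: "y \<in> carrier M" "y' \<in> carrier M" using ya y' sp by auto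
    have "n \<ominus>\<^bsub>M\<^esub> ?w = y \<ominus>\<^bsub>M\<^esub> y'"
      using c x ya(3) unfolding ya(1) a_minus_def by (simp add: M.minus_add M.add.m_ac M.r_neg M.r_neg1)
    then have "n \<ominus>\<^bsub>M\<^esub> ?w \<in> N \<inter> mspan R M F"
      using submodule_minus[OF N n wN] submodule_minus[OF spF ya(2) y'(1)] by simp
    then have "n \<ominus>\<^bsub>M\<^esub> ?w \<in> mspan R M ?S" using S0(3) mspan_mono[of S0 ?S] by auto
    moreover have "?w \<in> mspan R M ?S" using y'(2) mspan_mono[of "g ` T" ?S] by auto
    ultimately have "(n \<ominus>\<^bsub>M\<^esub> ?w) \<oplus>\<^bsub>M\<^esub> ?w \<in> mspan R M ?S" using spS(5) by blast
    moreover have "(n \<ominus>\<^bsub>M\<^esub> ?w) \<oplus>\<^bsub>M\<^esub> ?w = n"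
      using n wN N'(1) by (intro M.minus_add_cancel) auto
    ultimately show "n \<in> mspan R M ?S" by simp
  qed
  then have "N = mspan R M ?S" using mspan_minimal[OF N SN] by (rule equalityI)
  then show ?case using SN S0(1) T(1) by (intro exI[of _ ?S]) simp
qed

lemma noeth_moduleI:
  assumes "noetherian_ring R" "fg_module R M"
  shows "noeth_module R M"
proof -
  obtain S where "finite S" "S \<subseteq> carrier M" "carrier M \<subseteq> mspan R M S"
    using assms(2) fg_module_iff[OF module_axioms] by blast
  then show ?thesis
    unfolding noeth_module_def using fg_submodules_fg[OF assms(1)] submoduleE(1) by (meson subset_trans)
qed

text \<open>Splits one generator off from I times a span, so that the proof of Nakayama's lemma can
  eliminate generators one at a time.\<close>

lemma ideal_smult_mspan_insert:
  assumes I: "ideal I R" and F: "F \<subseteq> carrier M" and y: "y \<in> carrier M"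
    and z: "z \<in> ideal_smult M R I (mspan R M (insert y F))"
  shows "\<exists>a\<in>I. \<exists>w\<in>ideal_smult M R I (mspan R M F). z = a \<odot>\<^bsub>M\<^esub> y \<oplus>\<^bsub>M\<^esub> w"
proof -
  interpret I: ideal I R by fact
  let ?W = "ideal_smult M R I (mspan R M F)"
  have Fs: "mspan R M F \<subseteq> carrier M" by (rule mspan_carrier[OF F])
  have W: "submodule ?W R M" by (rule ideal_smult_submodule[OF I.a_subset Fs])
  have 1: "submodule {a \<odot>\<^bsub>M\<^esub> y | a. a \<in> I} R M"
  proof (rule submoduleI')
    show "\<zero>\<^bsub>M\<^esub> \<in> {a \<odot>\<^bsub>M\<^esub> y | a. a \<in> I}" using I.zero_closed y by (auto intro!: exI[of _ \<zero>])
    show "u \<oplus>\<^bsub>M\<^esub> v \<in> {a \<odot>\<^bsub>M\<^esub> y | a. a \<in> I}"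
      if "u \<in> {a \<odot>\<^bsub>M\<^esub> y | a. a \<in> I}" "v \<in> {a \<odot>\<^bsub>M\<^esub> y | a. a \<in> I}" for u v
    proof -
      from that obtain a b where ab: "u = a \<odot>\<^bsub>M\<^esub> y" "v = b \<odot>\<^bsub>M\<^esub> y" "a \<in> I" "b \<in> I" by blast
      then have "u \<oplus>\<^bsub>M\<^esub> v = (a \<oplus> b) \<odot>\<^bsub>M\<^esub> y" using y I.Icarr by (simp add: smult_l_distr)
      then show ?thesis using I.a_closed[OF ab(3,4)] by blast
    qed
    show "r \<odot>\<^bsub>M\<^esub> v \<in> {a \<odot>\<^bsub>M\<^esub> y | a. a \<in> I}" if "r \<in> carrier R" "v \<in> {a \<odot>\<^bsub>M\<^esub> y | a. a \<in> I}" for r v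
    proof -
      from that obtain a where a: "v = a \<odot>\<^bsub>M\<^esub> y" "a \<in> I" by blast
      then have "r \<odot>\<^bsub>M\<^esub> v = (r \<otimes> a) \<odot>\<^bsub>M\<^esub> y" using y I.Icarr that(1) by (simp add: smult_assoc1)
      then show ?thesis using I.I_l_closed[OF a(2) that(1)] by blast
    qed
  qed (use y I.Icarr in auto)
  have 2: "submodule {u \<oplus>\<^bsub>M\<^esub> w | u w. u \<in> {a \<odot>\<^bsub>M\<^esub> y | a. a \<in> I} \<and> w \<in> ?W} R M"
    by (rule submodule_sum[OF 1 W])
  have "ideal_smult M R I (mspan R M (insert y F)) \<subseteq> {u \<oplus>\<^bsub>M\<^esub> w | u w. u \<in> {a \<odot>\<^bsub>M\<^esub> y | a. a \<in> I} \<and> w \<in> ?W}"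
  proof (rule ideal_smult_minimal[OF 2])
    fix a x assume a: "a \<in> I" and "x \<in> mspan R M (insert y F)"
    then obtain v b where vb: "x = v \<oplus>\<^bsub>M\<^esub> b \<odot>\<^bsub>M\<^esub> y" "v \<in> mspan R M F" "b \<in> carrier R"
      using mspan_insert[OF F y] by auto
    have "a \<odot>\<^bsub>M\<^esub> x = (a \<otimes> b) \<odot>\<^bsub>M\<^esub> y \<oplus>\<^bsub>M\<^esub> a \<odot>\<^bsub>M\<^esub> v"
      using vb Fs y I.Icarr[OF a] by (simp add: subset_iff smult_r_distr smult_assoc1 M.add.m_comm)
    moreover have "a \<otimes> b \<in> I" using a vb(3) I.I_r_closed by blast
    moreover have "a \<odot>\<^bsub>M\<^esub> v \<in> ?W" using a vb(2) by (rule ideal_smultI)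
    ultimately show "a \<odot>\<^bsub>M\<^esub> x \<in> {u \<oplus>\<^bsub>M\<^esub> w | u w. u \<in> {a \<odot>\<^bsub>M\<^esub> y | a. a \<in> I} \<and> w \<in> ?W}" by blast
  qed
  then show ?thesis using z by blast
qed

text \<open>Nakayama's lemma for the localization at P, with the multipliers u and u' as
  denominators. A generator x is eliminated by rewriting u x = y + p x + w as (u - p) x = y + w,
  where u - p stays outside P.\<close>

lemma nakayama:
  assumes P: "primeideal P R" and F: "finite F" "F \<subseteq> carrier M" and Y: "submodule Y R M"
    and u: "u \<in> carrier R - P"
    and uF: "\<And>x. x \<in> mspan R M F \<Longrightarrow> \<exists>y\<in>Y. \<exists>z\<in>ideal_smult M R P (mspan R M F). u \<odot>\<^bsub>M\<^esub> x = y \<oplus>\<^bsub>M\<^esub> z"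
  shows "\<exists>u'\<in>carrier R - P. \<forall>x\<in>mspan R M F. u' \<odot>\<^bsub>M\<^esub> x \<in> Y"
  using F u uF
proof (induct F arbitrary: u)
  case empty
  then show ?case using mspan_empty submodule_zero[OF Y] by (intro bexI[of _ u]) auto
next
  case (insert x F)
  interpret P: primeideal P R by fact
  have x: "x \<in> carrier M" and F: "F \<subseteq> carrier M" using insert by auto
  let ?S = "mspan R M F"
  have spF: "submodule ?S R M" by (rule mspan_submodule[OF F])
  note sp = submoduleE[OF spF] submodule_zero[OF spF]
  note Y' = submoduleE[OF Y]
  have W: "submodule (ideal_smult M R P ?S) R M" by (rule ideal_smult_submodule[OF P.a_subset sp(1)])
  have WS: "ideal_smult M R P ?S \<subseteq> ?S"
    by (rule ideal_smult_minimal[OF spF]) (use sp(4) P.Icarr in blast)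
  have u: "u \<in> carrier R" "u \<notin> P" using insert.prems by auto
  have red: "\<exists>y\<in>Y. \<exists>a\<in>P. \<exists>w\<in>ideal_smult M R P ?S. u \<odot>\<^bsub>M\<^esub> z = y \<oplus>\<^bsub>M\<^esub> (a \<odot>\<^bsub>M\<^esub> x \<oplus>\<^bsub>M\<^esub> w)"
    if z: "z \<in> mspan R M (insert x F)" for z
    using insert.prems(3)[OF z] ideal_smult_mspan_insert[OF P.is_ideal F x] by metis
  obtain y p w where ypw: "y \<in> Y" "p \<in> P" "w \<in> ideal_smult M R P ?S" "u \<odot>\<^bsub>M\<^esub> x = y \<oplus>\<^bsub>M\<^esub> (p \<odot>\<^bsub>M\<^esub> x \<oplus>\<^bsub>M\<^esub> w)"
    using red[of x] mspan_superset[of x "insert x F"] by auto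
  let ?v = "u \<ominus> p"
  have pc: "p \<in> carrier R" using P.Icarr[OF ypw(2)] .
  have vc: "?v \<in> carrier R" using u pc by simp
  have vP: "?v \<notin> P"
  proof
    assume "?v \<in> P"
    then have "?v \<oplus> p \<in> P" using ypw(2) by (rule P.a_closed)
    moreover have "?v \<oplus> p = u" using u(1) pc by (simp add: R.minus_eq R.add.m_assoc R.l_neg)
    ultimately show False using u by simp
  qed
  have wS: "w \<in> ?S" using ypw(3) WS by blast
  have cc: "y \<in> carrier M" "w \<in> carrier M" using ypw(1) Y' wS sp(1) by auto
  have vx: "?v \<odot>\<^bsub>M\<^esub> x = y \<oplus>\<^bsub>M\<^esub> w"
  proof -
    have "?v \<odot>\<^bsub>M\<^esub> x = u \<odot>\<^bsub>M\<^esub> x \<ominus>\<^bsub>M\<^esub> p \<odot>\<^bsub>M\<^esub> x"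
      using u(1) pc x by (simp add: R.minus_eq M.minus_eq smult_l_distr smult_l_minus)
    also have "\<dots> = y \<oplus>\<^bsub>M\<^esub> w"
      unfolding ypw(4) using cc pc x by (simp add: M.minus_eq M.add.m_ac M.r_neg1 M.r_neg)
    finally show ?thesis .
  qed
  have "\<exists>u'\<in>carrier R - P. \<forall>x\<in>?S. u' \<odot>\<^bsub>M\<^esub> x \<in> Y"
  proof (rule insert(3)[OF F])
    \<comment> \<open>The factor \<open>?v\<close> turns the remaining multiple a x into a (y + w),
      so that only generators from F are left.\<close>
    show "?v \<otimes> u \<in> carrier R - P" using vc u vP P.I_prime by auto
    fix z assume z: "z \<in> ?S"
    obtain y1 a w1 where 1: "y1 \<in> Y" "a \<in> P" "w1 \<in> ideal_smult M R P ?S"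
        "u \<odot>\<^bsub>M\<^esub> z = y1 \<oplus>\<^bsub>M\<^esub> (a \<odot>\<^bsub>M\<^esub> x \<oplus>\<^bsub>M\<^esub> w1)"
      using red[of z] z mspan_mono[of F "insert x F"] by blast
    have c1: "y1 \<in> carrier M" "w1 \<in> carrier M" "a \<in> carrier R" "z \<in> carrier M"
      using 1 Y' WS sp(1) P.Icarr z by auto
    have "(?v \<otimes> u) \<odot>\<^bsub>M\<^esub> z = ?v \<odot>\<^bsub>M\<^esub> y1 \<oplus>\<^bsub>M\<^esub> (a \<odot>\<^bsub>M\<^esub> (?v \<odot>\<^bsub>M\<^esub> x) \<oplus>\<^bsub>M\<^esub> ?v \<odot>\<^bsub>M\<^esub> w1)"
    proof -
      have "(?v \<otimes> u) \<odot>\<^bsub>M\<^esub> z = ?v \<odot>\<^bsub>M\<^esub> (u \<odot>\<^bsub>M\<^esub> z)" using vc u c1 by (simp add: smult_assoc1)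
      also have "\<dots> = ?v \<odot>\<^bsub>M\<^esub> y1 \<oplus>\<^bsub>M\<^esub> (?v \<odot>\<^bsub>M\<^esub> (a \<odot>\<^bsub>M\<^esub> x) \<oplus>\<^bsub>M\<^esub> ?v \<odot>\<^bsub>M\<^esub> w1)"
        unfolding 1(4) using vc c1 x by (simp add: smult_r_distr)
      also have "?v \<odot>\<^bsub>M\<^esub> (a \<odot>\<^bsub>M\<^esub> x) = a \<odot>\<^bsub>M\<^esub> (?v \<odot>\<^bsub>M\<^esub> x)"
        using vc c1 x by (simp add: smult_assoc1[symmetric] R.m_comm)
      finally show ?thesis .
    qed
    also have "\<dots> = (?v \<odot>\<^bsub>M\<^esub> y1 \<oplus>\<^bsub>M\<^esub> a \<odot>\<^bsub>M\<^esub> y) \<oplus>\<^bsub>M\<^esub> (a \<odot>\<^bsub>M\<^esub> w \<oplus>\<^bsub>M\<^esub> ?v \<odot>\<^bsub>M\<^esub> w1)"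
      unfolding vx using vc c1 cc by (simp add: smult_r_distr M.add.m_ac)
    finally have eq: "(?v \<otimes> u) \<odot>\<^bsub>M\<^esub> z = (?v \<odot>\<^bsub>M\<^esub> y1 \<oplus>\<^bsub>M\<^esub> a \<odot>\<^bsub>M\<^esub> y) \<oplus>\<^bsub>M\<^esub> (a \<odot>\<^bsub>M\<^esub> w \<oplus>\<^bsub>M\<^esub> ?v \<odot>\<^bsub>M\<^esub> w1)" .
    have "?v \<odot>\<^bsub>M\<^esub> y1 \<oplus>\<^bsub>M\<^esub> a \<odot>\<^bsub>M\<^esub> y \<in> Y" using Y'(4,5) vc 1(1) c1(3) ypw(1) by blast
    moreover have "a \<odot>\<^bsub>M\<^esub> w \<oplus>\<^bsub>M\<^esub> ?v \<odot>\<^bsub>M\<^esub> w1 \<in> ideal_smult M R P ?S"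
      using submoduleE(4,5)[OF W] ideal_smultI[OF 1(2) wS] vc 1(3) by blast
    ultimately show "\<exists>y\<in>Y. \<exists>wa\<in>ideal_smult M R P ?S. (?v \<otimes> u) \<odot>\<^bsub>M\<^esub> z = y \<oplus>\<^bsub>M\<^esub> wa" using eq by blast
  qed
  then obtain u' where u': "u' \<in> carrier R" "u' \<notin> P" "\<And>z. z \<in> ?S \<Longrightarrow> u' \<odot>\<^bsub>M\<^esub> z \<in> Y" by auto
  have "u' \<otimes> ?v \<in> carrier R - P" using u' vc vP P.I_prime by auto
  moreover have "(u' \<otimes> ?v) \<odot>\<^bsub>M\<^esub> z \<in> Y" if z: "z \<in> mspan R M (insert x F)" for z
  proof -
    obtain s b where sb: "z = s \<oplus>\<^bsub>M\<^esub> b \<odot>\<^bsub>M\<^esub> x" "s \<in> ?S" "b \<in> carrier R" using z mspan_insert[OF F x] by auto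
    have sc: "s \<in> carrier M" using sb sp by auto
    have "(u' \<otimes> ?v) \<odot>\<^bsub>M\<^esub> z = ?v \<odot>\<^bsub>M\<^esub> (u' \<odot>\<^bsub>M\<^esub> s) \<oplus>\<^bsub>M\<^esub> b \<odot>\<^bsub>M\<^esub> (u' \<odot>\<^bsub>M\<^esub> (?v \<odot>\<^bsub>M\<^esub> x))"
    proof -
      have "(u' \<otimes> ?v) \<odot>\<^bsub>M\<^esub> z = (u' \<otimes> ?v) \<odot>\<^bsub>M\<^esub> s \<oplus>\<^bsub>M\<^esub> (u' \<otimes> ?v) \<odot>\<^bsub>M\<^esub> (b \<odot>\<^bsub>M\<^esub> x)"
        unfolding sb(1) using sc u'(1) vc sb(3) x by (simp add: smult_r_distr)
      moreover have "(u' \<otimes> ?v) \<odot>\<^bsub>M\<^esub> s = ?v \<odot>\<^bsub>M\<^esub> (u' \<odot>\<^bsub>M\<^esub> s)"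
        using sc u'(1) vc R.m_comm[of u' ?v] by (simp add: smult_assoc1)
      moreover have "(u' \<otimes> ?v) \<odot>\<^bsub>M\<^esub> (b \<odot>\<^bsub>M\<^esub> x) = b \<odot>\<^bsub>M\<^esub> (u' \<odot>\<^bsub>M\<^esub> (?v \<odot>\<^bsub>M\<^esub> x))"
        using x u'(1) vc sb(3) R.m_comm[of "u' \<otimes> ?v" b] by (simp add: smult_assoc1[symmetric] R.m_assoc)
      ultimately show ?thesis by simp
    qed
    moreover have "u' \<odot>\<^bsub>M\<^esub> (?v \<odot>\<^bsub>M\<^esub> x) = u' \<odot>\<^bsub>M\<^esub> y \<oplus>\<^bsub>M\<^esub> u' \<odot>\<^bsub>M\<^esub> w"
      unfolding vx using cc u'(1) by (simp add: smult_r_distr)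
    moreover have "u' \<odot>\<^bsub>M\<^esub> y \<oplus>\<^bsub>M\<^esub> u' \<odot>\<^bsub>M\<^esub> w \<in> Y" using Y'(4,5) u'(1) u'(3)[OF wS] ypw(1) by blast
    ultimately show ?thesis using Y'(4,5) vc sb(3) u'(3)[OF sb(2)] by simp
  qed
  ultimately show ?case by blast
qed

end

definition desc_chain :: "('a, 'x) ring_scheme \<Rightarrow> ('a, 'm, 'y) module_scheme \<Rightarrow> (nat \<Rightarrow> 'm set) \<Rightarrow> bool" where
  "desc_chain R M Z \<longleftrightarrow> (\<forall>n. submodule (Z n) R M \<and> Z (Suc n) \<subseteq> Z n)"

section \<open>Descending chains near a prime\<close>

text \<open>Eventually \<open>Z n \<inter> X \<subseteq> Z (n + 1) + Y\<close> after localizing at \<open>P\<close>. This replaces the descending chain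
  condition for finite-length modules over the local ring at \<open>P\<close>.\<close>

definition loc_stable :: "('a, 'x) ring_scheme \<Rightarrow> ('a, 'm, 'y) module_scheme \<Rightarrow> 'a set \<Rightarrow>
    (nat \<Rightarrow> 'm set) \<Rightarrow> 'm set \<Rightarrow> 'm set \<Rightarrow> bool" where
  "loc_stable R M P Z X Y \<longleftrightarrow> (\<exists>n0. \<forall>n\<ge>n0. \<exists>t\<in>carrier R - P. \<forall>z\<in>Z n \<inter> X.
     \<exists>z'\<in>Z (Suc n). \<exists>y\<in>Y. t \<odot>\<^bsub>M\<^esub> z = z' \<oplus>\<^bsub>M\<^esub> y)"

context module
begin

lemma loc_stable_mono:
  "loc_stable R M P Z X Y \<Longrightarrow> X' \<subseteq> X \<Longrightarrow> Y \<subseteq> Y' \<Longrightarrow> loc_stable R M P Z X' Y'"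
  unfolding loc_stable_def
  by (elim exE, rule exI, intro allI impI, drule spec, drule mp, assumption) blast

text \<open>The analogue of additivity of length. The error term y = t z - z' of the first stage
  lies again in \<open>Z n\<close>, because the chain decreases, so the second stage applies to
  it.\<close>

lemma loc_stable_trans:
  assumes P: "primeideal P R" and Z: "desc_chain R M Z"
    and sub: "submodule Y R M" "submodule W R M" and X: "X \<subseteq> carrier M"
    and 1: "loc_stable R M P Z X Y" and 2: "loc_stable R M P Z Y W"
  shows "loc_stable R M P Z X W"
proof -
  interpret P: primeideal P R by fact
  obtain n1 where n1: "\<And>n. n \<ge> n1 \<Longrightarrow> \<exists>t\<in>carrier R - P. \<forall>z\<in>Z n \<inter> X.
     \<exists>z'\<in>Z (Suc n). \<exists>y\<in>Y. t \<odot>\<^bsub>M\<^esub> z = z' \<oplus>\<^bsub>M\<^esub> y" using 1 unfolding loc_stable_def by blast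
  obtain n2 where n2: "\<And>n. n \<ge> n2 \<Longrightarrow> \<exists>t\<in>carrier R - P. \<forall>z\<in>Z n \<inter> Y.
     \<exists>z'\<in>Z (Suc n). \<exists>y\<in>W. t \<odot>\<^bsub>M\<^esub> z = z' \<oplus>\<^bsub>M\<^esub> y" using 2 unfolding loc_stable_def by blast
  show ?thesis unfolding loc_stable_def
  proof (intro exI[of _ "max n1 n2"] allI impI)
    fix n assume n: "max n1 n2 \<le> n"
    then have "n1 \<le> n" "n2 \<le> n" by auto
    obtain t where t: "t \<in> carrier R - P" "\<And>z. z \<in> Z n \<inter> X \<Longrightarrow>
       \<exists>z'\<in>Z (Suc n). \<exists>y\<in>Y. t \<odot>\<^bsub>M\<^esub> z = z' \<oplus>\<^bsub>M\<^esub> y" using n1[OF \<open>n1 \<le> n\<close>] by blast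
    obtain t' where t': "t' \<in> carrier R - P" "\<And>z. z \<in> Z n \<inter> Y \<Longrightarrow>
       \<exists>z'\<in>Z (Suc n). \<exists>y\<in>W. t' \<odot>\<^bsub>M\<^esub> z = z' \<oplus>\<^bsub>M\<^esub> y" using n2[OF \<open>n2 \<le> n\<close>] by blast
    have Zs: "submodule (Z n) R M" "submodule (Z (Suc n)) R M" "Z (Suc n) \<subseteq> Z n"
      using Z unfolding desc_chain_def by auto
    show "\<exists>t\<in>carrier R - P. \<forall>z\<in>Z n \<inter> X. \<exists>z'\<in>Z (Suc n). \<exists>y\<in>W. t \<odot>\<^bsub>M\<^esub> z = z' \<oplus>\<^bsub>M\<^esub> y"
    proof (intro bexI[of _ "t' \<otimes> t"] ballI)
      show "t' \<otimes> t \<in> carrier R - P" using t t' P.I_prime by auto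
      fix z assume z: "z \<in> Z n \<inter> X"
      obtain z' y where zy: "z' \<in> Z (Suc n)" "y \<in> Y" "t \<odot>\<^bsub>M\<^esub> z = z' \<oplus>\<^bsub>M\<^esub> y" using t(2)[OF z] by blast
      have c: "z \<in> carrier M" "z' \<in> carrier M" "y \<in> carrier M" "t \<in> carrier R" "t' \<in> carrier R"
        using z X zy submoduleE(1)[OF Zs(2)] submoduleE(1)[OF sub(1)] t t' by auto
      have "y = t \<odot>\<^bsub>M\<^esub> z \<ominus>\<^bsub>M\<^esub> z'"
        unfolding zy(3) using c by (simp add: M.minus_eq M.add.m_ac M.r_neg1 M.r_neg)
      moreover have "t \<odot>\<^bsub>M\<^esub> z \<in> Z n" using submoduleE(4)[OF Zs(1)] z c by blast
      ultimately have "y \<in> Z n" using submodule_minus[OF Zs(1)] zy(1) Zs(3) by blast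
      then obtain z'' w where zw: "z'' \<in> Z (Suc n)" "w \<in> W" "t' \<odot>\<^bsub>M\<^esub> y = z'' \<oplus>\<^bsub>M\<^esub> w"
        using t'(2)[of y] zy(2) by blast
      have c2: "z'' \<in> carrier M" "w \<in> carrier M"
        using zw submoduleE(1)[OF Zs(2)] submoduleE(1)[OF sub(2)] by auto
      have "(t' \<otimes> t) \<odot>\<^bsub>M\<^esub> z = t' \<odot>\<^bsub>M\<^esub> z' \<oplus>\<^bsub>M\<^esub> t' \<odot>\<^bsub>M\<^esub> y"
        using c zy(3) by (simp add: smult_assoc1 smult_r_distr)
      also have "\<dots> = (t' \<odot>\<^bsub>M\<^esub> z' \<oplus>\<^bsub>M\<^esub> z'') \<oplus>\<^bsub>M\<^esub> w" unfolding zw(3) using c c2 by (simp add: M.add.m_assoc)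
      finally have "(t' \<otimes> t) \<odot>\<^bsub>M\<^esub> z = (t' \<odot>\<^bsub>M\<^esub> z' \<oplus>\<^bsub>M\<^esub> z'') \<oplus>\<^bsub>M\<^esub> w" .
      moreover have "t' \<odot>\<^bsub>M\<^esub> z' \<oplus>\<^bsub>M\<^esub> z'' \<in> Z (Suc n)"
        using submoduleE(4,5)[OF Zs(2)] zy(1) zw(1) c(5) by blast
      ultimately show "\<exists>z'\<in>Z (Suc n). \<exists>y\<in>W. (t' \<otimes> t) \<odot>\<^bsub>M\<^esub> z = z' \<oplus>\<^bsub>M\<^esub> y" using zw(2) by blast
    qed
  qed
qed

text \<open>After localizing at P the quotient (Y + R x) / Y is at most one-dimensional over the
  residue field, so the image of the chain in it is either zero from some index on or everything at
  all indices.\<close>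

lemma loc_stable_cyclic:
  assumes P: "primeideal P R" and Z: "desc_chain R M Z"
    and Y: "submodule Y R M" and x: "x \<in> carrier M" and Px: "\<And>a. a \<in> P \<Longrightarrow> a \<odot>\<^bsub>M\<^esub> x \<in> Y"
  shows "loc_stable R M P Z (mspan R M (insert x Y)) Y"
proof -
  interpret P: primeideal P R by fact
  have Zs: "submodule (Z n) R M" "Z (Suc n) \<subseteq> Z n" for n using Z unfolding desc_chain_def by auto
  have Zdec: "Z n \<subseteq> Z m" if "m \<le> n" for m n
    using lift_Suc_antimono_le[of Z, OF Zs(2) that] .
  note Y' = submoduleE[OF Y] submodule_zero[OF Y]
  \<comment> \<open>If \<open>A m\<close> lies in P, no element of \<open>Z m\<close> involves x
    with a coefficient outside P. If no \<open>A n\<close> does, each contains a multiplier that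
    moves x into \<open>Z n\<close> + Y.\<close>
  define A where "A n = {a \<in> carrier R. \<exists>z\<in>Z n. \<exists>y\<in>Y. a \<odot>\<^bsub>M\<^esub> x = z \<oplus>\<^bsub>M\<^esub> y}" for n
  have inA: "a \<in> A n" if z: "z \<in> Z n" "z = y \<oplus>\<^bsub>M\<^esub> a \<odot>\<^bsub>M\<^esub> x" "y \<in> Y" "a \<in> carrier R" for z y a n
  proof -
    have c: "y \<in> carrier M" using z Y' by auto
    have "a \<odot>\<^bsub>M\<^esub> x = z \<oplus>\<^bsub>M\<^esub> \<ominus>\<^bsub>M\<^esub> y"
      unfolding z(2) using c z(4) x by (simp add: M.add.m_ac M.r_neg1 M.r_neg2 M.r_neg)
    then show ?thesis unfolding A_def using z Y'(3)[OF z(3)] by blast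
  qed
  show ?thesis
  proof (cases "\<exists>m. A m \<subseteq> P")
    case True
    then obtain m where m: "A m \<subseteq> P" by blast
    show ?thesis unfolding loc_stable_def
    proof (intro exI[of _ m] allI impI bexI[of _ \<one>] ballI)
      show "\<one> \<in> carrier R - P" using P.I_notcarr P.one_imp_carrier by auto
      fix n z assume n: "m \<le> n" and z: "z \<in> Z n \<inter> mspan R M (insert x Y)"
      then obtain y a where ya: "z = y \<oplus>\<^bsub>M\<^esub> a \<odot>\<^bsub>M\<^esub> x" "y \<in> Y" "a \<in> carrier R"
        using submodule_add_cyclic[OF Y x] by auto
      have "a \<in> A m" using inA[of z m y a] z ya Zdec[OF n] by blast
      then have "a \<in> P" using m by blast
      then have "z \<in> Y" using ya Px Y'(5) by blast
      moreover have "\<one> \<odot>\<^bsub>M\<^esub> z = \<zero>\<^bsub>M\<^esub> \<oplus>\<^bsub>M\<^esub> z" using \<open>z \<in> Y\<close> Y'(1) by auto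
      ultimately show "\<exists>z'\<in>Z (Suc n). \<exists>y\<in>Y. \<one> \<odot>\<^bsub>M\<^esub> z = z' \<oplus>\<^bsub>M\<^esub> y"
        using submodule_zero[OF Zs(1)] by blast
    qed
  next
    case False
    show ?thesis unfolding loc_stable_def
    proof (intro exI[of _ 0] allI impI)
      fix n
      obtain t where t: "t \<in> A (Suc n)" "t \<notin> P" using False by blast
      then obtain z' y' where zy': "z' \<in> Z (Suc n)" "y' \<in> Y" "t \<odot>\<^bsub>M\<^esub> x = z' \<oplus>\<^bsub>M\<^esub> y'" "t \<in> carrier R"
        unfolding A_def by blast
      show "\<exists>t\<in>carrier R - P. \<forall>z\<in>Z n \<inter> mspan R M (insert x Y). \<exists>z'\<in>Z (Suc n). \<exists>y\<in>Y. t \<odot>\<^bsub>M\<^esub> z = z' \<oplus>\<^bsub>M\<^esub> y"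
      proof (intro bexI[of _ t] ballI)
        show "t \<in> carrier R - P" using t zy' by simp
        fix z assume z: "z \<in> Z n \<inter> mspan R M (insert x Y)"
        then obtain y a where ya: "z = y \<oplus>\<^bsub>M\<^esub> a \<odot>\<^bsub>M\<^esub> x" "y \<in> Y" "a \<in> carrier R"
          using submodule_add_cyclic[OF Y x] by auto
        have c: "y \<in> carrier M" "y' \<in> carrier M" "z' \<in> carrier M"
          using ya(2) zy'(1,2) Y'(1) submoduleE(1)[OF Zs(1)[of "Suc n"]] by auto
        have "t \<odot>\<^bsub>M\<^esub> z = t \<odot>\<^bsub>M\<^esub> y \<oplus>\<^bsub>M\<^esub> a \<odot>\<^bsub>M\<^esub> (t \<odot>\<^bsub>M\<^esub> x)"
          unfolding ya(1) using c zy'(4) ya(3) x by (simp add: smult_r_distr smult_assoc1[symmetric] R.m_comm)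
        also have "\<dots> = a \<odot>\<^bsub>M\<^esub> z' \<oplus>\<^bsub>M\<^esub> (t \<odot>\<^bsub>M\<^esub> y \<oplus>\<^bsub>M\<^esub> a \<odot>\<^bsub>M\<^esub> y')"
          unfolding zy'(3) using c zy'(4) ya(3) by (simp add: smult_r_distr M.add.m_ac)
        finally have "t \<odot>\<^bsub>M\<^esub> z = a \<odot>\<^bsub>M\<^esub> z' \<oplus>\<^bsub>M\<^esub> (t \<odot>\<^bsub>M\<^esub> y \<oplus>\<^bsub>M\<^esub> a \<odot>\<^bsub>M\<^esub> y')" .
        moreover have "a \<odot>\<^bsub>M\<^esub> z' \<in> Z (Suc n)" using submoduleE(4)[OF Zs(1)] zy'(1) ya(3) by blast
        moreover have "t \<odot>\<^bsub>M\<^esub> y \<oplus>\<^bsub>M\<^esub> a \<odot>\<^bsub>M\<^esub> y' \<in> Y" using Y'(4,5) zy' ya by blast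
        ultimately show "\<exists>z'\<in>Z (Suc n). \<exists>y\<in>Y. t \<odot>\<^bsub>M\<^esub> z = z' \<oplus>\<^bsub>M\<^esub> y" by blast
      qed
    qed
  qed
qed

lemma loc_stable_refl:
  assumes "primeideal P R" "desc_chain R M Z" "submodule Y R M"
  shows "loc_stable R M P Z Y Y"
proof (rule loc_stable_mono[OF loc_stable_cyclic[OF assms, of "\<zero>\<^bsub>M\<^esub>"]])
  show "a \<odot>\<^bsub>M\<^esub> \<zero>\<^bsub>M\<^esub> \<in> Y" if "a \<in> P" for a
    using ideal.Icarr[OF primeideal.axioms(1)[OF assms(1)] that] submodule_zero[OF assms(3)] by simp
  show "Y \<subseteq> mspan R M (insert \<zero>\<^bsub>M\<^esub> Y)" using mspan_incl[of "insert \<zero>\<^bsub>M\<^esub> Y"] by blast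
qed simp_all

text \<open>The finite-dimensional case: generators are added one at a time on top of Y, and since P
  sends each of them into Y, every stage is a cyclic one.\<close>

lemma loc_stable_fg:
  assumes P: "primeideal P R" and Z: "desc_chain R M Z" and Y: "submodule Y R M"
    and F: "finite F" "F \<subseteq> carrier M" and PF: "\<And>a x. a \<in> P \<Longrightarrow> x \<in> F \<Longrightarrow> a \<odot>\<^bsub>M\<^esub> x \<in> Y"
  shows "loc_stable R M P Z (mspan R M (F \<union> Y)) Y"
  using F PF
proof (induct F)
  case empty
  then show ?case using loc_stable_refl[OF P Z Y] mspan_of_submodule[OF Y] by simp
next
  case (insert x F)
  have c: "x \<in> carrier M" "F \<union> Y \<subseteq> carrier M" using insert submoduleE(1)[OF Y] by auto
  let ?X = "mspan R M (F \<union> Y)"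
  have X: "submodule ?X R M" by (rule mspan_submodule[OF c(2)])
  have YX: "Y \<subseteq> ?X" using mspan_incl[of "F \<union> Y"] by blast
  have 1: "loc_stable R M P Z (mspan R M (insert x ?X)) ?X"
    by (rule loc_stable_cyclic[OF P Z X c(1)]) (use insert.prems(2) YX in blast)
  have 2: "loc_stable R M P Z ?X Y" using insert by auto
  have "loc_stable R M P Z (mspan R M (insert x ?X)) Y"
    using mspan_carrier[of "insert x ?X"] c(1) submoduleE(1)[OF X] by (intro loc_stable_trans[OF P Z X Y _ 1 2]) simp
  then show ?case using mspan_insert_mspan[OF c(2,1)] by simp
qed

text \<open>After localizing at P, X / P X is finite-dimensional over the residue field.\<close>

lemma loc_stable_ideal_smult:
  assumes P: "primeideal P R" and Z: "desc_chain R M Z" and no: "noeth_module R M" and X: "submodule X R M"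
  shows "loc_stable R M P Z X (ideal_smult M R P X)"
proof -
  interpret P: primeideal P R by fact
  obtain F where F: "finite F" "F \<subseteq> carrier M" "F \<subseteq> X" "X = mspan R M F"
    using noeth_module_obtain[OF no X] by blast
  have "loc_stable R M P Z (mspan R M (F \<union> ideal_smult M R P X)) (ideal_smult M R P X)"
    by (rule loc_stable_fg[OF P Z ideal_smult_submodule[OF P.a_subset submoduleE(1)[OF X]] F(1,2)])
       (use F(3) in \<open>auto intro: ideal_smultI\<close>)
  then show ?thesis by (rule loc_stable_mono) (use F(4) mspan_mono in auto)
qed

text \<open>Clearing of denominators: the product of multipliers chosen for the generators serves
  the whole span.\<close>

lemma common_multiplier:
  assumes P: "primeideal P R" and N: "submodule N R M" and F: "finite F" "F \<subseteq> carrier M"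
    and ex: "\<And>x. x \<in> F \<Longrightarrow> \<exists>t\<in>carrier R - P. t \<odot>\<^bsub>M\<^esub> x \<in> N"
  shows "\<exists>t\<in>carrier R - P. \<forall>x\<in>mspan R M F. t \<odot>\<^bsub>M\<^esub> x \<in> N"
proof -
  interpret P: primeideal P R by fact
  have "\<exists>t\<in>carrier R - P. \<forall>x\<in>F. t \<odot>\<^bsub>M\<^esub> x \<in> N" using F ex
  proof (induct F)
    case empty
    show ?case using P.I_notcarr P.one_imp_carrier by auto
  next
    case (insert x F)
    then obtain t where t: "t \<in> carrier R" "t \<notin> P" "\<And>x. x \<in> F \<Longrightarrow> t \<odot>\<^bsub>M\<^esub> x \<in> N" by auto
    obtain s where s: "s \<in> carrier R" "s \<notin> P" "s \<odot>\<^bsub>M\<^esub> x \<in> N" using insert.prems(2) by blast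
    have "(s \<otimes> t) \<odot>\<^bsub>M\<^esub> y \<in> N" if "y \<in> insert x F" for y
    proof (cases "y = x")
      case True
      have "(s \<otimes> t) \<odot>\<^bsub>M\<^esub> x = t \<odot>\<^bsub>M\<^esub> (s \<odot>\<^bsub>M\<^esub> x)"
        using s(1) t(1) insert.prems(1) R.m_comm[of s t] by (simp add: smult_assoc1)
      then show ?thesis using True submoduleE(4)[OF N t(1) s(3)] by simp
    next
      case False
      then have "(s \<otimes> t) \<odot>\<^bsub>M\<^esub> y = s \<odot>\<^bsub>M\<^esub> (t \<odot>\<^bsub>M\<^esub> y)"
        using s(1) t(1) insert.prems(1) that by (auto intro: smult_assoc1)
      then show ?thesis using submoduleE(4)[OF N s(1) t(3)] that False by simp
    qed
    then show ?case using s t P.I_prime by (intro bexI[of _ "s \<otimes> t"]) auto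
  qed
  then obtain t where t: "t \<in> carrier R - P" "\<And>x. x \<in> F \<Longrightarrow> t \<odot>\<^bsub>M\<^esub> x \<in> N" by auto
  have "mspan R M F \<subseteq> {x \<in> carrier M. t \<odot>\<^bsub>M\<^esub> x \<in> N}"
    by (rule mspan_minimal[OF submodule_vimage_smult[OF N]]) (use t F in auto)
  then show ?thesis using t(1) by blast
qed

end

section \<open>Prime ideals in regular local rings\<close>

context cring
begin

lemma ideal_multiples:
  assumes b: "ideal b R" and a: "a \<in> carrier R"
  shows "Idl (insert a b) = {y \<oplus> r \<otimes> a | y r. y \<in> b \<and> r \<in> carrier R}"
proof -
  interpret S: module R "self_mod R" by (rule module_self_mod)
  show ?thesis
    using S.submodule_add_cyclic[unfolded submodule_self_mod_iff mspan_self_mod, OF b] a by simp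
qed

text \<open>When Q is a minimal prime of I, the localization of R / I at Q is Artinian. Noetherian
  induction: a largest ideal b for which the claim fails lies in Q and is not prime. A product a c
  in b with a and c outside b then splits R / b into R / (b + (a)) and R / (b : a), for which the
  claim holds.\<close>

lemma loc_stable_if_minimal_prime:
  assumes no: "noetherian_ring R" and Q: "primeideal Q R" and I: "ideal I R"
    and min: "\<And>P. primeideal P R \<Longrightarrow> I \<subseteq> P \<Longrightarrow> P \<subseteq> Q \<Longrightarrow> P = Q"
    and Z: "desc_chain R (self_mod R) Z"
  shows "loc_stable R (self_mod R) Q Z (carrier R) I"
proof (rule ccontr)
  interpret S: module R "self_mod R" by (rule module_self_mod)
  interpret Q: primeideal Q R by fact
  \<comment> \<open>Failure is quantified over all chains, since the passage to the colon ideal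
    replaces \<open>Z\<close> by another chain.\<close>
  define F where "F = {b. ideal b R \<and> I \<subseteq> b \<and>
    (\<exists>Z. desc_chain R (self_mod R) Z \<and> \<not> loc_stable R (self_mod R) Q Z (carrier R) b)}"
  assume "\<not> ?thesis"
  then have "I \<in> F" using I Z unfolding F_def by auto
  moreover have "submodule b R (self_mod R)" if "b \<in> F" for b
    using that unfolding F_def submodule_self_mod_iff by blast
  ultimately obtain b where b: "b \<in> F" "\<And>b'. b' \<in> F \<Longrightarrow> b \<subseteq> b' \<Longrightarrow> b' = b"
    using S.maximal_submodule[OF noeth_module_self_mod[OF no], of F] by blast
  have bi: "ideal b R" "I \<subseteq> b" using b(1) unfolding F_def by auto
  interpret b: ideal b R by (rule bi)
  obtain Z where Z: "desc_chain R (self_mod R) Z" and ns: "\<not> loc_stable R (self_mod R) Q Z (carrier R) b"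
    using b(1) unfolding F_def by blast
  have Zi: "ideal (Z n) R" "Z (Suc n) \<subseteq> Z n" for n
    using Z unfolding desc_chain_def submodule_self_mod_iff by auto
  have zZ: "\<zero> \<in> Z n" for n using Zi(1) by (simp add: additive_subgroup.zero_closed ideal.axioms(1))
  have good: "loc_stable R (self_mod R) Q Z' (carrier R) b'"
    if "ideal b' R" "b \<subseteq> b'" "b' \<noteq> b" "desc_chain R (self_mod R) Z'" for b' Z'
    using b(2)[of b'] that bi unfolding F_def by blast
  have "b \<subseteq> Q"
  proof (rule ccontr)
    \<comment> \<open>An element of b outside Q is itself a multiplier that sends everything into
      b.\<close>
    assume "\<not> b \<subseteq> Q"
    then obtain t where t: "t \<in> b" "t \<notin> Q" by blast
    have "\<exists>z'\<in>Z (Suc n). \<exists>y\<in>b. t \<otimes> z = z' \<oplus> y" if "z \<in> Z n \<inter> carrier R" for z n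
    proof (intro bexI)
      show "t \<otimes> z = \<zero> \<oplus> t \<otimes> z" using that b.Icarr[OF t(1)] by simp
      show "t \<otimes> z \<in> b" using that b.I_r_closed[OF t(1)] by blast
    qed (rule zZ)
    then have "loc_stable R (self_mod R) Q Z (carrier R) b"
      unfolding loc_stable_def using t b.Icarr[OF t(1)]
      by (intro exI[of _ 0] allI impI, intro bexI[where x = t and A = "carrier R - Q"]) auto
    then show False using ns by simp
  qed
  have "b \<noteq> Q"
  proof
    \<comment> \<open>The quotient R / Q is generated by \<open>\<one>\<close> and killed by
      Q.\<close>
    assume "b = Q"
    have "loc_stable R (self_mod R) Q Z (mspan R (self_mod R) ({\<one>} \<union> Q)) Q"
      by (rule S.loc_stable_fg[OF Q Z]) (use Q.Icarr Q.is_ideal submodule_self_mod_iff in auto)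
    then have "loc_stable R (self_mod R) Q Z (carrier R) Q"
    proof (rule S.loc_stable_mono)
      have "ideal (Idl ({\<one>} \<union> Q)) R" using Q.a_subset by (intro genideal_ideal) auto
      moreover have "\<one> \<in> Idl ({\<one>} \<union> Q)" using genideal_self[of "{\<one>} \<union> Q"] Q.a_subset by auto
      ultimately show "carrier R \<subseteq> mspan R (self_mod R) ({\<one>} \<union> Q)"
        unfolding mspan_self_mod using ideal.one_imp_carrier by blast
    qed simp
    then show False using ns \<open>b = Q\<close> by simp
  qed
  then have "\<not> primeideal b R" using min[of b] bi \<open>b \<subseteq> Q\<close> by blast
  moreover have "b \<noteq> carrier R" using \<open>b \<subseteq> Q\<close> Q.I_notcarr Q.a_subset by blast
  ultimately obtain a c where ac: "a \<in> carrier R" "c \<in> carrier R" "a \<otimes> c \<in> b" "a \<notin> b" "c \<notin> b"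
    using b.primeidealCD[OF is_cring] by blast
  let ?A = "Idl (insert a b)" and ?C = "{r \<in> carrier R. a \<otimes> r \<in> b}"
  have iA: "ideal ?A R" using ac b.a_subset by (intro genideal_ideal) auto
  have subA: "insert a b \<subseteq> ?A" using ac b.a_subset by (intro genideal_self) auto
  have 1: "loc_stable R (self_mod R) Q Z (carrier R) ?A"
    using good[OF iA _ _ Z] subA ac by blast
  have iC: "ideal ?C R" using b.helper_max_prime[OF is_cring ac(1)] .
  have bC: "b \<subseteq> ?C" using b.Icarr b.I_l_closed ac by auto
  \<comment> \<open>Multiplication by a maps R / \<open>?C\<close> isomorphically onto
    \<open>?A\<close> / b. The chain that \<open>Z\<close> induces on the latter is pulled back to
    the former.\<close>
  define Z' where "Z' n = {r \<in> carrier R. \<exists>z\<in>Z n. \<exists>y\<in>b. r \<otimes> a = z \<oplus> y}" for n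
  have inZ': "r \<in> Z' n" if "r \<in> carrier R" "z \<in> Z n" "y \<in> b" "r \<otimes> a = z \<oplus> y" for r z n y
    unfolding Z'_def using that by blast
  have Z': "desc_chain R (self_mod R) Z'"
    unfolding desc_chain_def
  proof (intro allI conjI)
    fix n
    interpret Zn: ideal "Z n" R by (rule Zi)
    show "Z' (Suc n) \<subseteq> Z' n" using Zi(2) unfolding Z'_def by blast
    show "submodule (Z' n) R (self_mod R)"
    proof (rule S.submoduleI')
      show "\<zero>\<^bsub>self_mod R\<^esub> \<in> Z' n" unfolding Z'_def using ac Zn.zero_closed b.zero_closed
        by (auto intro!: bexI[of _ \<zero>])
      show "r \<oplus>\<^bsub>self_mod R\<^esub> s \<in> Z' n" if "r \<in> Z' n" "s \<in> Z' n" for r s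
      proof -
        from that obtain z y z' y' where *: "r \<in> carrier R" "s \<in> carrier R" "z \<in> Z n" "y \<in> b" "z' \<in> Z n" "y' \<in> b"
          "r \<otimes> a = z \<oplus> y" "s \<otimes> a = z' \<oplus> y'" unfolding Z'_def by blast
        have "(r \<oplus> s) \<otimes> a = (z \<oplus> z') \<oplus> (y \<oplus> y')"
          using * ac Zn.Icarr b.Icarr by (simp add: l_distr add.m_ac)
        then show ?thesis
          using inZ'[of "r \<oplus> s" "z \<oplus> z'" n "y \<oplus> y'"] * Zn.a_closed[OF *(3,5)] b.a_closed[OF *(4,6)] by simp
      qed
      show "r \<odot>\<^bsub>self_mod R\<^esub> s \<in> Z' n" if "r \<in> carrier R" "s \<in> Z' n" for r s
      proof -
        from that obtain z y where *: "s \<in> carrier R" "z \<in> Z n" "y \<in> b" "s \<otimes> a = z \<oplus> y"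
          unfolding Z'_def by blast
        have "(r \<otimes> s) \<otimes> a = r \<otimes> z \<oplus> r \<otimes> y"
          using * ac that Zn.Icarr b.Icarr by (simp add: m_assoc r_distr)
        then show ?thesis
          using inZ'[of "r \<otimes> s" "r \<otimes> z" n "r \<otimes> y"] * that Zn.I_l_closed[OF *(2) that(1)]
            b.I_l_closed[OF *(3) that(1)] by simp
      qed
    qed (auto simp: Z'_def)
  qed
  have "loc_stable R (self_mod R) Q Z' (carrier R) ?C"
    using good[OF iC bC _ Z'] ac by blast
  then obtain n0 where n0: "\<And>n. n \<ge> n0 \<Longrightarrow> \<exists>t\<in>carrier R - Q. \<forall>z\<in>Z' n \<inter> carrier R.
     \<exists>z'\<in>Z' (Suc n). \<exists>y\<in>?C. t \<otimes> z = z' \<oplus> y"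
    unfolding loc_stable_def by auto
  have 2: "loc_stable R (self_mod R) Q Z ?A b"
    unfolding loc_stable_def
  proof (intro exI[of _ n0] allI impI)
    fix n assume n: "n0 \<le> n"
    have Z'c: "Z' n \<inter> carrier R = Z' n" unfolding Z'_def by blast
    obtain t where t: "t \<in> carrier R - Q" "\<forall>z\<in>Z' n. \<exists>z'\<in>Z' (Suc n). \<exists>y\<in>?C. t \<otimes> z = z' \<oplus> y"
      using n0[OF n] unfolding Z'c by (elim bexE)
    interpret Zn: ideal "Z n" R by (rule Zi)
    interpret Zs: ideal "Z (Suc n)" R by (rule Zi)
    show "\<exists>t\<in>carrier R - Q. \<forall>z\<in>Z n \<inter> ?A. \<exists>z'\<in>Z (Suc n). \<exists>y\<in>b. t \<odot>\<^bsub>self_mod R\<^esub> z = z' \<oplus>\<^bsub>self_mod R\<^esub> y"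
    proof (intro bexI[OF _ t(1)] ballI)
      fix z assume z: "z \<in> Z n \<inter> ?A"
      then obtain y r where yr: "z = y \<oplus> r \<otimes> a" "y \<in> b" "r \<in> carrier R"
        using ideal_multiples[OF bi(1) ac(1)] by blast
      have c: "y \<in> carrier R" "t \<in> carrier R" using b.Icarr yr t by auto
      have "r \<otimes> a = z \<oplus> \<ominus> y" unfolding yr(1) using c yr(3) ac by (simp add: add.m_ac r_neg1 r_neg2 r_neg)
      then have "r \<in> Z' n" unfolding Z'_def using yr(2,3) z b.a_inv_closed[OF yr(2)] by blast
      then obtain z' w where zw: "z' \<in> Z' (Suc n)" "w \<in> ?C" "t \<otimes> r = z' \<oplus> w" using t(2) by (elim ballE[of _ _ r] bexE) auto
      then obtain z2 y2 where zy2: "z2 \<in> Z (Suc n)" "y2 \<in> b" "z' \<otimes> a = z2 \<oplus> y2" "z' \<in> carrier R" "w \<in> carrier R"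
        unfolding Z'_def by blast
      have c2: "z2 \<in> carrier R" "y2 \<in> carrier R" using zy2 Zs.Icarr b.Icarr by auto
      have wa: "w \<otimes> a \<in> b" using zw(2) ac m_comm[of a w] by auto
      have "t \<otimes> z = t \<otimes> y \<oplus> (t \<otimes> r) \<otimes> a"
        unfolding yr(1) using c yr(3) ac by (simp add: r_distr m_assoc)
      also have "\<dots> = t \<otimes> y \<oplus> (z' \<otimes> a \<oplus> w \<otimes> a)"
        unfolding zw(3) using zy2 ac by (simp add: l_distr)
      also have "\<dots> = z2 \<oplus> (t \<otimes> y \<oplus> (y2 \<oplus> w \<otimes> a))"
        unfolding zy2(3) using c c2 zy2 ac by (simp add: add.m_ac)
      finally have eq: "t \<otimes> z = z2 \<oplus> (t \<otimes> y \<oplus> (y2 \<oplus> w \<otimes> a))" .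
      have "t \<otimes> y \<oplus> (y2 \<oplus> w \<otimes> a) \<in> b" by (intro b.a_closed b.I_l_closed yr(2) c(2) zy2(2) wa)
      then show "\<exists>z'\<in>Z (Suc n). \<exists>y\<in>b. t \<odot>\<^bsub>self_mod R\<^esub> z = z' \<oplus>\<^bsub>self_mod R\<^esub> y"
        using eq zy2(1) unfolding self_mod_simps by blast
    qed
  qed
  have "loc_stable R (self_mod R) Q Z (carrier R) b"
    using S.loc_stable_trans[OF Q Z _ _ _ 1 2] iA bi submodule_self_mod_iff by simp
  then show False using ns by simp
qed

lemma prime_one_notin: "primeideal P R \<Longrightarrow> \<one> \<notin> P"
  using primeideal.I_notcarr ideal.one_imp_carrier primeideal.axioms(1) by blast

lemma prime_pow:
  assumes P: "primeideal P R" and x: "x \<in> carrier R" and "x [^] (n::nat) \<in> P" shows "x \<in> P"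
  using assms(3)
proof (induct n)
  case 0 then show ?case using prime_one_notin[OF P] by simp
next
  case (Suc n) then show ?case using primeideal.I_prime[OF P, of "x [^] n" x] x by auto
qed

text \<open>A form of Krull's principal ideal theorem; \<open>Z\<close> plays the role of the symbolic powers of \<open>Q\<close> modulo \<open>P\<close>.\<close>

lemma prime_between:
  assumes no: "noetherian_ring R" and P: "primeideal P R" and Q: "primeideal Q R" and Q': "primeideal Q' R"
    and PQ: "P \<subset> Q" and QQ': "Q \<subset> Q'" and x: "x \<in> Q'"
  shows "\<exists>Q1. primeideal Q1 R \<and> x \<in> Q1 \<and> P \<subset> Q1 \<and> Q1 \<subset> Q'"
proof (rule ccontr)
  assume contra: "\<not> ?thesis"
  interpret S: module R "self_mod R" by (rule module_self_mod)
  interpret P: primeideal P R by fact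
  interpret Q: primeideal Q R by fact
  interpret Q': primeideal Q' R by fact
  have xc: "x \<in> carrier R" using x Q'.Icarr by blast
  \<comment> \<open>Otherwise Q itself would be the prime asked for.\<close>
  have xQ: "x \<notin> Q" using contra Q PQ QQ' by blast
  then have xP: "x \<notin> P" using PQ by blast
  let ?I = "Idl (insert x P)"
  have I: "ideal ?I R" using xc P.a_subset by (intro genideal_ideal) auto
  have subI: "insert x P \<subseteq> ?I" using xc P.a_subset by (intro genideal_self) auto
  \<comment> \<open>By \<open>contra\<close>, Q' is a minimal prime of P + (x), so descending chains
    stabilize at Q' modulo that ideal.\<close>
  have min: "P' = Q'" if "primeideal P' R" "?I \<subseteq> P'" "P' \<subseteq> Q'" for P'
    using contra that subI xP by blast
  \<comment> \<open>The contraction to R of P + Q X localized at Q, with t as the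
    denominator.\<close>
  define G where "G X = {a \<in> carrier R. \<exists>t\<in>carrier R - Q. \<exists>y\<in>P. \<exists>w\<in>ideal_smult (self_mod R) R Q X. t \<otimes> a = y \<oplus> w}" for X
  define Z where "Z n = (G ^^ n) (carrier R)" for n
  have Z0: "Z 0 = carrier R" and ZS: "Z (Suc n) = G (Z n)" for n by (simp_all add: Z_def)
  have Gc: "G X \<subseteq> carrier R" for X unfolding G_def by blast
  have Zc: "Z n \<subseteq> carrier R" for n by (cases n) (use Z0 ZS Gc in auto)
  have W: "ideal (ideal_smult (self_mod R) R Q X) R" if "X \<subseteq> carrier R" for X
    using S.ideal_smult_submodule[OF Q.a_subset, of X] that by (simp add: submodule_self_mod_iff)
  have inG: "a \<in> G X" if "a \<in> carrier R" "t \<in> carrier R - Q" "y \<in> P" "w \<in> ideal_smult (self_mod R) R Q X"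
      "t \<otimes> a = y \<oplus> w" for a t y w X
    unfolding G_def using that by blast
  have GI: "ideal (G X) R" if X: "X \<subseteq> carrier R" for X
  proof -
    interpret W: ideal "ideal_smult (self_mod R) R Q X" R by (rule W[OF X])
    have "submodule (G X) R (self_mod R)"
    proof (rule S.submoduleI')
      show "\<zero>\<^bsub>self_mod R\<^esub> \<in> G X"
        using inG[of \<zero> \<one> \<zero> \<zero>] prime_one_notin[OF Q] P.zero_closed W.zero_closed by simp
      show "a \<oplus>\<^bsub>self_mod R\<^esub> b \<in> G X" if ab: "a \<in> G X" "b \<in> G X" for a b
      proof -
        from ab obtain t y w t' y' w' where *: "a \<in> carrier R" "b \<in> carrier R" "t \<in> carrier R - Q" "y \<in> P"
          "w \<in> ideal_smult (self_mod R) R Q X" "t' \<in> carrier R - Q" "y' \<in> P"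
          "w' \<in> ideal_smult (self_mod R) R Q X" "t \<otimes> a = y \<oplus> w" "t' \<otimes> b = y' \<oplus> w'"
          unfolding G_def by blast
        have c: "t \<in> carrier R" "t' \<in> carrier R" "y \<in> carrier R" "y' \<in> carrier R" "w \<in> carrier R" "w' \<in> carrier R"
          using * P.Icarr W.Icarr by auto
        have "(t \<otimes> t') \<otimes> (a \<oplus> b) = t' \<otimes> (t \<otimes> a) \<oplus> t \<otimes> (t' \<otimes> b)"
          using c *(1,2) by (simp add: r_distr m_ac)
        also have "\<dots> = (t' \<otimes> y \<oplus> t \<otimes> y') \<oplus> (t' \<otimes> w \<oplus> t \<otimes> w')"
          unfolding *(9,10) using c by (simp add: r_distr add.m_ac)
        finally have "(t \<otimes> t') \<otimes> (a \<oplus> b) = (t' \<otimes> y \<oplus> t \<otimes> y') \<oplus> (t' \<otimes> w \<oplus> t \<otimes> w')" .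
        moreover have "t' \<otimes> y \<oplus> t \<otimes> y' \<in> P" by (intro P.a_closed P.I_l_closed *(4,7) c)
        moreover have "t' \<otimes> w \<oplus> t \<otimes> w' \<in> ideal_smult (self_mod R) R Q X" by (intro W.a_closed W.I_l_closed *(5,8) c)
        moreover have "t \<otimes> t' \<in> carrier R - Q" using * Q.I_prime by auto
        ultimately show ?thesis using inG *(1,2) by simp
      qed
      show "r \<odot>\<^bsub>self_mod R\<^esub> a \<in> G X" if ra: "r \<in> carrier R" "a \<in> G X" for r a
      proof -
        from ra obtain t y w where *: "a \<in> carrier R" "t \<in> carrier R - Q" "y \<in> P"
          "w \<in> ideal_smult (self_mod R) R Q X" "t \<otimes> a = y \<oplus> w"
          unfolding G_def by blast
        have c: "t \<in> carrier R" "y \<in> carrier R" "w \<in> carrier R" using * P.Icarr W.Icarr by auto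
        have "t \<otimes> (r \<otimes> a) = r \<otimes> (t \<otimes> a)" using c *(1) ra by (simp add: m_ac)
        also have "\<dots> = r \<otimes> y \<oplus> r \<otimes> w" unfolding *(5) using c ra by (simp add: r_distr)
        finally have "t \<otimes> (r \<otimes> a) = r \<otimes> y \<oplus> r \<otimes> w" .
        moreover have "r \<otimes> y \<in> P" "r \<otimes> w \<in> ideal_smult (self_mod R) R Q X"
          by (intro P.I_l_closed W.I_l_closed *(3,4) ra(1))+
        ultimately show ?thesis using inG *(1,2) ra by simp
      qed
    qed (use Gc in auto)
    then show ?thesis by (simp add: submodule_self_mod_iff)
  qed
  have ZI: "ideal (Z n) R" for n by (cases n) (use Z0 ZS GI Zc oneideal in auto)
  have Gmono: "G X \<subseteq> G Y" if "X \<subseteq> Y" "Y \<subseteq> carrier R" for X Y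
  proof -
    have "ideal_smult (self_mod R) R Q X \<subseteq> ideal_smult (self_mod R) R Q Y"
      unfolding ideal_smult_def by (rule S.mspan_mono) (use that in auto)
    then show ?thesis unfolding G_def by blast
  qed
  have Zdec: "Z (Suc n) \<subseteq> Z n" for n
  proof (induct n)
    case 0 then show ?case using Z0 Zc by simp
  next
    case (Suc n) then show ?case using Gmono[OF Suc Zc] ZS by simp
  qed
  have Z: "desc_chain R (self_mod R) Z"
    unfolding desc_chain_def using ZI Zdec by (simp add: submodule_self_mod_iff)
  have PG: "P \<subseteq> G X" if X: "X \<subseteq> carrier R" for X
  proof
    fix y assume y: "y \<in> P"
    interpret W: ideal "ideal_smult (self_mod R) R Q X" R by (rule W[OF X])
    have "\<one> \<otimes> y = y \<oplus> \<zero>" using P.Icarr[OF y] by simp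
    then show "y \<in> G X" unfolding G_def using prime_one_notin[OF Q] W.zero_closed y P.Icarr[OF y] by blast
  qed
  have PZ: "P \<subseteq> Z n" for n by (cases n) (use Z0 ZS PG Zc P.a_subset in auto)
  \<comment> \<open>After localizing at Q the element x is a unit, and the terms of the chain are
    contracted from there.\<close>
  have canc: "c \<in> Z n" if "x \<otimes> c \<in> Z n" and c: "c \<in> carrier R" for c n
  proof (cases n)
    case 0 then show ?thesis using c Z0 by simp
  next
    case (Suc m)
    have "x \<otimes> c \<in> G (Z m)" using that(1) ZS Suc by simp
    then obtain t y w where t: "t \<in> carrier R - Q" "y \<in> P" "w \<in> ideal_smult (self_mod R) R Q (Z m)"
      "t \<otimes> (x \<otimes> c) = y \<oplus> w" unfolding G_def by blast
    have "(t \<otimes> x) \<otimes> c = y \<oplus> w" using t c xc by (simp add: m_assoc)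
    moreover have "t \<otimes> x \<in> carrier R - Q" using t xc xQ Q.I_prime by auto
    ultimately show ?thesis unfolding Suc ZS using inG[OF c _ t(2,3)] by simp
  qed
  obtain n where "\<exists>t\<in>carrier R - Q'. \<forall>z\<in>Z n \<inter> carrier R.
     \<exists>z'\<in>Z (Suc n). \<exists>y\<in>?I. t \<odot>\<^bsub>self_mod R\<^esub> z = z' \<oplus>\<^bsub>self_mod R\<^esub> y"
    using loc_stable_if_minimal_prime[OF no Q' I min Z] unfolding loc_stable_def by blast
  moreover have "Z n \<inter> carrier R = Z n" using Zc[of n] by blast
  ultimately have "\<exists>t\<in>carrier R - Q'. \<forall>z\<in>Z n. \<exists>z'\<in>Z (Suc n). \<exists>y\<in>?I. t \<otimes> z = z' \<oplus> y" by simp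
  then obtain t where t: "t \<in> carrier R - Q'" "\<And>z. z \<in> Z n \<Longrightarrow> \<exists>z'\<in>Z (Suc n). \<exists>y\<in>?I. t \<otimes> z = z' \<oplus> y"
    by blast
  obtain F where F: "finite F" "F \<subseteq> carrier R" "Z n = Idl F"
    using finite_ideal_generators[OF no ZI[of n]] by metis
  interpret Zn: ideal "Z n" R by (rule ZI)
  interpret Zs: ideal "Z (Suc n)" R by (rule ZI)
  \<comment> \<open>Stability at Q' writes t a as b + y0 + x c, and \<open>canc\<close> puts c into
    \<open>Z n\<close>. Hence t \<open>Z n\<close> lies in \<open>Z (Suc n)\<close> + Q'
    \<open>Z n\<close>, and Nakayama's lemma at Q' applies.\<close>
  have "\<exists>y\<in>Z (Suc n). \<exists>z\<in>ideal_smult (self_mod R) R Q' (Z n). t \<otimes> a = y \<oplus> z" if a: "a \<in> Z n" for a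
  proof -
    obtain b y where by1: "b \<in> Z (Suc n)" "y \<in> ?I" "t \<otimes> a = b \<oplus> y" using t(2)[OF a] by blast
    then obtain y0 c where yc: "y = y0 \<oplus> c \<otimes> x" "y0 \<in> P" "c \<in> carrier R"
      using ideal_multiples[OF P.is_ideal xc] by auto
    have c: "a \<in> carrier R" "b \<in> carrier R" "y0 \<in> carrier R" "t \<in> carrier R"
      using a Zn.Icarr Zs.Icarr by1 yc P.Icarr t by auto
    have b': "b \<oplus> y0 \<in> Z (Suc n)" using by1(1) yc(2) PZ Zs.a_closed by blast
    have eq: "t \<otimes> a = (b \<oplus> y0) \<oplus> x \<otimes> c"
      unfolding by1(3) yc(1) using c yc(3) xc by (simp add: a_assoc m_comm)
    have "x \<otimes> c = t \<otimes> a \<ominus> (b \<oplus> y0)"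
      unfolding eq using c yc(3) xc by (simp add: minus_eq minus_add add.m_ac r_neg1 r_neg2 r_neg)
    moreover have "t \<otimes> a \<ominus> (b \<oplus> y0) \<in> Z n"
      unfolding minus_eq using b' Zdec[of n] a c(4) Zn.I_l_closed Zn.a_inv_closed Zn.a_closed by blast
    ultimately have "c \<in> Z n" using canc yc(3) by simp
    then have "x \<otimes> c \<in> ideal_smult (self_mod R) R Q' (Z n)" using S.ideal_smultI[OF x] by simp
    then show ?thesis using b' eq by blast
  qed
  then have "\<exists>u'\<in>carrier R - Q'. \<forall>z\<in>mspan R (self_mod R) F. u' \<odot>\<^bsub>self_mod R\<^esub> z \<in> Z (Suc n)"
    using F t(1) ZI by (intro S.nakayama[OF Q']) (simp_all add: submodule_self_mod_iff mspan_self_mod)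
  then obtain u where u: "u \<in> carrier R" "u \<notin> Q" "\<And>z. z \<in> Z n \<Longrightarrow> u \<otimes> z \<in> Z (Suc n)"
    using F(3) QQ' by (auto simp: mspan_self_mod)
  let ?N = "{a \<oplus> b | a b. a \<in> P \<and> b \<in> ideal_smult (self_mod R) R Q (Z n)}"
  have N: "submodule ?N R (self_mod R)"
    using S.submodule_sum[of P "ideal_smult (self_mod R) R Q (Z n)"] W[OF Zc] P.is_ideal
    by (simp add: submodule_self_mod_iff)
  have "\<exists>v\<in>carrier R - Q. v \<otimes> z \<in> ?N" if z: "z \<in> Z n" for z
  proof -
    have "u \<otimes> z \<in> G (Z n)" using u(3)[OF z] ZS by simp
    then obtain s y w where s: "s \<in> carrier R - Q" "y \<in> P" "w \<in> ideal_smult (self_mod R) R Q (Z n)"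
      "s \<otimes> (u \<otimes> z) = y \<oplus> w" unfolding G_def by blast
    then have "(s \<otimes> u) \<otimes> z \<in> ?N" using u(1) Zn.Icarr[OF z] by (auto simp: m_assoc)
    moreover have "s \<otimes> u \<in> carrier R - Q" using s u Q.I_prime by auto
    ultimately show ?thesis by blast
  qed
  then have "\<exists>v\<in>carrier R - Q. \<forall>z\<in>mspan R (self_mod R) F. v \<odot>\<^bsub>self_mod R\<^esub> z \<in> ?N"
    using F genideal_self[OF F(2)] by (intro S.common_multiplier[OF Q N]) auto
  then obtain v where v: "v \<in> carrier R - Q" "\<And>z. z \<in> Z n \<Longrightarrow> v \<otimes> z \<in> ?N"
    using F(3) by (auto simp: mspan_self_mod)
  \<comment> \<open>Since \<open>Z (Suc n)\<close> is contracted from P + Q \<open>Z n\<close>,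
    locally at Q the module \<open>Z n\<close> lies in P + Q \<open>Z n\<close>. Nakayama's lemma,
    now at Q, puts it into P.\<close>
  have "\<exists>u'\<in>carrier R - Q. \<forall>z\<in>mspan R (self_mod R) F. u' \<odot>\<^bsub>self_mod R\<^esub> z \<in> P"
  proof (rule S.nakayama[OF Q F(1)])
    fix z assume "z \<in> mspan R (self_mod R) F"
    then have "v \<otimes> z \<in> ?N" using v(2) F(3) by (simp add: mspan_self_mod)
    then show "\<exists>y\<in>P. \<exists>w\<in>ideal_smult (self_mod R) R Q (mspan R (self_mod R) F). v \<odot>\<^bsub>self_mod R\<^esub> z = y \<oplus>\<^bsub>self_mod R\<^esub> w"
      using F(3) by (auto simp: mspan_self_mod)
  qed (use F v P.is_ideal in \<open>auto simp: submodule_self_mod_iff\<close>)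
  then obtain u' where u': "u' \<in> carrier R" "u' \<notin> Q" "\<And>z. z \<in> Z n \<Longrightarrow> u' \<otimes> z \<in> P"
    using F(3) by (auto simp: mspan_self_mod)
  have ZP: "Z n \<subseteq> P" using u' PQ P.I_prime Zn.Icarr by blast
  \<comment> \<open>Powers lie in symbolic powers, so by \<open>ZP\<close> some power of each
    element of Q lies in P.\<close>
  have pw: "a [^] m \<in> Z m" if a: "a \<in> Q" for a m
  proof (induct m)
    case 0 then show ?case using Z0 by simp
  next
    case (Suc m)
    have c: "a \<in> carrier R" using Q.Icarr[OF a] .
    have "a \<otimes> a [^] m \<in> ideal_smult (self_mod R) R Q (Z m)" using S.ideal_smultI[OF a Suc] by simp
    moreover have "\<one> \<otimes> a [^] Suc m = \<zero> \<oplus> a \<otimes> a [^] m" using c by (simp add: m_comm)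
    ultimately show ?case
      unfolding ZS using prime_one_notin[OF Q] P.zero_closed c by (intro inG[of _ \<one> \<zero>]) auto
  qed
  have "Q \<subseteq> P" using pw ZP prime_pow[OF P] Q.Icarr by blast
  then show False using PQ by blast
qed

section \<open>Chains of primes through a given element\<close>

definition prime_chain :: "(nat \<Rightarrow> 'a set) \<Rightarrow> nat \<Rightarrow> bool" where
  "prime_chain c l \<longleftrightarrow> (\<forall>i\<le>l. primeideal (c i) R) \<and> (\<forall>i<l. c i \<subset> c (Suc i))"

text \<open>The place at which x enters is lowered from the top: \<open>prime_between\<close>
  replaces \<open>c (Suc l)\<close> by a prime containing x, and the induction continues with the
  shorter chain that ends there.\<close>

lemma prime_chain_through:
  assumes no: "noetherian_ring R"
  shows "prime_chain c (Suc l) \<Longrightarrow> x \<in> c (Suc l) \<Longrightarrow>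
    \<exists>c'. prime_chain c' (Suc l) \<and> c' 0 = c 0 \<and> c' (Suc l) = c (Suc l) \<and> x \<in> c' 1"
proof (induct l arbitrary: c)
  case 0
  then show ?case by (intro exI[of _ c]) simp
next
  case (Suc l)
  note ch = Suc.prems(1)[unfolded prime_chain_def]
  have "primeideal (c l) R" "primeideal (c (Suc l)) R" "primeideal (c (Suc (Suc l))) R"
    "c l \<subset> c (Suc l)" "c (Suc l) \<subset> c (Suc (Suc l))" using ch by auto
  from prime_between[OF no this Suc.prems(2)] obtain Q where
    Q: "primeideal Q R" "x \<in> Q" "c l \<subset> Q" "Q \<subset> c (Suc (Suc l))" by blast
  have "prime_chain (c(Suc l := Q)) (Suc l)" using ch Q unfolding prime_chain_def by (auto simp: less_Suc_eq)
  from Suc.hyps[OF this] Q(2) obtain c' where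
    c': "prime_chain c' (Suc l)" "c' 0 = c 0" "c' (Suc l) = Q" "x \<in> c' 1" by auto
  let ?c = "c'(Suc (Suc l) := c (Suc (Suc l)))"
  have "prime_chain ?c (Suc (Suc l))"
    using c'(1,3) Q ch unfolding prime_chain_def by (auto simp: less_Suc_eq le_Suc_eq)
  moreover have "?c 0 = c 0" "?c (Suc (Suc l)) = c (Suc (Suc l))" "x \<in> ?c 1" using c' by auto
  ultimately show ?case by blast
qed

lemma prime_chain_tail: "prime_chain c (Suc l) \<Longrightarrow> prime_chain (\<lambda>i. c (Suc i)) l"
  unfolding prime_chain_def by auto

lemma prime_chain_mono: "prime_chain c l \<Longrightarrow> i \<le> j \<Longrightarrow> j \<le> l \<Longrightarrow> c i \<subseteq> c j"
proof (induct j)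
  case (Suc j)
  show ?case
  proof (cases "i = Suc j")
    case False
    then have "c i \<subseteq> c j" "c j \<subset> c (Suc j)" using Suc unfolding prime_chain_def by auto
    then show ?thesis by blast
  qed simp
qed simp

end

section \<open>Noetherian local rings and regular systems of parameters\<close>

lemma (in cring) proper_ideal_maximal:
  assumes no: "noetherian_ring R" and I: "ideal I R" "I \<noteq> carrier R"
  shows "\<exists>J. maximalideal J R \<and> I \<subseteq> J"
proof -
  interpret S: module R "self_mod R" by (rule module_self_mod)
  let ?F = "{J. ideal J R \<and> J \<noteq> carrier R \<and> I \<subseteq> J}"
  have "?F \<noteq> {}" using I by auto
  then have "\<exists>J\<in>?F. \<forall>J'\<in>?F. J \<subseteq> J' \<longrightarrow> J' = J"
    by (intro S.maximal_submodule[OF noeth_module_self_mod[OF no]]) (auto simp: submodule_self_mod_iff)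
  then obtain J where J: "ideal J R" "J \<noteq> carrier R" "I \<subseteq> J" "\<And>J'. J' \<in> ?F \<Longrightarrow> J \<subseteq> J' \<Longrightarrow> J' = J"
    by auto
  have "maximalideal J R"
  proof (rule maximalidealI)
    show "J' = J \<or> J' = carrier R" if "ideal J' R" "J \<subseteq> J'" for J' using J(3) J(4)[of J'] that by auto
  qed (use J in auto)
  then show ?thesis using J(3) by blast
qed

locale local_noeth = cring R for R :: "('a, 'x) ring_scheme" (structure) +
  fixes m assumes no: "noetherian_ring R" and max: "maximalideal m R" and uniq: "\<And>I. maximalideal I R \<Longrightarrow> I = m"
begin

lemma prime_m: "primeideal m R" by (rule maximalideal_prime[OF max])

lemma proper_le_m: "ideal I R \<Longrightarrow> I \<noteq> carrier R \<Longrightarrow> I \<subseteq> m"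
  using proper_ideal_maximal[OF no] uniq by blast

lemma unit_if_notin_m: assumes "u \<in> carrier R" "u \<notin> m" shows "\<exists>v\<in>carrier R. v \<otimes> u = \<one>"
proof -
  have "PIdl u = carrier R"
    using proper_le_m[OF cgenideal_ideal[OF assms(1)]] cgenideal_self[OF assms(1)] assms(2) by blast
  then have "\<one> \<in> PIdl u" by simp
  then show ?thesis unfolding cgenideal_def by auto
qed

lemma prime_le_m: "primeideal P R \<Longrightarrow> P \<subseteq> m"
  using proper_le_m primeideal.axioms(1) primeideal.I_notcarr by metis

text \<open>In a local ring the multiplier produced by \<open>nakayama\<close> is a unit and can be
  divided out.\<close>

lemma nakayama_local:
  assumes M: "module R M" and F: "finite F" "F \<subseteq> carrier M" and Y: "submodule Y R M"
    and uF: "\<And>x. x \<in> mspan R M F \<Longrightarrow> \<exists>y\<in>Y. \<exists>z\<in>ideal_smult M R m (mspan R M F). x = y \<oplus>\<^bsub>M\<^esub> z"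
  shows "mspan R M F \<subseteq> Y"
proof
  interpret M: module R M by fact
  fix x assume x: "x \<in> mspan R M F"
  have xc: "x \<in> carrier M" using M.mspan_carrier[OF F(2)] x by blast
  have "\<exists>u'\<in>carrier R - m. \<forall>x\<in>mspan R M F. u' \<odot>\<^bsub>M\<^esub> x \<in> Y"
    by (rule M.nakayama[OF prime_m F Y, of \<one>])
       (use prime_one_notin[OF prime_m] M.mspan_carrier[OF F(2)] uF in \<open>auto simp: subset_iff\<close>)
  then obtain u where u: "u \<in> carrier R" "u \<notin> m" "u \<odot>\<^bsub>M\<^esub> x \<in> Y" using x by blast
  obtain v where v: "v \<in> carrier R" "v \<otimes> u = \<one>" using unit_if_notin_m[OF u(1,2)] by blast
  have "v \<odot>\<^bsub>M\<^esub> (u \<odot>\<^bsub>M\<^esub> x) = x" using v u(1) xc M.smult_assoc1[of v u x] by simp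
  then show "x \<in> Y" using M.submoduleE(4)[OF Y v(1) u(3)] by simp
qed

end

locale regular_local = local_noeth +
  fixes S and c0
  assumes S: "finite S" "S \<subseteq> carrier R" "m = Idl S"
    and c0: "prime_chain c0 (card S)"
    and dim: "\<And>c l. prime_chain c l \<Longrightarrow> l \<le> card S"
begin

lemma chain_top:
  assumes "prime_chain c l" "c l \<noteq> m" shows "prime_chain (c(Suc l := m)) (Suc l)"
  using assms prime_m prime_le_m unfolding prime_chain_def by (auto simp: le_Suc_eq less_Suc_eq)

text \<open>A further parameter x can be pushed into the second prime of a chain ending in m, and
  dropping the first prime then costs one unit of length. Once T = S, the chain starts at m and has
  length 0.\<close>

lemma chain_length_bound:
  assumes "T \<subseteq> S" "prime_chain c l" "Idl T \<subseteq> c 0"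
  shows "l \<le> card (S - T)"
proof -
  have fin: "finite (S - T)" using S(1) by simp
  have "l \<le> card (S - T)" if "finite D" "D = S - T" "T \<subseteq> S" "prime_chain c l" "Idl T \<subseteq> c 0" "c l = m" for D T c l
    using that
  proof (induct D arbitrary: T c l)
    case empty
    then have "T = S" by auto
    then have m0: "m \<subseteq> c 0" using empty S by simp
    show ?case
    proof (cases l)
      case (Suc k)
      then have "c 0 \<subset> c 1" "c 1 \<subseteq> m"
        using empty prime_chain_mono[OF empty(3), of 1 l] unfolding prime_chain_def by auto
      then show ?thesis using m0 by blast
    qed simp
  next
    case (insert x D)
    have x: "x \<in> S" "x \<notin> T" using insert by auto
    have xm: "x \<in> m" unfolding S(3) using genideal_self[OF S(2)] x by blast
    show ?case
    proof (cases l)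
      case (Suc k)
      from prime_chain_through[OF no insert.prems(3)[unfolded Suc], of x] xm insert.prems(5) Suc
      obtain c' where c': "prime_chain c' (Suc k)" "c' 0 = c 0" "c' (Suc k) = m" "x \<in> c' 1" by auto
      have pc1: "primeideal (c' 1) R" using c'(1) unfolding prime_chain_def by auto
      have Tc: "T \<subseteq> c 0" using genideal_self[of T] insert.prems(2,4) S(2) by auto
      have "c' 0 \<subset> c' 1" using c'(1) unfolding prime_chain_def by auto
      then have "insert x T \<subseteq> c' 1" using c' Tc by auto
      then have sub: "Idl (insert x T) \<subseteq> c' 1" using pc1 primeideal.axioms(1) by (intro genideal_minimal) auto
      have "k \<le> card (S - insert x T)"
      proof (rule insert.hyps(3)[of _ "\<lambda>i. c' (Suc i)"])
        show "D = S - insert x T" using insert.prems(1) insert.hyps(2) by auto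
      qed (use prime_chain_tail[OF c'(1)] sub c'(3) x insert.prems in auto)
      moreover have "card (S - T) = Suc (card (S - insert x T))"
        using x S(1) by (metis Diff_insert card_Suc_Diff1 finite_Diff Diff_iff)
      ultimately show ?thesis using Suc by simp
    qed simp
  qed
  note * = this[OF fin refl assms(1)]
  show ?thesis
  proof (cases "c l = m")
    case True then show ?thesis using *[OF assms(2,3)] by simp
  next
    case False
    have "Suc l \<le> card (S - T)" using *[OF chain_top[OF assms(2) False]] assms(3) by simp
    then show ?thesis by simp
  qed
qed

text \<open>Start from \<open>c0\<close>, which ends in m because it cannot be prolonged, and give
  up the first prime of the chain for one parameter at a time.\<close>

lemma chain_above:
  assumes "T \<subseteq> S" shows "\<exists>c. prime_chain c (card (S - T)) \<and> Idl T \<subseteq> c 0 \<and> c (card (S - T)) = m"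
proof -
  have "finite T" using assms S(1) finite_subset by blast
  then show ?thesis using assms
  proof (induct T)
    case empty
    have "c0 (card S) = m"
    proof (rule ccontr)
      assume "c0 (card S) \<noteq> m"
      from dim[OF chain_top[OF c0 this]] show False by simp
    qed
    moreover have "ideal (c0 0) R" using c0 primeideal.axioms(1) unfolding prime_chain_def by blast
    ultimately show ?case using c0 genideal_minimal[of "c0 0" "{}"] by (intro exI[of _ c0]) auto
  next
    case (insert x T)
    then obtain c where c: "prime_chain c (card (S - T))" "Idl T \<subseteq> c 0" "c (card (S - T)) = m" by auto
    have x: "x \<in> S" "x \<notin> T" using insert by auto
    have xm: "x \<in> m" unfolding S(3) using genideal_self[OF S(2)] x by blast
    have card: "card (S - T) = Suc (card (S - insert x T))"
      using x S(1) by (metis Diff_insert card_Suc_Diff1 finite_Diff Diff_iff)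
    from prime_chain_through[OF no c(1)[unfolded card], of x] xm c(3) card
    obtain c' where c': "prime_chain c' (Suc (card (S - insert x T)))" "c' 0 = c 0"
      "c' (Suc (card (S - insert x T))) = m" "x \<in> c' 1" by auto
    have pc1: "primeideal (c' 1) R" using c'(1) unfolding prime_chain_def by auto
    have Tc: "T \<subseteq> c 0" using genideal_self[of T] insert.prems c(2) S(2) by auto
    have "c' 0 \<subset> c' 1" using c'(1) unfolding prime_chain_def by auto
    then have "insert x T \<subseteq> c' 1" using c' Tc by auto
    then have "Idl (insert x T) \<subseteq> c' 1" using pc1 primeideal.axioms(1) by (intro genideal_minimal) auto
    then show ?case using prime_chain_tail[OF c'(1)] c'(3) by (intro exI[of _ "\<lambda>i. c' (Suc i)"]) auto
  qed
qed

text \<open>If the bottom prime contained x, the chain would lie over one more parameter and be too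
  long for \<open>chain_length_bound\<close>.\<close>

lemma parameter_notin:
  assumes T: "T \<subseteq> S" and x: "x \<in> S - T" and P: "primeideal P R" "Idl T \<subseteq> P"
    and c: "prime_chain c (card (S - T))" "c 0 = P"
  shows "x \<notin> P"
proof
  assume "x \<in> P"
  moreover have "T \<subseteq> P" using genideal_self[of T] T S(2) P(2) by auto
  ultimately have "Idl (insert x T) \<subseteq> c 0" using P(1) primeideal.axioms(1) c(2) by (intro genideal_minimal) auto
  then have "card (S - T) \<le> card (S - insert x T)" using T x by (intro chain_length_bound[OF _ c(1)]) auto
  moreover have "card (S - T) = Suc (card (S - insert x T))"
    using x S(1) by (metis Diff_insert card_Suc_Diff1 finite_Diff)
  ultimately show False by simp
qed

text \<open>Descending induction on T, starting from m. The bottom prime P of a longest chain over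
  \<open>Idl T\<close> lies in \<open>Idl T\<close> + (x) but does not contain x. Hence P =
  \<open>Idl T\<close> + x P, and Nakayama's lemma gives P = \<open>Idl T\<close>.\<close>

lemma parameter_ideal_prime:
  assumes "T \<subseteq> S" shows "primeideal (Idl T) R"
proof -
  have "finite (S - T)" using S(1) by simp
  moreover have "primeideal (Idl T) R" if "finite D" "D = S - T" "T \<subseteq> S" for D T
    using that
  proof (induct D arbitrary: T)
    case empty
    then have "T = S" by auto
    then show ?case using prime_m S(3) by simp
  next
    case (insert x D)
    have x: "x \<in> S" "x \<notin> T" using insert by auto
    have xc: "x \<in> carrier R" using x S(2) by blast
    have TR: "T \<subseteq> carrier R" using insert.prems S(2) by auto
    have xm: "x \<in> m" unfolding S(3) using genideal_self[OF S(2)] x by blast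
    let ?J = "Idl (insert x T)"
    have pJ: "primeideal ?J R" using insert by (intro insert.hyps(3)) auto
    have card: "card (S - T) = Suc (card (S - insert x T))"
      using x S(1) by (metis Diff_insert card_Suc_Diff1 finite_Diff Diff_iff)
    obtain c where c: "prime_chain c (card (S - T))" "Idl T \<subseteq> c 0" "c (card (S - T)) = m"
      using chain_above[OF insert.prems(2)] by blast
    have pc0: "primeideal (c 0) R" using c(1) unfolding prime_chain_def by auto
    have xc0: "x \<notin> c 0" using parameter_notin[OF insert.prems(2) _ pc0 c(2,1)] x by blast
    from prime_chain_through[OF no c(1)[unfolded card], of x] xm c(3) card
    obtain c' where c': "prime_chain c' (Suc (card (S - insert x T)))" "c' 0 = c 0"
      "c' (Suc (card (S - insert x T))) = m" "x \<in> c' 1" by auto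
    have pc1: "primeideal (c' 1) R" and lt: "c 0 \<subset> c' 1"
      using c'(1,2) unfolding prime_chain_def by auto
    have Tc: "T \<subseteq> c 0" using genideal_self[OF TR] c(2) by auto
    have sub: "?J \<subseteq> c' 1" using Tc lt c'(4) pc1 primeideal.axioms(1) by (intro genideal_minimal) auto
    \<comment> \<open>Otherwise \<open>?J\<close>, prime by induction, could take the place of
      \<open>c' 0\<close>, and the chain over the parameters \<open>insert x T\<close> would be one
      step too long.\<close>
    have "?J = c' 1"
    proof (rule ccontr)
      assume "?J \<noteq> c' 1"
      then have "prime_chain (\<lambda>i. if i = 0 then ?J else c' i) (Suc (card (S - insert x T)))"
        using c'(1) pJ sub unfolding prime_chain_def by auto
      then have "Suc (card (S - insert x T)) \<le> card (S - insert x T)"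
        using x insert.prems by (intro chain_length_bound) auto
      then show False by simp
    qed
    then have le: "c 0 \<subseteq> ?J" using lt by blast
    have iT: "ideal (Idl T) R" by (rule genideal_ideal[OF TR])
    interpret T: ideal "Idl T" R by (rule iT)
    interpret C: primeideal "c 0" R by (rule pc0)
    obtain F where F: "finite F" "F \<subseteq> carrier R" "c 0 = Idl F"
      using finite_ideal_generators[OF no C.is_ideal] by metis
    interpret S: module R "self_mod R" by (rule module_self_mod)
    have eqJ: "?J = {y \<oplus> r \<otimes> x | y r. y \<in> Idl T \<and> r \<in> carrier R}"
      using S.mspan_insert[of T x] TR xc by (simp add: mspan_self_mod)
    have "mspan R (self_mod R) F \<subseteq> Idl T"
    proof (rule nakayama_local[OF module_self_mod F(1)])
      fix z assume "z \<in> mspan R (self_mod R) F"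
      then have z: "z \<in> c 0" by (simp add: mspan_self_mod F(3))
      then obtain y r where yr: "z = y \<oplus> r \<otimes> x" "y \<in> Idl T" "r \<in> carrier R" using le eqJ by blast
      have "r \<otimes> x = z \<ominus> y"
        unfolding yr(1) using yr(3) xc T.Icarr[OF yr(2)] by (simp add: minus_eq add.m_ac r_neg1 r_neg2 r_neg)
      moreover have "z \<ominus> y \<in> c 0" unfolding minus_eq using z yr(2) c(2) C.a_inv_closed C.a_closed by blast
      ultimately have "r \<in> c 0" using xc0 C.I_prime[OF yr(3) xc] by auto
      then have "x \<otimes> r \<in> ideal_smult (self_mod R) R m (c 0)" using S.ideal_smultI[OF xm] by simp
      then show "\<exists>y\<in>Idl T. \<exists>w\<in>ideal_smult (self_mod R) R m (mspan R (self_mod R) F). z = y \<oplus>\<^bsub>self_mod R\<^esub> w"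
        using yr xc F(3) m_comm[of x r] by (auto simp: mspan_self_mod)
    qed (use F iT in \<open>auto simp: submodule_self_mod_iff\<close>)
    then have "c 0 = Idl T" using c(2) F(3) by (simp add: mspan_self_mod)
    then show ?case using pc0 by simp
  qed
  ultimately show ?thesis using assms by blast
qed

lemma parameter_independent:
  assumes "T \<subseteq> S" "x \<in> S - T" shows "x \<notin> Idl T"
proof -
  obtain c where c: "prime_chain c (card (S - T))" "Idl T \<subseteq> c 0"
    using chain_above[OF assms(1)] by blast
  then have "primeideal (c 0) R" unfolding prime_chain_def by auto
  then show ?thesis using parameter_notin[OF assms _ c(2,1)] c(2) by blast
qed

end

section \<open>The binomial theorem in a commutative ring\<close>

context cring
begin

lemma binomial:
  assumes a: "a \<in> carrier R" and b: "b \<in> carrier R"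
  shows "(a \<oplus> b) [^] n = (\<Oplus>k\<in>{..n}. [(n choose k)] \<cdot> (a [^] k \<otimes> b [^] (n - k)))"
proof (induct n)
  case 0
  then show ?case by simp
next
  case (Suc n)
  let ?t = "\<lambda>n k. [(n choose k)] \<cdot> (a [^] k \<otimes> b [^] (n - k))"
  have c: "?t n k \<in> carrier R" for n k using a b by simp
  have A: "a \<otimes> (\<Oplus>k\<in>{..n}. ?t n k) = (\<Oplus>k\<in>{..n}. [(n choose k)] \<cdot> (a [^] Suc k \<otimes> b [^] (n - k)))"
  proof -
    have "a \<otimes> (\<Oplus>k\<in>{..n}. ?t n k) = (\<Oplus>k\<in>{..n}. a \<otimes> ?t n k)"
      using a c by (intro finsum_rdistr) auto
    also have "\<dots> = (\<Oplus>k\<in>{..n}. [(n choose k)] \<cdot> (a [^] Suc k \<otimes> b [^] (n - k)))"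
      using a b by (intro finsum_cong') (auto simp: add_pow_rdistr m_assoc m_lcomm m_comm)
    finally show ?thesis .
  qed
  have B: "b \<otimes> (\<Oplus>k\<in>{..n}. ?t n k) = (\<Oplus>k\<in>{..n}. [(n choose k)] \<cdot> (a [^] k \<otimes> b [^] (Suc n - k)))"
  proof -
    have "b \<otimes> (\<Oplus>k\<in>{..n}. ?t n k) = (\<Oplus>k\<in>{..n}. b \<otimes> ?t n k)"
      using b c by (intro finsum_rdistr) auto
    also have "\<dots> = (\<Oplus>k\<in>{..n}. [(n choose k)] \<cdot> (a [^] k \<otimes> b [^] (Suc n - k)))"
      using a b by (intro finsum_cong') (auto simp: add_pow_rdistr Suc_diff_le m_lcomm m_comm)
    finally show ?thesis .
  qed
  let ?X = "\<Oplus>k\<in>{..n}. [(n choose k)] \<cdot> (a [^] Suc k \<otimes> b [^] (n - k))"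
  let ?Y = "\<Oplus>k\<in>{..n}. [(n choose Suc k)] \<cdot> (a [^] Suc k \<otimes> b [^] (n - k))"
  let ?Z = "\<Oplus>k\<in>{..n}. [(n choose k)] \<cdot> (a [^] k \<otimes> b [^] (Suc n - k))"
  have "?Z = (\<Oplus>k\<in>{..Suc n}. [(n choose k)] \<cdot> (a [^] k \<otimes> b [^] (Suc n - k)))"
    using a b by (subst finsum_Suc) (auto simp: binomial_eq_0)
  also have "\<dots> = ?Y \<oplus> b [^] Suc n"
    using a b by (subst finsum_Suc2) auto
  finally have Z: "?Z = ?Y \<oplus> b [^] Suc n" .
  have "(\<Oplus>k\<in>{..Suc n}. ?t (Suc n) k) = (\<Oplus>k\<in>{..n}. ?t (Suc n) (Suc k)) \<oplus> b [^] Suc n"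
    using a b by (subst finsum_Suc2) auto
  also have "(\<Oplus>k\<in>{..n}. ?t (Suc n) (Suc k)) =
      (\<Oplus>k\<in>{..n}. [(n choose k)] \<cdot> (a [^] Suc k \<otimes> b [^] (n - k)) \<oplus> [(n choose Suc k)] \<cdot> (a [^] Suc k \<otimes> b [^] (n - k)))"
    using a b by (intro finsum_cong') (auto simp: add.nat_pow_mult)
  also have "\<dots> = ?X \<oplus> ?Y"
    using a b by (intro finsum_addf) auto
  finally have "(\<Oplus>k\<in>{..Suc n}. ?t (Suc n) k) = (?X \<oplus> ?Y) \<oplus> b [^] Suc n" .
  also have "\<dots> = ?X \<oplus> ?Z" unfolding Z using a b by (intro a_assoc finsum_closed) auto
  also have "\<dots> = (a \<oplus> b) \<otimes> (\<Oplus>k\<in>{..n}. ?t n k)"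
    unfolding A[symmetric] B[symmetric] using a b c by (intro l_distr[symmetric] finsum_closed) auto
  also have "\<dots> = (a \<oplus> b) [^] Suc n" using Suc a b by (simp add: m_comm)
  finally show ?case by simp
qed

end

section \<open>The local form of Kunz's theorem\<close>

locale cring_char = cring R for R :: "('a, 'x) ring_scheme" (structure) +
  fixes p :: nat
  assumes char: "has_prime_char R p"
begin

lemma prime_p: "Factorial_Ring.prime p" and p_one: "[p] \<cdot> \<one> = \<zero>"
  using char unfolding has_prime_char_def by auto

lemma add_pow_dvd_zero: assumes "p dvd n" "x \<in> carrier R" shows "[n] \<cdot> x = \<zero>"
proof -
  obtain m where n: "n = p * m" using assms(1) by blast
  have "[p] \<cdot> x = ([p] \<cdot> \<one>) \<otimes> x" using assms by (simp add: add_pow_ldistr)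
  then have "[p] \<cdot> x = \<zero>" using assms p_one by simp
  then show ?thesis unfolding n add.nat_pow_pow[OF assms(2), symmetric] by simp
qed

lemma frobenius_add1:
  assumes a: "a \<in> carrier R" and b: "b \<in> carrier R"
  shows "(a \<oplus> b) [^] p = a [^] p \<oplus> b [^] p"
proof -
  have p: "p > 0" using prime_p prime_gt_0_nat by blast
  have "(a \<oplus> b) [^] p = (\<Oplus>k\<in>{..p}. [(p choose k)] \<cdot> (a [^] k \<otimes> b [^] (p - k)))" by (rule binomial[OF a b])
  also have "\<dots> = (\<Oplus>k\<in>{..p}. (if k = 0 then b [^] p else \<zero>) \<oplus> (if k = p then a [^] p else \<zero>))"
  proof (rule finsum_cong')
    fix k assume "k \<in> {..p}"
    show "[(p choose k)] \<cdot> (a [^] k \<otimes> b [^] (p - k)) = (if k = 0 then b [^] p else \<zero>) \<oplus> (if k = p then a [^] p else \<zero>)"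
    proof (cases "k = 0 \<or> k = p")
      case False
      then have "p dvd (p choose k)" using \<open>k \<in> {..p}\<close> prime_p by (intro dvd_choose_prime) auto
      then show ?thesis using False a b by (simp add: add_pow_dvd_zero)
    qed (use a b p in auto)
  qed (use a b in auto)
  also have "\<dots> = (\<Oplus>k\<in>{..p}. (if k = 0 then b [^] p else \<zero>)) \<oplus> (\<Oplus>k\<in>{..p}. (if k = p then a [^] p else \<zero>))"
    using a b by (intro finsum_addf) auto
  also have "\<dots> = b [^] p \<oplus> a [^] p"
    using a b finsum_singleton[of 0 "{..p}" "\<lambda>_. b [^] p"] finsum_singleton[of p "{..p}" "\<lambda>_. a [^] p"]
    by (simp add: eq_commute)
  finally show ?thesis using a b by (simp add: a_comm)
qed

lemma frobenius_add:
  assumes a: "a \<in> carrier R" and b: "b \<in> carrier R"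
  shows "(a \<oplus> b) [^] (p ^ e) = a [^] (p ^ e) \<oplus> b [^] (p ^ e)"
proof (induct e)
  case (Suc e)
  have eq: "x [^] (p ^ Suc e) = (x [^] (p ^ e)) [^] p" if "x \<in> carrier R" for x
    using that by (simp add: nat_pow_pow mult.commute)
  show ?case using a b by (simp only: eq a_closed Suc frobenius_add1 nat_pow_closed)
qed (use a b in simp)

lemma q_pos: "p ^ e > 0" using prime_p prime_gt_0_nat by simp

lemma pow_q_zero: "\<zero> [^] (p ^ e) = \<zero>"
  using q_pos[of e] nat_pow_zero by (metis less_not_refl)

lemma frob_finsum:
  assumes "finite A" "f \<in> A \<rightarrow> carrier R"
  shows "(\<Oplus>i\<in>A. f i) [^] (p ^ e) = (\<Oplus>i\<in>A. f i [^] (p ^ e))"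
  using assms by (induct A) (auto simp: pow_q_zero frobenius_add Pi_def)

lemma frob_self_simps [simp]:
  "carrier (frob p e A N) = carrier N" "zero (frob p e A N) = zero N"
  "add (frob p e A N) = add N"
  "smult (frob p e A N) = (\<lambda>a x. (a [^]\<^bsub>A\<^esub> (p ^ e)) \<odot>\<^bsub>N\<^esub> x)"
  by (simp_all add: frob_def)

lemma a_inv_frob: "a_inv (frob p e A N) x = a_inv N x"
  by (simp add: a_inv_def m_inv_def frob_def)

lemma module_frob:
  assumes "module R N" shows "module R (frob p e R N)"
proof -
  interpret N: module R N by fact
  show ?thesis
  proof (rule moduleI)
    show "abelian_group (frob p e R N)"
      by (rule abelian_groupI)
         (auto simp: N.M.add.m_assoc N.M.add.m_comm N.M.add.m_lcomm intro!: bexI[of _ "\<ominus>\<^bsub>N\<^esub> x" for x] N.M.l_neg)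
  qed (auto simp: frobenius_add N.smult_l_distr N.smult_r_distr nat_pow_distrib N.smult_assoc1 is_cring)
qed

lemma module_frob_self: "module R (frob p e R (self_mod R))"
  by (rule module_frob[OF module_self_mod])

lemma ideal_submodule_frob:
  assumes "ideal I R" shows "submodule I R (frob p e R (self_mod R))"
proof -
  interpret I: ideal I R by fact
  interpret N: module R "frob p e R (self_mod R)" by (rule module_frob_self)
  show ?thesis by (rule N.submoduleI') (auto simp: I.I_l_closed I.a_subset)
qed

end

lemma (in cring) Idl_insert:
  assumes "S \<subseteq> carrier R" "x \<in> carrier R"
  shows "Idl (insert x S) = {y \<oplus> a \<otimes> x | y a. y \<in> Idl S \<and> a \<in> carrier R}"
proof -
  interpret S: module R "self_mod R" by (rule module_self_mod)
  show ?thesis using S.mspan_insert[of S x] assms by (simp add: mspan_self_mod)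
qed

section \<open>Ideals generated by powers of parameters\<close>

context regular_local
begin

definition pow_ideal :: "('a \<Rightarrow> nat) \<Rightarrow> 'a set \<Rightarrow> 'a set" where
  "pow_ideal n T = Idl ((\<lambda>x. x [^] n x) ` T)"

lemma pow_ideal_ideal: "T \<subseteq> S \<Longrightarrow> ideal (pow_ideal n T) R"
  unfolding pow_ideal_def using S(2) by (intro genideal_ideal) auto

lemma pow_ideal_insert:
  assumes "insert x T \<subseteq> S"
  shows "pow_ideal n (insert x T) = {y \<oplus> a \<otimes> x [^] n x | y a. y \<in> pow_ideal n T \<and> a \<in> carrier R}"
proof -
  have "(\<lambda>x. x [^] n x) ` T \<subseteq> carrier R" "x [^] n x \<in> carrier R" using assms S(2) by auto
  from Idl_insert[OF this] show ?thesis unfolding pow_ideal_def by simp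
qed

lemma pow_ideal_cong: "(\<And>x. x \<in> T \<Longrightarrow> n x = n' x) \<Longrightarrow> pow_ideal n T = pow_ideal n' T"
  unfolding pow_ideal_def by (metis (no_types, lifting) image_cong)

text \<open>Induction on the sum of the exponents. When all are 1, the ideal is the prime
  \<open>Idl T\<close>. Otherwise an exponent k + 2 is first lowered to k + 1, giving u = w + r
  x^(k+1), and then to 1, which shows that r is a multiple of x modulo the other generators.\<close>

lemma pow_ideal_primary:
  assumes "T \<subseteq> S" "\<And>x. x \<in> T \<Longrightarrow> n x \<ge> 1" "y \<in> carrier R - Idl T" "u \<in> carrier R" "y \<otimes> u \<in> pow_ideal n T"
  shows "u \<in> pow_ideal n T"
  using assms
proof (induct "\<Sum>x\<in>T. n x" arbitrary: T n y u rule: less_induct)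
  case less
  have finT: "finite T" using less.prems(1) S(1) finite_subset by blast
  show ?case
  proof (cases "\<forall>x\<in>T. n x = 1")
    case True
    have "(\<lambda>x. x [^] n x) ` T = T" using True less.prems(1) S(2) by force
    then have eq: "pow_ideal n T = Idl T" unfolding pow_ideal_def by simp
    then show ?thesis
      using primeideal.I_prime[OF parameter_ideal_prime[OF less.prems(1)]] less.prems(3-5) by auto
  next
    case False
    then obtain x where x: "x \<in> T" "n x \<noteq> 1" by blast
    define T' where "T' = T - {x}"
    have T: "T = insert x T'" "x \<notin> T'" "finite T'" using x finT by (auto simp: T'_def)
    have T'S: "T' \<subseteq> S" and TS: "insert x T' \<subseteq> S" using less.prems(1) T by auto
    have xc: "x \<in> carrier R" using TS S(2) by blast
    obtain k where k: "n x = Suc (Suc k)"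
    proof -
      have "n x \<ge> 2" using less.prems(2)[OF x(1)] x(2) by simp
      then show ?thesis using that[of "n x - 2"] by simp
    qed
    let ?n1 = "n(x := Suc k)" and ?n2 = "n(x := 1)"
    have sum: "(\<Sum>x\<in>insert x T'. m x) = m x + (\<Sum>x\<in>T'. m x)" for m :: "'a \<Rightarrow> nat" using T by simp
    have s1: "(\<Sum>x\<in>T'. ?n1 x) = (\<Sum>x\<in>T'. n x)" "(\<Sum>x\<in>T'. ?n2 x) = (\<Sum>x\<in>T'. n x)"
      using T by (auto intro!: sum.cong)
    have pI: "pow_ideal ?n1 T' = pow_ideal n T'" "pow_ideal ?n2 T' = pow_ideal n T'"
      using T by (auto intro!: pow_ideal_cong)
    interpret I: ideal "pow_ideal n T'" R by (rule pow_ideal_ideal[OF T'S])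
    have yc: "y \<in> carrier R" using less.prems by simp
    have In: "pow_ideal n T = {w \<oplus> a \<otimes> x [^] Suc (Suc k) | w a. w \<in> pow_ideal n T' \<and> a \<in> carrier R}"
      using pow_ideal_insert[OF TS, of n] T k by simp
    have In1: "pow_ideal ?n1 T = {w \<oplus> a \<otimes> x [^] Suc k | w a. w \<in> pow_ideal n T' \<and> a \<in> carrier R}"
      using pow_ideal_insert[OF TS, of ?n1] T pI by simp
    have In2: "pow_ideal ?n2 T = {w \<oplus> a \<otimes> x | w a. w \<in> pow_ideal n T' \<and> a \<in> carrier R}"
      using pow_ideal_insert[OF TS, of ?n2] T pI xc by simp
    \<comment> \<open>By the induction hypothesis for \<open>T'\<close>: the parameter x lies
      outside \<open>Idl T'\<close>, so it can be cancelled modulo powers of the other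
      parameters.\<close>
    have canc: "v \<in> pow_ideal n T'" if "x \<otimes> v \<in> pow_ideal n T'" "v \<in> carrier R" for v
    proof (rule less.hyps[of n T' x v])
      show "(\<Sum>x\<in>T'. n x) < (\<Sum>x\<in>T. n x)" using T sum[of n] k by simp
      show "x \<in> carrier R - Idl T'" using parameter_independent[OF T'S, of x] TS T xc by auto
    qed (use that T'S less.prems(2) T in auto)
    have canc_pow: "v \<in> pow_ideal n T'" if "x [^] j \<otimes> v \<in> pow_ideal n T'" "v \<in> carrier R" for v and j :: nat
      using that(1)
    proof (induct j)
      case 0 then show ?case using that(2) by simp
    next
      case (Suc j)
      have "x [^] Suc j \<otimes> v = x \<otimes> (x [^] j \<otimes> v)" using xc that(2) by (simp add: m_ac)
      then show ?case using Suc canc[of "x [^] j \<otimes> v"] xc that(2) by simp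
    qed
    obtain w' c where w'c: "y \<otimes> u = w' \<oplus> c \<otimes> x [^] Suc (Suc k)" "w' \<in> pow_ideal n T'" "c \<in> carrier R"
      using less.prems(5) In by auto
    have "y \<otimes> u = w' \<oplus> (c \<otimes> x) \<otimes> x [^] Suc k"
      unfolding w'c(1) using w'c(3) xc by (simp add: m_ac)
    then have "y \<otimes> u \<in> pow_ideal ?n1 T" unfolding In1 using w'c xc by blast
    then have "u \<in> pow_ideal ?n1 T"
      using less.prems T sum[of n] sum[of ?n1] s1 k by (intro less.hyps[of ?n1 T y u]) auto
    then obtain w r where wr: "u = w \<oplus> r \<otimes> x [^] Suc k" "w \<in> pow_ideal n T'" "r \<in> carrier R" using In1 by auto
    have cc: "w \<in> carrier R" "w' \<in> carrier R" using wr w'c I.Icarr by auto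
    let ?v = "y \<otimes> r \<ominus> c \<otimes> x"
    have vc: "?v \<in> carrier R" using yc wr w'c xc by simp
    \<comment> \<open>Inserting u = w + r x^(k+1) into y u = w' + c x^(k+2) leaves x^(k+1) (y r - c
      x) in the ideal belonging to \<open>T'\<close>, where x can be cancelled.\<close>
    have "x [^] Suc k \<otimes> ?v = w' \<ominus> y \<otimes> w"
    proof -
      have "x [^] Suc k \<otimes> ?v = y \<otimes> (r \<otimes> x [^] Suc k) \<ominus> c \<otimes> x [^] Suc (Suc k)"
        using yc wr(3) w'c(3) xc by (simp add: minus_eq r_distr r_minus m_ac)
      also have "r \<otimes> x [^] Suc k = u \<ominus> w"
        unfolding wr(1) using cc wr(3) xc by (simp add: minus_eq add.m_ac r_neg1 r_neg2 r_neg)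
      also have "y \<otimes> (u \<ominus> w) \<ominus> c \<otimes> x [^] Suc (Suc k) = (y \<otimes> u \<ominus> c \<otimes> x [^] Suc (Suc k)) \<ominus> y \<otimes> w"
        using yc less.prems(4) cc w'c(3) xc by (simp add: minus_eq r_distr r_minus add.m_ac)
      also have "y \<otimes> u \<ominus> c \<otimes> x [^] Suc (Suc k) = w'"
        unfolding w'c(1) using cc w'c(3) xc by (simp add: minus_eq a_assoc r_neg)
      finally show ?thesis .
    qed
    moreover have "w' \<ominus> y \<otimes> w \<in> pow_ideal n T'"
      unfolding minus_eq by (intro I.a_closed I.a_inv_closed I.I_l_closed w'c(2) wr(2) yc)
    ultimately have "?v \<in> pow_ideal n T'" using canc_pow[of "Suc k" ?v] vc by simp
    moreover have "y \<otimes> r = ?v \<oplus> c \<otimes> x" using yc wr(3) w'c(3) xc by (simp add: minus_add_cancel)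
    ultimately have "y \<otimes> r \<in> pow_ideal ?n2 T" unfolding In2 using w'c(3) by blast
    then have "r \<in> pow_ideal ?n2 T"
      using less.prems wr(3) T sum[of n] sum[of ?n2] s1 k by (intro less.hyps[of ?n2 T y r]) auto
    then obtain w2 d where wd: "r = w2 \<oplus> d \<otimes> x" "w2 \<in> pow_ideal n T'" "d \<in> carrier R" using In2 by auto
    have w2c: "w2 \<in> carrier R" using wd I.Icarr by auto
    have "u = (w \<oplus> w2 \<otimes> x [^] Suc k) \<oplus> d \<otimes> x [^] Suc (Suc k)"
      unfolding wr(1) wd(1) using cc w2c wd(3) xc by (simp add: l_distr r_distr m_ac a_assoc)
    moreover have "w \<oplus> w2 \<otimes> x [^] Suc k \<in> pow_ideal n T'"
      using xc by (intro I.a_closed I.I_r_closed wr(2) wd(2)) auto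
    ultimately show ?thesis unfolding In using wd(3) by blast
  qed
qed

end

locale regular_local_char = regular_local R m S c0 + cring_char R p
  for R :: "('a, 'x) ring_scheme" (structure) and m S c0 p +
  fixes e :: nat
begin

abbreviation "q \<equiv> p ^ e"
abbreviation "N \<equiv> frob p e R (self_mod R)"
abbreviation "J \<equiv> pow_ideal (\<lambda>_. q)"

sublocale N: module R N by (rule module_frob_self)

lemma J_mono: "T \<subseteq> T' \<Longrightarrow> T' \<subseteq> S \<Longrightarrow> J T \<subseteq> J T'"
  unfolding pow_ideal_def using S(2) by (intro subset_Idl_subset) auto

lemma q_pow_in_J:
  assumes "T \<subseteq> S" "a \<in> Idl T" shows "a [^] q \<in> J T"
proof -
  interpret J: ideal "J T" R by (rule pow_ideal_ideal[OF assms(1)])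
  interpret M: module R "self_mod R" by (rule module_self_mod)
  have "submodule {a \<in> carrier R. a [^] q \<in> J T} R (self_mod R)"
    by (rule M.submoduleI') (auto simp: pow_q_zero frobenius_add nat_pow_distrib J.I_l_closed)
  then have id: "ideal {a \<in> carrier R. a [^] q \<in> J T} R" by (simp add: submodule_self_mod_iff)
  have "(\<lambda>x. x [^] q) ` T \<subseteq> J T"
    unfolding pow_ideal_def using assms(1) S(2) by (intro genideal_self) auto
  then have "Idl T \<subseteq> {a \<in> carrier R. a [^] q \<in> J T}"
    using assms(1) S(2) by (intro genideal_minimal[OF id]) auto
  then show ?thesis using assms(2) by blast
qed

text \<open>The multiple of the pushforward by m is the ideal generated by the q-th powers of m.
  What needs an argument is closure under the ordinary multiplication of R, since a span in
  \<open>N\<close> is by construction closed only under multiplication by q-th powers.\<close>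

lemma J_le_ideal_smult: "J S \<subseteq> ideal_smult N R m (carrier R)"
proof -
  let ?W = "ideal_smult N R m (carrier R)"
  have mc: "m \<subseteq> carrier R" using ideal.Icarr[OF primeideal.axioms(1)[OF prime_m]] by blast
  have W: "submodule ?W R N" using mc by (intro N.ideal_smult_submodule) auto
  note W' = N.submoduleE[OF W] N.submodule_zero[OF W]
  interpret M: module R "self_mod R" by (rule module_self_mod)
  have mult: "r \<otimes> w \<in> ?W" if r: "r \<in> carrier R" and w: "w \<in> ?W" for r w
  proof -
    have sm: "submodule {w \<in> carrier R. r \<otimes> w \<in> ?W} R N"
    proof (rule N.submoduleI')
      fix a x assume a: "a \<in> carrier R" and x: "x \<in> {w \<in> carrier R. r \<otimes> w \<in> ?W}"
      then have "a [^] q \<otimes> (r \<otimes> x) \<in> ?W" using W'(4)[of a "r \<otimes> x"] by simp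
      moreover have "a [^] q \<otimes> (r \<otimes> x) = r \<otimes> (a [^] q \<otimes> x)" using a x r by (simp add: m_lcomm)
      ultimately show "a \<odot>\<^bsub>N\<^esub> x \<in> {w \<in> carrier R. r \<otimes> w \<in> ?W}" using a x by simp
    qed (use r W' in \<open>auto simp: r_distr\<close>)
    have "?W \<subseteq> {w \<in> carrier R. r \<otimes> w \<in> ?W}"
    proof (rule N.ideal_smult_minimal[OF sm])
      fix a x assume a: "a \<in> m" and x: "x \<in> carrier R"
      have "a \<odot>\<^bsub>N\<^esub> (r \<otimes> x) \<in> ?W" using a x r by (intro N.ideal_smultI) auto
      moreover have "r \<otimes> (a [^] q \<otimes> x) = a [^] q \<otimes> (r \<otimes> x)" using a x r mc by (simp add: m_lcomm subset_iff)
      ultimately show "a \<odot>\<^bsub>N\<^esub> x \<in> {w \<in> carrier R. r \<otimes> w \<in> ?W}" using a x mc by auto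
    qed
    then show ?thesis using w by blast
  qed
  have "submodule ?W R (self_mod R)"
    using W' mult by (intro M.submoduleI') auto
  then have id: "ideal ?W R" by (simp add: submodule_self_mod_iff)
  have "x [^] q \<in> ?W" if "x \<in> S" for x
  proof -
    have "x \<in> m" using genideal_self[OF S(2)] S(3) that by blast
    then have "x \<odot>\<^bsub>N\<^esub> \<one> \<in> ?W" by (intro N.ideal_smultI) auto
    then show ?thesis using that S(2) by auto
  qed
  then show ?thesis unfolding pow_ideal_def by (intro genideal_minimal[OF id]) auto
qed

text \<open>Local form of Kunz's theorem, with \<open>N\<close> playing the role of \<open>F\<^sup>e\<^sub>*R\<close>. For \<open>T = S\<close> the claim is the
  minimality of \<open>G\<close> (Nakayama); removing the parameters from \<open>T\<close> one at a time gives \<open>T = {}\<close>, where it says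
  that \<open>G\<close> is free.\<close>

lemma minimal_generators_free:
  assumes G: "finite G" "G \<subseteq> carrier R" "carrier R \<subseteq> mspan R N G"
    and min: "\<And>g. g \<in> G \<Longrightarrow> \<not> carrier R \<subseteq> mspan R N (G - {g})"
    and T: "T \<subseteq> S" and a: "a \<in> G \<rightarrow> carrier R" and sum: "(\<Oplus>g\<in>G. a g [^] q \<otimes> g) \<in> J T" and h: "h \<in> G"
  shows "a h \<in> Idl T"
proof -
  have "finite (S - T)" using S(1) by simp
  then show ?thesis using T a sum h
  proof (induct "S - T" arbitrary: T a h)
    case empty
    then have TS: "T = S" by auto
    show ?case
    proof (rule ccontr)
      assume "a h \<notin> Idl T"
      then have ah: "a h \<notin> m" "a h \<in> carrier R" using TS S(3) empty by auto
      \<comment> \<open>With \<open>a h\<close> a unit, h lies in the span of the other generators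
        plus \<open>J S\<close>. By Nakayama's lemma these would generate everything, against
        minimality.\<close>
      let ?U = "mspan R N (G - {h})"
      have Gh: "G - {h} \<subseteq> carrier N" using G by auto
      have U: "submodule ?U R N" by (rule N.mspan_submodule[OF Gh])
      note U' = N.submoduleE[OF U] N.submodule_zero[OF U]
      have JS: "submodule (J S) R N" using ideal_submodule_frob[OF pow_ideal_ideal] by simp
      let ?V = "{x \<oplus>\<^bsub>N\<^esub> y | x y. x \<in> ?U \<and> y \<in> J S}"
      have V: "submodule ?V R N" by (rule N.submodule_sum[OF U JS])
      note V' = N.submoduleE[OF V] N.submodule_zero[OF V]
      have UV: "?U \<subseteq> ?V"
      proof
        fix x assume x: "x \<in> ?U"
        then have "x = x \<oplus>\<^bsub>N\<^esub> \<zero>" using U'(1) by auto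
        then show "x \<in> ?V" using x N.submodule_zero[OF JS] by fastforce
      qed
      have JV: "J S \<subseteq> ?V"
      proof
        fix x assume x: "x \<in> J S"
        then have "x = \<zero> \<oplus>\<^bsub>N\<^esub> x" using N.submoduleE(1)[OF JS] by auto
        then show "x \<in> ?V" using x U'(7) by fastforce
      qed
      have rest: "(\<Oplus>g\<in>F. a g [^] q \<otimes> g) \<in> ?U" if "F \<subseteq> G - {h}" "finite F" for F
        using that(2,1)
      proof induct
        case empty then show ?case using U'(7) by simp
      next
        case (insert x F)
        have c: "x \<in> carrier R" "a x \<in> carrier R" using insert.prems G(2) empty.prems(2) by auto
        have "a x \<odot>\<^bsub>N\<^esub> x \<in> ?U" using insert.prems c by (intro U'(4) N.mspan_superset) auto
        then have "a x [^] q \<otimes> x \<oplus> (\<Oplus>g\<in>F. a g [^] q \<otimes> g) \<in> ?U" using U'(5) insert by simp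
        moreover have "(\<Oplus>g\<in>insert x F. a g [^] q \<otimes> g) = a x [^] q \<otimes> x \<oplus> (\<Oplus>g\<in>F. a g [^] q \<otimes> g)"
          using insert empty.prems(2) G(2) c by (intro finsum_insert) (auto simp: Pi_iff subset_iff)
        ultimately show ?case by simp
      qed
      have hc: "h \<in> carrier R" using empty G by auto
      let ?r = "\<Oplus>g\<in>G - {h}. a g [^] q \<otimes> g"
      have rU: "?r \<in> ?U" using rest[of "G - {h}"] G by simp
      have rc: "?r \<in> carrier R" using rU U'(1) by auto
      have "(\<Oplus>g\<in>G. a g [^] q \<otimes> g) = (\<Oplus>g\<in>insert h (G - {h}). a g [^] q \<otimes> g)"
        using empty.prems(4) by (simp add: insert_absorb)
      also have "\<dots> = a h [^] q \<otimes> h \<oplus> ?r"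
        using G empty.prems(2) hc ah by (intro finsum_insert) (auto simp: Pi_iff subset_iff)
      finally have eq: "(\<Oplus>g\<in>G. a g [^] q \<otimes> g) = a h [^] q \<otimes> h \<oplus> ?r" .
      have "a h [^] q \<otimes> h = (\<Oplus>g\<in>G. a g [^] q \<otimes> g) \<oplus> \<ominus> ?r"
        unfolding eq using rc hc ah by (simp add: a_assoc r_neg)
      moreover have "\<ominus> ?r \<in> ?V"
        using N.submoduleE(3)[OF U rU] UV by (auto simp: a_inv_frob)
      moreover have "(\<Oplus>g\<in>G. a g [^] q \<otimes> g) \<in> ?V" using empty.prems(3) TS JV by blast
      ultimately have "a h \<odot>\<^bsub>N\<^esub> h \<in> ?V" using V'(5) by simp
      moreover obtain v where v: "v \<in> carrier R" "v \<otimes> a h = \<one>" using unit_if_notin_m[OF ah(2,1)] by blast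
      ultimately have "v \<odot>\<^bsub>N\<^esub> (a h \<odot>\<^bsub>N\<^esub> h) \<in> ?V" using V'(4) by blast
      moreover have "v \<odot>\<^bsub>N\<^esub> (a h \<odot>\<^bsub>N\<^esub> h) = h" using N.smult_assoc1[of v "a h" h] N.smult_one[of h] v ah hc by simp
      ultimately have hV: "h \<in> ?V" by simp
      have "G \<subseteq> ?V" using hV UV N.mspan_incl[of "G - {h}"] by blast
      then have sp: "mspan R N G \<subseteq> ?V" by (rule N.mspan_minimal[OF V])
      have spG: "mspan R N G = carrier R" using G N.mspan_carrier[of G] by auto
      have "mspan R N G \<subseteq> ?U"
      proof (rule nakayama_local[OF module_frob_self G(1) _ U])
        fix x assume "x \<in> mspan R N G"
        then have "x \<in> ?V" using sp by blast
        then show "\<exists>y\<in>?U. \<exists>z\<in>ideal_smult N R m (mspan R N G). x = y \<oplus>\<^bsub>N\<^esub> z"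
          unfolding spG using J_le_ideal_smult by blast
      qed (use G in auto)
      then show False using min[OF empty.prems(4)] spG by simp
    qed
  next
    case (insert x D)
    have x: "x \<in> S" "x \<notin> T" "insert x T \<subseteq> S" and D: "D = S - insert x T" using insert.hyps insert.prems by auto
    have xc: "x \<in> carrier R" using x S by auto
    have TR: "T \<subseteq> carrier R" using insert.prems S by auto
    have xm: "x \<in> m" unfolding S(3) using genideal_self[OF S(2)] x by blast
    interpret J: ideal "J T" R by (rule pow_ideal_ideal[OF insert.prems(1)])
    interpret M: module R "self_mod R" by (rule module_self_mod)
    interpret P: primeideal "Idl T" R by (rule parameter_ideal_prime[OF insert.prems(1)])
    have xT: "x [^] q \<in> carrier R - Idl T"
      using parameter_independent[OF insert.prems(1), of x] x xc prime_pow[OF P.primeideal xc] by auto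
    \<comment> \<open>The ideal of all coefficients of h in relations modulo \<open>J T\<close>. The
      goal is that it lies in \<open>Idl T\<close> + x A, so that Nakayama's lemma puts it into
      \<open>Idl T\<close>.\<close>
    define A where "A = {b. \<exists>\<alpha>\<in>G \<rightarrow> carrier R. \<alpha> h = b \<and> (\<Oplus>g\<in>G. \<alpha> g [^] q \<otimes> g) \<in> J T}"
    have sc: "(\<lambda>g. \<alpha> g [^] q \<otimes> g) \<in> G \<rightarrow> carrier R" if "\<alpha> \<in> G \<rightarrow> carrier R" for \<alpha> using that G by auto
    have "submodule A R (self_mod R)"
    proof (rule M.submoduleI')
      have "(\<Oplus>g\<in>G. \<zero> [^] q \<otimes> g) = (\<Oplus>g\<in>G. \<zero>)"
        using G by (intro finsum_cong') (auto simp: pow_q_zero)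
      then show "\<zero>\<^bsub>self_mod R\<^esub> \<in> A" unfolding A_def by (auto intro!: bexI[of _ "\<lambda>_. \<zero>"])
      show "b \<oplus>\<^bsub>self_mod R\<^esub> c \<in> A" if "b \<in> A" "c \<in> A" for b c
      proof -
        from that obtain \<alpha> \<beta> where *: "\<alpha> \<in> G \<rightarrow> carrier R" "\<beta> \<in> G \<rightarrow> carrier R" "\<alpha> h = b" "\<beta> h = c"
          "(\<Oplus>g\<in>G. \<alpha> g [^] q \<otimes> g) \<in> J T" "(\<Oplus>g\<in>G. \<beta> g [^] q \<otimes> g) \<in> J T" unfolding A_def by blast
        have "(\<Oplus>g\<in>G. (\<alpha> g \<oplus> \<beta> g) [^] q \<otimes> g) = (\<Oplus>g\<in>G. \<alpha> g [^] q \<otimes> g \<oplus> \<beta> g [^] q \<otimes> g)"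
          using * G by (intro finsum_cong') (auto simp: frobenius_add l_distr Pi_iff subset_iff)
        also have "\<dots> = (\<Oplus>g\<in>G. \<alpha> g [^] q \<otimes> g) \<oplus> (\<Oplus>g\<in>G. \<beta> g [^] q \<otimes> g)"
          using sc[OF *(1)] sc[OF *(2)] by (rule finsum_addf)
        finally have "(\<Oplus>g\<in>G. (\<alpha> g \<oplus> \<beta> g) [^] q \<otimes> g) \<in> J T" using *(5,6) J.a_closed by simp
        then show ?thesis unfolding A_def using * by (intro CollectI bexI[of _ "\<lambda>g. \<alpha> g \<oplus> \<beta> g"]) auto
      qed
      show "r \<odot>\<^bsub>self_mod R\<^esub> b \<in> A" if r: "r \<in> carrier R" and "b \<in> A" for r b
      proof -
        from that obtain \<alpha> where *: "\<alpha> \<in> G \<rightarrow> carrier R" "\<alpha> h = b" "(\<Oplus>g\<in>G. \<alpha> g [^] q \<otimes> g) \<in> J T"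
          unfolding A_def by blast
        have "(\<Oplus>g\<in>G. (r \<otimes> \<alpha> g) [^] q \<otimes> g) = (\<Oplus>g\<in>G. r [^] q \<otimes> (\<alpha> g [^] q \<otimes> g))"
          using * G r by (intro finsum_cong') (auto simp: nat_pow_distrib m_assoc Pi_iff subset_iff)
        also have "\<dots> = r [^] q \<otimes> (\<Oplus>g\<in>G. \<alpha> g [^] q \<otimes> g)"
          using sc[OF *(1)] r G(1) by (intro finsum_rdistr[symmetric]) auto
        finally have "(\<Oplus>g\<in>G. (r \<otimes> \<alpha> g) [^] q \<otimes> g) \<in> J T" using *(3) r J.I_l_closed by simp
        then show ?thesis unfolding A_def using * r by (intro CollectI bexI[of _ "\<lambda>g. r \<otimes> \<alpha> g"]) auto
      qed
    qed (use insert.prems(4) in \<open>auto simp: A_def\<close>)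
    then have A: "ideal A R" by (simp add: submodule_self_mod_iff)
    then obtain F where F: "finite F" "F \<subseteq> carrier R" "A = Idl F"
      using finite_ideal_generators[OF no A] by metis
    have "mspan R (self_mod R) F \<subseteq> Idl T"
    proof (rule nakayama_local[OF module_self_mod F(1)])
      fix z assume "z \<in> mspan R (self_mod R) F"
      then have "z \<in> A" by (simp add: mspan_self_mod F(3))
      then obtain \<alpha> where \<alpha>: "\<alpha> \<in> G \<rightarrow> carrier R" "\<alpha> h = z" "(\<Oplus>g\<in>G. \<alpha> g [^] q \<otimes> g) \<in> J T"
        unfolding A_def by blast
      have "\<alpha> g \<in> Idl (insert x T)" if "g \<in> G" for g
        using insert.hyps(3)[OF D x(3) \<alpha>(1) _ that] \<alpha>(3) J_mono[of T "insert x T"] x(3) by blast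
      then have "\<forall>g\<in>G. \<exists>y r. \<alpha> g = y \<oplus> r \<otimes> x \<and> y \<in> Idl T \<and> r \<in> carrier R"
        using Idl_insert[OF TR xc] by auto
      then obtain \<beta> \<rho> where br: "\<And>g. g \<in> G \<Longrightarrow> \<alpha> g = \<beta> g \<oplus> \<rho> g \<otimes> x" "\<And>g. g \<in> G \<Longrightarrow> \<beta> g \<in> Idl T"
        "\<And>g. g \<in> G \<Longrightarrow> \<rho> g \<in> carrier R" by metis
      have bc: "\<beta> \<in> G \<rightarrow> carrier R" and rc: "\<rho> \<in> G \<rightarrow> carrier R" using br P.Icarr by auto
      have bJ: "(\<Oplus>g\<in>F. \<beta> g [^] q \<otimes> g) \<in> J T" if "finite F" "F \<subseteq> G" for F
        using that
      proof induct
        case empty then show ?case using J.zero_closed by simp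
      next
        case (insert y F)
        have "\<beta> y [^] q \<otimes> y \<in> J T"
          using q_pow_in_J[OF \<open>T \<subseteq> S\<close> br(2)] insert.prems G(2) by (intro J.I_r_closed) auto
        moreover have "(\<Oplus>g\<in>insert y F. \<beta> g [^] q \<otimes> g) = \<beta> y [^] q \<otimes> y \<oplus> (\<Oplus>g\<in>F. \<beta> g [^] q \<otimes> g)"
          using insert sc[OF bc] by (intro finsum_insert) auto
        ultimately show ?case using insert J.a_closed by simp
      qed
      let ?r = "\<Oplus>g\<in>G. \<rho> g [^] q \<otimes> g" and ?b = "\<Oplus>g\<in>G. \<beta> g [^] q \<otimes> g"
      have c: "?r \<in> carrier R" "?b \<in> carrier R" using sc[OF rc] sc[OF bc] by auto
      have "(\<Oplus>g\<in>G. \<alpha> g [^] q \<otimes> g) = (\<Oplus>g\<in>G. \<beta> g [^] q \<otimes> g \<oplus> x [^] q \<otimes> (\<rho> g [^] q \<otimes> g))"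
        using br(1) bc rc G(2) xc
        by (intro finsum_cong') (auto simp: frobenius_add nat_pow_distrib l_distr r_distr m_ac Pi_iff subset_iff)
      also have "\<dots> = ?b \<oplus> (\<Oplus>g\<in>G. x [^] q \<otimes> (\<rho> g [^] q \<otimes> g))"
        using sc[OF rc] sc[OF bc] xc by (intro finsum_addf) auto
      also have "(\<Oplus>g\<in>G. x [^] q \<otimes> (\<rho> g [^] q \<otimes> g)) = x [^] q \<otimes> ?r"
        using sc[OF rc] xc G(1) by (intro finsum_rdistr[symmetric]) auto
      finally have eq: "(\<Oplus>g\<in>G. \<alpha> g [^] q \<otimes> g) = ?b \<oplus> x [^] q \<otimes> ?r" .
      have "x [^] q \<otimes> ?r = (\<Oplus>g\<in>G. \<alpha> g [^] q \<otimes> g) \<oplus> \<ominus> ?b"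
        unfolding eq using c xc by (simp add: add.m_ac r_neg r_neg1 r_neg2)
      moreover have "(\<Oplus>g\<in>G. \<alpha> g [^] q \<otimes> g) \<oplus> \<ominus> ?b \<in> J T"
        using \<alpha>(3) bJ[of G] G(1) by (intro J.a_closed J.a_inv_closed) auto
      \<comment> \<open>The element x^q can be cancelled modulo \<open>J T\<close>, so the
        \<open>\<rho> g\<close> are again the coefficients of a relation.\<close>
      ultimately have "?r \<in> J T"
        using pow_ideal_primary[OF \<open>T \<subseteq> S\<close> _ xT c(1)] q_pos by (auto simp: Suc_le_eq)
      then have "\<rho> h \<in> A" unfolding A_def using rc by blast
      then have "x \<otimes> \<rho> h \<in> ideal_smult (self_mod R) R m A" using M.ideal_smultI[OF xm] by simp
      moreover have "z = \<beta> h \<oplus> x \<otimes> \<rho> h"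
        using br insert.prems(4) \<alpha>(2) xc m_comm[of x "\<rho> h"] by simp
      ultimately show "\<exists>y\<in>Idl T. \<exists>w\<in>ideal_smult (self_mod R) R m (mspan R (self_mod R) F). z = y \<oplus>\<^bsub>self_mod R\<^esub> w"
        using br(2)[OF insert.prems(4)] F(3) by (auto simp: mspan_self_mod)
    qed (use F P.is_ideal in \<open>auto simp: submodule_self_mod_iff\<close>)
    moreover have "a h \<in> A" unfolding A_def using insert.prems by blast
    ultimately show ?case using F(3) by (auto simp: mspan_self_mod)
  qed
qed

end

section \<open>Localization and projectivity of the Frobenius pushforward\<close>

locale localization = cring R for R :: "('a, 'x) ring_scheme" (structure) +
  fixes S
  assumes S_sub: "S \<subseteq> carrier R" and S_one: "\<one> \<in> S" and S_mult: "\<And>s t. s \<in> S \<Longrightarrow> t \<in> S \<Longrightarrow> s \<otimes> t \<in> S"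
begin

abbreviation "fr \<equiv> frac S (self_mod R)"
abbreviation "L \<equiv> loc_ring R S"

lemma Sc: "s \<in> S \<Longrightarrow> s \<in> carrier R" using S_sub by blast

lemma fr_mem: "(n, t) \<in> fr a s \<longleftrightarrow> n \<in> carrier R \<and> t \<in> S \<and> (\<exists>u\<in>S. u \<otimes> (t \<otimes> a) = u \<otimes> (s \<otimes> n))"
  by (simp add: frac_def)

lemma fr_eq_if:
  assumes "a \<in> carrier R" "b \<in> carrier R" "s \<in> S" "t \<in> S" "u \<in> S" "u \<otimes> (t \<otimes> a) = u \<otimes> (s \<otimes> b)"
  shows "fr a s \<subseteq> fr b t"
proof
  fix x assume x: "x \<in> fr a s"
  obtain n r where nr: "x = (n, r)" by (cases x)
  then obtain v where v: "n \<in> carrier R" "r \<in> S" "v \<in> S" "v \<otimes> (r \<otimes> a) = v \<otimes> (s \<otimes> n)"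
    using x by (auto simp: fr_mem)
  note c = assms(1,2) assms(3-5)[THEN Sc] v(1) v(2,3)[THEN Sc]
  have "(u \<otimes> v \<otimes> s) \<otimes> (r \<otimes> b) = v \<otimes> r \<otimes> (u \<otimes> (s \<otimes> b))" using c by (simp add: m_ac)
  also have "\<dots> = v \<otimes> r \<otimes> (u \<otimes> (t \<otimes> a))" by (simp only: assms(6))
  also have "\<dots> = u \<otimes> t \<otimes> (v \<otimes> (r \<otimes> a))" using c by (simp add: m_ac)
  also have "\<dots> = u \<otimes> t \<otimes> (v \<otimes> (s \<otimes> n))" by (simp only: v(4))
  also have "\<dots> = (u \<otimes> v \<otimes> s) \<otimes> (t \<otimes> n)" using c by (simp add: m_ac)
  finally show "x \<in> fr b t" unfolding nr fr_mem using assms v by (auto intro!: bexI[of _ "u \<otimes> v \<otimes> s"] S_mult)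
qed

lemma fr_eq_iff:
  assumes "a \<in> carrier R" "b \<in> carrier R" "s \<in> S" "t \<in> S"
  shows "fr a s = fr b t \<longleftrightarrow> (\<exists>u\<in>S. u \<otimes> (t \<otimes> a) = u \<otimes> (s \<otimes> b))"
proof
  assume eq: "fr a s = fr b t"
  have "(a, s) \<in> fr a s" using assms S_one by (auto simp: fr_mem)
  then have "\<exists>u\<in>S. u \<otimes> (s \<otimes> b) = u \<otimes> (t \<otimes> a)" unfolding eq by (simp add: fr_mem)
  then show "\<exists>u\<in>S. u \<otimes> (t \<otimes> a) = u \<otimes> (s \<otimes> b)" by metis
next
  assume "\<exists>u\<in>S. u \<otimes> (t \<otimes> a) = u \<otimes> (s \<otimes> b)"
  then obtain u where "u \<in> S" "u \<otimes> (t \<otimes> a) = u \<otimes> (s \<otimes> b)" by blast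
  then show "fr a s = fr b t" using fr_eq_if[of a b s t u] fr_eq_if[of b a t s u] assms by simp
qed

lemma fr_self: "a \<in> carrier R \<Longrightarrow> s \<in> S \<Longrightarrow> (a, s) \<in> fr a s"
  using S_one by (auto simp: fr_mem)

lemma fr_rep: "(b, t) \<in> fr a s \<Longrightarrow> a \<in> carrier R \<Longrightarrow> s \<in> S \<Longrightarrow> b \<in> carrier R \<and> t \<in> S \<and> (\<exists>u\<in>S. u \<otimes> (t \<otimes> a) = u \<otimes> (s \<otimes> b))"
  by (auto simp: fr_mem)

text \<open>The operations of \<open>loc_ring\<close> are unions over all representatives, so
  well-definedness means that such a union is taken over a constant family.\<close>

lemma union_const:
  assumes "(a, s) \<in> A" "(b, t) \<in> B" "\<And>a s b t. (a, s) \<in> A \<Longrightarrow> (b, t) \<in> B \<Longrightarrow> f a s b t = C"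
  shows "(\<Union>(a, s)\<in>A. \<Union>(b, t)\<in>B. f a s b t) = (C :: 'z set)"
proof (rule equalityI)
  show "(\<Union>(a, s)\<in>A. \<Union>(b, t)\<in>B. f a s b t) \<subseteq> C" using assms(3) by blast
  show "C \<subseteq> (\<Union>(a, s)\<in>A. \<Union>(b, t)\<in>B. f a s b t)" using assms by blast
qed

lemma L_mult:
  assumes "a \<in> carrier R" "b \<in> carrier R" "s \<in> S" "t \<in> S"
  shows "fr a s \<otimes>\<^bsub>L\<^esub> fr b t = fr (a \<otimes> b) (s \<otimes> t)"
proof -
  have "fr (a' \<otimes> b') (s' \<otimes> t') = fr (a \<otimes> b) (s \<otimes> t)" if 1: "(a', s') \<in> fr a s" and 2: "(b', t') \<in> fr b t" for a' s' b' t'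
  proof -
    obtain u where u: "a' \<in> carrier R" "s' \<in> S" "u \<in> S" "u \<otimes> (s' \<otimes> a) = u \<otimes> (s \<otimes> a')" using fr_rep[OF 1] assms by blast
    obtain v where v: "b' \<in> carrier R" "t' \<in> S" "v \<in> S" "v \<otimes> (t' \<otimes> b) = v \<otimes> (t \<otimes> b')" using fr_rep[OF 2] assms by blast
    note c = assms(1,2) assms(3,4)[THEN Sc] u(1) u(2,3)[THEN Sc] v(1) v(2,3)[THEN Sc]
    have "(u \<otimes> v) \<otimes> ((s' \<otimes> t') \<otimes> (a \<otimes> b)) = (u \<otimes> (s' \<otimes> a)) \<otimes> (v \<otimes> (t' \<otimes> b))" using c by (simp add: m_ac)
    also have "\<dots> = (u \<otimes> v) \<otimes> ((s \<otimes> t) \<otimes> (a' \<otimes> b'))" unfolding u(4) v(4) using c by (simp add: m_ac)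
    finally show ?thesis using c u v assms S_mult by (intro fr_eq_iff[THEN iffD2] bexI[of _ "u \<otimes> v"]) auto
  qed
  note * = union_const[OF fr_self[OF assms(1,3)] fr_self[OF assms(2,4)], of "\<lambda>a' s' b' t'. fr (a' \<otimes> b') (s' \<otimes> t')", OF this]
  have "fr a s \<otimes>\<^bsub>L\<^esub> fr b t = (\<Union>(a', s')\<in>fr a s. \<Union>(b', t')\<in>fr b t. fr (a' \<otimes> b') (s' \<otimes> t'))"
    by (simp add: loc_ring_def)
  then show ?thesis using * by simp
qed

lemma L_add:
  assumes "a \<in> carrier R" "b \<in> carrier R" "s \<in> S" "t \<in> S"
  shows "fr a s \<oplus>\<^bsub>L\<^esub> fr b t = fr ((t \<otimes> a) \<oplus> (s \<otimes> b)) (s \<otimes> t)"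
proof -
  have "fr ((t' \<otimes> a') \<oplus> (s' \<otimes> b')) (s' \<otimes> t') = fr ((t \<otimes> a) \<oplus> (s \<otimes> b)) (s \<otimes> t)"
    if 1: "(a', s') \<in> fr a s" and 2: "(b', t') \<in> fr b t" for a' s' b' t'
  proof -
    obtain u where u: "a' \<in> carrier R" "s' \<in> S" "u \<in> S" "u \<otimes> (s' \<otimes> a) = u \<otimes> (s \<otimes> a')" using fr_rep[OF 1] assms by blast
    obtain v where v: "b' \<in> carrier R" "t' \<in> S" "v \<in> S" "v \<otimes> (t' \<otimes> b) = v \<otimes> (t \<otimes> b')" using fr_rep[OF 2] assms by blast
    note c = assms(1,2) assms(3,4)[THEN Sc] u(1) u(2,3)[THEN Sc] v(1) v(2,3)[THEN Sc]
    have "(u \<otimes> v) \<otimes> ((s' \<otimes> t') \<otimes> ((t \<otimes> a) \<oplus> (s \<otimes> b))) =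
        v \<otimes> t' \<otimes> t \<otimes> (u \<otimes> (s' \<otimes> a)) \<oplus> u \<otimes> s' \<otimes> s \<otimes> (v \<otimes> (t' \<otimes> b))" using c by (simp add: r_distr m_ac)
    also have "\<dots> = (u \<otimes> v) \<otimes> ((s \<otimes> t) \<otimes> ((t' \<otimes> a') \<oplus> (s' \<otimes> b')))"
      unfolding u(4) v(4) using c by (simp add: r_distr m_ac)
    finally show ?thesis using c u v assms S_mult by (intro fr_eq_iff[THEN iffD2] bexI[of _ "u \<otimes> v"]) auto
  qed
  note * = union_const[OF fr_self[OF assms(1,3)] fr_self[OF assms(2,4)], of "\<lambda>a' s' b' t'. fr ((t' \<otimes> a') \<oplus> (s' \<otimes> b')) (s' \<otimes> t')", OF this]
  have "fr a s \<oplus>\<^bsub>L\<^esub> fr b t = (\<Union>(a', s')\<in>fr a s. \<Union>(b', t')\<in>fr b t. fr ((t' \<otimes> a') \<oplus> (s' \<otimes> b')) (s' \<otimes> t'))"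
    by (simp add: loc_ring_def)
  then show ?thesis using * by simp
qed

lemma L_carrier: "X \<in> carrier L \<longleftrightarrow> (\<exists>a s. a \<in> carrier R \<and> s \<in> S \<and> X = fr a s)"
  by (auto simp: loc_ring_def)

lemma L_one: "\<one>\<^bsub>L\<^esub> = fr \<one> \<one>" and L_zero: "\<zero>\<^bsub>L\<^esub> = fr \<zero> \<one>"
  by (simp_all add: loc_ring_def)

lemma fr_closed: "a \<in> carrier R \<Longrightarrow> s \<in> S \<Longrightarrow> fr a s \<in> carrier L"
  by (auto simp: L_carrier)

definition \<phi> where "\<phi> a = fr a \<one>"

lemma phi_hom: "\<phi> \<in> ring_hom R L"
  unfolding \<phi>_def by (rule ring_hom_memI) (use S_one in \<open>auto simp: fr_closed L_mult L_add L_one\<close>)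

lemma phi_eq_iff: "a \<in> carrier R \<Longrightarrow> b \<in> carrier R \<Longrightarrow> \<phi> a = \<phi> b \<longleftrightarrow> (\<exists>u\<in>S. u \<otimes> a = u \<otimes> b)"
  unfolding \<phi>_def using S_one by (simp add: fr_eq_iff)

lemma fr_cancel:
  assumes "a \<in> carrier R" "s \<in> S" "t \<in> S" shows "fr (t \<otimes> a) (t \<otimes> s) = fr a s"
  using assms Sc S_mult S_one by (intro fr_eq_iff[THEN iffD2] bexI[of _ \<one>]) (auto simp: m_ac)

lemma fr_pow:
  assumes "a \<in> carrier R" "s \<in> S" shows "fr a s [^]\<^bsub>L\<^esub> (n::nat) = fr (a [^] n) (s [^] n)" "s [^] n \<in> S"
proof -
  have *: "s [^] n \<in> S" for n :: nat by (induct n) (use assms S_one S_mult in auto)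
  show "s [^] n \<in> S" by (rule *)
  have "x [^]\<^bsub>L\<^esub> (0::nat) = \<one>\<^bsub>L\<^esub>" "x [^]\<^bsub>L\<^esub> Suc k = x [^]\<^bsub>L\<^esub> k \<otimes>\<^bsub>L\<^esub> x" for x k
    by (simp_all add: nat_pow_def)
  then show "fr a s [^]\<^bsub>L\<^esub> n = fr (a [^] n) (s [^] n)"
    by (induct n) (use assms * in \<open>auto simp: L_one L_mult\<close>)
qed

end

lemma (in cring) prime_localization:
  assumes P: "primeideal P R" shows "localization R (carrier R - P)"
proof unfold_locales
  show "\<one> \<in> carrier R - P" using prime_one_notin[OF P] by simp
  show "s \<otimes> t \<in> carrier R - P" if "s \<in> carrier R - P" "t \<in> carrier R - P" for s t
    using that primeideal.I_prime[OF P] by auto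
qed auto

lemma ring_hom_add_pow:
  fixes n :: nat
  assumes "cring A" "cring B" "h \<in> ring_hom A B" "x \<in> carrier A"
  shows "h (add_pow A n x) = add_pow B n (h x)"
proof -
  interpret A: cring A by fact
  interpret B: cring B by fact
  interpret h: ring_hom_ring A B h
    by (intro ring_hom_ringI2 A.ring_axioms B.ring_axioms assms(3))
  show ?thesis by (induct n) (use assms(4) in auto)
qed

lemma ring_hom_char:
  assumes "cring A" "cring B" "h \<in> ring_hom A B" "has_prime_char A p"
  shows "has_prime_char B p"
proof -
  interpret A: cring A by fact
  interpret B: cring B by fact
  interpret h: ring_hom_ring A B h
    by (intro ring_hom_ringI2 A.ring_axioms B.ring_axioms assms(3))
  show ?thesis
    using assms(4) ring_hom_add_pow[OF assms(1-3), of "\<one>\<^bsub>A\<^esub>" p] unfolding has_prime_char_def by simp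
qed

text \<open>Krull dimension is a supremum in \<open>enat\<close>. That a finite supremum is a
  maximum provides the chain \<open>c0\<close> of full length.\<close>

lemma Sup_enat_attained:
  assumes "Sup A = enat d" "A \<noteq> {}" shows "enat d \<in> A"
proof -
  have "finite A" using assms by (auto simp: Sup_enat_def split: if_splits)
  then show ?thesis using assms Max_in[of A] by (auto simp: Sup_enat_def)
qed

lemma regular_local_locale:
  fixes A :: "('a, 'x) ring_scheme"
  assumes "regular_local_ring A" "has_prime_char A p"
  shows "\<exists>m S c0. regular_local_char A m S c0 p"
proof -
  interpret A: cring A using assms(1) unfolding regular_local_ring_def by blast
  obtain m where m: "maximalideal m A" "\<And>I. maximalideal I A \<Longrightarrow> I = m"
    using assms(1) unfolding regular_local_ring_def by blast
  have no: "noetherian_ring A" using assms(1) unfolding regular_local_ring_def by blast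
  obtain S where S: "finite S" "S \<subseteq> carrier A" "maximalideal (genideal A S) A" "enat (card S) = krull_dim A"
    using assms(1) unfolding regular_local_ring_def by blast
  let ?D = "{enat n | n. \<exists>c. A.prime_chain c n}"
  have kd: "Sup ?D = enat (card S)" unfolding S(4) krull_dim_def A.prime_chain_def ..
  have "A.prime_chain (\<lambda>_. m) 0" unfolding A.prime_chain_def using A.maximalideal_prime[OF m(1)] by simp
  then have "?D \<noteq> {}" by blast
  then have "enat (card S) \<in> ?D" by (rule Sup_enat_attained[OF kd])
  then obtain c0 where c0: "A.prime_chain c0 (card S)" by auto
  have dim: "l \<le> card S" if "A.prime_chain c l" for c l
  proof -
    have "enat l \<in> ?D" using that by blast
    then have "enat l \<le> Sup ?D" by (rule Sup_upper)
    then show ?thesis unfolding kd by simp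
  qed
  have "local_noeth A m" by (intro local_noeth.intro local_noeth_axioms.intro A.is_cring no m)
  then have "regular_local A m S c0"
    by (intro regular_local.intro regular_local_axioms.intro) (use S m(2)[OF S(3)] c0 dim in auto)
  moreover have "cring_char A p" by unfold_locales (rule assms(2))
  ultimately show ?thesis by (blast intro: regular_local_char.intro)
qed

text \<open>A \<open>q\<close>-th-power-valued \<open>R\<^sup>q\<close>-linear operator on a reduced ring is an \<open>R\<close>-linear form on \<open>F\<^sup>e\<^sub>*R\<close> (followed by the
  \<open>q\<close>-th power). So \<open>dual_op q R \<tau>\<close> says that \<open>\<tau>\<close> is a finite sum \<open>\<Sum> \<delta>\<^sub>j(-) g\<^sub>j\<close> of forms times elements, and
  \<open>F\<^sup>e\<^sub>*R\<close> has a finite dual basis, i.e. is projective, once the identity is of this shape.\<close>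

definition good_op :: "nat \<Rightarrow> ('a, 'x) ring_scheme \<Rightarrow> ('a \<Rightarrow> 'a) \<Rightarrow> bool" where
  "good_op q R \<delta> \<longleftrightarrow> (\<forall>x\<in>carrier R. \<exists>r\<in>carrier R. \<delta> x = r [^]\<^bsub>R\<^esub> q) \<and>
     (\<forall>x\<in>carrier R. \<forall>y\<in>carrier R. \<delta> (x \<oplus>\<^bsub>R\<^esub> y) = \<delta> x \<oplus>\<^bsub>R\<^esub> \<delta> y) \<and>
     (\<forall>a\<in>carrier R. \<forall>x\<in>carrier R. \<delta> (a [^]\<^bsub>R\<^esub> q \<otimes>\<^bsub>R\<^esub> x) = a [^]\<^bsub>R\<^esub> q \<otimes>\<^bsub>R\<^esub> \<delta> x)"

inductive dual_op :: "nat \<Rightarrow> ('a, 'x) ring_scheme \<Rightarrow> ('a \<Rightarrow> 'a) \<Rightarrow> bool" for q R where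
  zero: "(\<And>x. x \<in> carrier R \<Longrightarrow> \<tau> x = \<zero>\<^bsub>R\<^esub>) \<Longrightarrow> dual_op q R \<tau>"
| add: "dual_op q R \<tau> \<Longrightarrow> good_op q R \<delta> \<Longrightarrow> g \<in> carrier R \<Longrightarrow>
    (\<And>x. x \<in> carrier R \<Longrightarrow> \<tau>' x = \<tau> x \<oplus>\<^bsub>R\<^esub> \<delta> x \<otimes>\<^bsub>R\<^esub> g) \<Longrightarrow> dual_op q R \<tau>'"

context cring
begin

lemma good_op_closed: "good_op q R \<delta> \<Longrightarrow> x \<in> carrier R \<Longrightarrow> \<delta> x \<in> carrier R"
  unfolding good_op_def by (metis nat_pow_closed)

lemma dual_op_closed: "dual_op q R \<tau> \<Longrightarrow> x \<in> carrier R \<Longrightarrow> \<tau> x \<in> carrier R"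
  by (induct rule: dual_op.induct) (auto simp: good_op_closed)

lemma dual_op_sum:
  assumes "dual_op q R \<tau>" "dual_op q R \<sigma>"
  shows "dual_op q R (\<lambda>x. \<tau> x \<oplus> \<sigma> x)"
  using assms(2)
proof (induct rule: dual_op.induct)
  case (zero \<sigma>)
  show ?case using assms(1)
  proof (cases rule: dual_op.cases)
    case zero': zero
    then show ?thesis using zero by (intro dual_op.zero) simp
  next
    case (add \<tau>1 \<delta> g)
    then show ?thesis using zero by (intro dual_op.add[OF add(1-3)]) (auto simp: good_op_closed dual_op_closed)
  qed
next
  case (add \<sigma> \<delta> g \<sigma>')
  show ?case
    using add assms(1) by (intro dual_op.add[OF add(2,3,4)]) (auto simp: good_op_closed dual_op_closed a_assoc)
qed

lemma dual_op_mult: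
  assumes "dual_op q R \<tau>" "c \<in> carrier R"
  shows "dual_op q R (\<lambda>x. c \<otimes> \<tau> x)"
  using assms(1)
proof (induct rule: dual_op.induct)
  case (zero \<sigma>)
  then show ?case using assms(2) by (intro dual_op.zero) auto
next
  case (add \<sigma> \<delta> g \<sigma>')
  show ?case
    by (rule dual_op.add[OF add(2,3), of "c \<otimes> g"])
       (use assms(2) add in \<open>auto simp: good_op_closed dual_op_closed r_distr m_lcomm\<close>)
qed

lemma dual_op_finsum:
  assumes "finite G" "G \<subseteq> carrier R" "\<And>g. g \<in> G \<Longrightarrow> good_op q R (\<delta> g)"
  shows "dual_op q R (\<lambda>x. \<Oplus>g\<in>G. \<delta> g x \<otimes> g)"
  using assms
proof (induct G)
  case empty
  show ?case by (rule dual_op.zero) simp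
next
  case (insert g G)
  show ?case
  proof (rule dual_op.add[of q R "\<lambda>x. \<Oplus>g\<in>G. \<delta> g x \<otimes> g" "\<delta> g" g])
    show "(\<Oplus>h\<in>insert g G. \<delta> h x \<otimes> h) = (\<Oplus>h\<in>G. \<delta> h x \<otimes> h) \<oplus> \<delta> g x \<otimes> g" if "x \<in> carrier R" for x
    proof -
      have cl: "\<delta> h x \<otimes> h \<in> carrier R" if "h \<in> insert g G" for h
        using good_op_closed[OF insert.prems(2)[OF that] \<open>x \<in> carrier R\<close>] insert.prems(1) that by auto
      then have "(\<Oplus>h\<in>insert g G. \<delta> h x \<otimes> h) = \<delta> g x \<otimes> g \<oplus> (\<Oplus>h\<in>G. \<delta> h x \<otimes> h)"
        using insert.hyps by (intro finsum_insert) auto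
      then show ?thesis using cl by (simp add: a_comm Pi_def)
    qed
  qed (use insert in auto)
qed

end

context cring_char
begin

lemma mspan_frob_finsum:
  assumes "finite G" "G \<subseteq> carrier R" "x \<in> mspan R (frob p e R (self_mod R)) G"
  shows "\<exists>\<alpha>\<in>G \<rightarrow> carrier R. x = (\<Oplus>g\<in>G. \<alpha> g [^] (p ^ e) \<otimes> g)"
  using assms
proof (induct G arbitrary: x)
  interpret N: module R "frob p e R (self_mod R)" by (rule module_frob_self)
  case empty
  then show ?case using N.mspan_empty by auto
next
  interpret N: module R "frob p e R (self_mod R)" by (rule module_frob_self)
  case (insert g G)
  have gG: "g \<in> carrier R" "G \<subseteq> carrier R" using insert by auto
  obtain y a where ya: "x = y \<oplus> a [^] (p ^ e) \<otimes> g" "y \<in> mspan R (frob p e R (self_mod R)) G" "a \<in> carrier R"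
    using insert.prems(2) N.mspan_insert[of G g] gG by auto
  obtain \<alpha> where \<alpha>: "\<alpha> \<in> G \<rightarrow> carrier R" "y = (\<Oplus>g\<in>G. \<alpha> g [^] (p ^ e) \<otimes> g)"
    using insert.hyps(3)[OF gG(2) ya(2)] by blast
  let ?\<beta> = "\<alpha>(g := a)"
  have c: "(\<lambda>h. \<alpha> h [^] (p ^ e) \<otimes> h) \<in> G \<rightarrow> carrier R" using \<alpha> gG by auto
  have eq: "(\<Oplus>h\<in>G. ?\<beta> h [^] (p ^ e) \<otimes> h) = y"
    unfolding \<alpha>(2) using c insert.hyps(2) by (intro finsum_cong') auto
  have "(\<Oplus>h\<in>insert g G. ?\<beta> h [^] (p ^ e) \<otimes> h) = ?\<beta> g [^] (p ^ e) \<otimes> g \<oplus> (\<Oplus>h\<in>G. ?\<beta> h [^] (p ^ e) \<otimes> h)"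
    using insert.hyps ya(3) gG \<alpha>(1) by (intro finsum_insert) (auto simp: Pi_iff subset_iff)
  also have "\<dots> = x" unfolding eq using ya \<alpha>(2) c gG by (simp add: a_comm)
  finally show ?case using \<alpha>(1) ya(3) by (intro bexI[of _ ?\<beta>]) auto
qed

end

lemma minimal_generating_subset:
  assumes "finite G" "P G" shows "\<exists>G0\<subseteq>G. P G0 \<and> (\<forall>G'\<subset>G0. \<not> P G')"
proof -
  let ?A = "{X. X \<subseteq> G \<and> P X}"
  have "finite ?A" "?A \<noteq> {}" using assms by auto
  then obtain G0 where "G0 \<in> ?A" "\<And>X. X \<in> ?A \<Longrightarrow> X \<subseteq> G0 \<Longrightarrow> X = G0"
    using finite_has_minimal[of ?A] by (metis (no_types, lifting))
  then show ?thesis by blast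
qed

section \<open>Dual bases, first at a prime and then globally\<close>

context cring_char
begin

text \<open>Over the local ring at P a minimal generating set of the pushforward is a basis.
  Clearing denominators turns its coordinate functions into forms over R, at the price of a factor c
  outside P. It appears as c^q because scalars act through q-th powers.\<close>

lemma local_dual_op:
  assumes no: "noetherian_ring R" and P: "primeideal P R"
    and reg: "regular_local_ring (loc_ring R (carrier R - P))"
    and G: "finite G" "G \<subseteq> carrier R" "carrier R \<subseteq> mspan R (frob p e R (self_mod R)) G"
  shows "\<exists>c\<in>carrier R - P. \<exists>\<tau>. dual_op (p ^ e) R \<tau> \<and> (\<forall>x\<in>carrier R. \<tau> x = c [^] (p ^ e) \<otimes> x)"
proof -
  interpret loc: localization R "carrier R - P" by (rule prime_localization[OF P])
  let ?q = "p ^ e" and ?N = "frob p e R (self_mod R)"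
  interpret N: module R ?N by (rule module_frob_self)
  interpret M: module R "self_mod R" by (rule module_self_mod)
  have crL: "cring loc.L" using reg unfolding regular_local_ring_def by blast
  interpret L: cring loc.L by (rule crL)
  have charL: "has_prime_char loc.L p" by (rule ring_hom_char[OF is_cring crL loc.phi_hom char])
  obtain m S c0 where "regular_local_char loc.L m S c0 p" using regular_local_locale[OF reg charL] by blast
  then interpret A: regular_local_char loc.L m S c0 p e .
  interpret phi: ring_hom_cring R loc.L loc.\<phi>
    by (intro ring_hom_cringI is_cring crL loc.phi_hom)
  have phi_pow: "loc.\<phi> (x [^] (n::nat)) = loc.\<phi> x [^]\<^bsub>loc.L\<^esub> n" if "x \<in> carrier R" for x n
    using that by simp
  obtain q' where q': "?q = Suc q'" using q_pos[of e] by (cases ?q) auto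
  have spanL: "carrier loc.L \<subseteq> mspan loc.L A.N (loc.\<phi> ` G)"
  proof
    have GL: "loc.\<phi> ` G \<subseteq> carrier A.N" using G(2) by auto
    have sp: "submodule (mspan loc.L A.N (loc.\<phi> ` G)) loc.L A.N" by (rule A.N.mspan_submodule[OF GL])
    note sp' = A.N.submoduleE[OF sp] A.N.submodule_zero[OF sp]
    have pre: "submodule {r \<in> carrier R. loc.\<phi> r \<in> mspan loc.L A.N (loc.\<phi> ` G)} R ?N"
    proof (rule N.submoduleI')
      show "a \<odot>\<^bsub>?N\<^esub> x \<in> {r \<in> carrier R. loc.\<phi> r \<in> mspan loc.L A.N (loc.\<phi> ` G)}"
        if "a \<in> carrier R" "x \<in> {r \<in> carrier R. loc.\<phi> r \<in> mspan loc.L A.N (loc.\<phi> ` G)}" for a x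
        using that sp'(4)[of "loc.\<phi> a" "loc.\<phi> x"] by simp
      show "a \<oplus>\<^bsub>?N\<^esub> x \<in> {r \<in> carrier R. loc.\<phi> r \<in> mspan loc.L A.N (loc.\<phi> ` G)}"
        if "a \<in> {r \<in> carrier R. loc.\<phi> r \<in> mspan loc.L A.N (loc.\<phi> ` G)}"
          "x \<in> {r \<in> carrier R. loc.\<phi> r \<in> mspan loc.L A.N (loc.\<phi> ` G)}" for a x
        using that sp'(5)[of "loc.\<phi> a" "loc.\<phi> x"] by simp
    qed (use sp'(7) in auto)
    have "mspan R ?N G \<subseteq> {r \<in> carrier R. loc.\<phi> r \<in> mspan loc.L A.N (loc.\<phi> ` G)}"
      by (rule N.mspan_minimal[OF pre]) (use G(2) A.N.mspan_incl in blast)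
    then have im: "loc.\<phi> r \<in> mspan loc.L A.N (loc.\<phi> ` G)" if "r \<in> carrier R" for r using G(3) that by blast
    fix X assume "X \<in> carrier loc.L"
    then obtain a s where as: "X = loc.fr a s" "a \<in> carrier R" "s \<in> carrier R - P" using loc.L_carrier by auto
    have sc: "s \<in> carrier R" using as by simp
    \<comment> \<open>As a/s = (1/s)^q s^(q-1) a, coefficients that are q-th powers of fractions
      suffice.\<close>
    have "X = loc.fr (s [^] q' \<otimes> a) (s [^] q' \<otimes> s)"
      unfolding as(1) using loc.fr_cancel[OF as(2,3), of "s [^] q'"] loc.fr_pow(2)[OF as(2,3)] by simp
    also have "s [^] q' \<otimes> s = s [^] ?q" unfolding q' by simp
    also have "loc.fr (s [^] q' \<otimes> a) (s [^] ?q) = loc.fr (\<one> [^] ?q) (s [^] ?q) \<otimes>\<^bsub>loc.L\<^esub> loc.\<phi> (s [^] q' \<otimes> a)"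
      unfolding loc.\<phi>_def using loc.L_mult[of \<one> "s [^] q' \<otimes> a" "s [^] ?q" \<one>] loc.fr_pow(2)[OF as(2,3)] sc as(2) loc.S_one
      by simp
    also have "\<dots> = loc.fr \<one> s \<odot>\<^bsub>A.N\<^esub> loc.\<phi> (s [^] q' \<otimes> a)"
      using loc.fr_pow(1)[OF one_closed as(3), of ?q] by simp
    finally have "X = loc.fr \<one> s \<odot>\<^bsub>A.N\<^esub> loc.\<phi> (s [^] q' \<otimes> a)" .
    moreover have "loc.fr \<one> s \<in> carrier loc.L" using loc.fr_closed as(3) by simp
    moreover have "loc.\<phi> (s [^] q' \<otimes> a) \<in> mspan loc.L A.N (loc.\<phi> ` G)" by (rule im) (use sc as(2) in simp)
    ultimately show "X \<in> mspan loc.L A.N (loc.\<phi> ` G)" using sp'(4) by simp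
  qed
  \<comment> \<open>Minimality is imposed on subsets of G rather than on their images. This makes
    \<open>loc.\<phi>\<close> injective on \<open>G0\<close>, so that sums over \<open>G0\<close>
    can be compared with sums over its image.\<close>
  obtain G0 where G0: "G0 \<subseteq> G" "carrier loc.L \<subseteq> mspan loc.L A.N (loc.\<phi> ` G0)"
    "\<And>G'. G' \<subset> G0 \<Longrightarrow> \<not> carrier loc.L \<subseteq> mspan loc.L A.N (loc.\<phi> ` G')"
    using minimal_generating_subset[where P = "\<lambda>G. carrier loc.L \<subseteq> mspan loc.L A.N (loc.\<phi> ` G)", OF G(1) spanL] by blast
  have fin0: "finite G0" using G0(1) G(1) finite_subset by blast
  have G0R: "G0 \<subseteq> carrier R" using G0(1) G(2) by blast
  have inj: "inj_on loc.\<phi> G0"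
  proof (rule inj_onI, rule ccontr)
    fix g h assume gh: "g \<in> G0" "h \<in> G0" "loc.\<phi> g = loc.\<phi> h" "g \<noteq> h"
    then have "loc.\<phi> ` (G0 - {h}) = loc.\<phi> ` G0" by (auto simp: image_iff)
    moreover have "G0 - {h} \<subset> G0" using gh by blast
    ultimately show False using G0(3)[of "G0 - {h}"] G0(2) by simp
  qed
  have min: "\<not> carrier loc.L \<subseteq> mspan loc.L A.N (loc.\<phi> ` G0 - {g})" if "g \<in> loc.\<phi> ` G0" for g
  proof -
    from that obtain h where h: "h \<in> G0" "g = loc.\<phi> h" by blast
    have "loc.\<phi> ` G0 - {g} = loc.\<phi> ` (G0 - {h})" using inj h by (auto simp: inj_on_def)
    moreover have "G0 - {h} \<subset> G0" using h by blast
    ultimately show ?thesis using G0(3)[of "G0 - {h}"] by simp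
  qed
  have free: "\<exists>t\<in>carrier R - P. t \<otimes> \<alpha> h = \<zero>"
    if \<alpha>: "\<alpha> \<in> G0 \<rightarrow> carrier R" "(\<Oplus>g\<in>G0. \<alpha> g [^] ?q \<otimes> g) = \<zero>" and h: "h \<in> G0" for \<alpha> h
  proof -
    define \<beta> where "\<beta> y = loc.\<phi> (\<alpha> (the_inv_into G0 loc.\<phi> y))" for y
    have b: "\<beta> (loc.\<phi> g) = loc.\<phi> (\<alpha> g)" if "g \<in> G0" for g
      unfolding \<beta>_def using the_inv_into_f_f[OF inj that] by simp
    have bc: "\<beta> \<in> loc.\<phi> ` G0 \<rightarrow> carrier loc.L" using b \<alpha>(1) by (auto intro!: phi.hom_closed simp: Pi_iff)
    have c: "(\<lambda>g. \<alpha> g [^] ?q \<otimes> g) \<in> G0 \<rightarrow> carrier R" using \<alpha> G0R by auto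
    have "(\<Oplus>\<^bsub>loc.L\<^esub>y\<in>loc.\<phi> ` G0. \<beta> y [^]\<^bsub>loc.L\<^esub> ?q \<otimes>\<^bsub>loc.L\<^esub> y) =
        (\<Oplus>\<^bsub>loc.L\<^esub>g\<in>G0. \<beta> (loc.\<phi> g) [^]\<^bsub>loc.L\<^esub> ?q \<otimes>\<^bsub>loc.L\<^esub> loc.\<phi> g)"
      using bc G0R by (intro L.finsum_reindex[OF _ inj]) auto
    also have "\<dots> = (\<Oplus>\<^bsub>loc.L\<^esub>g\<in>G0. loc.\<phi> (\<alpha> g [^] ?q \<otimes> g))"
      using b \<alpha>(1) G0R by (intro L.finsum_cong') (auto simp: Pi_iff subset_iff)
    also have "\<dots> = loc.\<phi> (\<Oplus>g\<in>G0. \<alpha> g [^] ?q \<otimes> g)"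
      using phi.hom_finsum[OF c] by (simp add: comp_def)
    also have "\<dots> = \<zero>\<^bsub>loc.L\<^esub>" unfolding \<alpha>(2) by simp
    finally have "(\<Oplus>\<^bsub>loc.L\<^esub>y\<in>loc.\<phi> ` G0. \<beta> y [^]\<^bsub>loc.L\<^esub> ?q \<otimes>\<^bsub>loc.L\<^esub> y) = \<zero>\<^bsub>loc.L\<^esub>" .
    moreover have "\<zero>\<^bsub>loc.L\<^esub> \<in> A.J {}"
      using ideal.axioms(1)[OF A.pow_ideal_ideal[of "{}"]] by (simp add: additive_subgroup.zero_closed)
    ultimately have "\<beta> (loc.\<phi> h) \<in> genideal loc.L {}"
      using fin0 G0R G0(2) min bc h by (intro A.minimal_generators_free[of "loc.\<phi> ` G0"]) auto
    moreover have "genideal loc.L {} \<subseteq> {\<zero>\<^bsub>loc.L\<^esub>}" by (rule L.genideal_minimal[OF L.zeroideal]) simp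
    ultimately have "loc.\<phi> (\<alpha> h) = loc.\<phi> \<zero>" using b[OF h] by auto
    then show ?thesis using loc.phi_eq_iff[of "\<alpha> h" \<zero>] \<alpha>(1) h by (auto simp: Pi_iff)
  qed
  \<comment> \<open>The kernel of localization. It is finitely generated, so a single t outside P
    kills it, and multiplication by t makes coordinates that are determined only up to K
    unique.\<close>
  define K where "K = {a \<in> carrier R. loc.\<phi> a = loc.\<phi> \<zero>}"
  have "submodule K R (self_mod R)" unfolding K_def by (rule M.submoduleI') auto
  then have "ideal K R" by (simp add: submodule_self_mod_iff)
  from finite_ideal_generators[OF no this]
  obtain F where F: "finite F" "F \<subseteq> carrier R" "F \<subseteq> K" "K = Idl F" by blast
  have "\<exists>t\<in>carrier R - P. \<forall>x\<in>mspan R (self_mod R) F. t \<odot>\<^bsub>self_mod R\<^esub> x \<in> {\<zero>}"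
  proof (rule M.common_multiplier[OF P])
    show "submodule {\<zero>} R (self_mod R)" using zeroideal by (simp add: submodule_self_mod_iff)
    fix x assume "x \<in> F"
    then have "x \<in> carrier R" "loc.\<phi> x = loc.\<phi> \<zero>" using F(3) unfolding K_def by auto
    then show "\<exists>t\<in>carrier R - P. t \<odot>\<^bsub>self_mod R\<^esub> x \<in> {\<zero>}" using loc.phi_eq_iff[of x \<zero>] by auto
  qed (use F in auto)
  then obtain t where t: "t \<in> carrier R - P" "\<And>a. a \<in> carrier R \<Longrightarrow> loc.\<phi> a = loc.\<phi> \<zero> \<Longrightarrow> t \<otimes> a = \<zero>"
    using F(4)[symmetric] by (auto simp: mspan_self_mod K_def)
  have G0N: "G0 \<subseteq> carrier ?N" using G0R by simp
  have sp0: "submodule (mspan R ?N G0) R ?N" by (rule N.mspan_submodule[OF G0N])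
  note sp0' = N.submoduleE[OF sp0] N.submodule_zero[OF sp0]
  have "\<exists>c\<in>carrier R - P. c \<odot>\<^bsub>?N\<^esub> x \<in> mspan R ?N G0" if x: "x \<in> carrier R" for x
  proof -
    \<comment> \<open>Combinations of \<open>G0\<close> divided by q-th powers. They form a
      submodule of the localized pushforward that contains the image of \<open>G0\<close>, hence all
      of it.\<close>
    define D where "D = {X. \<exists>r\<in>mspan R ?N G0. \<exists>s\<in>carrier R - P. X = loc.fr r (s [^] ?q)}"
    have rc: "r \<in> carrier R" if "r \<in> mspan R ?N G0" for r using that sp0'(1) by auto
    have sq: "s [^] ?q \<in> carrier R - P" if "s \<in> carrier R - P" for s using loc.fr_pow(2)[OF one_closed that] .
    have sm: "s [^] ?q \<otimes> r \<in> mspan R ?N G0" if "r \<in> mspan R ?N G0" "s \<in> carrier R" for r s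
      using sp0'(4)[OF that(2,1)] by simp
    have "submodule D loc.L A.N"
    proof (rule A.N.submoduleI')
      show "D \<subseteq> carrier A.N" unfolding D_def using rc sq loc.fr_closed by auto
      have "loc.fr \<zero> \<one> = loc.fr \<zero> (\<one> [^] ?q)" by simp
      moreover have "loc.fr \<zero> (\<one> [^] ?q) \<in> D" unfolding D_def using sp0'(7) loc.S_one by fastforce
      ultimately show "\<zero>\<^bsub>A.N\<^esub> \<in> D" using loc.L_zero by simp
      show "X \<oplus>\<^bsub>A.N\<^esub> Y \<in> D" if "X \<in> D" "Y \<in> D" for X Y
      proof -
        from that obtain r s r' s' where *: "r \<in> mspan R ?N G0" "s \<in> carrier R - P" "X = loc.fr r (s [^] ?q)"
          "r' \<in> mspan R ?N G0" "s' \<in> carrier R - P" "Y = loc.fr r' (s' [^] ?q)" unfolding D_def by blast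
        have "X \<oplus>\<^bsub>loc.L\<^esub> Y = loc.fr (s' [^] ?q \<otimes> r \<oplus> s [^] ?q \<otimes> r') (s [^] ?q \<otimes> s' [^] ?q)"
          unfolding *(3,6) using rc sq * by (intro loc.L_add) auto
        also have "s [^] ?q \<otimes> s' [^] ?q = (s \<otimes> s') [^] ?q" using * by (simp add: nat_pow_distrib)
        finally have "X \<oplus>\<^bsub>loc.L\<^esub> Y = loc.fr (s' [^] ?q \<otimes> r \<oplus> s [^] ?q \<otimes> r') ((s \<otimes> s') [^] ?q)" .
        moreover have "s' [^] ?q \<otimes> r \<oplus> s [^] ?q \<otimes> r' \<in> mspan R ?N G0"
          using sp0'(5)[OF sm[OF *(1), of s'] sm[OF *(4), of s]] * by simp
        moreover have "s \<otimes> s' \<in> carrier R - P" using loc.S_mult * by blast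
        ultimately show ?thesis unfolding D_def by auto
      qed
      show "Z \<odot>\<^bsub>A.N\<^esub> X \<in> D" if ZX: "Z \<in> carrier loc.L" "X \<in> D" for Z X
      proof -
        from ZX obtain r s where *: "r \<in> mspan R ?N G0" "s \<in> carrier R - P" "X = loc.fr r (s [^] ?q)"
          unfolding D_def by blast
        obtain a b where ab: "Z = loc.fr a b" "a \<in> carrier R" "b \<in> carrier R - P"
          using ZX(1) unfolding loc.L_carrier by blast
        have "Z \<odot>\<^bsub>A.N\<^esub> X = loc.fr (a [^] ?q) (b [^] ?q) \<otimes>\<^bsub>loc.L\<^esub> loc.fr r (s [^] ?q)"
          unfolding *(3) ab(1) using loc.fr_pow(1)[OF ab(2,3), of ?q] by simp
        also have "\<dots> = loc.fr (a [^] ?q \<otimes> r) (b [^] ?q \<otimes> s [^] ?q)"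
          using ab * rc sq by (intro loc.L_mult) auto
        also have "b [^] ?q \<otimes> s [^] ?q = (b \<otimes> s) [^] ?q" using ab * by (simp add: nat_pow_distrib)
        finally show ?thesis unfolding D_def using sm[OF *(1) ab(2)] loc.S_mult[OF ab(3) *(2)] by blast
      qed
    qed
    then have "mspan loc.L A.N (loc.\<phi> ` G0) \<subseteq> D"
    proof (rule A.N.mspan_minimal)
      show "loc.\<phi> ` G0 \<subseteq> D"
      proof safe
        fix g assume "g \<in> G0"
        moreover have "loc.\<phi> g = loc.fr g (\<one> [^] ?q)" unfolding loc.\<phi>_def by simp
        ultimately show "loc.\<phi> g \<in> D" unfolding D_def using N.mspan_superset[of g G0] loc.S_one by blast
      qed
    qed
    then have "loc.\<phi> x \<in> D" using G0(2) x by auto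
    then obtain r s where rs: "r \<in> mspan R ?N G0" "s \<in> carrier R - P" "loc.fr x \<one> = loc.fr r (s [^] ?q)"
      unfolding D_def loc.\<phi>_def by blast
    then obtain u where u: "u \<in> carrier R - P" "u \<otimes> (s [^] ?q \<otimes> x) = u \<otimes> (\<one> \<otimes> r)"
      using loc.fr_eq_iff[of x r \<one> "s [^] ?q"] x rc sq loc.S_one by blast
    have c: "u \<in> carrier R" "s \<in> carrier R" "r \<in> carrier R" using u rs rc by auto
    have "(u \<otimes> s) [^] ?q \<otimes> x = u [^] q' \<otimes> (u \<otimes> (s [^] ?q \<otimes> x))"
      using c x unfolding nat_pow_distrib[OF c(1,2)] by (simp add: q' m_ac)
    also have "\<dots> = u [^] ?q \<otimes> r" unfolding u(2) using c by (simp add: q' m_ac)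
    finally have "(u \<otimes> s) [^] ?q \<otimes> x = u [^] ?q \<otimes> r" .
    then have "(u \<otimes> s) \<odot>\<^bsub>?N\<^esub> x \<in> mspan R ?N G0" using sm[OF rs(1) c(1)] by simp
    then show ?thesis using loc.S_mult[OF u(1) rs(2)] by blast
  qed
  then have "\<exists>c\<in>carrier R - P. \<forall>x\<in>mspan R ?N G. c \<odot>\<^bsub>?N\<^esub> x \<in> mspan R ?N G0"
    using G by (intro N.common_multiplier[OF P sp0]) auto
  then obtain c where c: "c \<in> carrier R" "c \<notin> P" "\<And>x. x \<in> carrier R \<Longrightarrow> c [^] ?q \<otimes> x \<in> mspan R ?N G0"
    using G(3) by auto
  have ex: "\<forall>x\<in>carrier R. \<exists>\<alpha>. \<alpha> \<in> G0 \<rightarrow> carrier R \<and> c [^] ?q \<otimes> x = (\<Oplus>g\<in>G0. \<alpha> g [^] ?q \<otimes> g)"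
    using mspan_frob_finsum[OF fin0 G0R c(3)] by blast
  obtain \<alpha> where "\<forall>x\<in>carrier R. \<alpha> x \<in> G0 \<rightarrow> carrier R \<and> c [^] ?q \<otimes> x = (\<Oplus>g\<in>G0. \<alpha> x g [^] ?q \<otimes> g)"
    using bchoice[OF ex] by (elim exE)
  then have \<alpha>: "\<And>x. x \<in> carrier R \<Longrightarrow> \<alpha> x \<in> G0 \<rightarrow> carrier R"
    "\<And>x. x \<in> carrier R \<Longrightarrow> c [^] ?q \<otimes> x = (\<Oplus>g\<in>G0. \<alpha> x g [^] ?q \<otimes> g)" by blast+
  have tc: "t \<in> carrier R" using t by simp
  have uniq: "t \<otimes> \<beta> g = t \<otimes> \<gamma> g"
    if bg: "\<beta> \<in> G0 \<rightarrow> carrier R" "\<gamma> \<in> G0 \<rightarrow> carrier R" "g \<in> G0"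
      "(\<Oplus>g\<in>G0. \<beta> g [^] ?q \<otimes> g) = (\<Oplus>g\<in>G0. \<gamma> g [^] ?q \<otimes> g)" for \<beta> \<gamma> g
  proof -
    have cb: "(\<lambda>g. \<beta> g [^] ?q \<otimes> g) \<in> G0 \<rightarrow> carrier R" "(\<lambda>g. \<gamma> g [^] ?q \<otimes> g) \<in> G0 \<rightarrow> carrier R"
      "(\<lambda>g. (\<beta> g \<ominus> \<gamma> g) [^] ?q \<otimes> g) \<in> G0 \<rightarrow> carrier R"
      using bg(1,2) G0R by (auto simp: Pi_iff subset_iff)
    have "(\<Oplus>g\<in>G0. \<beta> g [^] ?q \<otimes> g) = (\<Oplus>g\<in>G0. (\<beta> g \<ominus> \<gamma> g) [^] ?q \<otimes> g \<oplus> \<gamma> g [^] ?q \<otimes> g)"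
    proof (rule finsum_cong')
      fix g assume g: "g \<in> G0"
      then have gc: "\<beta> g \<in> carrier R" "\<gamma> g \<in> carrier R" "g \<in> carrier R" using bg G0R by auto
      have "\<beta> g [^] ?q = ((\<beta> g \<ominus> \<gamma> g) \<oplus> \<gamma> g) [^] ?q" using gc by (simp add: minus_add_cancel)
      also have "\<dots> = (\<beta> g \<ominus> \<gamma> g) [^] ?q \<oplus> \<gamma> g [^] ?q" using gc by (intro frobenius_add) auto
      finally show "\<beta> g [^] ?q \<otimes> g = (\<beta> g \<ominus> \<gamma> g) [^] ?q \<otimes> g \<oplus> \<gamma> g [^] ?q \<otimes> g" using gc by (simp add: l_distr)
    qed (use cb in auto)
    also have "\<dots> = (\<Oplus>g\<in>G0. (\<beta> g \<ominus> \<gamma> g) [^] ?q \<otimes> g) \<oplus> (\<Oplus>g\<in>G0. \<gamma> g [^] ?q \<otimes> g)"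
      by (rule finsum_addf[OF cb(3,2)])
    finally have "(\<Oplus>g\<in>G0. (\<beta> g \<ominus> \<gamma> g) [^] ?q \<otimes> g) \<oplus> (\<Oplus>g\<in>G0. \<gamma> g [^] ?q \<otimes> g) = (\<Oplus>g\<in>G0. \<gamma> g [^] ?q \<otimes> g)"
      using bg(4) by simp
    then have "(\<Oplus>g\<in>G0. (\<beta> g \<ominus> \<gamma> g) [^] ?q \<otimes> g) = \<zero>"
      using cb by (simp add: add.r_cancel_one)
    then obtain u where u: "u \<in> carrier R - P" "u \<otimes> (\<beta> g \<ominus> \<gamma> g) = \<zero>"
      using free[of "\<lambda>g. \<beta> g \<ominus> \<gamma> g" g] bg by (auto simp: Pi_iff)
    have gc: "\<beta> g \<in> carrier R" "\<gamma> g \<in> carrier R" using bg by auto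
    have "loc.\<phi> (\<beta> g \<ominus> \<gamma> g) = loc.\<phi> \<zero>"
      using loc.phi_eq_iff[of "\<beta> g \<ominus> \<gamma> g" \<zero>] gc u by auto
    then have "t \<otimes> (\<beta> g \<ominus> \<gamma> g) = \<zero>" using t(2) gc by simp
    then show ?thesis using gc tc by (simp add: minus_eq r_distr r_minus) (metis add.inv_closed add.inv_equality add.inv_inv m_closed)
  qed
  \<comment> \<open>The coordinates \<open>\<alpha>\<close> are arbitrary choices. By
    \<open>uniq\<close> their multiples by t do not depend on the choice, hence are additive and
    compatible with scalars.\<close>
  define \<delta> where "\<delta> g x = (t \<otimes> \<alpha> x g) [^] ?q" for g x
  have \<alpha>c: "\<alpha> x g \<in> carrier R" if "x \<in> carrier R" "g \<in> G0" for x g using \<alpha>(1)[OF that(1)] that(2) by auto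
  have scl: "(\<lambda>g. \<beta> g [^] ?q \<otimes> g) \<in> G0 \<rightarrow> carrier R" if "\<beta> \<in> G0 \<rightarrow> carrier R" for \<beta> using that G0R by auto
  have good: "good_op ?q R (\<delta> g)" if g: "g \<in> G0" for g
    unfolding good_op_def
  proof (intro conjI ballI)
    fix x assume x: "x \<in> carrier R"
    show "\<exists>r\<in>carrier R. \<delta> g x = r [^] ?q" unfolding \<delta>_def using \<alpha>c[OF x g] tc by auto
    fix y assume y: "y \<in> carrier R"
    have eq: "(\<Oplus>g\<in>G0. \<alpha> (x \<oplus> y) g [^] ?q \<otimes> g) = (\<Oplus>g\<in>G0. (\<alpha> x g \<oplus> \<alpha> y g) [^] ?q \<otimes> g)"
    proof -
      have "(\<Oplus>g\<in>G0. \<alpha> (x \<oplus> y) g [^] ?q \<otimes> g) = c [^] ?q \<otimes> x \<oplus> c [^] ?q \<otimes> y"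
        using \<alpha>(2)[of "x \<oplus> y"] x y c(1) by (simp add: r_distr)
      also have "\<dots> = (\<Oplus>g\<in>G0. \<alpha> x g [^] ?q \<otimes> g) \<oplus> (\<Oplus>g\<in>G0. \<alpha> y g [^] ?q \<otimes> g)" using \<alpha>(2) x y by simp
      also have "\<dots> = (\<Oplus>g\<in>G0. \<alpha> x g [^] ?q \<otimes> g \<oplus> \<alpha> y g [^] ?q \<otimes> g)"
        using scl[OF \<alpha>(1)[OF x]] scl[OF \<alpha>(1)[OF y]] by (rule finsum_addf[symmetric])
      also have "\<dots> = (\<Oplus>g\<in>G0. (\<alpha> x g \<oplus> \<alpha> y g) [^] ?q \<otimes> g)"
        using \<alpha>c[OF x] \<alpha>c[OF y] G0R by (intro finsum_cong') (auto simp: frobenius_add l_distr subset_iff)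
      finally show ?thesis .
    qed
    have "t \<otimes> \<alpha> (x \<oplus> y) g = t \<otimes> (\<alpha> x g \<oplus> \<alpha> y g)"
      by (rule uniq[OF _ _ g eq]) (use \<alpha>(1)[of "x \<oplus> y"] \<alpha>c x y in auto)
    then show "\<delta> g (x \<oplus> y) = \<delta> g x \<oplus> \<delta> g y"
      unfolding \<delta>_def using \<alpha>c[OF x g] \<alpha>c[OF y g] tc by (simp add: r_distr frobenius_add)
  next
    fix a x assume a: "a \<in> carrier R" and x: "x \<in> carrier R"
    have eq: "(\<Oplus>g\<in>G0. \<alpha> (a [^] ?q \<otimes> x) g [^] ?q \<otimes> g) = (\<Oplus>g\<in>G0. (a \<otimes> \<alpha> x g) [^] ?q \<otimes> g)"
    proof -
      have "(\<Oplus>g\<in>G0. \<alpha> (a [^] ?q \<otimes> x) g [^] ?q \<otimes> g) = a [^] ?q \<otimes> (c [^] ?q \<otimes> x)"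
        using \<alpha>(2)[of "a [^] ?q \<otimes> x"] a x c(1) by (simp add: m_lcomm)
      also have "\<dots> = a [^] ?q \<otimes> (\<Oplus>g\<in>G0. \<alpha> x g [^] ?q \<otimes> g)" using \<alpha>(2) x by simp
      also have "\<dots> = (\<Oplus>g\<in>G0. a [^] ?q \<otimes> (\<alpha> x g [^] ?q \<otimes> g))"
        using scl[OF \<alpha>(1)[OF x]] a fin0 by (intro finsum_rdistr) auto
      also have "\<dots> = (\<Oplus>g\<in>G0. (a \<otimes> \<alpha> x g) [^] ?q \<otimes> g)"
        using \<alpha>c[OF x] a G0R by (intro finsum_cong') (auto simp: nat_pow_distrib m_assoc subset_iff)
      finally show ?thesis .
    qed
    have "t \<otimes> \<alpha> (a [^] ?q \<otimes> x) g = t \<otimes> (a \<otimes> \<alpha> x g)"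
      by (rule uniq[OF _ _ g eq]) (use \<alpha>(1)[of "a [^] ?q \<otimes> x"] \<alpha>c x a in auto)
    also have "\<dots> = a \<otimes> (t \<otimes> \<alpha> x g)" using \<alpha>c[OF x g] a tc by (simp add: m_lcomm)
    finally show "\<delta> g (a [^] ?q \<otimes> x) = a [^] ?q \<otimes> \<delta> g x"
      unfolding \<delta>_def using \<alpha>c[OF x g] a tc by (simp add: nat_pow_distrib)
  qed
  have "dual_op ?q R (\<lambda>x. \<Oplus>g\<in>G0. \<delta> g x \<otimes> g)" by (rule dual_op_finsum[OF fin0 G0R good])
  moreover have "(\<Oplus>g\<in>G0. \<delta> g x \<otimes> g) = (t \<otimes> c) [^] ?q \<otimes> x" if x: "x \<in> carrier R" for x
  proof -
    have "(\<Oplus>g\<in>G0. \<delta> g x \<otimes> g) = (\<Oplus>g\<in>G0. t [^] ?q \<otimes> (\<alpha> x g [^] ?q \<otimes> g))"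
      unfolding \<delta>_def using \<alpha>c[OF x] tc G0R
      by (intro finsum_cong') (auto simp: nat_pow_distrib m_assoc subset_iff)
    also have "\<dots> = t [^] ?q \<otimes> (\<Oplus>g\<in>G0. \<alpha> x g [^] ?q \<otimes> g)"
      using scl[OF \<alpha>(1)[OF x]] tc fin0 by (intro finsum_rdistr[symmetric]) auto
    also have "\<dots> = t [^] ?q \<otimes> (c [^] ?q \<otimes> x)" using \<alpha>(2)[OF x] by simp
    also have "\<dots> = (t \<otimes> c) [^] ?q \<otimes> x" using tc c(1) x by (simp add: nat_pow_distrib m_assoc)
    finally show ?thesis .
  qed
  moreover have "t \<otimes> c \<in> carrier R - P" using loc.S_mult[OF t(1), of c] c by blast
  ultimately show ?thesis by blast
qed

text \<open>The c for which c^q times the identity has a dual basis form an ideal, closed under sums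
  because the Frobenius is additive. By \<open>local_dual_op\<close> no maximal ideal contains it,
  so c = 1 is allowed.\<close>

theorem dual_basis:
  assumes reg: "regular_ring R"
    and G: "finite G" "G \<subseteq> carrier R" "carrier R \<subseteq> mspan R (frob p e R (self_mod R)) G"
  shows "\<exists>\<tau>. dual_op (p ^ e) R \<tau> \<and> (\<forall>x\<in>carrier R. \<tau> x = x)"
proof -
  have no: "noetherian_ring R" using reg unfolding regular_ring_def by blast
  interpret M: module R "self_mod R" by (rule module_self_mod)
  define C where "C = {c \<in> carrier R. \<exists>\<tau>. dual_op (p ^ e) R \<tau> \<and> (\<forall>x\<in>carrier R. \<tau> x = c [^] (p ^ e) \<otimes> x)}"
  have "submodule C R (self_mod R)"
  proof (rule M.submoduleI')
    show "\<zero>\<^bsub>self_mod R\<^esub> \<in> C" unfolding C_def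
      by (auto intro!: exI[of _ "\<lambda>_. \<zero>"] dual_op.zero simp: pow_q_zero)
    show "a \<oplus>\<^bsub>self_mod R\<^esub> b \<in> C" if "a \<in> C" "b \<in> C" for a b
    proof -
      from that obtain \<tau> \<sigma> where *: "a \<in> carrier R" "b \<in> carrier R" "dual_op (p ^ e) R \<tau>" "dual_op (p ^ e) R \<sigma>"
        "\<forall>x\<in>carrier R. \<tau> x = a [^] (p ^ e) \<otimes> x" "\<forall>x\<in>carrier R. \<sigma> x = b [^] (p ^ e) \<otimes> x" unfolding C_def by blast
      then show ?thesis unfolding C_def
        using dual_op_sum[OF *(3,4)] by (auto simp: frobenius_add l_distr intro!: exI[of _ "\<lambda>x. \<tau> x \<oplus> \<sigma> x"])
    qed
    show "r \<odot>\<^bsub>self_mod R\<^esub> a \<in> C" if "r \<in> carrier R" "a \<in> C" for r a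
    proof -
      from that obtain \<tau> where *: "a \<in> carrier R" "dual_op (p ^ e) R \<tau>"
        "\<forall>x\<in>carrier R. \<tau> x = a [^] (p ^ e) \<otimes> x" unfolding C_def by blast
      then show ?thesis unfolding C_def
        using dual_op_mult[OF *(2), of "r [^] (p ^ e)"] that(1)
        by (auto simp: nat_pow_distrib m_assoc intro!: exI[of _ "\<lambda>x. r [^] (p ^ e) \<otimes> \<tau> x"])
    qed
  qed (auto simp: C_def)
  then have C: "ideal C R" by (simp add: submodule_self_mod_iff)
  have "C = carrier R"
  proof (rule ccontr)
    assume "C \<noteq> carrier R"
    then obtain P where P: "maximalideal P R" "C \<subseteq> P" using proper_ideal_maximal[OF no C] by blast
    have prime: "primeideal P R" by (rule maximalideal_prime[OF P(1)])
    have "regular_local_ring (loc_ring R (carrier R - P))" using reg prime unfolding regular_ring_def by blast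
    from local_dual_op[OF no prime this G] show False using P(2) unfolding C_def by blast
  qed
  then have "\<one> \<in> C" by simp
  then obtain \<tau> where "dual_op (p ^ e) R \<tau>" "\<forall>x\<in>carrier R. \<tau> x = \<one> [^] (p ^ e) \<otimes> x" unfolding C_def by blast
  then show ?thesis by auto
qed

end

section \<open>F-finiteness\<close>

definition frob_span :: "nat \<Rightarrow> nat \<Rightarrow> ('a, 'x) ring_scheme \<Rightarrow> 'a set \<Rightarrow> 'a set" where
  "frob_span p e R G = mspan R (frob p e R (self_mod R)) G"

context cring_char
begin

lemma frob_span_subset: "G \<subseteq> carrier R \<Longrightarrow> G \<subseteq> frob_span p e R G"
proof -
  interpret N: module R "frob p e R (self_mod R)" by (rule module_frob_self)
  show ?thesis unfolding frob_span_def by (rule N.mspan_incl)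
qed

lemma frob_span_induct:
  assumes x: "x \<in> frob_span p e R G" and G: "G \<subseteq> carrier R"
    and base: "\<And>g. g \<in> G \<Longrightarrow> Q g" and zero: "Q \<zero>"
    and add: "\<And>x y. x \<in> carrier R \<Longrightarrow> y \<in> carrier R \<Longrightarrow> Q x \<Longrightarrow> Q y \<Longrightarrow> Q (x \<oplus> y)"
    and smult: "\<And>a x. a \<in> carrier R \<Longrightarrow> x \<in> carrier R \<Longrightarrow> Q x \<Longrightarrow> Q (a [^] (p ^ e) \<otimes> x)"
  shows "Q x"
proof -
  interpret N: module R "frob p e R (self_mod R)" by (rule module_frob_self)
  have "submodule {x \<in> carrier R. Q x} R (frob p e R (self_mod R))"
    by (rule N.submoduleI') (use zero add smult in auto)
  then have "frob_span p e R G \<subseteq> {x \<in> carrier R. Q x}"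
    unfolding frob_span_def by (rule N.mspan_minimal) (use G base in auto)
  then show ?thesis using x by blast
qed

lemma frob_span_closed:
  assumes G: "G \<subseteq> carrier R"
  shows "frob_span p e R G \<subseteq> carrier R" "\<zero> \<in> frob_span p e R G"
    "x \<in> frob_span p e R G \<Longrightarrow> y \<in> frob_span p e R G \<Longrightarrow> x \<oplus> y \<in> frob_span p e R G"
    "a \<in> carrier R \<Longrightarrow> x \<in> frob_span p e R G \<Longrightarrow> a [^] (p ^ e) \<otimes> x \<in> frob_span p e R G"
    "x \<in> frob_span p e R G \<Longrightarrow> \<ominus> x \<in> frob_span p e R G"
proof -
  interpret N: module R "frob p e R (self_mod R)" by (rule module_frob_self)
  have s: "submodule (frob_span p e R G) R (frob p e R (self_mod R))"
    unfolding frob_span_def using G by (intro N.mspan_submodule) auto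
  note s' = N.submoduleE[OF s] N.submodule_zero[OF s]
  show "frob_span p e R G \<subseteq> carrier R" "\<zero> \<in> frob_span p e R G"
    "x \<in> frob_span p e R G \<Longrightarrow> y \<in> frob_span p e R G \<Longrightarrow> x \<oplus> y \<in> frob_span p e R G"
    "x \<in> frob_span p e R G \<Longrightarrow> \<ominus> x \<in> frob_span p e R G"
    using s'(1,3,5,7) by (auto simp: a_inv_frob)
  show "a \<in> carrier R \<Longrightarrow> x \<in> frob_span p e R G \<Longrightarrow> a [^] (p ^ e) \<otimes> x \<in> frob_span p e R G"
    using s'(4)[of a x] by simp
qed

lemma frob_span_mult_closed:
  assumes G: "G \<subseteq> carrier R" and H: "H \<subseteq> carrier R"
    and gg: "\<And>g h. g \<in> G \<Longrightarrow> h \<in> G \<Longrightarrow> g \<otimes> h \<in> frob_span p e R H"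
    and x: "x \<in> frob_span p e R G" and y: "y \<in> frob_span p e R G"
  shows "x \<otimes> y \<in> frob_span p e R H"
proof -
  note H' = frob_span_closed[where e = e, OF H]
  have 1: "g \<otimes> y \<in> frob_span p e R H" if g: "g \<in> G" for g
  proof -
    have gc: "g \<in> carrier R" using g G by blast
    show ?thesis
    proof (rule frob_span_induct[OF y G])
      show "g \<otimes> (a [^] p ^ e \<otimes> x) \<in> frob_span p e R H"
        if "a \<in> carrier R" "x \<in> carrier R" "g \<otimes> x \<in> frob_span p e R H" for a x
        using H'(4)[OF that(1,3)] that gc m_lcomm[of g "a [^] p ^ e" x] by simp
    qed (use gc gg[OF g] H' in \<open>auto simp: r_distr\<close>)
  qed
  have yc: "y \<in> carrier R" using y frob_span_closed(1)[OF G] by blast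
  show ?thesis
    by (rule frob_span_induct[OF x G]) (use yc 1 H' in \<open>auto simp: l_distr m_assoc\<close>)
qed

text \<open>The powers s^i with i < p suffice, because s^p acts as a scalar and reduces higher
  exponents by p. Closure under products is carried along so that the span ends up containing the
  ring generated by all adjoined elements.\<close>

lemma frob_span_adjoin:
  assumes G: "finite G" "G \<subseteq> carrier R" and one: "\<one> \<in> frob_span p 1 R G"
    and mult: "\<forall>x\<in>frob_span p 1 R G. \<forall>y\<in>frob_span p 1 R G. x \<otimes> y \<in> frob_span p 1 R G"
    and s: "s \<in> carrier R"
  shows "\<exists>H. finite H \<and> H \<subseteq> carrier R \<and> frob_span p 1 R G \<subseteq> frob_span p 1 R H \<and> s \<in> frob_span p 1 R H \<and>
    (\<forall>x\<in>frob_span p 1 R H. \<forall>y\<in>frob_span p 1 R H. x \<otimes> y \<in> frob_span p 1 R H)"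
proof -
  define H where "H = (\<lambda>(g, i). g \<otimes> s [^] i) ` (G \<times> {..<p})"
  have H: "finite H" "H \<subseteq> carrier R" unfolding H_def using G s by auto
  note H' = frob_span_closed[where e = 1, OF H(2)]
  have Gc: "frob_span p 1 R G \<subseteq> carrier R" by (rule frob_span_closed(1)[OF G(2)])
  have 1: "x \<otimes> s [^] k \<in> frob_span p 1 R H" if x: "x \<in> frob_span p 1 R G" for x and k :: nat
  proof (induct k rule: less_induct)
    case (less k)
    show ?case
    proof (cases "k < p")
      case True
      have "g \<otimes> s [^] k \<in> frob_span p 1 R H" if "g \<in> G" for g
        using frob_span_subset[OF H(2), of 1] that True unfolding H_def by auto
      then show ?thesis
        by (rule frob_span_induct[OF x G(2)]) (use s H' in \<open>auto simp: l_distr m_assoc\<close>)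
    next
      case False
      have "x \<otimes> s [^] (k - p) \<in> frob_span p 1 R H" using less[of "k - p"] False prime_gt_0_nat[OF prime_p] by simp
      then have "s [^] (p ^ 1) \<otimes> (x \<otimes> s [^] (k - p)) \<in> frob_span p 1 R H" by (rule H'(4)[OF s])
      moreover have "s [^] (p ^ 1) \<otimes> (x \<otimes> s [^] (k - p)) = x \<otimes> (s [^] p \<otimes> s [^] (k - p))"
        using s x Gc by (simp add: m_lcomm subset_iff)
      ultimately show ?thesis using s False by (simp add: nat_pow_mult)
    qed
  qed
  have "frob_span p 1 R G \<subseteq> frob_span p 1 R H"
  proof
    fix x assume "x \<in> frob_span p 1 R G"
    then show "x \<in> frob_span p 1 R H" using 1[of x 0] Gc by auto
  qed
  moreover have "s \<in> frob_span p 1 R H" using 1[OF one, of 1] s by simp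
  moreover have "x \<otimes> y \<in> frob_span p 1 R H" if "x \<in> frob_span p 1 R H" "y \<in> frob_span p 1 R H" for x y
  proof (rule frob_span_mult_closed[OF H(2,2) _ that])
    fix g h assume "g \<in> H" "h \<in> H"
    then obtain g' h' and i j :: nat where gh: "g' \<in> G" "h' \<in> G" "g = g' \<otimes> s [^] i" "h = h' \<otimes> s [^] j"
      unfolding H_def by auto
    have c: "g' \<in> carrier R" "h' \<in> carrier R" using gh G(2) by auto
    have "g \<otimes> h = (g' \<otimes> h') \<otimes> (s [^] i \<otimes> s [^] j)" unfolding gh(3,4) using c s by (simp add: m_ac)
    also have "\<dots> = (g' \<otimes> h') \<otimes> s [^] (i + j)" using s by (simp add: nat_pow_mult)
    finally have "g \<otimes> h = (g' \<otimes> h') \<otimes> s [^] (i + j)" .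
    moreover have "g' \<otimes> h' \<in> frob_span p 1 R G"
      using mult gh(1,2) frob_span_subset[OF G(2), of 1] by blast
    ultimately show "g \<otimes> h \<in> frob_span p 1 R H" using 1 by simp
  qed
  ultimately show ?thesis using H by blast
qed

lemma frob_span_adjoin_finite:
  assumes S: "finite S" "S \<subseteq> carrier R" and G: "finite G" "G \<subseteq> carrier R" and one: "\<one> \<in> frob_span p 1 R G"
    and mult: "\<forall>x\<in>frob_span p 1 R G. \<forall>y\<in>frob_span p 1 R G. x \<otimes> y \<in> frob_span p 1 R G"
  shows "\<exists>H. finite H \<and> H \<subseteq> carrier R \<and> frob_span p 1 R G \<union> S \<subseteq> frob_span p 1 R H \<and>
    (\<forall>x\<in>frob_span p 1 R H. \<forall>y\<in>frob_span p 1 R H. x \<otimes> y \<in> frob_span p 1 R H)"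
  using S
proof induct
  case empty
  then show ?case using G mult by blast
next
  case (insert s S)
  then obtain H where H: "finite H" "H \<subseteq> carrier R" "frob_span p 1 R G \<union> S \<subseteq> frob_span p 1 R H"
    "\<forall>x\<in>frob_span p 1 R H. \<forall>y\<in>frob_span p 1 R H. x \<otimes> y \<in> frob_span p 1 R H" by auto
  have one': "\<one> \<in> frob_span p 1 R H" using one H(3) by blast
  have sc: "s \<in> carrier R" using insert.prems by simp
  obtain K where K: "finite K" "K \<subseteq> carrier R" "frob_span p 1 R H \<subseteq> frob_span p 1 R K"
    "s \<in> frob_span p 1 R K" "\<forall>x\<in>frob_span p 1 R K. \<forall>y\<in>frob_span p 1 R K. x \<otimes> y \<in> frob_span p 1 R K"
    using frob_span_adjoin[OF H(1,2) one' H(4) sc] by (elim exE conjE)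
  have "frob_span p 1 R G \<union> insert s S \<subseteq> frob_span p 1 R K" using H(3) K(3,4) by auto
  then show ?case using K(1,2,5) by (intro exI[of _ K] conjI)
qed

text \<open>If the g generate over p-th powers and the h over p^e-th powers, then the products
  g^(p^e) h generate over powers with exponent p^(e+1).\<close>

lemma frob_span_iterate:
  assumes G: "finite G" "G \<subseteq> carrier R" "carrier R \<subseteq> frob_span p 1 R G"
  shows "\<exists>H. finite H \<and> H \<subseteq> carrier R \<and> carrier R \<subseteq> frob_span p e R H"
proof (induct e)
  case 0
  have "x \<in> frob_span p 0 R {\<one>}" if "x \<in> carrier R" for x
  proof -
    have "x [^] (p ^ 0) \<otimes> \<one> \<in> frob_span p 0 R {\<one>}"
      by (rule frob_span_closed(4)) (use that frob_span_subset[of "{\<one>}" 0] in auto)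
    then show ?thesis using that by simp
  qed
  then show ?case by (intro exI[of _ "{\<one>}"]) auto
next
  case (Suc e)
  then obtain H where H: "finite H" "H \<subseteq> carrier R" "carrier R \<subseteq> frob_span p e R H" by blast
  define K where "K = (\<lambda>(g, h). g [^] (p ^ e) \<otimes> h) ` (G \<times> H)"
  have K: "finite K" "K \<subseteq> carrier R" unfolding K_def using G H by auto
  note K' = frob_span_closed[where e = "Suc e", OF K(2)]
  have 1: "c [^] (p ^ e) \<otimes> h \<in> frob_span p (Suc e) R K" if c: "c \<in> carrier R" and h: "h \<in> H" for c h
  proof -
    have hc: "h \<in> carrier R" using h H by blast
    have "c \<in> frob_span p 1 R G" using c G(3) by blast
    then show ?thesis
    proof (rule frob_span_induct[OF _ G(2)])
      show "g [^] (p ^ e) \<otimes> h \<in> frob_span p (Suc e) R K" if "g \<in> G" for g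
        using frob_span_subset[OF K(2), of "Suc e"] that h unfolding K_def by auto
      show "(a [^] p ^ 1 \<otimes> x) [^] p ^ e \<otimes> h \<in> frob_span p (Suc e) R K"
        if "a \<in> carrier R" "x \<in> carrier R" "x [^] p ^ e \<otimes> h \<in> frob_span p (Suc e) R K" for a x
      proof -
        have "(a [^] p ^ 1 \<otimes> x) [^] p ^ e \<otimes> h = a [^] (p ^ Suc e) \<otimes> (x [^] p ^ e \<otimes> h)"
          using that(1,2) hc by (simp add: nat_pow_distrib nat_pow_pow m_assoc)
        then show ?thesis using K'(4)[OF that(1,3)] by simp
      qed
    qed (use hc K' in \<open>auto simp: frobenius_add l_distr pow_q_zero\<close>)
  qed
  \<comment> \<open>The extra factor d carries the induction: a scalar a^(p^e) is absorbed into
    it.\<close>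
  have "\<forall>d\<in>carrier R. d [^] (p ^ e) \<otimes> x \<in> frob_span p (Suc e) R K" if "x \<in> carrier R" for x
  proof (rule frob_span_induct[OF _ H(2)])
    show "x \<in> frob_span p e R H" using that H(3) by blast
    show "\<forall>d\<in>carrier R. d [^] p ^ e \<otimes> (a [^] p ^ e \<otimes> y) \<in> frob_span p (Suc e) R K"
      if "a \<in> carrier R" "y \<in> carrier R" "\<forall>d\<in>carrier R. d [^] p ^ e \<otimes> y \<in> frob_span p (Suc e) R K" for a y
    proof
      fix d assume d: "d \<in> carrier R"
      have "d [^] p ^ e \<otimes> (a [^] p ^ e \<otimes> y) = (d \<otimes> a) [^] p ^ e \<otimes> y"
        using d that by (simp add: nat_pow_distrib m_assoc)
      then show "d [^] p ^ e \<otimes> (a [^] p ^ e \<otimes> y) \<in> frob_span p (Suc e) R K" using that d by simp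
    qed
  qed (use 1 K' in \<open>auto simp: r_distr\<close>)
  then have "x \<in> frob_span p (Suc e) R K" if "x \<in> carrier R" for x
    using that by (metis l_one nat_pow_one one_closed)
  then show ?case using K by blast
qed

end

lemma frob_span_hom:
  assumes A: "cring_char A p" and B: "cring_char B p" and h: "h \<in> ring_hom A B"
    and G: "G \<subseteq> carrier A" and x: "x \<in> frob_span p e A G"
  shows "h x \<in> frob_span p e B (h ` G)"
proof -
  interpret A: cring_char A p by fact
  interpret B: cring_char B p by fact
  interpret h: ring_hom_cring A B h by (intro ring_hom_cringI A.is_cring B.is_cring h)
  have hG: "h ` G \<subseteq> carrier B" using G by auto
  note B' = B.frob_span_closed[where e = e, OF hG]
  show ?thesis
    by (rule A.frob_span_induct[OF x G]) (use B.frob_span_subset[OF hG] B' in auto)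
qed

text \<open>F-finiteness passes from k to a finitely generated algebra by adjoining the generators
  one at a time, and to a localization because b/w = (1/w)^p w^(p-1) b.\<close>

lemma ess_finite_type_frob_span:
  fixes k :: "'k ring" and R :: "'a ring"
  assumes k: "field k" and ch: "has_prime_char k p" and ff: "F_finite p k"
    and eft: "ess_finite_type k R" and R: "cring R"
  shows "has_prime_char R p \<and> (\<exists>G. finite G \<and> G \<subseteq> carrier R \<and> carrier R \<subseteq> frob_span p 1 R G)"
proof -
  interpret k: field k by fact
  interpret R: cring R by fact
  interpret kc: cring_char k p by unfold_locales (rule ch)
  obtain B :: "'a ring" and \<psi> S W where B: "cring B" "\<psi> \<in> ring_hom k B" "finite S" "S \<subseteq> carrier B"
     "generate_ring B (\<psi> ` carrier k \<union> S) = carrier B" "submonoid W B" "loc_ring B W \<simeq> R"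
    using eft unfolding ess_finite_type_def by blast
  interpret B: cring B by (rule B(1))
  have chB: "has_prime_char B p" by (rule ring_hom_char[OF k.is_cring B(1,2) ch])
  interpret Bc: cring_char B p by unfold_locales (rule chB)
  interpret psi: ring_hom_cring k B \<psi> by (intro ring_hom_cringI k.is_cring B)
  interpret N: module k "frob p 1 k (self_mod k)" by (rule kc.module_frob_self)
  obtain T where T: "finite T" "T \<subseteq> carrier k" "carrier k \<subseteq> frob_span p 1 k T"
    using ff unfolding F_finite_def fg_module_iff[OF N.module_axioms] frob_span_def by auto
  have psiT: "finite (\<psi> ` T)" "\<psi> ` T \<subseteq> carrier B" using T by auto
  have psik: "\<psi> x \<in> frob_span p 1 B (\<psi> ` T)" if "x \<in> carrier k" for x
    using frob_span_hom[OF kc.cring_char_axioms Bc.cring_char_axioms B(2) T(2)] T(3) that by blast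
  have one: "\<one>\<^bsub>B\<^esub> \<in> frob_span p 1 B (\<psi> ` T)" using psik[OF k.one_closed] by simp
  have mult: "\<forall>x\<in>frob_span p 1 B (\<psi> ` T). \<forall>y\<in>frob_span p 1 B (\<psi> ` T). x \<otimes>\<^bsub>B\<^esub> y \<in> frob_span p 1 B (\<psi> ` T)"
  proof (intro ballI, rule Bc.frob_span_mult_closed[OF psiT(2,2)])
    fix g h assume "g \<in> \<psi> ` T" "h \<in> \<psi> ` T"
    then obtain g' h' where "g' \<in> T" "h' \<in> T" "g = \<psi> g'" "h = \<psi> h'" by blast
    moreover from this have "g' \<in> carrier k" "h' \<in> carrier k" using T(2) by auto
    ultimately show "g \<otimes>\<^bsub>B\<^esub> h \<in> frob_span p 1 B (\<psi> ` T)" using psik[of "g' \<otimes>\<^bsub>k\<^esub> h'"] by simp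
  qed auto
  obtain H where H: "finite H" "H \<subseteq> carrier B" "frob_span p 1 B (\<psi> ` T) \<union> S \<subseteq> frob_span p 1 B H"
    "\<And>x y. x \<in> frob_span p 1 B H \<Longrightarrow> y \<in> frob_span p 1 B H \<Longrightarrow> x \<otimes>\<^bsub>B\<^esub> y \<in> frob_span p 1 B H"
    using Bc.frob_span_adjoin_finite[OF B(3,4) psiT one mult] by blast
  have "x \<in> frob_span p 1 B H" if "x \<in> generate_ring B (\<psi> ` carrier k \<union> S)" for x
    using that
  proof induct
    case one
    then show ?case using \<open>\<one>\<^bsub>B\<^esub> \<in> _\<close> H(3) by blast
  next
    case (incl h)
    then show ?case using psik H(3) by blast
  qed (use Bc.frob_span_closed[OF H(2)] H(4) in auto)
  then have BH: "carrier B \<subseteq> frob_span p 1 B H" using B(5) by blast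
  interpret W: submonoid W B by (rule B(6))
  interpret loc: localization B W by unfold_locales auto
  obtain h where h: "h \<in> ring_hom loc.L R" "bij_betw h (carrier loc.L) (carrier R)"
    using B(7) unfolding is_ring_iso_def ring_iso_def by blast
  define \<chi> where "\<chi> b = h (loc.\<phi> b)" for b
  have chi: "\<chi> \<in> ring_hom B R"
    using ring_hom_trans[OF loc.phi_hom h(1)] unfolding \<chi>_def comp_def .
  have chR: "has_prime_char R p" by (rule ring_hom_char[OF B(1) R chi chB])
  interpret Rc: cring_char R p by unfold_locales (rule chR)
  have HR: "\<chi> ` H \<subseteq> carrier R" using H(2) ring_hom_closed[OF chi] by auto
  have "r \<in> frob_span p 1 R (\<chi> ` H)" if r: "r \<in> carrier R" for r
  proof -
    obtain X where X: "X \<in> carrier loc.L" "r = h X" using r h(2) unfolding bij_betw_def by blast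
    then obtain b w where bw: "b \<in> carrier B" "w \<in> W" "X = loc.fr b w" unfolding loc.L_carrier by blast
    have wc: "w \<in> carrier B" using bw by auto
    obtain p' where p': "p = Suc p'" using Bc.prime_p prime_gt_0_nat by (metis gr0_implies_Suc)
    have wp: "w [^]\<^bsub>B\<^esub> (n::nat) \<in> W" for n using loc.fr_pow(2)[OF B.one_closed bw(2)] .
    have "X = loc.fr (w [^]\<^bsub>B\<^esub> p' \<otimes>\<^bsub>B\<^esub> b) (w [^]\<^bsub>B\<^esub> p' \<otimes>\<^bsub>B\<^esub> w)"
      unfolding bw(3) using loc.fr_cancel[OF bw(1,2) wp] by simp
    also have "w [^]\<^bsub>B\<^esub> p' \<otimes>\<^bsub>B\<^esub> w = w [^]\<^bsub>B\<^esub> p" unfolding p' by simp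
    also have "loc.fr (w [^]\<^bsub>B\<^esub> p' \<otimes>\<^bsub>B\<^esub> b) (w [^]\<^bsub>B\<^esub> p) =
        loc.fr (\<one>\<^bsub>B\<^esub> [^]\<^bsub>B\<^esub> p) (w [^]\<^bsub>B\<^esub> p) \<otimes>\<^bsub>loc.L\<^esub> loc.\<phi> (w [^]\<^bsub>B\<^esub> p' \<otimes>\<^bsub>B\<^esub> b)"
      unfolding loc.\<phi>_def
      using loc.L_mult[of "\<one>\<^bsub>B\<^esub>" "w [^]\<^bsub>B\<^esub> p' \<otimes>\<^bsub>B\<^esub> b" "w [^]\<^bsub>B\<^esub> p" "\<one>\<^bsub>B\<^esub>"] wp wc bw(1) loc.S_one by simp
    finally have Xeq: "X = loc.fr (\<one>\<^bsub>B\<^esub> [^]\<^bsub>B\<^esub> p) (w [^]\<^bsub>B\<^esub> p) \<otimes>\<^bsub>loc.L\<^esub> loc.\<phi> (w [^]\<^bsub>B\<^esub> p' \<otimes>\<^bsub>B\<^esub> b)" .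
    have vL: "loc.fr \<one>\<^bsub>B\<^esub> w \<in> carrier loc.L" using loc.fr_closed bw by simp
    have hpow: "h (Y [^]\<^bsub>loc.L\<^esub> n) = h Y [^]\<^bsub>R\<^esub> n" if "Y \<in> carrier loc.L" "\<And>n :: nat. Y [^]\<^bsub>loc.L\<^esub> n \<in> carrier loc.L" for Y and n :: nat
    proof (induct n)
      case 0
      then show ?case using ring_hom_one[OF h(1)] by (simp add: nat_pow_def)
    next
      case (Suc n)
      have "Y [^]\<^bsub>loc.L\<^esub> Suc n = Y [^]\<^bsub>loc.L\<^esub> n \<otimes>\<^bsub>loc.L\<^esub> Y" by (simp add: nat_pow_def)
      then show ?case using ring_hom_mult[OF h(1) that(2) that(1)] Suc by simp
    qed
    have powL: "loc.fr \<one>\<^bsub>B\<^esub> w [^]\<^bsub>loc.L\<^esub> (n::nat) \<in> carrier loc.L" for n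
      unfolding loc.fr_pow(1)[OF B.one_closed bw(2)] using loc.fr_closed wp by simp
    have "r = h (loc.fr \<one>\<^bsub>B\<^esub> w [^]\<^bsub>loc.L\<^esub> p) \<otimes>\<^bsub>R\<^esub> \<chi> (w [^]\<^bsub>B\<^esub> p' \<otimes>\<^bsub>B\<^esub> b)"
      unfolding X(2) Xeq \<chi>_def loc.fr_pow(1)[OF B.one_closed bw(2), symmetric]
      using ring_hom_closed[OF loc.phi_hom] wc bw(1) by (intro ring_hom_mult[OF h(1) powL]) simp
    then have "r = h (loc.fr \<one>\<^bsub>B\<^esub> w) [^]\<^bsub>R\<^esub> (p ^ 1) \<otimes>\<^bsub>R\<^esub> \<chi> (w [^]\<^bsub>B\<^esub> p' \<otimes>\<^bsub>B\<^esub> b)"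
      using hpow[OF vL powL] by simp
    moreover have "\<chi> (w [^]\<^bsub>B\<^esub> p' \<otimes>\<^bsub>B\<^esub> b) \<in> frob_span p 1 R (\<chi> ` H)"
      using frob_span_hom[OF Bc.cring_char_axioms Rc.cring_char_axioms chi H(2)] BH wc bw(1) by (meson B.m_closed B.nat_pow_closed subsetD)
    moreover have "h (loc.fr \<one>\<^bsub>B\<^esub> w) \<in> carrier R" using ring_hom_closed[OF h(1) vL] .
    ultimately show ?thesis using Rc.frob_span_closed(4)[OF HR, where e = 1] by simp
  qed
  then show ?thesis using chR HR H(1) by blast
qed

section \<open>Stabilization of the non-F-pure chain\<close>

locale cartier = cring_char R p + module R M
  for R :: "('a, 'x) ring_scheme" (structure) and p and M :: "('a, 'm) module" (structure) +
  fixes \<kappa> :: "'m \<Rightarrow> 'm"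
  assumes no_ring: "noetherian_ring R" and no_mod: "noeth_module R M"
    and kappa: "lin_map R (frob p 1 R M) M \<kappa>"
begin

abbreviation K where "K e \<equiv> \<kappa> ^^ e"

lemma kappa_props:
  "x \<in> carrier M \<Longrightarrow> \<kappa> x \<in> carrier M"
  "x \<in> carrier M \<Longrightarrow> y \<in> carrier M \<Longrightarrow> \<kappa> (x \<oplus>\<^bsub>M\<^esub> y) = \<kappa> x \<oplus>\<^bsub>M\<^esub> \<kappa> y"
  "a \<in> carrier R \<Longrightarrow> x \<in> carrier M \<Longrightarrow> \<kappa> ((a [^] p) \<odot>\<^bsub>M\<^esub> x) = a \<odot>\<^bsub>M\<^esub> \<kappa> x"
  using kappa unfolding lin_map_def by auto

lemma K_closed: "x \<in> carrier M \<Longrightarrow> K e x \<in> carrier M"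
  by (induct e) (auto simp: kappa_props)

lemma K_add: "x \<in> carrier M \<Longrightarrow> y \<in> carrier M \<Longrightarrow> K e (x \<oplus>\<^bsub>M\<^esub> y) = K e x \<oplus>\<^bsub>M\<^esub> K e y"
  by (induct e) (auto simp: kappa_props K_closed)

lemma K_smult: "a \<in> carrier R \<Longrightarrow> x \<in> carrier M \<Longrightarrow> K e ((a [^] (p ^ e)) \<odot>\<^bsub>M\<^esub> x) = a \<odot>\<^bsub>M\<^esub> K e x"
proof (induct e arbitrary: a)
  case (Suc e)
  have "a [^] (p ^ Suc e) = (a [^] p) [^] (p ^ e)" using Suc by (simp add: nat_pow_pow)
  then show ?case using Suc by (simp add: kappa_props K_closed)
qed simp

lemma K_zero: "K e \<zero>\<^bsub>M\<^esub> = \<zero>\<^bsub>M\<^esub>"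
  using K_smult[of \<zero> "\<zero>\<^bsub>M\<^esub>" e] K_closed[of "\<zero>\<^bsub>M\<^esub>" e] by simp

lemma K_image_submodule:
  assumes "submodule X R M" shows "submodule (K e ` X) R M"
proof (rule submoduleI')
  note X = submoduleE[OF assms] submodule_zero[OF assms]
  show "K e ` X \<subseteq> carrier M" using X K_closed by auto
  show "\<zero>\<^bsub>M\<^esub> \<in> K e ` X" using X K_zero by (metis image_eqI)
  show "a \<oplus>\<^bsub>M\<^esub> b \<in> K e ` X" if "a \<in> K e ` X" "b \<in> K e ` X" for a b
  proof -
    from that obtain x y where "x \<in> X" "y \<in> X" "a = K e x" "b = K e y" by blast
    then show ?thesis using K_add[of x y e] X by (metis image_eqI subsetD)
  qed
  show "a \<odot>\<^bsub>M\<^esub> b \<in> K e ` X" if "a \<in> carrier R" "b \<in> K e ` X" for a b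
  proof -
    from that obtain x where x: "x \<in> X" "b = K e x" by blast
    then have "a \<odot>\<^bsub>M\<^esub> b = K e ((a [^] (p ^ e)) \<odot>\<^bsub>M\<^esub> x)" using K_smult[of a x e] X that by auto
    then show ?thesis using X(4)[OF nat_pow_closed[OF that(1)] x(1)] by blast
  qed
qed

lemma smult_image_submodule:
  assumes "submodule X R M" "g \<in> carrier R" shows "submodule ((\<lambda>x. g \<odot>\<^bsub>M\<^esub> x) ` X) R M"
proof (rule submoduleI')
  note X = submoduleE[OF assms(1)] submodule_zero[OF assms(1)]
  let ?Y = "(\<lambda>x. g \<odot>\<^bsub>M\<^esub> x) ` X"
  show "?Y \<subseteq> carrier M" using X assms(2) by auto
  show "\<zero>\<^bsub>M\<^esub> \<in> ?Y" using X assms(2) smult_r_null[OF assms(2)] by (metis image_eqI)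
  show "a \<oplus>\<^bsub>M\<^esub> b \<in> ?Y" if "a \<in> ?Y" "b \<in> ?Y" for a b
  proof -
    from that obtain x y where "x \<in> X" "y \<in> X" "a = g \<odot>\<^bsub>M\<^esub> x" "b = g \<odot>\<^bsub>M\<^esub> y" by blast
    then show ?thesis using smult_r_distr[OF assms(2), of x y] X by (metis image_eqI subsetD)
  qed
  show "a \<odot>\<^bsub>M\<^esub> b \<in> ?Y" if "a \<in> carrier R" "b \<in> ?Y" for a b
  proof -
    from that obtain x where x: "x \<in> X" "b = g \<odot>\<^bsub>M\<^esub> x" by blast
    then have "a \<odot>\<^bsub>M\<^esub> b = g \<odot>\<^bsub>M\<^esub> (a \<odot>\<^bsub>M\<^esub> x)"
      using smult_assoc1[of a g x] smult_assoc1[of g a x] X that assms(2) m_comm[of a g] by auto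
    then show ?thesis using X(4)[OF that(1) x(1)] by blast
  qed
qed

end

locale cartier_graded = cartier R p M \<kappa> for R (structure) and p and M (structure) and \<kappa> +
  fixes g :: "nat \<Rightarrow> 'a"
  assumes g: "\<And>e. g e \<in> carrier R"
begin

text \<open>The operation X |-> C_+ X for the algebra with C_e = kappa^e g_e R. Leaving g arbitrary
  covers all exponents lambda at once.\<close>

definition D where "D X = C_plus (add_monoid M) (cartier_alg R M \<kappa> g) X"

lemma D_eq: "D X = generate (add_monoid M) {K e ((g e \<otimes> r) \<odot>\<^bsub>M\<^esub> x) | e r x. e \<ge> 1 \<and> r \<in> carrier R \<and> x \<in> X}"
proof -
  let ?A = "{\<phi> x | \<phi> x. (\<exists>e\<ge>1. \<phi> \<in> cartier_alg R M \<kappa> g e) \<and> x \<in> X}"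
  let ?B = "{K e ((g e \<otimes> r) \<odot>\<^bsub>M\<^esub> x) | e r x. e \<ge> 1 \<and> r \<in> carrier R \<and> x \<in> X}"
  have "?A = ?B"
  proof (intro equalityI subsetI)
    fix y assume "y \<in> ?A"
    then obtain \<phi> x e where 1: "y = \<phi> x" "e \<ge> 1" "\<phi> \<in> cartier_alg R M \<kappa> g e" "x \<in> X" by blast
    then obtain r where "r \<in> carrier R" "\<phi> = (\<lambda>m. K e ((g e \<otimes> r) \<odot>\<^bsub>M\<^esub> m))" unfolding cartier_alg_def by blast
    then show "y \<in> ?B" using 1 by blast
  next
    fix y assume "y \<in> ?B"
    then obtain e r x where 1: "y = K e ((g e \<otimes> r) \<odot>\<^bsub>M\<^esub> x)" "e \<ge> 1" "r \<in> carrier R" "x \<in> X" by blast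
    then have "(\<lambda>m. K e ((g e \<otimes> r) \<odot>\<^bsub>M\<^esub> m)) \<in> cartier_alg R M \<kappa> g e" unfolding cartier_alg_def by blast
    then show "y \<in> ?A" using 1 by (intro CollectI exI[of _ "\<lambda>m. K e ((g e \<otimes> r) \<odot>\<^bsub>M\<^esub> m)"] exI[of _ x]) auto
  qed
  then show ?thesis unfolding D_def C_plus_def by simp
qed

lemma D_mono: assumes "X \<subseteq> Y" shows "D X \<subseteq> D Y"
  unfolding D_eq by (rule M.add.mono_generate) (use assms in blast)

lemma D_gen:
  assumes "submodule X R M" "e \<ge> 1" "x \<in> X" shows "K e (g e \<odot>\<^bsub>M\<^esub> x) \<in> D X"
  unfolding D_eq
proof (rule generate.incl, rule CollectI, intro exI conjI)
  show "K e (g e \<odot>\<^bsub>M\<^esub> x) = K e ((g e \<otimes> \<one>) \<odot>\<^bsub>M\<^esub> x)" using g by simp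
qed (use assms in auto)

lemma D_minimal:
  assumes X: "submodule X R M" and N: "submodule N R M"
    and gen: "\<And>e x. e \<ge> 1 \<Longrightarrow> x \<in> X \<Longrightarrow> K e (g e \<odot>\<^bsub>M\<^esub> x) \<in> N"
  shows "D X \<subseteq> N"
  unfolding D_eq
proof (rule M.add.generate_subgroup_incl)
  show "subgroup N (add_monoid M)" by (rule submodule.axioms(1)[OF N])
  show "{K e ((g e \<otimes> r) \<odot>\<^bsub>M\<^esub> x) | e r x. e \<ge> 1 \<and> r \<in> carrier R \<and> x \<in> X} \<subseteq> N"
  proof safe
    fix e :: nat and r x assume "1 \<le> e" "r \<in> carrier R" "x \<in> X"
    moreover from this have "(g e \<otimes> r) \<odot>\<^bsub>M\<^esub> x = g e \<odot>\<^bsub>M\<^esub> (r \<odot>\<^bsub>M\<^esub> x)"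
      using g submoduleE(1)[OF X] by (auto intro: smult_assoc1)
    ultimately show "K e ((g e \<otimes> r) \<odot>\<^bsub>M\<^esub> x) \<in> N" using gen submoduleE(4)[OF X] by simp
  qed
qed

text \<open>A scalar a passes into \<open>K e\<close> as a^(p^e) and is absorbed by the coefficient
  r. So the generators are closed under scalars, and the additive group they generate is a
  submodule.\<close>

lemma D_submodule: assumes X: "submodule X R M" shows "submodule (D X) R M"
proof (rule submodule.intro)
  let ?S = "{K e ((g e \<otimes> r) \<odot>\<^bsub>M\<^esub> x) | e r x. e \<ge> 1 \<and> r \<in> carrier R \<and> x \<in> X}"
  have S: "?S \<subseteq> carrier M" using g K_closed submoduleE(1)[OF X] by auto
  show sg: "subgroup (D X) (add_monoid M)" unfolding D_eq using S by (intro M.add.generate_is_subgroup) simp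
  have "a \<odot>\<^bsub>M\<^esub> y \<in> D X" if a: "a \<in> carrier R" and y: "y \<in> D X" for a y
    using y unfolding D_eq
  proof induct
    case one
    show ?case using a generate.one[of "add_monoid M"] by simp
  next
    case (incl h)
    then obtain e r x where h: "h = K e ((g e \<otimes> r) \<odot>\<^bsub>M\<^esub> x)" "e \<ge> 1" "r \<in> carrier R" "x \<in> X" by blast
    have xc: "x \<in> carrier M" using h submoduleE(1)[OF X] by auto
    have "a \<odot>\<^bsub>M\<^esub> h = K e (a [^] (p ^ e) \<odot>\<^bsub>M\<^esub> ((g e \<otimes> r) \<odot>\<^bsub>M\<^esub> x))"
      unfolding h(1) using K_smult[OF a, of "(g e \<otimes> r) \<odot>\<^bsub>M\<^esub> x" e] g h(3) xc by simp
    also have "a [^] (p ^ e) \<odot>\<^bsub>M\<^esub> ((g e \<otimes> r) \<odot>\<^bsub>M\<^esub> x) = (g e \<otimes> (r \<otimes> a [^] (p ^ e))) \<odot>\<^bsub>M\<^esub> x"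
      using a g h(3) xc by (simp add: smult_assoc1[symmetric] m_ac)
    finally have "a \<odot>\<^bsub>M\<^esub> h \<in> ?S" using h(2-4) a by blast
    then show ?case by (rule generate.incl)
  next
    case (inv h)
    then obtain e r x where h: "h = K e ((g e \<otimes> r) \<odot>\<^bsub>M\<^esub> x)" "e \<ge> 1" "r \<in> carrier R" "x \<in> X" by blast
    have xc: "x \<in> carrier M" using h submoduleE(1)[OF X] by auto
    have hc: "h \<in> carrier M" using inv S by blast
    have "a \<odot>\<^bsub>M\<^esub> h = K e (a [^] (p ^ e) \<odot>\<^bsub>M\<^esub> ((g e \<otimes> r) \<odot>\<^bsub>M\<^esub> x))"
      unfolding h(1) using K_smult[OF a, of "(g e \<otimes> r) \<odot>\<^bsub>M\<^esub> x" e] g h(3) xc by simp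
    also have "a [^] (p ^ e) \<odot>\<^bsub>M\<^esub> ((g e \<otimes> r) \<odot>\<^bsub>M\<^esub> x) = (g e \<otimes> (r \<otimes> a [^] (p ^ e))) \<odot>\<^bsub>M\<^esub> x"
      using a g h(3) xc by (simp add: smult_assoc1[symmetric] m_ac)
    finally have "a \<odot>\<^bsub>M\<^esub> h \<in> ?S" using h(2-4) a by blast
    then have "inv\<^bsub>add_monoid M\<^esub> (a \<odot>\<^bsub>M\<^esub> h) \<in> generate (add_monoid M) ?S" by (rule generate.inv)
    then show ?case using smult_r_minus[OF a hc] by (simp add: a_inv_def)
  next
    case (eng h1 h2)
    have "h1 \<in> carrier M" "h2 \<in> carrier M" using eng M.add.generate_in_carrier[of ?S] S by auto
    then show ?case using generate.eng[OF eng(2,4)] a by (simp add: smult_r_distr)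
  qed
  then show "submodule_axioms (D X) R M" unfolding submodule_axioms_def by blast
qed

definition Mn where "Mn n = (D ^^ n) (carrier M)"

lemma Mn_0: "Mn 0 = carrier M" and Mn_Suc: "Mn (Suc n) = D (Mn n)" by (simp_all add: Mn_def)

lemma Mn_submodule: "submodule (Mn n) R M"
  by (induct n) (auto simp: Mn_0 Mn_Suc D_submodule carrier_is_submodule)

lemma Mn_dec: "Mn (Suc n) \<subseteq> Mn n"
proof (induct n)
  case 0 then show ?case using submoduleE(1)[OF Mn_submodule] by (simp add: Mn_0)
next
  case (Suc n) then show ?case using D_mono by (simp add: Mn_Suc)
qed

text \<open>Since a enters \<open>K e\<close> as a^(p^e), only the action of the powers a^(p^e) on X
  matters.\<close>

lemma smult_D:
  assumes X: "submodule X R M" and N: "submodule N R M" and a: "a \<in> carrier R" and y: "y \<in> D X"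
    and ax: "\<And>e x. e \<ge> 1 \<Longrightarrow> x \<in> X \<Longrightarrow> a [^] (p ^ e) \<odot>\<^bsub>M\<^esub> x \<in> N"
  shows "a \<odot>\<^bsub>M\<^esub> y \<in> D N"
proof -
  have "D X \<subseteq> {y \<in> carrier M. a \<odot>\<^bsub>M\<^esub> y \<in> D N}"
  proof (rule D_minimal[OF X submodule_vimage_smult[OF D_submodule[OF N] a]])
    fix e :: nat and x assume e: "e \<ge> 1" and x: "x \<in> X"
    have xc: "x \<in> carrier M" using x submoduleE(1)[OF X] by blast
    have "a \<odot>\<^bsub>M\<^esub> K e (g e \<odot>\<^bsub>M\<^esub> x) = K e (a [^] (p ^ e) \<odot>\<^bsub>M\<^esub> (g e \<odot>\<^bsub>M\<^esub> x))"
      using K_smult[OF a, of "g e \<odot>\<^bsub>M\<^esub> x"] g xc by simp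
    also have "a [^] (p ^ e) \<odot>\<^bsub>M\<^esub> (g e \<odot>\<^bsub>M\<^esub> x) = g e \<odot>\<^bsub>M\<^esub> (a [^] (p ^ e) \<odot>\<^bsub>M\<^esub> x)"
      using a g xc by (simp add: smult_assoc1[symmetric] m_comm)
    also have "K e \<dots> \<in> D N" using D_gen[OF N e ax[OF e x]] .
    finally show "K e (g e \<odot>\<^bsub>M\<^esub> x) \<in> {y \<in> carrier M. a \<odot>\<^bsub>M\<^esub> y \<in> D N}" using K_closed g xc by simp
  qed
  then show ?thesis using y by blast
qed

text \<open>Because p^e is at least 2. Thus one step along the chain turns information about the
  square of a into information about a.\<close>

lemma pow_q_split: assumes "a \<in> carrier R" "e \<ge> 1" shows "\<exists>b\<in>carrier R. a [^] (p ^ e) = b \<otimes> (a \<otimes> a)"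
proof -
  have "p ^ e \<ge> 2" using prime_ge_2_nat[OF prime_p] power_increasing[of 1 e p] assms(2) by simp
  then obtain k where "p ^ e = Suc (Suc k)" by (metis add_2_eq_Suc le_Suc_ex)
  then have "a [^] (p ^ e) = a [^] k \<otimes> (a \<otimes> a)" using assms(1) by (simp add: m_assoc)
  then show ?thesis using assms(1) by blast
qed

text \<open>Hartshorne--Speiser--Gabber: were the chain unstable, it would be unstable at a prime \<open>P\<close> associated to the
  stable value \<open>I\<close> of the annihilators of successive quotients, but \<open>I\<close> is radical and its square already maps
  \<open>Mn n0\<close> into every term of the chain, leaving only a quotient of finite length at \<open>P\<close>.\<close>

theorem Mn_stable: "\<exists>n0. \<forall>n\<ge>n0. Mn n = Mn n0"
proof -
  interpret S: module R "self_mod R" by (rule module_self_mod)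
  define I where "I n = {a \<in> carrier R. \<forall>x\<in>Mn n. a \<odot>\<^bsub>M\<^esub> x \<in> Mn (Suc n)}" for n
  have Mc: "Mn n \<subseteq> carrier M" for n by (rule submoduleE(1)[OF Mn_submodule])
  have idI: "ideal (I n) R" for n unfolding I_def by (rule colon_ideal[OF Mn_submodule Mc])
  have up: "a \<in> I (Suc n)" if a: "a \<in> carrier R" and ax: "\<And>e x. e \<ge> 1 \<Longrightarrow> x \<in> Mn n \<Longrightarrow> a [^] (p ^ e) \<odot>\<^bsub>M\<^esub> x \<in> Mn (Suc n)" for a n
  proof -
    have "a \<odot>\<^bsub>M\<^esub> y \<in> Mn (Suc (Suc n))" if "y \<in> Mn (Suc n)" for y
      unfolding Mn_Suc[of "Suc n"]
      by (rule smult_D[OF Mn_submodule Mn_submodule a that[unfolded Mn_Suc] ax])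
    then show ?thesis using a unfolding I_def by blast
  qed
  have inc: "I n \<subseteq> I (Suc n)" for n
  proof
    fix a assume a: "a \<in> I n"
    then have ac: "a \<in> carrier R" unfolding I_def by blast
    show "a \<in> I (Suc n)"
    proof (rule up[OF ac])
      fix e :: nat and x assume e: "(e::nat) \<ge> 1" and x: "x \<in> Mn n"
      obtain b where b: "b \<in> carrier R" "a [^] (p ^ e) = b \<otimes> (a \<otimes> a)" using pow_q_split[OF ac e] by blast
      have "a [^] (p ^ e) \<in> I n" unfolding b(2) using a b ac by (intro ideal.I_l_closed[OF idI]) auto
      then show "a [^] (p ^ e) \<odot>\<^bsub>M\<^esub> x \<in> Mn (Suc n)" using x unfolding I_def by blast
    qed
  qed
  have "submodule (I n) R (self_mod R)" for n using idI by (simp add: submodule_self_mod_iff)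
  then obtain n0 where n0: "\<And>n. n \<ge> n0 \<Longrightarrow> I n = I n0"
    using S.ascending_chain[OF noeth_module_self_mod[OF no_ring], of I] inc by blast
  define J where "J = I n0"
  interpret J: ideal J R unfolding J_def by (rule idI)
  have Jn: "I n = J" if "n \<ge> n0" for n using n0 that unfolding J_def by blast
  have rad: "x \<in> J" if x: "x \<in> carrier R" "x \<otimes> x \<in> J" for x
  proof -
    have "x \<in> I (Suc n0)"
    proof (rule up[OF x(1)])
      fix e :: nat and y assume e: "(e::nat) \<ge> 1" and y: "y \<in> Mn n0"
      obtain b where b: "b \<in> carrier R" "x [^] (p ^ e) = b \<otimes> (x \<otimes> x)" using pow_q_split[OF x(1) e] by blast
      have "x [^] (p ^ e) \<in> I n0" unfolding b(2) using x b J.I_l_closed J_def by blast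
      then show "x [^] (p ^ e) \<odot>\<^bsub>M\<^esub> y \<in> Mn (Suc n0)" using y unfolding I_def by blast
    qed
    then show ?thesis using Jn[of "Suc n0"] by simp
  qed
  have "J = carrier R"
  proof (rule ccontr)
    assume "J \<noteq> carrier R"
    then have one: "\<one> \<notin> J" using J.one_imp_carrier by blast
    \<comment> \<open>A maximal member among the proper colon ideals (J : s) is prime; it is the
      associated prime P.\<close>
    define F where "F = {{a \<in> carrier R. s \<otimes> a \<in> J} | s. s \<in> carrier R \<and> s \<notin> J}"
    have "F \<noteq> {}" using one unfolding F_def by blast
    moreover have "submodule N R (self_mod R)" if "N \<in> F" for N
      using that J.helper_max_prime[OF is_cring] unfolding F_def by (auto simp: submodule_self_mod_iff)
    ultimately obtain P where P: "P \<in> F" "\<And>P'. P' \<in> F \<Longrightarrow> P \<subseteq> P' \<Longrightarrow> P' = P"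
      using S.maximal_submodule[OF noeth_module_self_mod[OF no_ring], of F] by blast
    then obtain s where s: "s \<in> carrier R" "s \<notin> J" "P = {a \<in> carrier R. s \<otimes> a \<in> J}" unfolding F_def by blast
    have iP: "ideal P R" unfolding s(3) by (rule J.helper_max_prime[OF is_cring s(1)])
    have prime: "primeideal P R"
    proof (rule primeidealI[OF iP is_cring])
      have "\<one> \<notin> P" using s by simp
      then show "carrier R \<noteq> P" by auto
      fix a b assume ab: "a \<in> carrier R" "b \<in> carrier R" "a \<otimes> b \<in> P"
      show "a \<in> P \<or> b \<in> P"
      proof (rule disjCI, rule ccontr)
        assume bP: "b \<notin> P" and aP: "a \<notin> P"
        let ?P' = "{c \<in> carrier R. (s \<otimes> a) \<otimes> c \<in> J}"
        have "s \<otimes> a \<notin> J" using aP ab s by auto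
        then have "?P' \<in> F" using s ab unfolding F_def by blast
        moreover have "P \<subseteq> ?P'"
        proof
          fix c assume c: "c \<in> P"
          then have "(s \<otimes> a) \<otimes> c = a \<otimes> (s \<otimes> c)" using s ab by (simp add: m_ac)
          then show "c \<in> ?P'" using c s ab J.I_l_closed by auto
        qed
        ultimately have "?P' = P" using P(2) by blast
        moreover have "b \<in> ?P'" using ab s by (auto simp: m_assoc)
        ultimately show False using bP by simp
      qed
    qed
    interpret P: primeideal P R by (rule prime)
    \<comment> \<open>Membership would mean that the square of s lies in J, hence s itself, as J is
      radical.\<close>
    have sP: "s \<notin> P" using rad[OF s(1)] s(2) unfolding s(3) by blast
    have JP: "J \<subseteq> P" unfolding s(3) using J.Icarr J.I_l_closed s(1) by blast
    \<comment> \<open>The factor y moves z one step down the chain, and x^(p^e) is a multiple of the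
      square of x, so the claim for the pair x, x at index j yields the next index.\<close>
    have sq: "x \<odot>\<^bsub>M\<^esub> (y \<odot>\<^bsub>M\<^esub> z) \<in> Mn (n0 + j)" if "x \<in> J" "y \<in> J" "z \<in> Mn n0" for x y z j
      using that
    proof (induct j arbitrary: x y z)
      case 0
      then show ?case using submoduleE(4)[OF Mn_submodule] J.Icarr by simp
    next
      case (Suc j)
      have xc: "x \<in> carrier R" using Suc J.Icarr by blast
      have "y \<odot>\<^bsub>M\<^esub> z \<in> Mn (Suc n0)" using Suc.prems(2,3) unfolding J_def I_def by blast
      then have yz: "y \<odot>\<^bsub>M\<^esub> z \<in> D (Mn n0)" by (simp add: Mn_Suc)
      have "x \<odot>\<^bsub>M\<^esub> (y \<odot>\<^bsub>M\<^esub> z) \<in> D (Mn (n0 + j))"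
      proof (rule smult_D[OF Mn_submodule Mn_submodule xc yz])
        fix e :: nat and w assume e: "(e::nat) \<ge> 1" and w: "w \<in> Mn n0"
        obtain b where b: "b \<in> carrier R" "x [^] (p ^ e) = b \<otimes> (x \<otimes> x)" using pow_q_split[OF xc e] by blast
        have "x [^] (p ^ e) \<odot>\<^bsub>M\<^esub> w = b \<odot>\<^bsub>M\<^esub> (x \<odot>\<^bsub>M\<^esub> (x \<odot>\<^bsub>M\<^esub> w))"
          unfolding b(2) using b(1) xc w Mc by (simp add: smult_assoc1 subset_iff)
        then show "x [^] (p ^ e) \<odot>\<^bsub>M\<^esub> w \<in> Mn (n0 + j)"
          using submoduleE(4)[OF Mn_submodule b(1) Suc.hyps[OF Suc.prems(1,1) w]] by simp
      qed
      then show ?case by (simp add: Mn_Suc)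
    qed
    have Z: "desc_chain R M Mn" unfolding desc_chain_def using Mn_submodule Mn_dec by blast
    let ?X = "Mn n0"
    let ?PX = "ideal_smult M R P ?X"
    let ?PPX = "ideal_smult M R P ?PX"
    have sPX: "submodule ?PX R M" by (rule ideal_smult_submodule[OF P.a_subset Mc])
    have sPPX: "submodule ?PPX R M" by (rule ideal_smult_submodule[OF P.a_subset submoduleE(1)[OF sPX]])
    \<comment> \<open>Two factors P are split off because s P lies in J and \<open>sq\<close>
      consumes two factors from J.\<close>
    have "loc_stable R M P Mn ?X ?PPX"
      by (rule loc_stable_trans[OF prime Z sPX sPPX Mc
          loc_stable_ideal_smult[OF prime Z no_mod Mn_submodule] loc_stable_ideal_smult[OF prime Z no_mod sPX]])
    then obtain n1 where n1: "\<forall>n\<ge>n1. \<exists>t\<in>carrier R - P. \<forall>z\<in>Mn n \<inter> ?X. \<exists>z'\<in>Mn (Suc n). \<exists>y\<in>?PPX. t \<odot>\<^bsub>M\<^esub> z = z' \<oplus>\<^bsub>M\<^esub> y"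
      unfolding loc_stable_def by (elim exE)
    define i where "i = n0 + n1"
    have i: "n1 \<le> i" "n0 \<le> i" unfolding i_def by auto
    obtain t where t: "t \<in> carrier R - P" "\<forall>z\<in>Mn i \<inter> ?X. \<exists>z'\<in>Mn (Suc i). \<exists>y\<in>?PPX. t \<odot>\<^bsub>M\<^esub> z = z' \<oplus>\<^bsub>M\<^esub> y"
      using n1[rule_format, OF i(1)] by (elim bexE)
    have MiX: "Mn i \<subseteq> ?X" using lift_Suc_antimono_le[of Mn, OF Mn_dec i(2)] .
    have key: "s \<odot>\<^bsub>M\<^esub> (s \<odot>\<^bsub>M\<^esub> y) \<in> Mn (Suc i)" if y: "y \<in> ?PPX" for y
    proof -
      have ssc: "s \<otimes> s \<in> carrier R" using s(1) by simp
      have in1: "(s \<otimes> s) \<odot>\<^bsub>M\<^esub> (b \<odot>\<^bsub>M\<^esub> (c \<odot>\<^bsub>M\<^esub> x)) \<in> Mn (Suc i)" if "b \<in> P" "c \<in> P" "x \<in> ?X" for b c x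
      proof -
        have cc: "b \<in> carrier R" "c \<in> carrier R" "x \<in> carrier M" using that P.Icarr Mc by auto
        have "(s \<otimes> s) \<odot>\<^bsub>M\<^esub> (b \<odot>\<^bsub>M\<^esub> (c \<odot>\<^bsub>M\<^esub> x)) = (s \<otimes> b) \<odot>\<^bsub>M\<^esub> ((s \<otimes> c) \<odot>\<^bsub>M\<^esub> x)"
          using s(1) cc by (simp add: smult_assoc1[symmetric] m_ac)
        moreover have "s \<otimes> b \<in> J" "s \<otimes> c \<in> J" using that(1,2) unfolding s(3) by auto
        ultimately show ?thesis using sq[of "s \<otimes> b" "s \<otimes> c" x "Suc n1"] that(3) unfolding i_def by simp
      qed
      have in2: "(s \<otimes> s) \<odot>\<^bsub>M\<^esub> (b \<odot>\<^bsub>M\<^esub> w) \<in> Mn (Suc i)" if b: "b \<in> P" and w: "w \<in> ?PX" for b w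
      proof -
        have bc: "b \<in> carrier R" using P.Icarr b by blast
        have "?PX \<subseteq> {w \<in> carrier M. b \<odot>\<^bsub>M\<^esub> w \<in> {w \<in> carrier M. (s \<otimes> s) \<odot>\<^bsub>M\<^esub> w \<in> Mn (Suc i)}}"
        proof (rule ideal_smult_minimal[OF submodule_vimage_smult[OF submodule_vimage_smult[OF Mn_submodule ssc] bc]])
          fix a x assume ax: "a \<in> P" "x \<in> ?X"
          then have "a \<in> carrier R" "x \<in> carrier M" using P.Icarr Mc by blast+
          then show "a \<odot>\<^bsub>M\<^esub> x \<in> {w \<in> carrier M. b \<odot>\<^bsub>M\<^esub> w \<in> {w \<in> carrier M. (s \<otimes> s) \<odot>\<^bsub>M\<^esub> w \<in> Mn (Suc i)}}"
            using in1[OF b ax] bc by simp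
        qed
        then show ?thesis using w by blast
      qed
      have "?PPX \<subseteq> {w \<in> carrier M. (s \<otimes> s) \<odot>\<^bsub>M\<^esub> w \<in> Mn (Suc i)}"
      proof (rule ideal_smult_minimal[OF submodule_vimage_smult[OF Mn_submodule ssc]])
        fix a x assume ax: "a \<in> P" "x \<in> ?PX"
        then have "a \<in> carrier R" "x \<in> carrier M" using P.Icarr submoduleE(1)[OF sPX] by blast+
        then show "a \<odot>\<^bsub>M\<^esub> x \<in> {w \<in> carrier M. (s \<otimes> s) \<odot>\<^bsub>M\<^esub> w \<in> Mn (Suc i)}" using in2[OF ax] by simp
      qed
      then show ?thesis using y s(1) by (auto simp: smult_assoc1)
    qed
    \<comment> \<open>Modulo \<open>?PPX\<close>, t carries \<open>Mn i\<close> into the next term,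
      and s s takes care of the remainder by \<open>key\<close>. So s s t lies in J and hence in P,
      although s and t do not.\<close>
    have "(s \<otimes> s) \<otimes> t \<in> I i"
    proof -
      have "((s \<otimes> s) \<otimes> t) \<odot>\<^bsub>M\<^esub> z \<in> Mn (Suc i)" if z: "z \<in> Mn i" for z
      proof -
        obtain z' y where zy: "z' \<in> Mn (Suc i)" "y \<in> ?PPX" "t \<odot>\<^bsub>M\<^esub> z = z' \<oplus>\<^bsub>M\<^esub> y"
          using t(2) z MiX by blast
        have cc: "z \<in> carrier M" "z' \<in> carrier M" "y \<in> carrier M" "t \<in> carrier R"
          using z zy Mc submoduleE(1)[OF sPPX] t by auto
        have "((s \<otimes> s) \<otimes> t) \<odot>\<^bsub>M\<^esub> z = (s \<otimes> s) \<odot>\<^bsub>M\<^esub> (t \<odot>\<^bsub>M\<^esub> z)" using s(1) cc by (simp add: smult_assoc1)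
        also have "\<dots> = (s \<otimes> s) \<odot>\<^bsub>M\<^esub> z' \<oplus>\<^bsub>M\<^esub> s \<odot>\<^bsub>M\<^esub> (s \<odot>\<^bsub>M\<^esub> y)"
          unfolding zy(3) using s(1) cc by (simp add: smult_r_distr smult_assoc1)
        also have "\<dots> \<in> Mn (Suc i)"
          using submoduleE(5)[OF Mn_submodule submoduleE(4)[OF Mn_submodule _ zy(1)] key[OF zy(2)]] s(1) by simp
        finally show ?thesis .
      qed
      then show ?thesis unfolding I_def using s(1) t(1) by auto
    qed
    then have "(s \<otimes> s) \<otimes> t \<in> P" using Jn[OF i(2)] JP by blast
    then show False using P.I_prime[of "s \<otimes> s" t] P.I_prime[of s s] s(1) t(1) sP by auto
  qed
  have "Mn n \<subseteq> Mn (Suc n)" if "n \<ge> n0" for n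
  proof
    fix x assume x: "x \<in> Mn n"
    have "\<one> \<in> I n" using Jn[OF that] \<open>J = carrier R\<close> by simp
    then have "\<one> \<odot>\<^bsub>M\<^esub> x \<in> Mn (Suc n)" using x unfolding I_def by blast
    moreover have "x \<in> carrier M" using x Mc by blast
    ultimately show "x \<in> Mn (Suc n)" by simp
  qed
  then have eq: "Mn (Suc n) = Mn n" if "n \<ge> n0" for n using Mn_dec[of n] that by blast
  have "Mn (n0 + k) = Mn n0" for k by (induct k) (simp_all add: eq)
  then show ?thesis by (metis le_iff_add)
qed

end

section \<open>Non-F-pure submodules\<close>

locale cartier_f = cartier R p M \<kappa> for R (structure) and p and M (structure) and \<kappa> +
  fixes f
  assumes f: "f \<in> carrier R"
begin

text \<open>The exponent of f in degree e of the algebra that defines sigma(M, f^l).\<close>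

definition ex :: "rat \<Rightarrow> nat \<Rightarrow> nat" where "ex l e = nat \<lceil>l * (of_nat p ^ e - 1)\<rceil>"

lemma cartier_graded_pow: "cartier_graded R p M \<kappa> (\<lambda>e. f [^] ex l e)"
  by unfold_locales (use f in simp)

abbreviation DD where "DD l \<equiv> cartier_graded.D R M \<kappa> (\<lambda>e. f [^] ex l e)"

lemma sigma_alg_eq: "C_plus (add_monoid M) (sigma_alg p R M \<kappa> f l) = DD l"
proof -
  interpret G: cartier_graded R p M \<kappa> "\<lambda>e. f [^] ex l e" by (rule cartier_graded_pow)
  show ?thesis unfolding sigma_alg_def ex_def[symmetric] by (rule ext) (simp only: G.D_def)
qed

definition chain :: "rat \<Rightarrow> nat \<Rightarrow> _ set" where "chain l n = (DD l ^^ n) (carrier M)"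

lemma chain_submodule: "submodule (chain l n) R M"
proof -
  interpret G: cartier_graded R p M \<kappa> "\<lambda>e. f [^] ex l e" by (rule cartier_graded_pow)
  show ?thesis using G.Mn_submodule[of n] unfolding G.Mn_def chain_def .
qed

text \<open>Stabilization of the chain, from \<open>Mn_stable\<close>, makes the definite
  description in \<open>sigma\<close> meaningful.\<close>

lemma sigma_eq: "\<exists>h0. \<forall>h\<ge>h0. chain l h = sigma p R M \<kappa> f l"
proof -
  interpret G: cartier_graded R p M \<kappa> "\<lambda>e. f [^] ex l e" by (rule cartier_graded_pow)
  obtain n0 where n0: "\<forall>n\<ge>n0. chain l n = chain l n0"
    using G.Mn_stable unfolding G.Mn_def chain_def by blast
  have "sigma p R M \<kappa> f l = chain l n0"
    unfolding sigma_def sigma_alg_eq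
  proof (rule the_equality)
    show "\<exists>h0. \<forall>h\<ge>h0. (DD l ^^ h) (carrier M) = chain l n0" using n0 unfolding chain_def by blast
    fix N assume "\<exists>h0. \<forall>h\<ge>h0. (DD l ^^ h) (carrier M) = N"
    then obtain h0 where "\<forall>h\<ge>h0. chain l h = N" unfolding chain_def by blast
    then show "N = chain l n0" using n0 by (metis max.cobounded1 max.cobounded2)
  qed
  then show ?thesis using n0 by metis
qed

lemma sigma_submodule: "submodule (sigma p R M \<kappa> f l) R M"
  using sigma_eq[of l] chain_submodule by (metis order_refl)

lemma of_ex_ge: "of_nat (ex l e) \<ge> l * (of_nat p ^ e - 1)"
proof -
  have "l * (of_nat p ^ e - 1) \<le> of_int \<lceil>l * (of_nat p ^ e - 1)\<rceil>" by (rule le_of_int_ceiling)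
  also have "\<dots> \<le> of_int (int (ex l e))" unfolding of_int_le_iff ex_def by simp
  finally show ?thesis by simp
qed

lemma p_pow_ge1: "(1::rat) \<le> of_nat p ^ e"
  using prime_gt_0_nat[OF prime_p] by (simp add: one_le_power)

lemma f_split:
  assumes "x \<in> carrier M" "m \<le> n" shows "(f [^] (n::nat)) \<odot>\<^bsub>M\<^esub> x = (f [^] m) \<odot>\<^bsub>M\<^esub> ((f [^] (n - m)) \<odot>\<^bsub>M\<^esub> x)"
  using assms f by (simp add: smult_assoc1[symmetric] nat_pow_mult)

text \<open>The map kappa^r turns a factor f^(n p^r) into f^n. The comparisons of exponents below
  rest on this identity.\<close>

lemma K_factor:
  assumes x: "x \<in> carrier M" and k: "n * p ^ r \<le> k"
  shows "K (e + r) ((f [^] k) \<odot>\<^bsub>M\<^esub> x) = K e ((f [^] n) \<odot>\<^bsub>M\<^esub> K r ((f [^] (k - n * p ^ r)) \<odot>\<^bsub>M\<^esub> x))"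
proof -
  let ?y = "(f [^] (k - n * p ^ r)) \<odot>\<^bsub>M\<^esub> x"
  have y: "?y \<in> carrier M" using f x by simp
  have "(f [^] k) \<odot>\<^bsub>M\<^esub> x = (f [^] (n * p ^ r)) \<odot>\<^bsub>M\<^esub> ?y" using f_split[OF x k] .
  also have "f [^] (n * p ^ r) = (f [^] n) [^] (p ^ r)" using f by (simp add: nat_pow_pow)
  finally have "K r ((f [^] k) \<odot>\<^bsub>M\<^esub> x) = (f [^] n) \<odot>\<^bsub>M\<^esub> K r ?y" using K_smult[of "f [^] n" ?y r] f y by simp
  then show ?thesis by (simp add: funpow_add)
qed

lemma ex_mono: "l \<le> l' \<Longrightarrow> ex l e \<le> ex l' e"
  unfolding ex_def using p_pow_ge1[of e] by (intro nat_mono ceiling_mono mult_right_mono) auto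

lemma chain_antimono:
  assumes "l \<le> l'" shows "chain l' n \<subseteq> chain l n"
proof (induct n)
  case 0 then show ?case by (simp add: chain_def)
next
  case (Suc n)
  interpret G: cartier_graded R p M \<kappa> "\<lambda>e. f [^] ex l e" by (rule cartier_graded_pow)
  interpret G': cartier_graded R p M \<kappa> "\<lambda>e. f [^] ex l' e" by (rule cartier_graded_pow)
  have S: "chain l (Suc n) = DD l (chain l n)" "chain l' (Suc n) = DD l' (chain l' n)" by (simp_all add: chain_def)
  show ?case unfolding S
  proof (rule G'.D_minimal[OF chain_submodule G.D_submodule[OF chain_submodule]])
    fix e x assume e: "(e::nat) \<ge> 1" and "x \<in> chain l' n"
    then have x: "x \<in> chain l n" using Suc by blast
    have xc: "x \<in> carrier M" using x submoduleE(1)[OF chain_submodule] by blast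
    have "(f [^] (ex l' e - ex l e)) \<odot>\<^bsub>M\<^esub> x \<in> chain l n" using submoduleE(4)[OF chain_submodule _ x] f by simp
    then have "K e ((f [^] ex l e) \<odot>\<^bsub>M\<^esub> ((f [^] (ex l' e - ex l e)) \<odot>\<^bsub>M\<^esub> x)) \<in> DD l (chain l n)"
      by (rule G.D_gen[OF chain_submodule e])
    then show "K e ((f [^] ex l' e) \<odot>\<^bsub>M\<^esub> x) \<in> DD l (chain l n)"
      using f_split[OF xc ex_mono[OF assms], of e] by simp
  qed
qed

lemma sigma_antimono: "l \<le> l' \<Longrightarrow> sigma p R M \<kappa> f l' \<subseteq> sigma p R M \<kappa> f l"
proof -
  assume l: "l \<le> l'"
  obtain h0 h1 where "\<forall>h\<ge>h0. chain l h = sigma p R M \<kappa> f l" "\<forall>h\<ge>h1. chain l' h = sigma p R M \<kappa> f l'"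
    using sigma_eq by metis
  then show ?thesis using chain_antimono[OF l, of "max h0 h1"] by simp
qed

text \<open>The modules grow as epsilon shrinks. Along epsilon = 1/(i+1) they become constant by the
  ascending chain condition, and monotonicity squeezes every smaller epsilon between two terms of
  this sequence.\<close>

lemma sigma_plus_eq: "\<exists>\<delta>>0. \<forall>\<epsilon>. 0 < \<epsilon> \<and> \<epsilon> < \<delta> \<longrightarrow> sigma p R M \<kappa> f (l + \<epsilon>) = sigma_plus p R M \<kappa> f l"
proof -
  let ?N = "\<lambda>i::nat. sigma p R M \<kappa> f (l + 1 / of_nat (Suc i))"
  have "?N i \<subseteq> ?N (Suc i)" for i by (rule sigma_antimono) (simp add: frac_le)
  then obtain i0 where i0: "\<And>i. i \<ge> i0 \<Longrightarrow> ?N i = ?N i0"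
    using ascending_chain[OF no_mod, of ?N] sigma_submodule by blast
  define \<delta> :: rat where "\<delta> = 1 / of_nat (Suc i0)"
  have d: "\<delta> > 0" unfolding \<delta>_def by simp
  have eq: "sigma p R M \<kappa> f (l + \<epsilon>) = ?N i0" if e: "0 < \<epsilon> \<and> \<epsilon> < \<delta>" for \<epsilon>
  proof
    show "?N i0 \<subseteq> sigma p R M \<kappa> f (l + \<epsilon>)" by (rule sigma_antimono) (use e in \<open>simp add: \<delta>_def\<close>)
    obtain n where n: "1 / \<epsilon> < of_nat n" using reals_Archimedean2 by blast
    define i where "i = max i0 n"
    have "1 / \<epsilon> < of_nat (Suc i)" using n by (rule less_le_trans) (simp add: i_def)
    then have "1 / of_nat (Suc i) < \<epsilon>" using e by (simp add: field_simps)
    then have "sigma p R M \<kappa> f (l + \<epsilon>) \<subseteq> ?N i" by (intro sigma_antimono) simp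
    then show "sigma p R M \<kappa> f (l + \<epsilon>) \<subseteq> ?N i0" using i0[of i] unfolding i_def by simp
  qed
  have "sigma_plus p R M \<kappa> f l = ?N i0"
    unfolding sigma_plus_def
  proof (rule the_equality)
    show "\<exists>\<delta>>0. \<forall>\<epsilon>. 0 < \<epsilon> \<and> \<epsilon> < \<delta> \<longrightarrow> sigma p R M \<kappa> f (l + \<epsilon>) = ?N i0" using d eq by blast
    fix N assume "\<exists>\<delta>>0. \<forall>\<epsilon>. 0 < \<epsilon> \<and> \<epsilon> < \<delta> \<longrightarrow> sigma p R M \<kappa> f (l + \<epsilon>) = N"
    then obtain \<delta>' where d': "\<delta>' > 0" "\<And>\<epsilon>. 0 < \<epsilon> \<and> \<epsilon> < \<delta>' \<Longrightarrow> sigma p R M \<kappa> f (l + \<epsilon>) = N" by blast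
    let ?e = "min \<delta> \<delta>' / 2"
    have "0 < ?e" "?e < \<delta>" "?e < \<delta>'" using d d'(1) by (auto simp: min_def)
    then show "N = ?N i0" using eq[of ?e] d'(2)[of ?e] by simp
  qed
  then show ?thesis using d eq by metis
qed

definition img where "img e n = K e ` ((\<lambda>x. (f [^] (n::nat)) \<odot>\<^bsub>M\<^esub> x) ` carrier M)"

lemma img_submodule: "submodule (img e n) R M"
  unfolding img_def using f by (intro K_image_submodule smult_image_submodule carrier_is_submodule) simp

lemma imgI: "x \<in> carrier M \<Longrightarrow> K e ((f [^] n) \<odot>\<^bsub>M\<^esub> x) \<in> img e n"
  unfolding img_def by blast

text \<open>Elements of C_+^h M are sums of terms kappa^e'(f^k x) with e' at least h and k at least
  l (p^e' - 1). This unrounded bound survives composition, since l (p^(a+b) - 1) = l (p^a - 1) p^b +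
  l (p^b - 1). The hypothesis is what is needed to pull kappa^e f^n out of each term of degree at
  least e.\<close>

lemma chain_le_img:
  assumes n: "\<And>r k. of_nat k \<ge> l * (of_nat p ^ (e + r) - 1) \<Longrightarrow> n * p ^ r \<le> k"
  shows "chain l e \<subseteq> img e n"
proof -
  interpret G: cartier_graded R p M \<kappa> "\<lambda>e. f [^] ex l e" by (rule cartier_graded_pow)
  define W where "W h = mspan R M {K e' ((f [^] k) \<odot>\<^bsub>M\<^esub> x) | e' k x. e' \<ge> h \<and> of_nat k \<ge> l * (of_nat p ^ e' - 1) \<and> x \<in> carrier M}" for h
  have c: "{K e' ((f [^] k) \<odot>\<^bsub>M\<^esub> x) | e' k x. e' \<ge> h \<and> of_nat k \<ge> l * (of_nat p ^ e' - 1) \<and> x \<in> carrier M} \<subseteq> carrier M" for h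
    using f K_closed by auto
  have W: "submodule (W h) R M" for h unfolding W_def by (rule mspan_submodule[OF c])
  have "chain l h \<subseteq> W h" for h
  proof (induct h)
    case 0
    have "x \<in> W 0" if x: "x \<in> carrier M" for x
    proof -
      have "K 0 ((f [^] (0::nat)) \<odot>\<^bsub>M\<^esub> x) \<in> W 0" unfolding W_def
        by (rule mspan_superset, rule CollectI, rule exI[of _ 0], rule exI[of _ 0], rule exI[of _ x]) (use x in auto)
      then show ?thesis using x by simp
    qed
    then show ?case by (auto simp: chain_def)
  next
    case (Suc h)
    have S: "chain l (Suc h) = DD l (chain l h)" by (simp add: chain_def)
    show ?case unfolding S
    proof (rule subset_trans[OF G.D_mono[OF Suc] G.D_minimal[OF W W]])
      fix e1 x assume e1: "(e1::nat) \<ge> 1" and x: "x \<in> W h"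
      let ?E = "f [^] ex l e1"
      \<comment> \<open>The quantifier over a makes this a submodule, as \<open>K e1\<close> is
        linear only over p^e1-th powers.\<close>
      let ?U = "{x \<in> carrier M. \<forall>a\<in>carrier R. K e1 (?E \<odot>\<^bsub>M\<^esub> (a \<odot>\<^bsub>M\<^esub> x)) \<in> W (Suc h)}"
      note W' = submoduleE[OF W[of "Suc h"]] submodule_zero[OF W[of "Suc h"]]
      have U: "submodule ?U R M"
      proof (rule submoduleI')
        show "\<zero>\<^bsub>M\<^esub> \<in> ?U" using f K_zero W' by simp
        show "a \<oplus>\<^bsub>M\<^esub> b \<in> ?U" if "a \<in> ?U" "b \<in> ?U" for a b
          using that f W'(5) by (simp add: smult_r_distr K_add)
        show "a \<odot>\<^bsub>M\<^esub> y \<in> ?U" if a: "a \<in> carrier R" and y: "y \<in> ?U" for a y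
          using a y by (simp add: smult_assoc1[symmetric])
      qed auto
      have "W h \<subseteq> ?U"
        unfolding W_def[of h]
      proof (rule mspan_minimal[OF U], safe)
        fix e' k y assume *: "h \<le> e'" "l * (of_nat p ^ e' - 1) \<le> of_nat k" "y \<in> carrier M"
        show "K e' ((f [^] k) \<odot>\<^bsub>M\<^esub> y) \<in> carrier M" using f * K_closed by simp
        fix a assume a: "a \<in> carrier R"
        let ?z = "(a [^] (p ^ e')) \<odot>\<^bsub>M\<^esub> y"
        have zc: "?z \<in> carrier M" using a * by simp
        have "a \<odot>\<^bsub>M\<^esub> K e' ((f [^] k) \<odot>\<^bsub>M\<^esub> y) = K e' ((a [^] (p ^ e')) \<odot>\<^bsub>M\<^esub> ((f [^] k) \<odot>\<^bsub>M\<^esub> y))"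
          using K_smult[OF a, of "(f [^] k) \<odot>\<^bsub>M\<^esub> y" e'] f * by simp
        also have "(a [^] (p ^ e')) \<odot>\<^bsub>M\<^esub> ((f [^] k) \<odot>\<^bsub>M\<^esub> y) = (f [^] k) \<odot>\<^bsub>M\<^esub> ?z"
          using a f * by (simp add: smult_assoc1[symmetric] m_comm)
        finally have 1: "a \<odot>\<^bsub>M\<^esub> K e' ((f [^] k) \<odot>\<^bsub>M\<^esub> y) = K e' ((f [^] k) \<odot>\<^bsub>M\<^esub> ?z)" .
        let ?k = "ex l e1 * p ^ e' + k"
        have 2: "K e1 (?E \<odot>\<^bsub>M\<^esub> K e' ((f [^] k) \<odot>\<^bsub>M\<^esub> ?z)) = K (e1 + e') ((f [^] ?k) \<odot>\<^bsub>M\<^esub> ?z)"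
          using K_factor[OF zc, of "ex l e1" e' ?k e1] by simp
        have "l * (of_nat p ^ (e1 + e') - 1) = l * (of_nat p ^ e1 - 1) * of_nat p ^ e' + l * (of_nat p ^ e' - 1)"
          by (simp add: power_add algebra_simps)
        also have "\<dots> \<le> of_nat (ex l e1) * of_nat p ^ e' + of_nat k"
          using of_ex_ge[of l e1] *(2) by (intro add_mono mult_right_mono) auto
        finally have "l * (of_nat p ^ (e1 + e') - 1) \<le> of_nat ?k" by simp
        then have "K (e1 + e') ((f [^] ?k) \<odot>\<^bsub>M\<^esub> ?z) \<in> W (Suc h)"
          unfolding W_def using e1 *(1) zc by (intro mspan_superset CollectI exI conjI refl) auto
        then show "K e1 (?E \<odot>\<^bsub>M\<^esub> (a \<odot>\<^bsub>M\<^esub> K e' ((f [^] k) \<odot>\<^bsub>M\<^esub> y))) \<in> W (Suc h)" using 1 2 by simp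
      qed
      then have xU: "x \<in> ?U" using x by blast
      then have "K e1 (?E \<odot>\<^bsub>M\<^esub> (\<one> \<odot>\<^bsub>M\<^esub> x)) \<in> W (Suc h)" by blast
      then show "K e1 (?E \<odot>\<^bsub>M\<^esub> x) \<in> W (Suc h)" using xU by simp
    qed
  qed
  moreover have "W e \<subseteq> img e n"
    unfolding W_def
  proof (rule mspan_minimal[OF img_submodule], safe)
    fix e' k x assume "e \<le> e'" and k: "l * (of_nat p ^ e' - 1) \<le> of_nat k" and x: "x \<in> carrier M"
    then obtain r where r: "e' = e + r" using le_Suc_ex by blast
    have "n * p ^ r \<le> k" using n k unfolding r by blast
    then show "K e' ((f [^] k) \<odot>\<^bsub>M\<^esub> x) \<in> img e n"
      unfolding r K_factor[OF x \<open>n * p ^ r \<le> k\<close>] using f x K_closed by (intro imgI) simp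
  qed
  ultimately show ?thesis by blast
qed

lemma Gr_trivial_le:
  assumes "carrier (Gr_sigma p R M \<kappa> f l) = {\<one>\<^bsub>Gr_sigma p R M \<kappa> f l\<^esub>}"
  shows "sigma p R M \<kappa> f l \<subseteq> sigma_plus p R M \<kappa> f l"
proof
  fix x assume x: "x \<in> sigma p R M \<kappa> f l"
  let ?G = "add_monoid (M\<lparr>carrier := sigma p R M \<kappa> f l\<rparr>)" and ?H = "sigma_plus p R M \<kappa> f l"
  obtain \<delta> where \<delta>: "\<delta> > 0" "\<forall>\<epsilon>. 0 < \<epsilon> \<and> \<epsilon> < \<delta> \<longrightarrow> sigma p R M \<kappa> f (l + \<epsilon>) = ?H"
    using sigma_plus_eq by blast
  then have H: "?H = sigma p R M \<kappa> f (l + \<delta> / 2)" by (metis half_gt_zero field_sum_of_halves less_add_same_cancel1)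
  have zero: "\<zero>\<^bsub>M\<^esub> \<in> ?H" unfolding H by (rule submodule_zero[OF sigma_submodule])
  have "carrier (?G Mod ?H) = {?H}"
    using assms unfolding Gr_sigma_def A_FactGroup_def by (simp add: FactGroup_def)
  moreover have "?H #>\<^bsub>?G\<^esub> x \<in> carrier (?G Mod ?H)"
    using x unfolding FactGroup_def RCOSETS_def by auto
  ultimately have "?H #>\<^bsub>?G\<^esub> x = ?H" by blast
  moreover have "\<zero>\<^bsub>M\<^esub> \<oplus>\<^bsub>M\<^esub> x \<in> ?H #>\<^bsub>?G\<^esub> x" using zero unfolding r_coset_def by auto
  moreover have "x \<in> carrier M" using x submoduleE(1)[OF sigma_submodule] by blast
  ultimately show "x \<in> ?H" by simp
qed

text \<open>When l (p^a - 1) and l (p^e - 1) are integers, no rounding occurs: n = na p^(e-a) + n'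
  with n' = l (p^(e-a) - 1). So kappa^e f^n is kappa^a f^na applied after kappa^(e-a) f^n', and j
  repetitions exhibit j factors from C_+.\<close>

lemma img_le_chain:
  assumes a: "a \<ge> 1" "l * (of_nat p ^ a - 1) = of_nat na" and l: "l \<ge> 0"
  shows "a * j \<le> e \<Longrightarrow> l * (of_nat p ^ e - 1) = of_nat n \<Longrightarrow> img e n \<subseteq> chain l j"
proof (induct j arbitrary: e n)
  case 0
  then show ?case using submoduleE(1)[OF img_submodule] by (simp add: chain_def)
next
  case (Suc j)
  interpret G: cartier_graded R p M \<kappa> "\<lambda>e. f [^] ex l e" by (rule cartier_graded_pow)
  define e' where "e' = e - a"
  have e: "e = a + e'" "a * j \<le> e'" using Suc.prems(1) unfolding e'_def by auto
  have split: "of_nat n = of_nat na * of_nat p ^ e' + l * (of_nat p ^ e' - 1)"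
    unfolding a(2)[symmetric] Suc.prems(2)[symmetric] e(1) by (simp add: power_add algebra_simps)
  have "l * (of_nat p ^ e' - 1) \<ge> 0" using l p_pow_ge1[of e'] by simp
  then have "(of_nat (na * p ^ e') :: rat) \<le> of_nat n" using split by simp
  then have le: "na * p ^ e' \<le> n" by (simp only: of_nat_le_iff)
  have n': "l * (of_nat p ^ e' - 1) = of_nat (n - na * p ^ e')" using split le by (simp add: of_nat_diff)
  have exa: "ex l a = na" unfolding ex_def a(2) by simp
  show ?case
  proof
    fix y assume "y \<in> img e n"
    then obtain x where x: "x \<in> carrier M" "y = K e ((f [^] n) \<odot>\<^bsub>M\<^esub> x)" unfolding img_def by blast
    have "y = K a ((f [^] na) \<odot>\<^bsub>M\<^esub> K e' ((f [^] (n - na * p ^ e')) \<odot>\<^bsub>M\<^esub> x))"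
      unfolding x(2) e(1) by (rule K_factor[OF x(1) le])
    moreover have "K e' ((f [^] (n - na * p ^ e')) \<odot>\<^bsub>M\<^esub> x) \<in> chain l j"
      using Suc.hyps[OF e(2) n'] imgI[OF x(1)] by blast
    ultimately have "y \<in> DD l (chain l j)" using G.D_gen[OF chain_submodule a(1)] exa by metis
    then show "y \<in> chain l (Suc j)" by (simp add: chain_def)
  qed
qed

lemma p_pow_unbounded: "\<exists>e0. \<forall>e\<ge>e0. (x::rat) \<le> of_nat p ^ e - 1"
proof -
  obtain n where n: "x < of_nat n" using reals_Archimedean2 by blast
  have "x \<le> of_nat p ^ e - 1" if "e \<ge> n" for e
  proof -
    have "Suc n \<le> 2 ^ e" using less_exp[of e] that by linarith
    also have "\<dots> \<le> p ^ e" using prime_ge_2_nat[OF prime_p] by (rule power_mono) simp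
    finally have "(of_nat (Suc n) :: rat) \<le> of_nat (p ^ e)" by (simp only: of_nat_le_iff)
    then show ?thesis using n by simp
  qed
  then show ?thesis by blast
qed

text \<open>The module kappa^e(f^n M) lies in sigma(M, f^l), by assumption in sigma(M, f^(l +
  epsilon)), and this lies in kappa^e(f^(n+1) M) because the surplus epsilon (p^e - 1) pays for one
  more factor f.\<close>

theorem Gr_trivial_img:
  assumes l: "l > 0" and Gr: "carrier (Gr_sigma p R M \<kappa> f l) = {\<one>\<^bsub>Gr_sigma p R M \<kappa> f l\<^esub>}"
  shows "\<exists>e0. \<forall>e\<ge>e0. \<forall>n. l * (of_nat p ^ e - 1) = of_nat n \<longrightarrow> img e n \<subseteq> img e (Suc n)"
proof (cases "\<exists>a\<ge>1. \<exists>na. l * (of_nat p ^ a - 1) = of_nat na")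
  case False
  \<comment> \<open>The bound 1 excludes e = 0, for which l (p^e - 1) = 0 is an integer for every
    l.\<close>
  then show ?thesis by (intro exI[of _ 1]) auto
next
  case True
  then obtain a na where a: "a \<ge> 1" "l * (of_nat p ^ a - 1) = of_nat na" by blast
  obtain h0 where h0: "\<forall>h\<ge>h0. chain l h = sigma p R M \<kappa> f l" using sigma_eq by blast
  obtain \<delta> where \<delta>: "\<delta> > 0" "\<forall>\<epsilon>. 0 < \<epsilon> \<and> \<epsilon> < \<delta> \<longrightarrow> sigma p R M \<kappa> f (l + \<epsilon>) = sigma_plus p R M \<kappa> f l"
    using sigma_plus_eq by blast
  define \<epsilon> where "\<epsilon> = \<delta> / 2"
  have eps: "\<epsilon> > 0" "sigma_plus p R M \<kappa> f l = sigma p R M \<kappa> f (l + \<epsilon>)" using \<delta> unfolding \<epsilon>_def by auto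
  obtain h1 where h1: "\<forall>h\<ge>h1. chain (l + \<epsilon>) h = sigma p R M \<kappa> f (l + \<epsilon>)" using sigma_eq by blast
  obtain e1 where e1: "\<forall>e\<ge>e1. 1 / \<epsilon> \<le> of_nat p ^ e - 1" using p_pow_unbounded by blast
  show ?thesis
  \<comment> \<open>Here \<open>a * h0\<close> makes room for h0 factors of degree a,
    \<open>h1\<close> is the stabilization index for l + epsilon, and from \<open>e1\<close> on the
    surplus epsilon (p^e - 1) is at least 1.\<close>
  proof (intro exI[of _ "max (a * h0) (max h1 e1)"] allI impI)
    fix e n assume e: "max (a * h0) (max h1 e1) \<le> e" and n: "l * (of_nat p ^ e - 1) = of_nat n"
    have "img e n \<subseteq> chain l h0" using img_le_chain[OF a _ _ n, of h0] l e by simp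
    also have "\<dots> = sigma p R M \<kappa> f l" using h0 by simp
    also have "\<dots> \<subseteq> sigma p R M \<kappa> f (l + \<epsilon>)" using Gr_trivial_le[OF Gr] eps by simp
    also have "\<dots> = chain (l + \<epsilon>) e" using h1 e by simp
    also have "\<dots> \<subseteq> img e (Suc n)"
    proof (rule chain_le_img)
      fix r k assume k: "(l + \<epsilon>) * (of_nat p ^ (e + r) - 1) \<le> of_nat k"
      let ?P = "of_nat p ^ r :: rat" and ?Q = "of_nat p ^ e :: rat"
      have "1 \<le> \<epsilon> * (?Q - 1)" using e1 e eps(1) by (simp add: field_simps)
      then have 1: "?P \<le> \<epsilon> * (?Q - 1) * ?P" using p_pow_ge1[of r] mult_right_mono[of 1 "\<epsilon> * (?Q - 1)" ?P] by simp
      have 2: "\<epsilon> * (?Q - 1) * ?P \<le> \<epsilon> * (?Q * ?P - 1)"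
        using eps(1) p_pow_ge1[of r] by (simp add: algebra_simps)
      have 3: "l * (?Q - 1) * ?P \<le> l * (?Q * ?P - 1)"
        using l p_pow_ge1[of r] by (simp add: algebra_simps)
      have "of_nat (Suc n * p ^ r) = l * (?Q - 1) * ?P + ?P" unfolding n by (simp add: algebra_simps)
      also have "\<dots> \<le> l * (?Q * ?P - 1) + \<epsilon> * (?Q * ?P - 1)" using 1 2 3 by linarith
      also have "\<dots> = (l + \<epsilon>) * (of_nat p ^ (e + r) - 1)" by (simp add: power_add algebra_simps)
      also have "\<dots> \<le> of_nat k" by (rule k)
      finally show "Suc n * p ^ r \<le> k" by (simp only: of_nat_le_iff)
    qed
    finally show "img e n \<subseteq> img e (Suc n)" .
  qed
qed

end

section \<open>Operators on the polynomial ring\<close>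

lemma hom_mod_simps:
  "g \<in> carrier (hom_mod A M N) \<longleftrightarrow> g \<in> extensional (carrier M) \<and> lin_map A M N g"
  "\<zero>\<^bsub>hom_mod A M N\<^esub> = (\<lambda>x\<in>carrier M. \<zero>\<^bsub>N\<^esub>)"
  "g \<oplus>\<^bsub>hom_mod A M N\<^esub> h = (\<lambda>x\<in>carrier M. g x \<oplus>\<^bsub>N\<^esub> h x)"
  by (simp_all add: hom_mod_def)

lemma lin_mapD:
  assumes "lin_map A M N h"
  shows "x \<in> carrier M \<Longrightarrow> h x \<in> carrier N"
    "x \<in> carrier M \<Longrightarrow> y \<in> carrier M \<Longrightarrow> h (x \<oplus>\<^bsub>M\<^esub> y) = h x \<oplus>\<^bsub>N\<^esub> h y"
    "a \<in> carrier A \<Longrightarrow> x \<in> carrier M \<Longrightarrow> h (a \<odot>\<^bsub>M\<^esub> x) = a \<odot>\<^bsub>N\<^esub> h x"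
  using assms unfolding lin_map_def by auto

lemma lin_mapI:
  assumes "\<And>x. x \<in> carrier M \<Longrightarrow> h x \<in> carrier N"
    "\<And>x y. x \<in> carrier M \<Longrightarrow> y \<in> carrier M \<Longrightarrow> h (x \<oplus>\<^bsub>M\<^esub> y) = h x \<oplus>\<^bsub>N\<^esub> h y"
    "\<And>a x. a \<in> carrier A \<Longrightarrow> x \<in> carrier M \<Longrightarrow> h (a \<odot>\<^bsub>M\<^esub> x) = a \<odot>\<^bsub>N\<^esub> h x"
  shows "lin_map A M N h"
  using assms unfolding lin_map_def by auto

lemma lin_map_zero:
  assumes "module A M" "module A N" "lin_map A M N h" shows "h \<zero>\<^bsub>M\<^esub> = \<zero>\<^bsub>N\<^esub>"
proof -
  interpret M: module A M by fact
  interpret N: module A N by fact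
  have "h (\<zero>\<^bsub>A\<^esub> \<odot>\<^bsub>M\<^esub> \<zero>\<^bsub>M\<^esub>) = \<zero>\<^bsub>A\<^esub> \<odot>\<^bsub>N\<^esub> h \<zero>\<^bsub>M\<^esub>" by (rule lin_mapD(3)[OF assms(3)]) auto
  then show ?thesis using lin_mapD(1)[OF assms(3), of "\<zero>\<^bsub>M\<^esub>"] by simp
qed

locale hom_group = M: module A M + N: module A N for A :: "('a, 'x) ring_scheme"
  and M :: "('a, 'm, 'y) module_scheme" and N :: "('a, 'n, 'z) module_scheme"
begin

abbreviation "HM \<equiv> hom_mod A M N"

lemma HM_add_closed: "g \<in> carrier HM \<Longrightarrow> h \<in> carrier HM \<Longrightarrow> g \<oplus>\<^bsub>HM\<^esub> h \<in> carrier HM"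
  unfolding hom_mod_simps
  by (intro conjI lin_mapI) (auto simp: lin_mapD M.M.add.m_closed N.smult_r_distr N.M.add.m_ac lin_mapD[where A = A])

lemma HM_neg:
  assumes "g \<in> carrier HM"
  shows "(\<lambda>x\<in>carrier M. \<ominus>\<^bsub>N\<^esub> g x) \<in> carrier HM"
    "(\<lambda>x\<in>carrier M. \<ominus>\<^bsub>N\<^esub> g x) \<oplus>\<^bsub>HM\<^esub> g = \<zero>\<^bsub>HM\<^esub>"
proof -
  have g: "lin_map A M N g" using assms unfolding hom_mod_simps by blast
  show "(\<lambda>x\<in>carrier M. \<ominus>\<^bsub>N\<^esub> g x) \<in> carrier HM"
    unfolding hom_mod_simps
    by (intro conjI lin_mapI) (auto simp: lin_mapD[OF g] N.smult_r_minus N.M.minus_add)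
  show "(\<lambda>x\<in>carrier M. \<ominus>\<^bsub>N\<^esub> g x) \<oplus>\<^bsub>HM\<^esub> g = \<zero>\<^bsub>HM\<^esub>"
    unfolding hom_mod_simps by (rule restrict_ext) (auto simp: lin_mapD[OF g] N.M.l_neg)
qed

sublocale HM: abelian_group HM
proof (rule abelian_groupI)
  show zero: "\<zero>\<^bsub>HM\<^esub> \<in> carrier HM"
    unfolding hom_mod_simps by (intro conjI lin_mapI) auto
  fix g assume g: "g \<in> carrier HM"
  then have gl: "lin_map A M N g" "g \<in> extensional (carrier M)" unfolding hom_mod_simps by auto
  show "\<zero>\<^bsub>HM\<^esub> \<oplus>\<^bsub>HM\<^esub> g = g"
    unfolding hom_mod_simps by (rule extensionalityI[OF restrict_extensional gl(2)]) (simp add: lin_mapD[OF gl(1)])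
  show "\<exists>h\<in>carrier HM. h \<oplus>\<^bsub>HM\<^esub> g = \<zero>\<^bsub>HM\<^esub>" using HM_neg[OF g] by blast
  fix h assume h: "h \<in> carrier HM"
  then have hl: "lin_map A M N h" unfolding hom_mod_simps by auto
  show "g \<oplus>\<^bsub>HM\<^esub> h \<in> carrier HM" by (rule HM_add_closed[OF g h])
  show "g \<oplus>\<^bsub>HM\<^esub> h = h \<oplus>\<^bsub>HM\<^esub> g"
    unfolding hom_mod_simps by (rule restrict_ext) (simp add: lin_mapD[OF gl(1)] lin_mapD[OF hl] N.M.add.m_comm)
  fix k assume k: "k \<in> carrier HM"
  then have kl: "lin_map A M N k" unfolding hom_mod_simps by auto
  show "(g \<oplus>\<^bsub>HM\<^esub> h) \<oplus>\<^bsub>HM\<^esub> k = g \<oplus>\<^bsub>HM\<^esub> (h \<oplus>\<^bsub>HM\<^esub> k)"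
    unfolding hom_mod_simps
    by (rule restrict_ext) (simp add: lin_mapD[OF gl(1)] lin_mapD[OF hl] lin_mapD[OF kl] N.M.add.m_assoc)
qed

lemma HM_a_inv: "g \<in> carrier HM \<Longrightarrow> \<ominus>\<^bsub>HM\<^esub> g = (\<lambda>x\<in>carrier M. \<ominus>\<^bsub>N\<^esub> g x)"
  using HM.minus_equality[OF HM_neg(2) _ HM_neg(1)] by blast

end

lemma end_ring_simps:
  "carrier (end_ring A M) = carrier (hom_mod A M M)" "add (end_ring A M) = add (hom_mod A M M)"
  "zero (end_ring A M) = zero (hom_mod A M M)" "\<one>\<^bsub>end_ring A M\<^esub> = (\<lambda>x\<in>carrier M. x)"
  "mult (end_ring A M) = compose (carrier M)"
  by (simp_all add: end_ring_def)

lemma end_ring_a_inv: "\<ominus>\<^bsub>end_ring A M\<^esub> g = \<ominus>\<^bsub>hom_mod A M M\<^esub> g"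
  by (simp add: a_inv_def m_inv_def end_ring_simps)

lemma compose_lin:
  assumes "module A M" "g \<in> carrier (hom_mod A N P)" "h \<in> carrier (hom_mod A M N)"
  shows "compose (carrier M) g h \<in> carrier (hom_mod A M P)"
proof -
  interpret M: module A M by fact
  have g: "lin_map A N P g" and h: "lin_map A M N h" using assms unfolding hom_mod_simps by auto
  show ?thesis unfolding hom_mod_simps
    by (intro conjI lin_mapI) (auto simp: compose_def lin_mapD[OF g] lin_mapD[OF h])
qed

locale up_frob = cring_char R p for R :: "('a, 'x) ring_scheme" (structure) and p +
  fixes e :: nat
begin

abbreviation "q \<equiv> p ^ e"
abbreviation "U \<equiv> UP R"

sublocale UPc: UP_cring R U
  by unfold_locales simp

lemma coeff_U: "g \<in> carrier U \<Longrightarrow> coeff U g = g"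
  by (simp add: UP_def)

lemma U_closed: "g \<in> carrier U \<Longrightarrow> g k \<in> carrier R"
  using UPc.coeff_closed[of g k] by (simp add: coeff_U)

lemma U_add: "g \<in> carrier U \<Longrightarrow> h \<in> carrier U \<Longrightarrow> (g \<oplus>\<^bsub>U\<^esub> h) k = g k \<oplus> h k"
  using UPc.coeff_add[of g h k] by (simp add: coeff_U)

lemma U_zero: "\<zero>\<^bsub>U\<^esub> k = \<zero>"
  using UPc.coeff_zero[of k] by (simp add: coeff_U)

lemma U_neg: "g \<in> carrier U \<Longrightarrow> (\<ominus>\<^bsub>U\<^esub> g) k = \<ominus> g k"
  using UPc.coeff_a_inv[of g k] by (simp add: coeff_U)

lemma U_memI: "(\<And>k. g k \<in> carrier R) \<Longrightarrow> (\<And>k. k > n \<Longrightarrow> g k = \<zero>) \<Longrightarrow> g \<in> carrier U"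
  by (auto simp: UP_def up_def bound_def)

lemma U_map:
  assumes g: "g \<in> carrier U" and t: "\<And>k x. x \<in> carrier R \<Longrightarrow> t k x \<in> carrier R" "\<And>k. t k \<zero> = \<zero>"
  shows "(\<lambda>k. t k (g k)) \<in> carrier U"
proof -
  obtain n where "bound \<zero> n g" using g by (auto simp: UP_def up_def)
  then show ?thesis using g t by (intro U_memI[of _ n]) (auto simp: U_closed bound_def)
qed

lemma char_U: "has_prime_char U p"
proof (rule ring_hom_char[OF is_cring UPc.UP_cring _ char])
  show "(\<lambda>a. monom U a 0) \<in> ring_hom R U"
    by (rule ring_hom_memI) (auto simp: UPc.monom_mult[of _ _ 0 0, simplified])
qed

sublocale Uc: cring_char U p
  by (intro cring_char.intro cring_char_axioms.intro UPc.UP_cring char_U)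

lemma U_induct:
  assumes g: "g \<in> carrier U" and zero: "Q \<zero>\<^bsub>U\<^esub>"
    and add: "\<And>g h. g \<in> carrier U \<Longrightarrow> h \<in> carrier U \<Longrightarrow> Q g \<Longrightarrow> Q h \<Longrightarrow> Q (g \<oplus>\<^bsub>U\<^esub> h)"
    and monom: "\<And>c i. c \<in> carrier R \<Longrightarrow> Q (monom U c i)"
  shows "Q g"
proof -
  have "Q (\<Oplus>\<^bsub>U\<^esub>i\<in>A. monom U (coeff U g i) i)" if "finite A" for A
    using that
  proof induct
    case empty then show ?case using zero by simp
  next
    case (insert i A)
    have c: "(\<lambda>i. monom U (coeff U g i) i) \<in> A \<rightarrow> carrier U" using UPc.coeff_closed[OF g] by auto
    then have "(\<Oplus>\<^bsub>U\<^esub>i\<in>insert i A. monom U (coeff U g i) i) = monom U (coeff U g i) i \<oplus>\<^bsub>U\<^esub> (\<Oplus>\<^bsub>U\<^esub>i\<in>A. monom U (coeff U g i) i)"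
      using insert UPc.coeff_closed[OF g] by (intro abelian_monoid.finsum_insert[OF abelian_group.axioms(1)[OF ring.axioms(1)[OF cring.axioms(1)[OF UPc.UP_cring]]]]) auto
    then show ?case using insert c UPc.coeff_closed[OF g] by (auto intro!: add monom)
  qed
  from this[of "{..deg R g}"] show ?thesis using UPc.up_repr[OF g] by simp
qed

lemma monom_mult_coeff:
  assumes c: "c \<in> carrier R" and g: "g \<in> carrier U"
  shows "(monom U c n \<otimes>\<^bsub>U\<^esub> g) k = (if n \<le> k then c \<otimes> g (k - n) else \<zero>)"
proof (cases "n \<le> k")
  case True
  then obtain m where m: "k = m + n" using le_Suc_ex by (metis add.commute)
  have "coeff U (monom U c n \<otimes>\<^bsub>U\<^esub> g) (m + n) = c \<otimes> coeff U g m" by (rule UPc.coeff_monom_mult[OF c g])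
  then show ?thesis using True m c g by (simp add: coeff_U)
next
  case False
  have "coeff U (monom U c n \<otimes>\<^bsub>U\<^esub> g) k = (\<Oplus>i\<in>{..k}. coeff U (monom U c n) i \<otimes> coeff U g (k - i))"
    using c g by simp
  also have "\<dots> = (\<Oplus>i\<in>{..k}. \<zero>)"
    using False c g UPc.coeff_closed[OF g] by (intro finsum_cong') auto
  finally show ?thesis using False c g by (simp add: coeff_U)
qed

lemma monom_pow_q: "c \<in> carrier R \<Longrightarrow> (monom U c i) [^]\<^bsub>U\<^esub> q = monom U (c [^] q) (i * q)"
  by (rule UPc.monom_pow)

text \<open>One form for both kinds of generators of \<open>euler_alg\<close>: for coefficient
  operators t does not depend on the exponent, for Euler operators it multiplies by an
  integer.\<close>

definition cop :: "(nat \<Rightarrow> 'a \<Rightarrow> 'a) \<Rightarrow> (nat \<Rightarrow> 'a) \<Rightarrow> (nat \<Rightarrow> 'a)" where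
  "cop t = (\<lambda>g\<in>carrier U. \<lambda>k. t k (g k))"

abbreviation "NU \<equiv> frob p e U (self_mod U)"

lemma module_NU: "module U NU" by (rule Uc.module_frob_self)

sublocale HU: hom_group U NU NU
  by (intro hom_group.intro module_NU)

lemma diff_ops_eq: "diff_ops p e A = end_ring A (frob p e A (self_mod A))"
  by (simp add: diff_ops_def)

text \<open>A q-th power of a polynomial is a sum of monomials c^q t^(i q). The factor c^q is
  handled by \<open>sm\<close>, and t^(i q) shifts exponents by a multiple of q, which
  \<open>per\<close> makes harmless.\<close>

lemma cop_diff_op:
  assumes cl: "\<And>k x. x \<in> carrier R \<Longrightarrow> t k x \<in> carrier R"
    and add: "\<And>k x y. x \<in> carrier R \<Longrightarrow> y \<in> carrier R \<Longrightarrow> t k (x \<oplus> y) = t k x \<oplus> t k y"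
    and sm: "\<And>k c x. c \<in> carrier R \<Longrightarrow> x \<in> carrier R \<Longrightarrow> t k (c [^] q \<otimes> x) = c [^] q \<otimes> t k x"
    and per: "\<And>k x. x \<in> carrier R \<Longrightarrow> t (k + q) x = t k x"
  shows "cop t \<in> carrier (diff_ops p e U)"
proof -
  have zero: "t k \<zero> = \<zero>" for k using sm[of \<zero> \<zero> k] cl[of \<zero> k] by (simp add: pow_q_zero)
  have per': "t (k + i * q) x = t k x" if "x \<in> carrier R" for k i x
  proof (induct i)
    case (Suc i)
    have "k + Suc i * q = (k + i * q) + q" by simp
    then show ?case using per[OF that, of "k + i * q"] Suc by metis
  qed simp
  have mem: "cop t g \<in> carrier U" if "g \<in> carrier U" for g
    using U_map[OF that, of t] cl zero that unfolding cop_def by simp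
  have addc: "cop t (g \<oplus>\<^bsub>U\<^esub> h) = cop t g \<oplus>\<^bsub>U\<^esub> cop t h" if "g \<in> carrier U" "h \<in> carrier U" for g h
  proof
    fix k
    show "cop t (g \<oplus>\<^bsub>U\<^esub> h) k = (cop t g \<oplus>\<^bsub>U\<^esub> cop t h) k"
      using that U_add[OF mem[OF that(1)] mem[OF that(2)]] by (simp add: cop_def U_add add U_closed)
  qed
  have "cop t (a [^]\<^bsub>U\<^esub> q \<otimes>\<^bsub>U\<^esub> g) = a [^]\<^bsub>U\<^esub> q \<otimes>\<^bsub>U\<^esub> cop t g" if a: "a \<in> carrier U" and g: "g \<in> carrier U" for a g
  proof (rule U_induct[OF a])
    have "cop t \<zero>\<^bsub>U\<^esub> = \<zero>\<^bsub>U\<^esub>" by (rule ext) (simp add: cop_def U_zero zero)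
    then show "cop t (\<zero>\<^bsub>U\<^esub> [^]\<^bsub>U\<^esub> q \<otimes>\<^bsub>U\<^esub> g) = \<zero>\<^bsub>U\<^esub> [^]\<^bsub>U\<^esub> q \<otimes>\<^bsub>U\<^esub> cop t g"
      using g mem[OF g] by (simp add: Uc.pow_q_zero)
  next
    fix a b assume *: "a \<in> carrier U" "b \<in> carrier U"
      "cop t (a [^]\<^bsub>U\<^esub> q \<otimes>\<^bsub>U\<^esub> g) = a [^]\<^bsub>U\<^esub> q \<otimes>\<^bsub>U\<^esub> cop t g"
      "cop t (b [^]\<^bsub>U\<^esub> q \<otimes>\<^bsub>U\<^esub> g) = b [^]\<^bsub>U\<^esub> q \<otimes>\<^bsub>U\<^esub> cop t g"
    show "cop t ((a \<oplus>\<^bsub>U\<^esub> b) [^]\<^bsub>U\<^esub> q \<otimes>\<^bsub>U\<^esub> g) = (a \<oplus>\<^bsub>U\<^esub> b) [^]\<^bsub>U\<^esub> q \<otimes>\<^bsub>U\<^esub> cop t g"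
      unfolding Uc.frobenius_add[OF *(1,2)] using * g mem[OF g]
      by (simp add: UPc.UP_l_distr addc)
  next
    fix c i assume c: "c \<in> carrier R"
    have cq: "c [^] q \<in> carrier R" using c by simp
    show "cop t (monom U c i [^]\<^bsub>U\<^esub> q \<otimes>\<^bsub>U\<^esub> g) = monom U c i [^]\<^bsub>U\<^esub> q \<otimes>\<^bsub>U\<^esub> cop t g"
    proof
      fix k
      have "cop t (monom U c i [^]\<^bsub>U\<^esub> q \<otimes>\<^bsub>U\<^esub> g) k = t k (if i * q \<le> k then c [^] q \<otimes> g (k - i * q) else \<zero>)"
        unfolding monom_pow_q[OF c] cop_def using cq g by (simp add: monom_mult_coeff)
      also have "\<dots> = (if i * q \<le> k then c [^] q \<otimes> cop t g (k - i * q) else \<zero>)"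
      proof (cases "i * q \<le> k")
        case True
        then have "t k (g (k - i * q)) = t (k - i * q) (g (k - i * q))"
          using per'[of "g (k - i * q)" "k - i * q" i] U_closed[OF g] by simp
        then show ?thesis using True g c by (simp add: sm U_closed cop_def)
      qed (simp add: zero)
      also have "\<dots> = (monom U c i [^]\<^bsub>U\<^esub> q \<otimes>\<^bsub>U\<^esub> cop t g) k"
        unfolding monom_pow_q[OF c] using cq mem[OF g] by (simp add: monom_mult_coeff)
      finally show "cop t (monom U c i [^]\<^bsub>U\<^esub> q \<otimes>\<^bsub>U\<^esub> g) k = (monom U c i [^]\<^bsub>U\<^esub> q \<otimes>\<^bsub>U\<^esub> cop t g) k" .
    qed
  qed
  then show ?thesis
    unfolding diff_ops_eq end_ring_simps hom_mod_simps
    using mem addc by (intro conjI lin_mapI) (auto simp: cop_def)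
qed

text \<open>Diagonal operators, whose weights matter only modulo p. Euler operators, integer
  constants and the projectors onto joint eigenspaces all have this form; with natural numbers as
  weights, -1 is written p - 1.\<close>

definition scal :: "(nat \<Rightarrow> nat) \<Rightarrow> (nat \<Rightarrow> 'a) \<Rightarrow> (nat \<Rightarrow> 'a)" where
  "scal w = cop (\<lambda>k x. add_pow R (w k) x)"

lemma scal_apply: "g \<in> carrier U \<Longrightarrow> scal w g = (\<lambda>k. add_pow R (w k) (g k))"
  by (simp add: scal_def cop_def)

lemma add_pow_mod: "x \<in> carrier R \<Longrightarrow> add_pow R (n mod p) x = add_pow R n x"
proof -
  assume x: "x \<in> carrier R"
  have "add_pow R n x = add_pow R (p * (n div p) + n mod p) x" by simp
  also have "\<dots> = add_pow R (p * (n div p)) x \<oplus> add_pow R (n mod p) x"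
    using x by (simp only: add.nat_pow_mult)
  also have "add_pow R (p * (n div p)) x = \<zero>" by (rule add_pow_dvd_zero) (use x in auto)
  finally show ?thesis using x by simp
qed

lemma scal_cong: "(\<And>k. w k mod p = w' k mod p) \<Longrightarrow> scal w = scal w'"
  unfolding scal_def cop_def using add_pow_mod[OF U_closed] by (intro restrict_ext ext) metis

lemma scal_mem: "g \<in> carrier U \<Longrightarrow> scal w g \<in> carrier U"
  unfolding scal_apply by (rule U_map) auto

lemma scal_diff_op:
  assumes "\<And>k. w (k + q) mod p = w k mod p" shows "scal w \<in> carrier (diff_ops p e U)"
  unfolding scal_def
proof (rule cop_diff_op)
  show "add_pow R (w (k + q)) x = add_pow R (w k) x" if "x \<in> carrier R" for k x
    using add_pow_mod[OF that] assms by metis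
qed (auto simp: add.nat_pow_distrib add_pow_rdistr)

lemma scal_additive:
  assumes "g \<in> carrier U" "h \<in> carrier U"
  shows "scal w (g \<oplus>\<^bsub>U\<^esub> h) = scal w g \<oplus>\<^bsub>U\<^esub> scal w h"
proof
  fix k
  show "scal w (g \<oplus>\<^bsub>U\<^esub> h) k = (scal w g \<oplus>\<^bsub>U\<^esub> scal w h) k"
    using assms scal_mem[OF assms(1), of w] scal_mem[OF assms(2), of w]
      add.nat_pow_distrib[OF U_closed[OF assms(1)] U_closed[OF assms(2)], of "w k" k k]
    by (simp add: U_add scal_apply)
qed

lemma scal_neg:
  assumes "g \<in> carrier U" shows "scal w (\<ominus>\<^bsub>U\<^esub> g) = \<ominus>\<^bsub>U\<^esub> scal w g"
proof
  fix k
  show "scal w (\<ominus>\<^bsub>U\<^esub> g) k = (\<ominus>\<^bsub>U\<^esub> scal w g) k"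
    using assms scal_mem[OF assms(1), of w] add.nat_pow_inv[OF U_closed[OF assms], of "w k" k]
    by (simp add: U_neg scal_apply)
qed

lemma add_pow_add: "x \<in> carrier R \<Longrightarrow> add_pow R (m + n) x = add_pow R m x \<oplus> add_pow R n x" for m n :: nat
  by (simp add: add.nat_pow_mult)

lemma scal_mult: "compose (carrier U) (scal w) (scal w') = scal (\<lambda>k. w k * w' k)"
proof
  fix g
  show "compose (carrier U) (scal w) (scal w') g = scal (\<lambda>k. w k * w' k) g"
  proof (cases "g \<in> carrier U")
    case True
    have "scal w (scal w' g) = (\<lambda>k. add_pow R (w k) (scal w' g k))" by (rule scal_apply[OF scal_mem[OF True]])
    then show ?thesis
      using True by (simp add: compose_def scal_apply add.nat_pow_pow U_closed mult.commute)
  next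
    case False
    then show ?thesis by (simp add: compose_def scal_def cop_def)
  qed
qed

lemma scal_add: "scal w \<oplus>\<^bsub>diff_ops p e U\<^esub> scal w' = scal (\<lambda>k. w k + w' k)"
  unfolding diff_ops_eq end_ring_simps hom_mod_simps
proof
  fix g
  show "(\<lambda>x\<in>carrier NU. scal w x \<oplus>\<^bsub>NU\<^esub> scal w' x) g = scal (\<lambda>k. w k + w' k) g"
  proof (cases "g \<in> carrier U")
    case True
    have "(scal w g \<oplus>\<^bsub>U\<^esub> scal w' g) k = scal (\<lambda>k. w k + w' k) g k" for k
      using True scal_mem[OF True, of w] scal_mem[OF True, of w']
      by (simp add: U_add scal_apply add.nat_pow_mult U_closed)
    then show ?thesis using True by auto
  next
    case False
    then show ?thesis by (simp add: scal_def cop_def)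
  qed
qed

lemma scal_one: "scal (\<lambda>_. 1) = \<one>\<^bsub>diff_ops p e U\<^esub>"
  unfolding diff_ops_eq end_ring_simps
  by (rule ext) (auto simp: scal_def cop_def U_closed)

end

section \<open>Binomial coefficients at powers of p and base p digits\<close>

lemma prime_dvd_binomial_power:
  assumes p: "Factorial_Ring.prime (p::nat)" and k: "0 < k" "k < p ^ j"
  shows "p dvd (p ^ j choose k)"
proof (rule ccontr)
  assume "\<not> p dvd (p ^ j choose k)"
  then have "coprime (p ^ j) (p ^ j choose k)" using p by (simp add: prime_imp_coprime)
  moreover obtain k' where k': "k = Suc k'" using k(1) gr0_implies_Suc by blast
  \<comment> \<open>From k (p^j choose k) = p^j (p^j - 1 choose k - 1).\<close>
  have "p ^ j dvd Suc k' * (p ^ j choose Suc k')"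
  proof -
    obtain P where P: "p ^ j = Suc P" using k(2) by (cases "p ^ j") auto
    show ?thesis unfolding P by (metis Suc_times_binomial_eq dvd_triv_left mult.commute)
  qed
  then have "p ^ j dvd k * (p ^ j choose k)" using k' by simp
  ultimately have "p ^ j dvd k" by (simp add: coprime_dvd_mult_left_iff)
  then show False using k by (simp add: nat_dvd_not_less)
qed

text \<open>The case of Lucas' theorem that identifies the eigenvalue of theta_(p^j) on t^m with the
  digit of weight p^j of m. In Vandermonde's sum for m = p^j + l only the two end terms survive
  modulo p, so adding p^j raises the value by one.\<close>

lemma binomial_prime_power_mod:
  assumes p: "Factorial_Ring.prime (p::nat)"
  shows "(m choose p ^ j) mod p = (m div p ^ j) mod p"
proof (induct m rule: less_induct)
  case (less m)
  have pj: "p ^ j > 0" using p prime_gt_0_nat by simp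
  show ?case
  proof (cases "m < p ^ j")
    case True then show ?thesis by (simp add: binomial_eq_0)
  next
    case False
    define l where "l = m - p ^ j"
    have m: "m = p ^ j + l" using False unfolding l_def by simp
    let ?t = "\<lambda>k. (p ^ j choose k) * (l choose (p ^ j - k))"
    have "(m choose p ^ j) = (\<Sum>k\<le>p ^ j. ?t k)" unfolding m by (rule vandermonde[symmetric])
    also have "{..p ^ j} = insert 0 (insert (p ^ j) {0<..<p ^ j})" by auto
    also have "sum ?t \<dots> = ?t 0 + (?t (p ^ j) + sum ?t {0<..<p ^ j})"
      using pj by (subst sum.insert; simp)
    finally have eq: "(m choose p ^ j) = (l choose p ^ j) + 1 + (\<Sum>k\<in>{0<..<p ^ j}. ?t k)" by simp
    have "p dvd (\<Sum>k\<in>{0<..<p ^ j}. (p ^ j choose k) * (l choose (p ^ j - k)))"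
      using prime_dvd_binomial_power[OF p] by (intro dvd_sum) auto
    then have "(m choose p ^ j) mod p = ((l choose p ^ j) + 1) mod p" unfolding eq by (auto simp: mod_add_eq elim!: dvdE)
    also have "\<dots> = (l div p ^ j + 1) mod p" using less[of l] m pj by (metis add.commute less_add_same_cancel2 mod_add_left_eq)
    also have "l div p ^ j + 1 = m div p ^ j" using m pj by simp
    finally show ?thesis .
  qed
qed

text \<open>This periodicity makes the Euler operators linear over t^(p^e), so that they belong to
  \<open>diff_ops p e\<close>.\<close>

lemma binomial_prime_power_periodic:
  assumes p: "Factorial_Ring.prime (p::nat)" and j: "j < e"
  shows "((m + p ^ e) choose p ^ j) mod p = (m choose p ^ j) mod p"
proof -
  have pj: "p ^ j > 0" using p prime_gt_0_nat by simp
  obtain d where "e = Suc (j + d)" using j less_imp_Suc_add by blast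
  then have e: "p ^ e = p ^ j * (p * p ^ d)" by (simp add: power_add)
  have "(m + p ^ e) div p ^ j = m div p ^ j + p * p ^ d" unfolding e using pj by simp
  then show ?thesis unfolding binomial_prime_power_mod[OF p] by simp
qed

lemma digits_determine_mod:
  assumes "\<And>j. j < e \<Longrightarrow> (m div p ^ j) mod p = d j"
  shows "m mod p ^ e = (\<Sum>j<e. d j * p ^ j :: nat)"
  using assms
proof (induct e)
  case (Suc e)
  have "m mod p ^ Suc e = p ^ e * (m div p ^ e mod p) + m mod p ^ e"
    by (simp only: power_Suc2 mod_mult2_eq)
  then show ?case using Suc by (simp add: mult.commute)
qed simp

section \<open>Eigenspaces of the Euler operators\<close>

locale graph = cartier_f R p M \<kappa> f + up_frob R p e
  for R :: "('a, 'x) ring_scheme" (structure) and p and M :: "('a, 'm) module" (structure) and \<kappa> f e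
begin

abbreviation "\<gamma> \<equiv> graph_map R f"
abbreviation "G \<equiv> graph_push R f M"
abbreviation "H \<equiv> F_shriek p e U G"
abbreviation "E \<equiv> euler_alg p e R"
abbreviation "cmp \<equiv> compose (carrier U)"

lemma gamma_hom: "\<gamma> \<in> ring_hom U R"
proof -
  interpret UP_pre_univ_prop R R "\<lambda>r. r" U
    by unfold_locales (auto simp: ring_hom_def)
  show ?thesis unfolding graph_map_def by (rule eval_ring_hom[OF f])
qed

sublocale gam: ring_hom_cring U R \<gamma>
  by (intro ring_hom_cringI UPc.UP_cring is_cring gamma_hom)

lemma gamma_eq: "g \<in> carrier U \<Longrightarrow> \<gamma> g = (\<Oplus>i\<in>{..deg R g}. g i \<otimes> f [^] i)"
  unfolding graph_map_def eval_def by (simp add: coeff_U)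

lemma G_simps: "carrier G = carrier M" "add G = add M" "zero G = zero M"
  "smult G = (\<lambda>g m. \<gamma> g \<odot>\<^bsub>M\<^esub> m)"
  by (simp_all add: graph_push_def)

lemma module_G: "module U G"
proof (rule moduleI)
  show "cring U" by (rule UPc.UP_cring)
  show "abelian_group G"
    by (rule abelian_groupI)
       (auto simp: G_simps M.add.m_assoc M.add.m_comm M.add.m_lcomm intro!: bexI[of _ "\<ominus>\<^bsub>M\<^esub> x" for x] M.l_neg)
qed (auto simp: G_simps smult_l_distr smult_r_distr smult_assoc1)

sublocale FH: hom_group U NU G
  by (intro hom_group.intro module_NU module_G)

lemma H_eq: "H = FH.HM" by (simp add: F_shriek_def)

sublocale Hg: abelian_group H unfolding H_eq by (rule FH.HM.abelian_group_axioms)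

lemma H_carrier: "y \<in> carrier H \<longleftrightarrow> y \<in> extensional (carrier U) \<and> lin_map U NU G y"
  unfolding H_eq hom_mod_simps by simp

lemma H_add: "y \<oplus>\<^bsub>H\<^esub> z = (\<lambda>x\<in>carrier U. y x \<oplus>\<^bsub>M\<^esub> z x)"
  unfolding H_eq hom_mod_simps by (simp add: G_simps)

lemma H_zero: "\<zero>\<^bsub>H\<^esub> = (\<lambda>x\<in>carrier U. \<zero>\<^bsub>M\<^esub>)"
  unfolding H_eq hom_mod_simps by (simp add: G_simps)

lemma HD:
  assumes "y \<in> carrier H"
  shows "x \<in> carrier U \<Longrightarrow> y x \<in> carrier M"
    "x \<in> carrier U \<Longrightarrow> z \<in> carrier U \<Longrightarrow> y (x \<oplus>\<^bsub>U\<^esub> z) = y x \<oplus>\<^bsub>M\<^esub> y z"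
    "y \<in> extensional (carrier U)"
  using assms lin_mapD[of U NU G y] unfolding H_carrier by (auto simp: G_simps)

lemma H_ext: "y \<in> carrier H \<Longrightarrow> z \<in> carrier H \<Longrightarrow> (\<And>x. x \<in> carrier U \<Longrightarrow> y x = z x) \<Longrightarrow> y = z"
  by (rule extensionalityI) (auto intro: HD(3))

abbreviation "DO \<equiv> diff_ops p e U"

lemma DO_carrier: "carrier DO = carrier HU.HM"
  unfolding diff_ops_eq end_ring_simps ..

lemma DO_mem: "\<delta> \<in> carrier DO \<Longrightarrow> x \<in> carrier U \<Longrightarrow> \<delta> x \<in> carrier U"
  unfolding DO_carrier hom_mod_simps using lin_mapD(1)[of U NU NU \<delta> x] by simp

lemma cmp_closed: "y \<in> carrier H \<Longrightarrow> \<delta> \<in> carrier DO \<Longrightarrow> cmp y \<delta> \<in> carrier H"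
  unfolding DO_carrier H_eq using compose_lin[OF module_NU, of y NU G \<delta>] by simp

lemma cmp_add:
  assumes "\<delta> \<in> carrier DO"
  shows "cmp (y \<oplus>\<^bsub>H\<^esub> z) \<delta> = cmp y \<delta> \<oplus>\<^bsub>H\<^esub> cmp z \<delta>"
  unfolding H_add compose_def by (rule restrict_ext) (simp add: DO_mem[OF assms])

lemma cmp_zero: "\<delta> \<in> carrier DO \<Longrightarrow> cmp \<zero>\<^bsub>H\<^esub> \<delta> = \<zero>\<^bsub>H\<^esub>"
  unfolding H_zero compose_def by (rule restrict_ext) (simp add: DO_mem)

lemma coeff_op_eq: "coeff_op R \<delta> = cop (\<lambda>k. \<delta>)"
  by (simp add: coeff_op_def cop_def)

lemma euler_op_eq: "euler_op R a = scal (\<lambda>k. k choose a)"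
  by (simp add: euler_op_def scal_def cop_def)

lemma R_diff_op:
  "\<delta> \<in> carrier (diff_ops p e R) \<longleftrightarrow> \<delta> \<in> extensional (carrier R) \<and> (\<forall>x\<in>carrier R. \<delta> x \<in> carrier R) \<and>
    (\<forall>x\<in>carrier R. \<forall>y\<in>carrier R. \<delta> (x \<oplus> y) = \<delta> x \<oplus> \<delta> y) \<and>
    (\<forall>a\<in>carrier R. \<forall>x\<in>carrier R. \<delta> (a [^] q \<otimes> x) = a [^] q \<otimes> \<delta> x)"
  unfolding diff_ops_def end_ring_simps hom_mod_simps lin_map_def by auto

lemma E_gens: "coeff_op R ` carrier (diff_ops p e R) \<union> {euler_op R (p ^ j) | j. j < e} \<subseteq> carrier DO"
proof (rule Un_least)
  show "coeff_op R ` carrier (diff_ops p e R) \<subseteq> carrier DO"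
    unfolding coeff_op_eq R_diff_op by (safe, rule cop_diff_op) (auto simp: R_diff_op)
  show "{euler_op R (p ^ j) | j. j < e} \<subseteq> carrier DO"
    unfolding euler_op_eq using binomial_prime_power_periodic[OF prime_p] by (auto intro!: scal_diff_op)
qed

lemma E_carrier: "E \<subseteq> carrier DO"
proof
  fix \<delta> assume "\<delta> \<in> E"
  then show "\<delta> \<in> carrier DO" unfolding euler_alg_def
  proof induct
    case one
    show ?case unfolding scal_one[symmetric] by (rule scal_diff_op) simp
  next
    case (incl h)
    then show ?case using E_gens by blast
  next
    case (a_inv h)
    then have "h \<in> carrier HU.HM" by (simp only: DO_carrier)
    from HU.HM.a_inv_closed[OF this] show ?case by (simp only: DO_carrier diff_ops_eq end_ring_a_inv end_ring_simps)
  next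
    case (eng_add h1 h2)
    then show ?case unfolding DO_carrier unfolding diff_ops_eq end_ring_simps by (intro HU.HM.add.m_closed)
  next
    case (eng_mult h1 h2)
    then show ?case unfolding DO_carrier unfolding diff_ops_eq end_ring_simps using compose_lin[OF module_NU] by blast
  qed
qed

lemma E_mult: "\<delta> \<in> E \<Longrightarrow> \<delta>' \<in> E \<Longrightarrow> cmp \<delta> \<delta>' \<in> E"
  using generate_ring.eng_mult[of \<delta> DO _ \<delta>'] unfolding euler_alg_def by (simp add: diff_ops_eq end_ring_simps)

lemma E_add: "\<delta> \<in> E \<Longrightarrow> \<delta>' \<in> E \<Longrightarrow> \<delta> \<oplus>\<^bsub>DO\<^esub> \<delta>' \<in> E"
  unfolding euler_alg_def by (rule generate_ring.eng_add)

lemma E_one: "scal (\<lambda>_. 1) \<in> E"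
  unfolding scal_one euler_alg_def by (rule generate_ring.one)

lemma E_coeff: "\<delta> \<in> carrier (diff_ops p e R) \<Longrightarrow> coeff_op R \<delta> \<in> E"
  unfolding euler_alg_def by (rule generate_ring.incl) blast

lemma E_euler: "j < e \<Longrightarrow> scal (\<lambda>k. k choose p ^ j) \<in> E"
  unfolding euler_alg_def euler_op_eq[symmetric] by (rule generate_ring.incl) blast

lemma E_scal_add: "scal w \<in> E \<Longrightarrow> scal w' \<in> E \<Longrightarrow> scal (\<lambda>k. w k + w' k) \<in> E"
  using E_add scal_add by metis

lemma E_scal_mult: "scal w \<in> E \<Longrightarrow> scal w' \<in> E \<Longrightarrow> scal (\<lambda>k. w k * w' k) \<in> E"
  using E_mult scal_mult by metis

lemma E_scal_const: "scal (\<lambda>_. c) \<in> E"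
proof -
  have S: "scal (\<lambda>_. Suc c) \<in> E" for c
  proof (induct c)
    case 0 then show ?case using E_one by simp
  next
    case (Suc c) then show ?case using E_scal_add[OF Suc E_one] by simp
  qed
  show ?thesis
  proof (cases c)
    case 0
    \<comment> \<open>Constants are built by adding units, so zero is obtained as p times the
      unit.\<close>
    have "scal (\<lambda>_. 0) = scal (\<lambda>_. p)" by (rule scal_cong) simp
    also have "p = Suc (p - 1)" using prime_gt_0_nat[OF prime_p] by simp
    finally show ?thesis using S[of "p - 1"] 0 by metis
  qed (use S in simp)
qed

lemma E_scal_power: "scal w \<in> E \<Longrightarrow> scal (\<lambda>k. w k ^ n) \<in> E"
proof (induct n)
  case 0 then show ?case using E_one by simp
next
  case (Suc n) then show ?case using E_scal_mult[of w "\<lambda>k. w k ^ n"] by simp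
qed

text \<open>Coefficient operators are additive, so they commute with integer multiples of
  coefficients, and diagonal operators commute with each other. Both facts pass to the generated
  ring. Hence the projectors built from Euler operators can be moved past any element of
  \<open>E\<close>.\<close>

lemma E_commute:
  assumes "\<delta> \<in> E" shows "g \<in> carrier U \<Longrightarrow> \<delta> (scal w g) = scal w (\<delta> g)"
  using assms unfolding euler_alg_def
proof (induct arbitrary: g)
  case one
  then show ?case using scal_mem by (simp add: diff_ops_eq end_ring_simps)
next
  case (incl h)
  from incl(1) show ?case
  proof
    assume "h \<in> coeff_op R ` carrier (diff_ops p e R)"
    then obtain \<delta> where \<delta>: "\<delta> \<in> carrier (diff_ops p e R)" "h = cop (\<lambda>k. \<delta>)" unfolding coeff_op_eq by blast
    have "\<delta> (\<zero> [^] q \<otimes> \<zero>) = \<zero> [^] q \<otimes> \<delta> \<zero>" "\<delta> \<zero> \<in> carrier R"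
      using \<delta>(1) unfolding R_diff_op by blast+
    then have d0: "\<delta> \<zero> = \<zero>" by (simp add: pow_q_zero)
    have "\<delta> (add_pow R n x) = add_pow R n (\<delta> x)" if "x \<in> carrier R" for n :: nat and x
      by (induct n) (use that \<delta>(1) d0 in \<open>auto simp: R_diff_op\<close>)
    moreover have "h g \<in> carrier U" using DO_mem[of h g] E_gens incl(1,2) by blast
    ultimately show ?thesis
      using incl(2) scal_mem[OF incl(2), of w] unfolding \<delta>(2) by (auto simp: cop_def scal_apply U_closed)
  next
    assume "h \<in> {euler_op R (p ^ j) | j. j < e}"
    then obtain v where h: "h = scal v" unfolding euler_op_eq by blast
    have "h (scal w g) = cmp (scal v) (scal w) g" "scal w (h g) = cmp (scal w) (scal v) g"
      using incl(2) by (simp_all add: compose_def h)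
    then show ?thesis unfolding scal_mult by (simp add: mult.commute)
  qed
next
  case (a_inv h)
  have h: "h \<in> carrier DO" using a_inv(1) E_carrier unfolding euler_alg_def by blast
  then have "\<ominus>\<^bsub>DO\<^esub> h = (\<lambda>x\<in>carrier U. \<ominus>\<^bsub>U\<^esub> h x)"
    unfolding DO_carrier unfolding diff_ops_eq end_ring_a_inv by (simp add: HU.HM_a_inv Uc.a_inv_frob)
  then show ?case using a_inv scal_mem DO_mem[OF h] by (simp add: scal_neg)
next
  case (eng_add h1 h2)
  have h: "h1 \<in> carrier DO" "h2 \<in> carrier DO" using eng_add(1,3) E_carrier unfolding euler_alg_def by blast+
  have "h1 \<oplus>\<^bsub>DO\<^esub> h2 = (\<lambda>x\<in>carrier U. h1 x \<oplus>\<^bsub>U\<^esub> h2 x)"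
    unfolding diff_ops_eq end_ring_simps hom_mod_simps by simp
  then show ?case using eng_add(2,4,5) scal_mem DO_mem[OF h(1)] DO_mem[OF h(2)] by (simp add: scal_additive)
next
  case (eng_mult h1 h2)
  have h: "h1 \<in> carrier DO" "h2 \<in> carrier DO" using eng_mult(1,3) E_carrier unfolding euler_alg_def by blast+
  have "h1 \<otimes>\<^bsub>DO\<^esub> h2 = cmp h1 h2" unfolding diff_ops_eq end_ring_simps by simp
  then show ?case using eng_mult(2,4,5) scal_mem DO_mem[OF h(2)] by (simp add: compose_def)
qed

lemma cmp_assoc: "\<delta>' \<in> carrier DO \<Longrightarrow> cmp (cmp y \<delta>) \<delta>' = cmp y (cmp \<delta> \<delta>')"
  unfolding compose_def by (rule restrict_ext) (simp add: DO_mem)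

definition hm where "hm m = (\<lambda>s\<in>carrier U. K e (\<gamma> s \<odot>\<^bsub>M\<^esub> m))"

lemma graph_C_eq: "graph_C e R M \<kappa> f A = hm ` A"
  unfolding graph_C_def hm_def by blast

lemma hm_closed: assumes "m \<in> carrier M" shows "hm m \<in> carrier H"
  unfolding H_carrier
proof (intro conjI lin_mapI)
  show "hm m (x \<oplus>\<^bsub>NU\<^esub> y) = hm m x \<oplus>\<^bsub>G\<^esub> hm m y" if "x \<in> carrier NU" "y \<in> carrier NU" for x y
    using that assms by (simp add: hm_def G_simps smult_l_distr K_add)
  show "hm m (a \<odot>\<^bsub>NU\<^esub> x) = a \<odot>\<^bsub>G\<^esub> hm m x" if "a \<in> carrier U" "x \<in> carrier NU" for a x
    using that assms by (simp add: hm_def G_simps smult_assoc1 K_smult)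
qed (use assms in \<open>auto simp: hm_def G_simps K_closed\<close>)

abbreviation "CD A \<equiv> graph_CD p e R M \<kappa> f A"

lemma CD_eq: "CD A = generate (add_monoid H) {cmp (hm m) \<delta> | m \<delta>. m \<in> A \<and> \<delta> \<in> E}"
proof -
  have "{cmp h \<delta> | h \<delta>. h \<in> hm ` A \<and> \<delta> \<in> E} = {cmp (hm m) \<delta> | m \<delta>. m \<in> A \<and> \<delta> \<in> E}" by blast
  then show ?thesis unfolding graph_CD_def graph_C_eq by simp
qed

lemma CD_gens: "A \<subseteq> carrier M \<Longrightarrow> {cmp (hm m) \<delta> | m \<delta>. m \<in> A \<and> \<delta> \<in> E} \<subseteq> carrier H"
  using cmp_closed hm_closed E_carrier by (auto simp: subset_iff)

lemma CD_subgroup: "A \<subseteq> carrier M \<Longrightarrow> subgroup (CD A) (add_monoid H)"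
  unfolding CD_eq by (rule Hg.add.generate_is_subgroup[OF CD_gens])

lemma CD_closed:
  assumes "A \<subseteq> carrier M"
  shows "y \<in> CD A \<Longrightarrow> y \<in> carrier H" "\<zero>\<^bsub>H\<^esub> \<in> CD A"
    "y \<in> CD A \<Longrightarrow> z \<in> CD A \<Longrightarrow> y \<oplus>\<^bsub>H\<^esub> z \<in> CD A" "y \<in> CD A \<Longrightarrow> \<ominus>\<^bsub>H\<^esub> y \<in> CD A"
  using subgroup.mem_carrier[OF CD_subgroup[OF assms]] subgroup.one_closed[OF CD_subgroup[OF assms]]
    subgroup.m_closed[OF CD_subgroup[OF assms]] subgroup.m_inv_closed[OF CD_subgroup[OF assms]]
  by (auto simp: a_inv_def)

lemma CD_gen: "m \<in> A \<Longrightarrow> \<delta> \<in> E \<Longrightarrow> cmp (hm m) \<delta> \<in> CD A"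
  unfolding CD_eq by (rule generate.incl) blast

text \<open>Right composition with \<open>\<pi>\<close> is additive, so it is enough to test it on
  generators.\<close>

lemma CD_induct:
  assumes A: "A \<subseteq> carrier M" and B: "B \<subseteq> carrier M" and \<pi>: "\<pi> \<in> carrier DO"
    and gen: "\<And>m \<delta>. m \<in> A \<Longrightarrow> \<delta> \<in> E \<Longrightarrow> cmp (cmp (hm m) \<delta>) \<pi> \<in> CD B" and y: "y \<in> CD A"
  shows "cmp y \<pi> \<in> CD B"
proof -
  have neg: "cmp (\<ominus>\<^bsub>H\<^esub> y) \<pi> \<in> CD B" if "y \<in> carrier H" "cmp y \<pi> \<in> CD B" for y
  proof -
    have "cmp (\<ominus>\<^bsub>H\<^esub> y) \<pi> \<oplus>\<^bsub>H\<^esub> cmp y \<pi> = \<zero>\<^bsub>H\<^esub>"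
      using that(1) by (simp add: cmp_add[OF \<pi>, symmetric] Hg.l_neg cmp_zero[OF \<pi>])
    then have "cmp (\<ominus>\<^bsub>H\<^esub> y) \<pi> = \<ominus>\<^bsub>H\<^esub> cmp y \<pi>"
      using that(1) by (metis Hg.minus_equality Hg.a_inv_closed cmp_closed[OF _ \<pi>])
    then show ?thesis using CD_closed(4)[OF B that(2)] by simp
  qed
  have "subgroup {y \<in> carrier H. cmp y \<pi> \<in> CD B} (add_monoid H)"
  proof (rule Hg.add.subgroupI)
    show "{y \<in> carrier H. cmp y \<pi> \<in> CD B} \<noteq> {}"
      using CD_closed(2)[OF B] cmp_zero[OF \<pi>] Hg.zero_closed by (metis (mono_tags, lifting) empty_iff mem_Collect_eq)
    show "\<ominus>\<^bsub>H\<^esub> y \<in> {y \<in> carrier H. cmp y \<pi> \<in> CD B}" if "y \<in> {y \<in> carrier H. cmp y \<pi> \<in> CD B}" for y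
      using that neg[of y] by simp
  qed (use CD_closed(3)[OF B] cmp_add[OF \<pi>] in auto)
  then have "CD A \<subseteq> {y \<in> carrier H. cmp y \<pi> \<in> CD B}"
    unfolding CD_eq[of A] using gen CD_gens[OF A] by (intro Hg.add.generate_subgroup_incl) blast+
  then show ?thesis using y by blast
qed

lemma CD_comp:
  assumes A: "A \<subseteq> carrier M" and \<delta>: "\<delta> \<in> E" and y: "y \<in> CD A"
  shows "cmp y \<delta> \<in> CD A"
proof (rule CD_induct[OF A A _ _ y])
  show \<delta>c: "\<delta> \<in> carrier DO" using \<delta> E_carrier by blast
  show "cmp (cmp (hm m) \<delta>') \<delta> \<in> CD A" if "m \<in> A" "\<delta>' \<in> E" for m \<delta>'
    unfolding cmp_assoc[OF \<delta>c] using CD_gen E_mult that \<delta> by blast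
qed

abbreviation "fM \<equiv> (\<lambda>m. f \<odot>\<^bsub>M\<^esub> m) ` carrier M"
abbreviation "L \<equiv> CD (carrier M)"
abbreviation "N' \<equiv> CD fM"

lemma fM_sub: "fM \<subseteq> carrier M" using f by auto

lemma good_op_zero: assumes "good_op q R \<delta>" shows "\<delta> \<zero> = \<zero>"
proof -
  have "\<delta> (\<zero> [^] q \<otimes> \<zero>) = \<zero> [^] q \<otimes> \<delta> \<zero>" using assms unfolding good_op_def by blast
  then show ?thesis using good_op_closed[OF assms, of \<zero>] by (simp add: pow_q_zero)
qed

lemma dual_op_zero: "dual_op q R \<tau> \<Longrightarrow> \<tau> \<zero> = \<zero>"
  by (induct rule: dual_op.induct) (simp_all add: good_op_zero)

text \<open>When \<open>w\<close> is supported on the residue class of \<open>n\<close>, each summand \<open>\<delta>(-) g\<close> of \<open>\<tau>\<close> contributes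
  \<open>\<kappa>\<^sup>e(g f\<^sup>n m)\<close> times an element of \<open>R\<close>, and by the assumption on \<open>img\<close> this can be rewritten as
  \<open>\<kappa>\<^sup>e(f\<^sup>n f m')\<close>, that is, as coming from \<open>fM\<close>.\<close>

lemma cmp_hm_image:
  assumes \<tau>: "dual_op q R \<tau>" and img: "img e n \<subseteq> img e (Suc n)"
    and supp: "\<And>k. k mod q \<noteq> n \<Longrightarrow> p dvd w k" and w: "scal w \<in> E" and m: "m \<in> carrier M"
  shows "(\<lambda>s\<in>carrier U. K e (\<gamma> (\<lambda>k. \<tau> (scal w s k)) \<odot>\<^bsub>M\<^esub> m)) \<in> N'"
  using \<tau>
proof induct
  case (zero \<tau>)
  have "(\<lambda>s\<in>carrier U. K e (\<gamma> (\<lambda>k. \<tau> (scal w s k)) \<odot>\<^bsub>M\<^esub> m)) = \<zero>\<^bsub>H\<^esub>"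
    unfolding H_zero
  proof (rule restrict_ext)
    fix s assume s: "s \<in> carrier U"
    have "(\<lambda>k. \<tau> (scal w s k)) = \<zero>\<^bsub>U\<^esub>"
      using zero U_closed[OF scal_mem[OF s]] by (auto simp: U_zero)
    then show "K e (\<gamma> (\<lambda>k. \<tau> (scal w s k)) \<odot>\<^bsub>M\<^esub> m) = \<zero>\<^bsub>M\<^esub>"
      using m by (simp add: K_zero)
  qed
  then show ?case using CD_closed(2)[OF fM_sub] by simp
next
  case (add \<tau> \<delta> g \<tau>')
  have \<delta>: "\<And>x. x \<in> carrier R \<Longrightarrow> \<exists>r\<in>carrier R. \<delta> x = r [^] q"
    "\<And>x y. x \<in> carrier R \<Longrightarrow> y \<in> carrier R \<Longrightarrow> \<delta> (x \<oplus> y) = \<delta> x \<oplus> \<delta> y"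
    "\<And>a x. a \<in> carrier R \<Longrightarrow> x \<in> carrier R \<Longrightarrow> \<delta> (a [^] q \<otimes> x) = a [^] q \<otimes> \<delta> x"
    using add(3) unfolding good_op_def by blast+
  have \<delta>c: "\<delta> x \<in> carrier R" if "x \<in> carrier R" for x using good_op_closed[OF add(3) that] .
  have \<delta>0: "\<delta> \<zero> = \<zero>" by (rule good_op_zero[OF add(3)])
  define \<delta>' where "\<delta>' = restrict \<delta> (carrier R)"
  have d': "\<delta>' \<in> carrier (diff_ops p e R)"
    unfolding R_diff_op \<delta>'_def using \<delta>(2,3) \<delta>c by auto
  have gm: "g \<odot>\<^bsub>M\<^esub> m \<in> carrier M" using add(4) m by simp
  \<comment> \<open>The replacement m' is chosen here, before the argument s is fixed, and depends
    only on g and m.\<close>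
  have "K e ((f [^] n) \<odot>\<^bsub>M\<^esub> (g \<odot>\<^bsub>M\<^esub> m)) \<in> img e (Suc n)" using img imgI[OF gm] by blast
  then obtain m' where m': "m' \<in> carrier M"
    "K e ((f [^] n) \<odot>\<^bsub>M\<^esub> (g \<odot>\<^bsub>M\<^esub> m)) = K e ((f [^] Suc n) \<odot>\<^bsub>M\<^esub> m')" unfolding img_def by blast
  \<comment> \<open>The substitute for the summand of g: the factor v^q f^n coming from
    \<open>\<delta>\<close> is the same, only g m has become f m'.\<close>
  let ?z = "cmp (cmp (hm (f \<odot>\<^bsub>M\<^esub> m')) (coeff_op R \<delta>')) (scal w)"
  have zN: "?z \<in> N'"
    by (rule CD_comp[OF fM_sub w CD_gen[OF _ E_coeff[OF d']]]) (use m' in blast)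
  have coeffc: "coeff_op R \<delta>' s \<in> carrier U" if "s \<in> carrier U" for s
    using DO_mem[OF subsetD[OF E_carrier E_coeff[OF d']] that] .
  have \<tau>c: "(\<lambda>k. \<tau> (s k)) \<in> carrier U" if s: "s \<in> carrier U" for s
  proof -
    have "\<tau> \<zero> = \<zero>" by (rule dual_op_zero[OF add(1)])
    then show ?thesis using U_map[OF s, of "\<lambda>k. \<tau>"] dual_op_closed[OF add(1)] by blast
  qed
  have eq: "(\<lambda>s\<in>carrier U. K e (\<gamma> (\<lambda>k. \<tau>' (scal w s k)) \<odot>\<^bsub>M\<^esub> m)) =
      (\<lambda>s\<in>carrier U. K e (\<gamma> (\<lambda>k. \<tau> (scal w s k)) \<odot>\<^bsub>M\<^esub> m)) \<oplus>\<^bsub>H\<^esub> ?z"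
    unfolding H_add
  proof (rule restrict_ext)
    fix s assume s: "s \<in> carrier U"
    let ?s = "scal w s"
    have sc: "?s \<in> carrier U" by (rule scal_mem[OF s])
    define u where "u = (\<lambda>k. \<delta> (?s k))"
    have u: "u \<in> carrier U" unfolding u_def by (rule U_map[OF sc]) (auto simp: \<delta>c \<delta>0)
    have ugU: "(\<lambda>k. g \<otimes> u k) \<in> carrier U" by (rule U_map[OF u]) (use add(4) in auto)
    have "(\<lambda>k. \<tau>' (?s k)) = (\<lambda>k. \<tau> (?s k)) \<oplus>\<^bsub>U\<^esub> (\<lambda>k. g \<otimes> u k)"
    proof
      fix k
      show "\<tau>' (?s k) = ((\<lambda>k. \<tau> (?s k)) \<oplus>\<^bsub>U\<^esub> (\<lambda>k. g \<otimes> u k)) k"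
        unfolding U_add[OF \<tau>c[OF sc] ugU] unfolding u_def
        using add(4,5) U_closed[OF sc] \<delta>c by (simp add: m_comm)
    qed
    then have g1: "\<gamma> (\<lambda>k. \<tau>' (?s k)) = \<gamma> (\<lambda>k. \<tau> (?s k)) \<oplus> \<gamma> (\<lambda>k. g \<otimes> u k)"
      using \<tau>c[OF sc] ugU by simp
    have "(\<lambda>k. g \<otimes> u k) = monom U g 0 \<otimes>\<^bsub>U\<^esub> u"
      by (rule ext) (use add(4) u in \<open>simp add: monom_mult_coeff\<close>)
    moreover have "\<gamma> (monom U g 0) = g"
    proof -
      interpret UP_pre_univ_prop R R "\<lambda>r. r" U
        by unfold_locales (auto simp: ring_hom_def)
      show ?thesis unfolding graph_map_def using eval_const[OF f add(4)] .
    qed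
    ultimately have g2: "\<gamma> (\<lambda>k. g \<otimes> u k) = g \<otimes> \<gamma> u" using add(4) u by simp
    have "\<exists>v\<in>carrier R. \<gamma> u = v [^] q \<otimes> f [^] n"
    proof -
      have "\<forall>k. \<exists>r. r \<in> carrier R \<and> u k = r [^] q"
        unfolding u_def using \<delta>(1) U_closed[OF sc] by blast
      then obtain r where r: "\<And>k. r k \<in> carrier R" "\<And>k. u k = r k [^] q" by metis
      have u0: "u k = \<zero>" if "k mod q \<noteq> n" for k
        unfolding u_def scal_apply[OF s] using add_pow_dvd_zero[OF supp[OF that] U_closed[OF s]] \<delta>0 by simp
      \<comment> \<open>On the support of w an exponent k equals q (k div q) + n, so
        \<open>v k\<close> is a q-th root of what remains of the k-th term after f^n is split
        off.\<close>
      define v where "v k = (if k mod q = n then r k \<otimes> f [^] (k div q) else \<zero>)" for k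
      have vc: "v k \<in> carrier R" for k unfolding v_def using r f by simp
      have "u k \<otimes> f [^] k = v k [^] q \<otimes> f [^] n" for k
      proof (cases "k mod q = n")
        case True
        then have "(k div q) * q + n = k" using div_mult_mod_eq[of k q] by simp
        then have "f [^] k = f [^] ((k div q) * q + n)" by simp
        also have "\<dots> = (f [^] (k div q)) [^] q \<otimes> f [^] n" using f by (simp only: nat_pow_mult[symmetric] nat_pow_pow)
        finally show ?thesis using True r f by (simp add: v_def nat_pow_distrib m_assoc)
      next
        case False
        then show ?thesis using u0[OF False] f by (simp add: v_def pow_q_zero)
      qed
      then have "\<gamma> u = (\<Oplus>i\<in>{..deg R u}. v i [^] q \<otimes> f [^] n)" unfolding gamma_eq[OF u] by simp
      also have "\<dots> = (\<Oplus>i\<in>{..deg R u}. v i [^] q) \<otimes> f [^] n"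
        using vc f by (intro finsum_ldistr[symmetric]) auto
      also have "(\<Oplus>i\<in>{..deg R u}. v i [^] q) = (\<Oplus>i\<in>{..deg R u}. v i) [^] q"
        using vc by (intro frob_finsum[symmetric]) auto
      finally show ?thesis using vc by (intro bexI[of _ "\<Oplus>i\<in>{..deg R u}. v i"]) (auto intro: finsum_closed)
    qed
    then obtain v where v: "v \<in> carrier R" "\<gamma> u = v [^] q \<otimes> f [^] n" by blast
    have gu: "\<gamma> u \<in> carrier R" using u by simp
    have "K e (\<gamma> (\<lambda>k. g \<otimes> u k) \<odot>\<^bsub>M\<^esub> m) = K e ((v [^] q) \<odot>\<^bsub>M\<^esub> ((f [^] n) \<odot>\<^bsub>M\<^esub> (g \<odot>\<^bsub>M\<^esub> m)))"
      unfolding g2 v(2) using v(1) f add(4) m by (simp add: smult_assoc1[symmetric] m_ac)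
    also have "\<dots> = v \<odot>\<^bsub>M\<^esub> K e ((f [^] n) \<odot>\<^bsub>M\<^esub> (g \<odot>\<^bsub>M\<^esub> m))" using v(1) f gm by (intro K_smult) auto
    also have "\<dots> = v \<odot>\<^bsub>M\<^esub> K e ((f [^] Suc n) \<odot>\<^bsub>M\<^esub> m')" unfolding m'(2) ..
    also have "\<dots> = K e ((v [^] q) \<odot>\<^bsub>M\<^esub> ((f [^] Suc n) \<odot>\<^bsub>M\<^esub> m'))" using v(1) f m' by (intro K_smult[symmetric]) auto
    also have "(v [^] q) \<odot>\<^bsub>M\<^esub> ((f [^] Suc n) \<odot>\<^bsub>M\<^esub> m') = \<gamma> u \<odot>\<^bsub>M\<^esub> (f \<odot>\<^bsub>M\<^esub> m')"
      unfolding v(2) using v(1) f m' by (simp add: smult_assoc1[symmetric] m_ac)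
    finally have key: "K e (\<gamma> (\<lambda>k. g \<otimes> u k) \<odot>\<^bsub>M\<^esub> m) = K e (\<gamma> u \<odot>\<^bsub>M\<^esub> (f \<odot>\<^bsub>M\<^esub> m'))" .
    have "coeff_op R \<delta>' ?s = u"
      unfolding coeff_op_eq u_def cop_def \<delta>'_def using sc by (auto simp: U_closed)
    then have zs: "?z s = K e (\<gamma> u \<odot>\<^bsub>M\<^esub> (f \<odot>\<^bsub>M\<^esub> m'))"
      using s sc u by (simp add: compose_def hm_def)
    have "K e (\<gamma> (\<lambda>k. \<tau>' (?s k)) \<odot>\<^bsub>M\<^esub> m) = K e (\<gamma> (\<lambda>k. \<tau> (?s k)) \<odot>\<^bsub>M\<^esub> m \<oplus>\<^bsub>M\<^esub> \<gamma> (\<lambda>k. g \<otimes> u k) \<odot>\<^bsub>M\<^esub> m)"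
      unfolding g1 using \<tau>c[OF sc] ugU m by (simp add: smult_l_distr)
    also have "\<dots> = K e (\<gamma> (\<lambda>k. \<tau> (?s k)) \<odot>\<^bsub>M\<^esub> m) \<oplus>\<^bsub>M\<^esub> K e (\<gamma> (\<lambda>k. g \<otimes> u k) \<odot>\<^bsub>M\<^esub> m)"
      using \<tau>c[OF sc] ugU m by (intro K_add) auto
    finally show "K e (\<gamma> (\<lambda>k. \<tau>' (?s k)) \<odot>\<^bsub>M\<^esub> m) =
        (\<lambda>s\<in>carrier U. K e (\<gamma> (\<lambda>k. \<tau> (scal w s k)) \<odot>\<^bsub>M\<^esub> m)) s \<oplus>\<^bsub>M\<^esub> ?z s"
      unfolding key zs using s by simp
  qed
  show ?case unfolding eq by (rule CD_closed(3)[OF fM_sub add(2) zN])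
qed

text \<open>A generator of \<open>L\<close> is some \<open>hm m\<close> followed by an element of
  \<open>E\<close>. The projector is moved past that element by \<open>E_commute\<close>, and
  \<open>cmp_hm_image\<close>, with \<open>\<tau>\<close> acting as the identity, applies to
  \<open>hm m\<close>.\<close>

lemma L_comp_in_N':
  assumes \<tau>: "dual_op q R \<tau>" "\<And>x. x \<in> carrier R \<Longrightarrow> \<tau> x = x" and img: "img e n \<subseteq> img e (Suc n)"
    and supp: "\<And>k. k mod q \<noteq> n \<Longrightarrow> p dvd w k" and w: "scal w \<in> E" and y: "y \<in> L"
  shows "cmp y (scal w) \<in> N'"
proof (rule CD_induct[OF _ fM_sub _ _ y])
  show wD: "scal w \<in> carrier DO" using w E_carrier by blast
  fix m \<delta> assume m: "m \<in> carrier M" and \<delta>: "\<delta> \<in> E"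
  have \<delta>D: "\<delta> \<in> carrier DO" using \<delta> E_carrier by blast
  have "cmp \<delta> (scal w) = cmp (scal w) \<delta>"
    unfolding compose_def by (rule restrict_ext) (simp add: E_commute[OF \<delta>])
  then have "cmp (cmp (hm m) \<delta>) (scal w) = cmp (cmp (hm m) (scal w)) \<delta>"
    by (simp add: cmp_assoc wD \<delta>D)
  moreover have "cmp (hm m) (scal w) = (\<lambda>s\<in>carrier U. K e (\<gamma> (\<lambda>k. \<tau> (scal w s k)) \<odot>\<^bsub>M\<^esub> m))"
    unfolding compose_def hm_def
    by (rule restrict_ext) (simp add: scal_mem \<tau>(2) U_closed[OF scal_mem])
  ultimately show "cmp (cmp (hm m) \<delta>) (scal w) \<in> N'"
    using CD_comp[OF fM_sub \<delta> cmp_hm_image[OF \<tau>(1) img supp w m]] by simp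
qed simp

lemma E_DO: "scal w \<in> E \<Longrightarrow> scal w \<in> carrier DO" using E_carrier by blast

lemma cmp_scal_add:
  assumes y: "y \<in> carrier H"
  shows "cmp y (scal (\<lambda>k. w k + w' k)) = cmp y (scal w) \<oplus>\<^bsub>H\<^esub> cmp y (scal w')"
  unfolding H_add compose_def
proof (rule restrict_ext)
  fix s assume s: "s \<in> carrier U"
  have "scal (\<lambda>k. w k + w' k) s = scal w s \<oplus>\<^bsub>U\<^esub> scal w' s"
  proof
    fix k
    show "scal (\<lambda>k. w k + w' k) s k = (scal w s \<oplus>\<^bsub>U\<^esub> scal w' s) k"
      unfolding U_add[OF scal_mem[OF s] scal_mem[OF s]] using s
      by (simp add: scal_apply add_pow_add U_closed)
  qed
  then show "y (scal (\<lambda>k. w k + w' k) s) = (\<lambda>x\<in>carrier U. y (scal w x)) s \<oplus>\<^bsub>M\<^esub> (\<lambda>x\<in>carrier U. y (scal w' x)) s"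
    using s HD(2)[OF y scal_mem[OF s] scal_mem[OF s]] by simp
qed

lemma cmp_scal_mult: "scal w' \<in> E \<Longrightarrow> cmp (cmp y (scal w)) (scal w') = cmp y (scal (\<lambda>k. w k * w' k))"
  by (simp add: cmp_assoc[OF E_DO] scal_mult)

lemma cmp_scal_one: assumes y: "y \<in> carrier H" shows "cmp y (scal (\<lambda>_. 1)) = y"
proof (rule H_ext[OF cmp_closed[OF y E_DO[OF E_one]] y])
  fix x assume "x \<in> carrier U"
  moreover from this have "scal (\<lambda>_. 1) x = x" by (auto simp: scal_apply U_closed)
  ultimately show "cmp y (scal (\<lambda>_. 1)) x = y x" by (simp add: compose_def)
qed

lemma cmp_scal_dvd:
  assumes y: "y \<in> carrier H" and w: "\<And>k. p dvd w k" shows "cmp y (scal w) = \<zero>\<^bsub>H\<^esub>"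
  unfolding H_zero compose_def
proof (rule restrict_ext)
  fix s assume s: "s \<in> carrier U"
  have "scal w s = \<zero>\<^bsub>U\<^esub>"
    unfolding scal_apply[OF s] using add_pow_dvd_zero[OF w U_closed[OF s]] by (auto simp: U_zero)
  moreover have "y \<zero>\<^bsub>U\<^esub> = \<zero>\<^bsub>M\<^esub>"
    using lin_map_zero[OF module_NU module_G, of y] y unfolding H_carrier by (simp add: G_simps)
  ultimately show "y (scal w s) = \<zero>\<^bsub>M\<^esub>" by simp
qed

text \<open>Each theta_(p^j) - i_(j+1) sends h into \<open>N'\<close>, so modulo \<open>N'\<close>
  the vector h is fixed by the projector onto exponents congruent to n modulo p^e. That projector
  sends all of \<open>L\<close> into \<open>N'\<close>, hence h lies there.\<close>

lemma joint_eigenvector: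
  assumes \<tau>: "dual_op q R \<tau>" "\<And>x. x \<in> carrier R \<Longrightarrow> \<tau> x = x" and img: "img e n \<subseteq> img e (Suc n)"
    and n: "n = (\<Sum>j<e. i (Suc j) * p ^ j)" and i: "\<And>j. j < e \<Longrightarrow> i (Suc j) < p"
    and h: "h \<in> L"
    and eig: "\<And>j. j < e \<Longrightarrow> \<exists>y\<in>N'. cmp h (scal (\<lambda>k. k choose p ^ j)) = y \<oplus>\<^bsub>H\<^esub> cmp h (scal (\<lambda>_. i (Suc j)))"
  shows "h \<in> N'"
proof -
  have p2: "p \<ge> 2" using prime_ge_2_nat[OF prime_p] .
  have hH: "h \<in> carrier H" using CD_closed(1)[OF _ h] by simp
  \<comment> \<open>The weights of theta_(p^j) - i_(j+1), with -1 written as p - 1.\<close>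
  define w0 where "w0 j k = (k choose p ^ j) + (p - 1) * i (Suc j)" for j k
  have w0E: "scal (w0 j) \<in> E" if "j < e" for j
    unfolding w0_def by (rule E_scal_add[OF E_euler[OF that] E_scal_const])
  have w0N: "cmp h (scal (w0 j)) \<in> N'" if j: "j < e" for j
  proof -
    obtain y where y: "y \<in> N'" "cmp h (scal (\<lambda>k. k choose p ^ j)) = y \<oplus>\<^bsub>H\<^esub> cmp h (scal (\<lambda>_. i (Suc j)))"
      using eig[OF j] by blast
    let ?a = "cmp h (scal (\<lambda>_. i (Suc j)))" and ?b = "cmp h (scal (\<lambda>_. (p - 1) * i (Suc j)))"
    have c: "y \<in> carrier H" "?a \<in> carrier H" "?b \<in> carrier H"
      using CD_closed(1)[OF fM_sub y(1)] cmp_closed[OF hH] E_DO[OF E_scal_const] by auto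
    have "i (Suc j) + (p - 1) * i (Suc j) = p * i (Suc j)" using p2 by (cases p) auto
    then have "?a \<oplus>\<^bsub>H\<^esub> ?b = \<zero>\<^bsub>H\<^esub>"
      using cmp_scal_add[OF hH, of "\<lambda>_. i (Suc j)" "\<lambda>_. (p - 1) * i (Suc j)"] cmp_scal_dvd[OF hH, of "\<lambda>_. p * i (Suc j)"]
      by simp
    then have "(y \<oplus>\<^bsub>H\<^esub> ?a) \<oplus>\<^bsub>H\<^esub> ?b = y" using c by (simp add: Hg.a_assoc)
    then have "cmp h (scal (w0 j)) = y"
      unfolding w0_def cmp_scal_add[OF hH] y(2) .
    then show ?thesis using y(1) by simp
  qed
  \<comment> \<open>By Fermat, \<open>r j\<close> is modulo \<open>p\<close> the indicator function of the vanishing of \<open>w0 j\<close>, so the product of the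
     \<open>r j\<close> projects onto the joint eigenspace.\<close>
  define r where "r j k = 1 + (p - 1) * w0 j k ^ (p - 1)" for j k
  have rE: "scal (r j) \<in> E" if "j < e" for j
    unfolding r_def by (rule E_scal_add[OF E_one E_scal_mult[OF E_scal_const E_scal_power[OF w0E[OF that]]]])
  have rdec: "\<exists>y\<in>N'. h = cmp h (scal (r j)) \<oplus>\<^bsub>H\<^esub> y" if j: "j < e" for j
  proof -
    \<comment> \<open>The power p - 1 is split as 1 + (p - 2): the first factor is known to send h
      into \<open>N'\<close>, and the rest preserves \<open>N'\<close>.\<close>
    have "cmp (cmp h (scal (w0 j))) (scal (\<lambda>k. w0 j k ^ (p - 2))) \<in> N'"
      by (rule CD_comp[OF fM_sub E_scal_power[OF w0E[OF j]] w0N[OF j]])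
    then have "cmp h (scal (\<lambda>k. w0 j k * w0 j k ^ (p - 2))) \<in> N'"
      by (simp add: cmp_scal_mult[OF E_scal_power[OF w0E[OF j]]])
    moreover have "p - 1 = Suc (p - 2)" using p2 by simp
    ultimately have y: "cmp h (scal (\<lambda>k. w0 j k ^ (p - 1))) \<in> N'" by (simp only: power_Suc)
    have "scal (\<lambda>k. r j k + w0 j k ^ (p - 1)) = scal (\<lambda>_. 1)"
    proof (rule scal_cong)
      fix k
      have "r j k + w0 j k ^ (p - 1) = 1 + p * w0 j k ^ (p - 1)" unfolding r_def using p2 by (cases p) auto
      then show "(r j k + w0 j k ^ (p - 1)) mod p = 1 mod p" by (simp only: mod_mult_self2)
    qed
    then have "h = cmp h (scal (\<lambda>k. r j k + w0 j k ^ (p - 1)))" using cmp_scal_one[OF hH] by simp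
    also have "\<dots> = cmp h (scal (r j)) \<oplus>\<^bsub>H\<^esub> cmp h (scal (\<lambda>k. w0 j k ^ (p - 1)))" by (rule cmp_scal_add[OF hH])
    finally show ?thesis using y by (intro bexI)
  qed
  define P where "P c k = (\<Prod>j<c. r j k)" for c k
  have PE: "c \<le> e \<Longrightarrow> scal (P c) \<in> E" for c
  proof (induct c)
    case 0 then show ?case using E_one by (simp add: P_def)
  next
    case (Suc c)
    then have "scal (\<lambda>k. P c k * r c k) \<in> E" by (intro E_scal_mult rE) auto
    then show ?case by (simp add: P_def)
  qed
  have Pdec: "c \<le> e \<Longrightarrow> \<exists>y\<in>N'. h = cmp h (scal (P c)) \<oplus>\<^bsub>H\<^esub> y" for c
  proof (induct c)
    case 0
    have "P 0 = (\<lambda>_. 1)" by (rule ext) (simp add: P_def)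
    then have "h = cmp h (scal (P 0)) \<oplus>\<^bsub>H\<^esub> \<zero>\<^bsub>H\<^esub>" using cmp_scal_one[OF hH] hH by simp
    then show ?case using CD_closed(2)[OF fM_sub] by blast
  next
    case (Suc c)
    then have c: "c < e" "c \<le> e" by auto
    obtain y where y: "y \<in> N'" "h = cmp h (scal (P c)) \<oplus>\<^bsub>H\<^esub> y" using Suc c by blast
    obtain z where z: "z \<in> N'" "h = cmp h (scal (r c)) \<oplus>\<^bsub>H\<^esub> z" using rdec[OF c(1)] by blast
    have PD: "scal (P c) \<in> carrier DO" by (rule E_DO[OF PE[OF c(2)]])
    have "cmp h (scal (P c)) = cmp (cmp h (scal (r c)) \<oplus>\<^bsub>H\<^esub> z) (scal (P c))" using z(2) by simp
    also have "\<dots> = cmp h (scal (\<lambda>k. r c k * P c k)) \<oplus>\<^bsub>H\<^esub> cmp z (scal (P c))"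
      by (simp add: cmp_add[OF PD] cmp_scal_mult[OF PE[OF c(2)]])
    also have "(\<lambda>k. r c k * P c k) = P (Suc c)" by (rule ext) (simp add: P_def)
    finally have "h = (cmp h (scal (P (Suc c))) \<oplus>\<^bsub>H\<^esub> cmp z (scal (P c))) \<oplus>\<^bsub>H\<^esub> y" using y(2) by simp
    moreover have zN: "cmp z (scal (P c)) \<in> N'" by (rule CD_comp[OF fM_sub PE[OF c(2)] z(1)])
    moreover have "cmp h (scal (P (Suc c))) \<in> carrier H" by (rule cmp_closed[OF hH E_DO[OF PE[OF Suc.prems]]])
    ultimately have "h = cmp h (scal (P (Suc c))) \<oplus>\<^bsub>H\<^esub> (cmp z (scal (P c)) \<oplus>\<^bsub>H\<^esub> y)"
      using CD_closed(1)[OF fM_sub] y(1) by (simp add: Hg.a_assoc)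
    then show ?case using CD_closed(3)[OF fM_sub zN y(1)] by blast
  qed
  \<comment> \<open>An exponent outside the class of n differs from n in some digit j, and there the
    factor \<open>r j k\<close> vanishes modulo p.\<close>
  have supp: "p dvd P e k" if "k mod q \<noteq> n" for k
  proof -
    have "\<exists>j<e. (k div p ^ j) mod p \<noteq> i (Suc j)"
    proof (rule ccontr)
      assume "\<not> ?thesis"
      then have "k mod q = (\<Sum>j<e. i (Suc j) * p ^ j)" by (intro digits_determine_mod) blast
      then show False using that n by simp
    qed
    then obtain j where j: "j < e" "(k div p ^ j) mod p \<noteq> i (Suc j)" by blast
    have "\<not> p dvd w0 j k"
    proof
      assume "p dvd w0 j k"
      then have "(w0 j k + i (Suc j)) mod p = i (Suc j) mod p" by (metis add_0 dvd_imp_mod_0 mod_add_left_eq)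
      moreover have "w0 j k + i (Suc j) = (k choose p ^ j) + p * i (Suc j)" unfolding w0_def using p2 by (cases p) auto
      ultimately have "(k choose p ^ j) mod p = i (Suc j)" using i[OF j(1)] by simp
      then show False using j(2) binomial_prime_power_mod[OF prime_p] by simp
    qed
    then have "[w0 j k ^ (p - 1) = 1] (mod p)" using fermat_theorem[OF prime_p] by blast
    then have "[1 + (p - 1) * w0 j k ^ (p - 1) = 1 + (p - 1) * 1] (mod p)" by (intro cong_add cong_mult cong_refl)
    then have "p dvd r j k" unfolding r_def using p2 by (simp add: cong_def dvd_eq_mod_eq_0)
    then show ?thesis unfolding P_def using j(1) by (meson dvd_prodI dvd_trans finite_lessThan lessThan_iff)
  qed
  obtain y where y: "y \<in> N'" "h = cmp h (scal (P e)) \<oplus>\<^bsub>H\<^esub> y" using Pdec by blast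
  have "cmp h (scal (P e)) \<in> N'" by (rule L_comp_in_N'[OF \<tau> img supp PE h]) auto
  then show ?thesis using CD_closed(3)[OF fM_sub _ y(1)] y(2) by metis
qed

section \<open>The quotient N_e as a group of cosets\<close>

abbreviation "NM \<equiv> N_mod p e R M \<kappa> f"

definition N_coset where "N_coset h = {y \<oplus>\<^bsub>H\<^esub> h | y. y \<in> N'}"

lemma NM_simps: "carrier NM = N_coset ` L" "\<one>\<^bsub>NM\<^esub> = N'"
  "X \<otimes>\<^bsub>NM\<^esub> Y = {x \<oplus>\<^bsub>H\<^esub> y | x y. x \<in> X \<and> y \<in> Y}"
  unfolding N_mod_def A_FactGroup_def FactGroup_def RCOSETS_def set_mult_def
  by (auto simp: r_coset_def N_coset_def)

lemmas N'c = CD_closed[OF fM_sub]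
lemmas Lc = CD_closed[OF subset_refl]

lemma N_coset_add: assumes "a \<in> carrier H" "b \<in> carrier H" shows "N_coset a \<otimes>\<^bsub>NM\<^esub> N_coset b = N_coset (a \<oplus>\<^bsub>H\<^esub> b)"
proof
  show "N_coset a \<otimes>\<^bsub>NM\<^esub> N_coset b \<subseteq> N_coset (a \<oplus>\<^bsub>H\<^esub> b)"
  proof
    fix x assume "x \<in> N_coset a \<otimes>\<^bsub>NM\<^esub> N_coset b"
    then obtain y z where yz: "y \<in> N'" "z \<in> N'" "x = (y \<oplus>\<^bsub>H\<^esub> a) \<oplus>\<^bsub>H\<^esub> (z \<oplus>\<^bsub>H\<^esub> b)"
      unfolding NM_simps N_coset_def by blast
    then have "x = (y \<oplus>\<^bsub>H\<^esub> z) \<oplus>\<^bsub>H\<^esub> (a \<oplus>\<^bsub>H\<^esub> b)"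
      using assms N'c(1) by (simp add: Hg.add.m_ac)
    then show "x \<in> N_coset (a \<oplus>\<^bsub>H\<^esub> b)" unfolding N_coset_def using N'c(3)[OF yz(1,2)] by blast
  qed
  show "N_coset (a \<oplus>\<^bsub>H\<^esub> b) \<subseteq> N_coset a \<otimes>\<^bsub>NM\<^esub> N_coset b"
  proof
    fix x assume "x \<in> N_coset (a \<oplus>\<^bsub>H\<^esub> b)"
    then obtain y where y: "y \<in> N'" "x = y \<oplus>\<^bsub>H\<^esub> (a \<oplus>\<^bsub>H\<^esub> b)" unfolding N_coset_def by blast
    then have "x = (y \<oplus>\<^bsub>H\<^esub> a) \<oplus>\<^bsub>H\<^esub> (\<zero>\<^bsub>H\<^esub> \<oplus>\<^bsub>H\<^esub> b)" using assms N'c(1) by (simp add: Hg.a_assoc)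
    then show "x \<in> N_coset a \<otimes>\<^bsub>NM\<^esub> N_coset b" unfolding NM_simps N_coset_def using y(1) N'c(2) by blast
  qed
qed

lemma N_coset_zero: "N_coset \<zero>\<^bsub>H\<^esub> = N'"
  unfolding N_coset_def using N'c(1) by force

lemma N_coset_mem: "h \<in> carrier H \<Longrightarrow> h \<in> N_coset h"
  unfolding N_coset_def using N'c(2) Hg.l_zero by force

lemma N_coset_N': "h \<in> N' \<Longrightarrow> N_coset h = N'"
proof
  assume h: "h \<in> N'"
  show "N_coset h \<subseteq> N'" unfolding N_coset_def using N'c(3) h by blast
  show "N' \<subseteq> N_coset h"
  proof
    fix y assume y: "y \<in> N'"
    have "y = (y \<oplus>\<^bsub>H\<^esub> \<ominus>\<^bsub>H\<^esub> h) \<oplus>\<^bsub>H\<^esub> h" using y h N'c(1) by (simp add: Hg.a_assoc Hg.l_neg)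
    then show "y \<in> N_coset h" unfolding N_coset_def using N'c(3)[OF y N'c(4)[OF h]] by blast
  qed
qed

text \<open>Powers in the multiplicatively written quotient are integer multiples. Expressing them
  through \<open>scal\<close> puts the eigenvalue side of the equations into the same form as the
  Euler operators.\<close>

lemma N_coset_pow: "h \<in> carrier H \<Longrightarrow> N_coset h [^]\<^bsub>NM\<^esub> (k::nat) = N_coset (cmp h (scal (\<lambda>_. k)))"
proof (induct k)
  case 0
  then show ?case using cmp_scal_dvd[of h "\<lambda>_. 0"] by (simp add: nat_pow_def N_coset_zero NM_simps(2))
next
  case (Suc k)
  have "N_coset h [^]\<^bsub>NM\<^esub> Suc k = N_coset h [^]\<^bsub>NM\<^esub> k \<otimes>\<^bsub>NM\<^esub> N_coset h" by (simp add: nat_pow_def)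
  also have "\<dots> = N_coset (cmp h (scal (\<lambda>_. k)) \<oplus>\<^bsub>H\<^esub> cmp h (scal (\<lambda>_. 1)))"
    unfolding cmp_scal_one[OF Suc(2)] Suc(1)[OF Suc(2)]
    by (rule N_coset_add[OF cmp_closed[OF Suc(2) E_DO[OF E_scal_const]] Suc(2)])
  also have "\<dots> = N_coset (cmp h (scal (\<lambda>_. k + 1)))" unfolding cmp_scal_add[OF Suc(2)] ..
  finally show ?case by simp
qed

lemma N_act_N_coset:
  assumes h: "h \<in> carrier H" and \<delta>: "\<delta> \<in> E"
  shows "N_act p e R M \<kappa> f \<delta> (N_coset h) = N_coset (cmp h \<delta>)"
proof -
  have \<delta>D: "\<delta> \<in> carrier DO" using \<delta> E_carrier by blast
  have hc: "cmp h \<delta> \<in> carrier H" by (rule cmp_closed[OF h \<delta>D])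
  have eq: "N_act p e R M \<kappa> f \<delta> (N_coset h) = {y \<oplus>\<^bsub>H\<^esub> cmp x \<delta> | y x. y \<in> N' \<and> x \<in> N_coset h}"
    unfolding N_act_def quot_op_def set_add_def' by blast
  show ?thesis unfolding eq
  proof
    show "{y \<oplus>\<^bsub>H\<^esub> cmp x \<delta> | y x. y \<in> N' \<and> x \<in> N_coset h} \<subseteq> N_coset (cmp h \<delta>)"
    proof safe
      fix y x assume y: "y \<in> N'" and "x \<in> N_coset h"
      then obtain z where z: "z \<in> N'" "x = z \<oplus>\<^bsub>H\<^esub> h" unfolding N_coset_def by blast
      have zN: "cmp z \<delta> \<in> N'" by (rule CD_comp[OF fM_sub \<delta> z(1)])
      have "y \<oplus>\<^bsub>H\<^esub> cmp x \<delta> = (y \<oplus>\<^bsub>H\<^esub> cmp z \<delta>) \<oplus>\<^bsub>H\<^esub> cmp h \<delta>"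
        unfolding z(2) cmp_add[OF \<delta>D] using N'c(1)[OF y] N'c(1)[OF zN] hc by (simp add: Hg.a_assoc)
      then show "y \<oplus>\<^bsub>H\<^esub> cmp x \<delta> \<in> N_coset (cmp h \<delta>)" unfolding N_coset_def using N'c(3)[OF y zN] by blast
    qed
    show "N_coset (cmp h \<delta>) \<subseteq> {y \<oplus>\<^bsub>H\<^esub> cmp x \<delta> | y x. y \<in> N' \<and> x \<in> N_coset h}"
      unfolding N_coset_def[of "cmp h \<delta>"] using N_coset_mem[OF h] by blast
  qed
qed

text \<open>Choosing a representative of a coset turns each eigenvalue equation into an equation up
  to \<open>N'\<close>, the form that \<open>joint_eigenvector\<close> takes. The opposite inclusion
  says only that the neutral element satisfies the equations for every i.\<close>

theorem eigenspace_trivial: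
  assumes \<tau>: "dual_op q R \<tau>" "\<And>x. x \<in> carrier R \<Longrightarrow> \<tau> x = x" and img: "img e n \<subseteq> img e (Suc n)"
    and n: "n = (\<Sum>j<e. i (Suc j) * p ^ j)" and i: "\<And>j. j < e \<Longrightarrow> i (Suc j) < p"
  shows "eigenspace p e R M \<kappa> f i = {\<one>\<^bsub>NM\<^esub>}"
proof
  show "eigenspace p e R M \<kappa> f i \<subseteq> {\<one>\<^bsub>NM\<^esub>}"
  proof
    fix X assume X: "X \<in> eigenspace p e R M \<kappa> f i"
    then obtain h where h: "h \<in> L" "X = N_coset h" unfolding eigenspace_def NM_simps by blast
    have hH: "h \<in> carrier H" by (rule Lc(1)[OF h(1)])
    have "h \<in> N'"
    proof (rule joint_eigenvector[OF \<tau> img n i h(1)])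
      fix j assume j: "j < e"
      have "\<forall>j\<in>{1..e}. N_act p e R M \<kappa> f (euler_op R (p ^ (j - 1))) X = X [^]\<^bsub>NM\<^esub> i j"
        using X unfolding eigenspace_def by blast
      from bspec[OF this, of "Suc j"]
      have "N_act p e R M \<kappa> f (euler_op R (p ^ j)) X = X [^]\<^bsub>NM\<^esub> i (Suc j)"
        using j by simp
      then have "N_coset (cmp h (scal (\<lambda>k. k choose p ^ j))) = N_coset (cmp h (scal (\<lambda>_. i (Suc j))))"
        unfolding h(2) euler_op_eq using N_act_N_coset[OF hH E_euler[OF j]] N_coset_pow[OF hH] by simp
      then have "cmp h (scal (\<lambda>k. k choose p ^ j)) \<in> N_coset (cmp h (scal (\<lambda>_. i (Suc j))))"
        using N_coset_mem[OF cmp_closed[OF hH E_DO[OF E_euler[OF j]]]] by simp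
      then show "\<exists>y\<in>N'. cmp h (scal (\<lambda>k. k choose p ^ j)) = y \<oplus>\<^bsub>H\<^esub> cmp h (scal (\<lambda>_. i (Suc j)))"
        unfolding N_coset_def by blast
    qed
    then show "X \<in> {\<one>\<^bsub>NM\<^esub>}" using h(2) N_coset_N' NM_simps(2) by simp
  qed
  have "N_act p e R M \<kappa> f (euler_op R (p ^ (j - 1))) N' = N' [^]\<^bsub>NM\<^esub> i j" if j: "j \<in> {1..e}" for j
  proof -
    have E: "scal (\<lambda>k. k choose p ^ (j - 1)) \<in> E" using j by (intro E_euler) auto
    have "N_act p e R M \<kappa> f (euler_op R (p ^ (j - 1))) (N_coset \<zero>\<^bsub>H\<^esub>) = N_coset \<zero>\<^bsub>H\<^esub>"
      unfolding euler_op_eq N_act_N_coset[OF Hg.zero_closed E] cmp_zero[OF E_DO[OF E]] ..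
    moreover have "N_coset \<zero>\<^bsub>H\<^esub> [^]\<^bsub>NM\<^esub> i j = N_coset \<zero>\<^bsub>H\<^esub>"
      unfolding N_coset_pow[OF Hg.zero_closed] cmp_zero[OF E_DO[OF E_scal_const]] ..
    ultimately show ?thesis unfolding N_coset_zero by simp
  qed
  moreover have "N' \<in> carrier NM" unfolding NM_simps using Lc(2) N_coset_zero by (metis image_eqI)
  ultimately show "{\<one>\<^bsub>NM\<^esub>} \<subseteq> eigenspace p e R M \<kappa> f i" unfolding eigenspace_def NM_simps(2) by blast
qed

end

text \<open>A zero of a finite product is a zero of a factor, and multiplication by p^e gives i_j
  the weight p^(j-1). The shift \<open>Suc j\<close> matches digits counted from 0 with eigenvalues
  counted from 1.\<close>

lemma bernstein_sato_root:
  assumes "poly (bernstein_sato_poly p e R M \<kappa> f) (of_nat n / of_nat p ^ e) = 0" and p: "p > 0"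
  shows "\<exists>i\<in>Gamma_set p e R M \<kappa> f. n = (\<Sum>j<e. i (Suc j) * p ^ j)"
proof -
  have "Gamma_set p e R M \<kappa> f \<subseteq> {1..e} \<rightarrow>\<^sub>E {0..<p}" unfolding Gamma_set_def by blast
  then have "finite (Gamma_set p e R M \<kappa> f)" by (rule finite_subset) (simp add: finite_PiE)
  then obtain i where i: "i \<in> Gamma_set p e R M \<kappa> f"
    "(of_nat n :: rat) / of_nat p ^ e = (\<Sum>j=1..e. of_nat (i j) / of_nat p ^ (e + 1 - j))"
    using assms(1) unfolding bernstein_sato_poly_def by (auto simp: poly_prod prod_zero_iff)
  have "(of_nat n :: rat) = (\<Sum>j=1..e. of_nat (i j) / of_nat p ^ (e + 1 - j)) * of_nat p ^ e"
    using i(2) p by (simp add: field_simps)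
  also have "\<dots> = (\<Sum>j=1..e. of_nat (i j) * of_nat p ^ (j - 1))"
    unfolding sum_distrib_right
  proof (rule sum.cong[OF refl])
    fix j assume j: "j \<in> {1..e}"
    then have "e = (e + 1 - j) + (j - 1)" by auto
    then have "(of_nat p :: rat) ^ e = of_nat p ^ (e + 1 - j) * of_nat p ^ (j - 1)" by (metis power_add)
    then show "of_nat (i j) / of_nat p ^ (e + 1 - j) * of_nat p ^ e = of_nat (i j) * (of_nat p :: rat) ^ (j - 1)"
      using p by simp
  qed
  also have "\<dots> = (\<Sum>j<e. of_nat (i (Suc j)) * of_nat p ^ j)"
    by (rule sum.reindex_bij_witness[of _ Suc "\<lambda>j. j - 1"]) auto
  finally have "(of_nat n :: rat) = of_nat (\<Sum>j<e. i (Suc j) * p ^ j)" by simp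
  then have "n = (\<Sum>j<e. i (Suc j) * p ^ j)" by (simp only: of_nat_eq_iff)
  then show ?thesis using i(1) by blast
qed

theorem theorem5p3:
  fixes k :: "'k ring" and R :: "'a ring" and M :: "('a, 'm) module"
    and \<kappa> :: "'m \<Rightarrow> 'm" and f :: 'a and p :: nat and l :: rat
  assumes "field k" and "has_prime_char k p" and "F_finite p k"
    and "ess_finite_type k R" and "regular_ring R"
    and "cartier_module p R M \<kappa>"
    and "f \<in> carrier R" and "regular_element M f"
    and "F_regular p (loc_ring R (powers R f)) (loc_mod R (powers R f) M)
           (loc_kappa p R (powers R f) M \<kappa>)"
    and "0 < l" and "l \<le> 1" and "\<exists>a b :: int. \<not> int p dvd b \<and> l = of_int a / of_int b"
  shows "\<exists>e0. \<forall>e\<ge>e0. l * (of_nat p ^ e - 1) \<in> \<int> \<and>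
           poly (bernstein_sato_poly p e R M \<kappa> f) (of_int (\<lceil>l * of_nat p ^ e\<rceil> - 1) / of_nat p ^ e) = 0
         \<longrightarrow> carrier (Gr_sigma p R M \<kappa> f l) \<noteq> {\<one>\<^bsub>Gr_sigma p R M \<kappa> f l\<^esub>}"
proof (cases "carrier (Gr_sigma p R M \<kappa> f l) = {\<one>\<^bsub>Gr_sigma p R M \<kappa> f l\<^esub>}")
  \<comment> \<open>Only a vanishing graded piece leaves something to show, and then the root is
    refuted for all e from some index on.\<close>
  case True
  have R: "cring R" and no: "noetherian_ring R" using assms(5) unfolding regular_ring_def by auto
  obtain G where G: "has_prime_char R p" "finite G" "G \<subseteq> carrier R" "carrier R \<subseteq> frob_span p 1 R G"
    using ess_finite_type_frob_span[OF assms(1-4) R] by blast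
  interpret Rc: cring_char R p by (intro cring_char.intro cring_char_axioms.intro R G(1))
  have M: "module R M" "fg_module R M" "lin_map R (frob p 1 R M) M \<kappa>"
    using assms(6) unfolding cartier_module_def by auto
  interpret module R M by (rule M)
  interpret cartier_f R p M \<kappa> f
    by (intro cartier_f.intro cartier.intro cartier_axioms.intro cartier_f_axioms.intro
      Rc.cring_char_axioms M(1) no noeth_moduleI[OF no M(2)] M(3) assms(7))
  obtain e0 where e0: "\<forall>e\<ge>e0. \<forall>n. l * (of_nat p ^ e - 1) = of_nat n \<longrightarrow> img e n \<subseteq> img e (Suc n)"
    using Gr_trivial_img[OF assms(10) True] by blast
  show ?thesis
  proof (intro exI[of _ e0] allI impI notI)
    fix e assume e: "e0 \<le> e" and h: "l * (of_nat p ^ e - 1) \<in> \<int> \<and>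
      poly (bernstein_sato_poly p e R M \<kappa> f) (of_int (\<lceil>l * of_nat p ^ e\<rceil> - 1) / of_nat p ^ e) = 0"
    obtain z where z: "l * (of_nat p ^ e - 1) = of_int z" using h by (auto elim: Ints_cases)
    have "0 \<le> l * (of_nat p ^ e - 1)" using assms(10) p_pow_ge1[of e] by simp
    then have "0 \<le> z" unfolding z by simp
    then obtain n where n: "z = int n" using nonneg_int_cases by blast
    have ln: "l * (of_nat p ^ e - 1) = of_nat n" using z n by simp
    \<comment> \<open>Here l p^e = z + l with 0 < l \<le> 1, so the root in question is n /
      p^e.\<close>
    have "\<lceil>l * of_nat p ^ e\<rceil> = z + 1"
      by (rule ceiling_unique) (use z assms(10,11) in \<open>auto simp: algebra_simps\<close>)
    then have "poly (bernstein_sato_poly p e R M \<kappa> f) (of_nat n / of_nat p ^ e) = 0" using h n by simp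
    from bernstein_sato_root[OF this prime_gt_0_nat[OF Rc.prime_p]]
    obtain i where i: "i \<in> Gamma_set p e R M \<kappa> f" "n = (\<Sum>j<e. i (Suc j) * p ^ j)" by blast
    have ip: "i (Suc j) < p" if "j < e" for j using i(1) that unfolding Gamma_set_def by (auto simp: PiE_iff)
    obtain H where H: "finite H" "H \<subseteq> carrier R" "carrier R \<subseteq> mspan R (frob p e R (self_mod R)) H"
      using Rc.frob_span_iterate[OF G(2-4), of e] unfolding frob_span_def by blast
    obtain \<tau> where \<tau>: "dual_op (p ^ e) R \<tau>" "\<forall>x\<in>carrier R. \<tau> x = x"
      using Rc.dual_basis[OF assms(5) H] by blast
    interpret gr: graph R p M \<kappa> f e by unfold_locales
    have "eigenspace p e R M \<kappa> f i = {\<one>\<^bsub>N_mod p e R M \<kappa> f\<^esub>}"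
      using e0 e ln \<tau> by (intro gr.eigenspace_trivial[OF \<tau>(1) _ _ i(2) ip]) auto
    then show False using i(1) unfolding Gamma_set_def by blast
  qed
qed simp

end
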